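(* Let $X$, $Y$, $(\mathcal{L},\tau)$, $M(X,\mathcal{L})$ and $M_0(X,\mathcal{L})$ be as in the context, and suppose that Assumption (A) stated there holds. If $M_0(X,\mathcal{L})$ is an $\mathcal{L}^\infty$ space, then $M_0(X,\mathcal{L})$ is isomorphic to $c_0$ and $M(X,\mathcal{L})$ is isomorphic to $\ell^\infty$.
   Context: Setting. $X$ and $Y$ are Banach spaces, with $X$ separable and reflexive. $\mathcal{L}\subset B(X,Y)$ is a collection of bounded linear operators $L:X\to Y$, equipped with a topology $\tau$ such that $(\mathcal{L},\tau)$ is Hausdorff, $\sigma$-compact and locally compact, and such that for every $x\in X$ the map $L\mapsto Lx$ is continuous from $(\mathcal{L},\tau)$ to $Y$. The limit $L\to\infty$ means that $L$ escapes all compact subsets of $(\mathcal{L},\tau)$ (equivalently, $L$ tends to $\infty$ in the one-point compactification $\mathcal{L}\cup\{\infty\}$); thus $\varlimsup_{\mathcal{L}\ni L\to\infty}\|Lx\|_Y=\inf_{K}\sup_{L\in\mathcal{L}\setminus K}\|Lx\|_Y$, the infimum being over compact $K\subset\mathcal{L}$, with $\sup\emptyset=0$. Define $$M(X,\mathcal{L})=\{x\in X:\sup_{L\in\mathcal{L}}\|Lx\|_Y<\infty\},\qquad M_0(X,\mathcal{L})=\{x\in M(X,\mathcal{L}):\varlimsup_{\mathcal{L}\ni L\to\infty}\|Lx\|_Y=0\},$$ with norm $\|x\|_M=\sup_{L\in\mathcal{L}}\|Lx\|_Y$ on both. It is assumed that $M(X,\mathcal{L})$ is dense in $X$ in the $X$-norm,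 and that $M(X,\mathcal{L})$ is a Banach space under $\|\cdot\|_M$, continuously contained in $X$. Assumption (A). For every $x\in M(X,\mathcal{L})$ there is a bounded sequence $(x_n)_{n=1}^\infty$ in $M_0(X,\mathcal{L})$ such that $x_n$ converges weakly to $x$ in $X$ and $\sup_n\|x_n\|_M\le\|x\|_M$. $\mathcal{L}^\infty$ spaces (in the sense of Lindenstrauss, Pełczyński and Rosenthal; the symbol is unrelated to the operator collection $\mathcal{L}$). A Banach space $Z$ is an $\mathcal{L}^\infty$ space if there is a constant $\lambda\ge 1$ such that every finite-dimensional subspace $B\subset Z$ is contained in a finite-dimensional subspace $C\subset Z$ whose Banach–Mazur distance to $\ell^\infty_n$, $n=\dim C$, is at most $\lambda$. "Isomorphic" means linearly homeomorphic.
   Formalization: The formal theorem additionally assumes that M_0(X,L) is infinite-dimensional (the claim fails, e.g., for X = Y = R with L consisting of the identity alone); Banach spaces are taken over the reals. *)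

theory Defs
  imports "HOL-Analysis.Analysis"
begin

section \<open>Normed spaces carried by a subspace of an ambient vector space\<close>

text \<open>
  \<open>M(X, \<L>)\<close> is a linear subspace of \<open>X\<close> with a norm of its own, so normed spaces are given here
  as pairs of a carrier \<open>V\<close> and a norm \<open>N\<close>; only the values of \<open>N\<close> on \<open>V\<close> matter. Banach spaces
  are real, as in the type class \<open>banach\<close>.
\<close>

definition normed_space_on :: "'v::real_vector set \<Rightarrow> ('v \<Rightarrow> real) \<Rightarrow> bool" where
  "normed_space_on V N \<longleftrightarrow>
     subspace V \<and>
     (\<forall>x\<in>V. 0 \<le> N x \<and> (N x = 0 \<longleftrightarrow> x = 0)) \<and>
     (\<forall>x\<in>V. \<forall>c. N (c *\<^sub>R x) = \<bar>c\<bar> * N x) \<and>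
     (\<forall>x\<in>V. \<forall>y\<in>V. N (x + y) \<le> N x + N y)"

definition banach_space_on :: "'v::real_vector set \<Rightarrow> ('v \<Rightarrow> real) \<Rightarrow> bool" where
  "banach_space_on V N \<longleftrightarrow>
     normed_space_on V N \<and> Metric_space.mcomplete V (\<lambda>x y. N (x - y))"

definition norm_topology :: "'v::real_vector set \<Rightarrow> ('v \<Rightarrow> real) \<Rightarrow> 'v topology" where
  "norm_topology V N = Metric_space.mtopology V (\<lambda>x y. N (x - y))"

definition linear_homeomorphism ::
    "'v::real_vector set \<Rightarrow> ('v \<Rightarrow> real) \<Rightarrow> 'w::real_vector set \<Rightarrow> ('w \<Rightarrow> real) \<Rightarrow> ('v \<Rightarrow> 'w) \<Rightarrow> bool" where
  "linear_homeomorphism V N W N' T \<longleftrightarrow>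
     (\<forall>x\<in>V. \<forall>y\<in>V. T (x + y) = T x + T y) \<and>
     (\<forall>x\<in>V. \<forall>c. T (c *\<^sub>R x) = c *\<^sub>R T x) \<and>
     homeomorphic_map (norm_topology V N) (norm_topology W N') T"

definition isomorphic_spaces ::
    "'v::real_vector set \<Rightarrow> ('v \<Rightarrow> real) \<Rightarrow> 'w::real_vector set \<Rightarrow> ('w \<Rightarrow> real) \<Rightarrow> bool" where
  "isomorphic_spaces V N W N' \<longleftrightarrow> (\<exists>T. linear_homeomorphism V N W N' T)"

definition operator_norm_on ::
    "'v set \<Rightarrow> ('v \<Rightarrow> real) \<Rightarrow> ('w \<Rightarrow> real) \<Rightarrow> ('v \<Rightarrow> 'w) \<Rightarrow> ennreal" where
  "operator_norm_on V N N' T = (SUP x\<in>{x\<in>V. N x \<le> 1}. ennreal (N' (T x)))"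

text \<open>The infimum is \<open>\<infinity>\<close> for spaces that are not isomorphic.\<close>

definition banach_mazur_distance ::
    "'v::real_vector set \<Rightarrow> ('v \<Rightarrow> real) \<Rightarrow> 'w::real_vector set \<Rightarrow> ('w \<Rightarrow> real) \<Rightarrow> ennreal" where
  "banach_mazur_distance V N W N' =
     (INF T\<in>{T. linear_homeomorphism V N W N' T}.
        operator_norm_on V N N' T * operator_norm_on W N' N (inv_into V T))"


section \<open>Sequence spaces\<close>

text \<open>
  Since \<open>nat\<close> is discrete, \<open>nat \<Rightarrow>\<^sub>C real\<close> is the space \<open>\<ell>\<^sup>\<infinity>\<close> of all bounded real sequences,
  with the supremum norm. The space \<open>\<ell>\<^sup>\<infinity>\<^sub>n\<close> is realised inside it by padding with zeros.
\<close>

definition linf :: "(nat \<Rightarrow>\<^sub>C real) set" where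
  "linf = UNIV"

definition c0 :: "(nat \<Rightarrow>\<^sub>C real) set" where
  "c0 = {a. apply_bcontfun a \<longlonglongrightarrow> 0}"

definition linf_n :: "nat \<Rightarrow> (nat \<Rightarrow>\<^sub>C real) set" where
  "linf_n n = {a. \<forall>k\<ge>n. apply_bcontfun a k = 0}"


section \<open>Lindenstrauss--Pelczynski--Rosenthal spaces\<close>

definition finite_dimensional :: "'v::real_vector set \<Rightarrow> bool" where
  "finite_dimensional V \<longleftrightarrow> (\<exists>S. finite S \<and> V = span S)"

text \<open>
  Every finite-dimensional normed space is included here, so results about isomorphism with
  \<open>c\<^sub>0\<close> need infinite dimension as a separate hypothesis.
\<close>

definition script_Linf_space :: "'v::real_vector set \<Rightarrow> ('v \<Rightarrow> real) \<Rightarrow> bool" where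
  "script_Linf_space Z N \<longleftrightarrow>
     banach_space_on Z N \<and>
     (\<exists>r\<ge>1. \<forall>B. finite_dimensional B \<and> B \<subseteq> Z \<longrightarrow>
        (\<exists>C. finite_dimensional C \<and> B \<subseteq> C \<and> C \<subseteq> Z \<and>
             banach_mazur_distance C N (linf_n (dim C)) norm \<le> ennreal r))"


section \<open>Topological notions\<close>

definition sigma_compact_space :: "'t topology \<Rightarrow> bool" where
  "sigma_compact_space T \<longleftrightarrow>
     (\<exists>\<K>. countable \<K> \<and> (\<forall>K\<in>\<K>. compactin T K) \<and> \<Union>\<K> = topspace T)"

definition separable_type :: "'a::topological_space itself \<Rightarrow> bool" where
  "separable_type _ \<longleftrightarrow> (\<exists>D::'a set. countable D \<and> closure D = UNIV)"

text \<open>Surjectivity of the canonical embedding into the bidual.\<close>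

definition reflexive_type :: "'a::real_normed_vector itself \<Rightarrow> bool" where
  "reflexive_type _ \<longleftrightarrow>
     (\<forall>\<phi> :: ('a \<Rightarrow>\<^sub>L real) \<Rightarrow>\<^sub>L real. \<exists>x::'a. \<forall>f.
        blinfun_apply \<phi> f = blinfun_apply f x)"

definition weakly_converges :: "(nat \<Rightarrow> 'a::real_normed_vector) \<Rightarrow> 'a \<Rightarrow> bool" where
  "weakly_converges u x \<longleftrightarrow>
     (\<forall>f :: 'a \<Rightarrow>\<^sub>L real. (\<lambda>n. blinfun_apply f (u n)) \<longlonglongrightarrow> blinfun_apply f x)"


section \<open>The spaces \<open>M(X, \<L>)\<close> and \<open>M\<^sub>0(X, \<L>)\<close>\<close>

text \<open>
  Suprema are taken in \<open>ennreal\<close>, where they may be \<open>\<infinity>\<close> and where the supremum of the empty set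
  is \<open>0\<close>.
\<close>

definition M_space :: "('a::real_normed_vector \<Rightarrow>\<^sub>L 'b::real_normed_vector) set \<Rightarrow> 'a set" where
  "M_space \<L> = {x. (SUP L\<in>\<L>. ennreal (norm (blinfun_apply L x))) < \<infinity>}"

definition M_norm :: "('a::real_normed_vector \<Rightarrow>\<^sub>L 'b::real_normed_vector) set \<Rightarrow> 'a \<Rightarrow> real" where
  "M_norm \<L> x = enn2real (SUP L\<in>\<L>. ennreal (norm (blinfun_apply L x)))"

definition limsup_at_infinity ::
    "('a::real_normed_vector \<Rightarrow>\<^sub>L 'b::real_normed_vector) set \<Rightarrow> ('a \<Rightarrow>\<^sub>L 'b) topology \<Rightarrow> 'a \<Rightarrow> ennreal" where
  "limsup_at_infinity \<L> \<tau> x =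
     (INF K\<in>{K. compactin \<tau> K}. SUP L\<in>\<L> - K. ennreal (norm (blinfun_apply L x)))"

definition M0_space ::
    "('a::real_normed_vector \<Rightarrow>\<^sub>L 'b::real_normed_vector) set \<Rightarrow> ('a \<Rightarrow>\<^sub>L 'b) topology \<Rightarrow> 'a set" where
  "M0_space \<L> \<tau> = {x \<in> M_space \<L>. limsup_at_infinity \<L> \<tau> x = 0}"

definition assumption_A ::
    "('a::real_normed_vector \<Rightarrow>\<^sub>L 'b::real_normed_vector) set \<Rightarrow> ('a \<Rightarrow>\<^sub>L 'b) topology \<Rightarrow> bool" where
  "assumption_A \<L> \<tau> \<longleftrightarrow>
     (\<forall>x\<in>M_space \<L>. \<exists>u::nat \<Rightarrow> 'a.
        range u \<subseteq> M0_space \<L> \<tau> \<and>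
        bdd_above (range (\<lambda>n. M_norm \<L> (u n))) \<and>
        weakly_converges u x \<and>
        (SUP n. M_norm \<L> (u n)) \<le> M_norm \<L> x)"

end

theory Submission
  imports Defs "HOL-Complex_Analysis.Great_Picard" "HOL-Library.Diagonal_Subsequence"
begin

text \<open>
  Write \<open>Z\<close> for \<open>M\<^sub>0\<close>. A gliding hump shows that a bounded sequence of \<open>Z\<close> that is weakly null in \<open>X\<close>
  is weakly null in \<open>Z\<close>. Since \<open>Z\<close> is an \<open>\<L>\<^sup>\<infinity>\<close> space and \<open>X\<close> is reflexive, the inclusion \<open>Z \<rightarrow> X\<close> extends
  to all bounded functions on the dual ball of \<open>Z\<close>; as \<open>X\<close> contains no \<open>c\<^sub>0\<close>, a lattice version of
  Egorov's theorem makes this inclusion compact. Finite nets then give functionals \<open>g\<^sub>j \<in> X\<^sup>*\<close> that embed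
  \<open>Z\<close> into \<open>c\<^sub>0\<close>. Extending the local coordinates of \<open>Z\<close> to \<open>c\<^sub>0\<close> yields operators from \<open>c\<^sub>0\<close> to \<open>Z\<close>
  that are exact on larger and larger finite-dimensional subspaces and form a Cauchy sequence as operators
  into \<open>X\<close>; by the gliding hump their differences sum up to a factorisation of the identity of \<open>Z\<close>
  through \<open>c\<^sub>0\<close>, and Pelczynski's decomposition method gives \<open>Z \<cong> c\<^sub>0\<close>. The isomorphism extends to \<open>\<ell>\<^sup>\<infinity>\<close>
  because the image of the unit vector basis is weakly unconditionally Cauchy, hence boundedly summable, in \<open>X\<close>;
  it is onto \<open>M\<close> by Assumption (A).
\<close>

section \<open>The Hahn--Banach theorem for cones\<close>

text \<open>The proof plays two norms against each other. \<open>N\<close>, the norm of M, is a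
  supremum over operators, so a sum of vectors stays bounded in \<open>N\<close> when each operator
  notices only a few of them. On a compact set of operators, which is norm bounded by the uniform
  boundedness principle, this follows from smallness in \<open>X\<close>; away from a large compact
  set it follows from membership in M_0. Hence limits are taken in \<open>X\<close> only, while
  \<open>N\<close> is merely kept bounded. The obstacle is that the local factorisations of
  \<open>Z\<close> through c_0 are unrelated to each other and need not converge in
  \<open>N\<close>. Compactness of the inclusion produces limits in \<open>X\<close>, and
  reflexivity makes the convergence uniform on the ball of c_0, because weakly unconditionally
  Cauchy series have uniformly small tails. The bidual of \<open>Z\<close> never appears: Banach
  limits of vectors of \<open>X\<close> take the place of weak-star limits. Infinite dimension of
  \<open>Z\<close> serves to find a complemented copy of c_0 inside it, which the decomposition
  method absorbs.\<close>

definition sublinear :: "('v::real_vector \<Rightarrow> real) \<Rightarrow> bool" where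
  "sublinear p \<longleftrightarrow> (\<forall>x y. p (x + y) \<le> p x + p y) \<and> (\<forall>c>0. \<forall>x. p (c *\<^sub>R x) = c * p x)"

lemma sublinear_zero:
  assumes "sublinear p" shows "p 0 = 0"
proof -
  have "p (2 *\<^sub>R 0) = 2 * p 0" using assms unfolding sublinear_def by (metis zero_less_numeral)
  then show ?thesis by simp
qed

lemma sublinear_add: "sublinear p \<Longrightarrow> p (x + y) \<le> p x + p y"
  by (simp add: sublinear_def)

lemma sublinear_scale: "sublinear p \<Longrightarrow> 0 \<le> c \<Longrightarrow> p (c *\<^sub>R x) = c * p x"
  by (cases "c = 0") (auto simp: sublinear_def sublinear_zero)

lemma sublinear_minus_le:
  assumes "sublinear p" shows "- p (- x) \<le> p x"
  using sublinear_add[OF assms, of x "- x"] sublinear_zero[OF assms] by simp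

text \<open>A convex cone in the product with the reals that lies below the graph of
  \<open>p\<close>. It need not be the graph of a function, so one theorem covers the extension from
  subspaces, the separation of a convex set from a ball, and Banach limits.\<close>

definition cone_minorant :: "('v::real_vector \<times> real) set \<Rightarrow> ('v \<Rightarrow> real) \<Rightarrow> bool" where
  "cone_minorant A p \<longleftrightarrow> (0, 0) \<in> A \<and>
     (\<forall>y r y' r'. (y, r) \<in> A \<longrightarrow> (y', r') \<in> A \<longrightarrow> (y + y', r + r') \<in> A) \<and>
     (\<forall>c y r. c > 0 \<longrightarrow> (y, r) \<in> A \<longrightarrow> (c *\<^sub>R y, c * r) \<in> A) \<and>
     (\<forall>y r. (y, r) \<in> A \<longrightarrow> r \<le> p y)"

text \<open>\<open>q x\<close> is the infimum of \<open>p (x + y) - r\<close> over the cone. The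
  estimate of \<open>q (- y)\<close> is the useful part: a linear functional \<open>g\<close> below
  \<open>q\<close> satisfies \<open>- g y \<le> - r\<close>, so it is automatically above
  \<open>r\<close> at \<open>y\<close>.\<close>

lemma sublinear_cone_Inf:
  fixes p :: "'v::real_vector \<Rightarrow> real"
  assumes p: "sublinear p" and A: "cone_minorant A p"
  shows "\<exists>q. sublinear q \<and> (\<forall>x. q x \<le> p x) \<and> (\<forall>y r. (y, r) \<in> A \<longrightarrow> q (- y) \<le> - r)"
proof -
  define q where "q x = Inf ((\<lambda>(y, r). p (x + y) - r) ` A)" for x
  have A0: "(0, 0) \<in> A" and Aadd: "\<And>y r y' r'. (y, r) \<in> A \<Longrightarrow> (y', r') \<in> A \<Longrightarrow> (y + y', r + r') \<in> A"
    and Asc: "\<And>c y r. c > 0 \<Longrightarrow> (y, r) \<in> A \<Longrightarrow> (c *\<^sub>R y, c * r) \<in> A"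
    and Ale: "\<And>y r. (y, r) \<in> A \<Longrightarrow> r \<le> p y"
    using A unfolding cone_minorant_def by blast+
  have ne: "(\<lambda>(y, r). p (x + y) - r) ` A \<noteq> {}" for x using A0 by auto
  have bdd: "bdd_below ((\<lambda>(y, r). p (x + y) - r) ` A)" for x
  proof (rule bdd_belowI[of _ "- p (- x)"], clarsimp)
    fix y r assume "(y, r) \<in> A"
    then have "r \<le> p ((x + y) + (- x))" using Ale by simp
    also have "\<dots> \<le> p (x + y) + p (- x)" by (rule sublinear_add[OF p])
    finally show "- p (- x) \<le> p (x + y) - r" by simp
  qed
  have lower: "q x \<le> p (x + y) - r" if "(y, r) \<in> A" for x y r
    unfolding q_def using that by (intro cInf_lower bdd) force
  have greatest: "c \<le> q x" if "\<And>y r. (y, r) \<in> A \<Longrightarrow> c \<le> p (x + y) - r" for c x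
    unfolding q_def using that by (intro cInf_greatest ne) auto
  have "sublinear q"
    unfolding sublinear_def
  proof (intro conjI allI impI)
    fix x x'
    have "q (x + x') - q x \<le> q x'"
    proof (rule greatest)
      fix y' r' assume 1: "(y', r') \<in> A"
      have "q (x + x') - (p (x' + y') - r') \<le> q x"
      proof (rule greatest)
        fix y r assume 2: "(y, r) \<in> A"
        have "q (x + x') \<le> p ((x + x') + (y + y')) - (r + r')"
          by (rule lower[OF Aadd[OF 2 1]])
        also have "p ((x + x') + (y + y')) \<le> p (x + y) + p (x' + y')"
          using sublinear_add[OF p, of "x + y" "x' + y'"] by (simp add: algebra_simps)
        finally show "q (x + x') - (p (x' + y') - r') \<le> p (x + y) - r" by simp
      qed
      then show "q (x + x') - q x \<le> p (x' + y') - r'" by simp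
    qed
    then show "q (x + x') \<le> q x + q x'" by simp
  next
    \<comment> \<open>The inequality for all positive \<open>c\<close> also yields its converse, by
      applying it to \<open>1/c\<close> and the point \<open>c *\<^sub>R x\<close>.\<close>
    have half: "c * q x \<le> q (c *\<^sub>R x)" if c: "c > 0" for c :: real and x
    proof (rule greatest)
      fix y r assume "(y, r) \<in> A"
      then have "((1/c) *\<^sub>R y, (1/c) * r) \<in> A" using c by (intro Asc) auto
      from lower[OF this, of x] have "c * q x \<le> c * (p (x + (1/c) *\<^sub>R y) - (1/c) * r)"
        using c by (intro mult_left_mono) auto
      also have "\<dots> = p (c *\<^sub>R (x + (1/c) *\<^sub>R y)) - r"
        using c by (simp add: sublinear_scale[OF p] right_diff_distrib)
      also have "c *\<^sub>R (x + (1/c) *\<^sub>R y) = c *\<^sub>R x + y" using c by (simp add: scaleR_add_right)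
      finally show "c * q x \<le> p (c *\<^sub>R x + y) - r" .
    qed
    fix c :: real and x assume c: "c > 0"
    have "(1/c) * q (c *\<^sub>R x) \<le> q ((1/c) *\<^sub>R (c *\<^sub>R x))" using c by (intro half) auto
    then have "q (c *\<^sub>R x) \<le> c * q x" using c by (simp add: field_simps)
    with half[OF c, of x] show "q (c *\<^sub>R x) = c * q x" by simp
  qed
  moreover have "q x \<le> p x" for x using lower[OF A0, of x] by simp
  moreover have "q (- y) \<le> - r" if "(y, r) \<in> A" for y r
    using lower[OF that, of "- y"] sublinear_zero[OF p] by simp
  ultimately show ?thesis by blast
qed

text \<open>A minimal sublinear functional is linear: lowering it along the ray through a point changes nothing.\<close>

lemma linear_below_sublinear:
  fixes p :: "'v::real_vector \<Rightarrow> real"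
  assumes p: "sublinear p"
  shows "\<exists>g. linear g \<and> (\<forall>x. g x \<le> p x)"
proof -
  define S where "S = {q. sublinear q \<and> (\<forall>x. q x \<le> p x)}"
  \<comment> \<open>The order is reversed, so Zorn's maximal element is a minimal
    functional.\<close>
  define P where "P = (\<lambda>q q' :: 'v \<Rightarrow> real. \<forall>x. q' x \<le> q x)"
  have po: "partial_order_on S (relation_of P S)"
    unfolding partial_order_on_def preorder_on_def refl_on_def trans_def antisym_def relation_of_def P_def
    by (auto intro: order_trans intro!: ext antisym)
  have "\<exists>u\<in>S. \<forall>a\<in>C. P a u" if C: "C \<in> Chains (relation_of P S)" for C
  proof (cases "C = {}")
    case True then show ?thesis using p by (auto simp: S_def)
  next
    case False
    have CS: "C \<subseteq> S" and lin: "\<And>a b. a \<in> C \<Longrightarrow> b \<in> C \<Longrightarrow> P a b \<or> P b a"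
      using C by (auto simp: Chains_def relation_of_def)
    define u where "u x = Inf ((\<lambda>q. q x) ` C)" for x
    have bdd: "bdd_below ((\<lambda>q. q x) ` C)" for x
    proof (rule bdd_belowI[of _ "- p (- x)"], clarsimp)
      fix q assume "q \<in> C"
      then have "sublinear q" "q (- x) \<le> p (- x)" using CS by (auto simp: S_def)
      then show "- p (- x) \<le> q x" using sublinear_minus_le[of q x] by simp
    qed
    have lower: "u x \<le> q x" if "q \<in> C" for q x
      unfolding u_def using that by (intro cInf_lower bdd) auto
    have greatest: "c \<le> u x" if "\<And>q. q \<in> C \<Longrightarrow> c \<le> q x" for c x
      unfolding u_def using that False by (intro cInf_greatest) auto
    have sub: "sublinear q" if "q \<in> C" for q using CS that by (auto simp: S_def)
    have "sublinear u"
      unfolding sublinear_def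
    proof (intro conjI allI impI)
      fix x y
      have "u (x + y) - u x \<le> u y"
      proof (rule greatest)
        fix q assume q: "q \<in> C"
        have "u (x + y) - q y \<le> u x"
        proof (rule greatest)
          fix q' assume q': "q' \<in> C"
          \<comment> \<open>Two members of a chain are comparable, so the smaller one can be used at
            both \<open>x\<close> and \<open>y\<close>; an infimum of unrelated sublinear
            functionals need not be subadditive.\<close>
          from lin[OF q q'] show "u (x + y) - q y \<le> q' x"
          proof
            assume "P q q'"
            then have "q' y \<le> q y" by (simp add: P_def)
            then show ?thesis using lower[OF q', of "x + y"] sublinear_add[OF sub[OF q'], of x y] by simp
          next
            assume "P q' q"
            then have "q x \<le> q' x" by (simp add: P_def)
            then show ?thesis using lower[OF q, of "x + y"] sublinear_add[OF sub[OF q], of x y] by simp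
          qed
        qed
        then show "u (x + y) - u x \<le> q y" by simp
      qed
      then show "u (x + y) \<le> u x + u y" by simp
    next
      have half: "c * u x \<le> u (c *\<^sub>R x)" if c: "c > 0" for c :: real and x
      proof (rule greatest)
        fix q assume "q \<in> C"
        then show "c * u x \<le> q (c *\<^sub>R x)"
          using lower[of q x] sublinear_scale[OF sub, of q c x] c by (simp add: mult_left_mono)
      qed
      fix c :: real and x assume c: "c > 0"
      have "(1/c) * u (c *\<^sub>R x) \<le> u ((1/c) *\<^sub>R (c *\<^sub>R x))" using c by (intro half) auto
      then have "u (c *\<^sub>R x) \<le> c * u x" using c by (simp add: field_simps)
      with half[OF c, of x] show "u (c *\<^sub>R x) = c * u x" by simp
    qed
    moreover have "u x \<le> p x" for x
    proof -
      obtain q where "q \<in> C" using False by blast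
      then have "u x \<le> q x" "q x \<le> p x" using lower[of q x] CS by (auto simp: S_def)
      then show ?thesis by simp
    qed
    ultimately show ?thesis using lower by (auto simp: S_def P_def)
  qed
  from predicate_Zorn[OF po this] obtain q where q: "q \<in> S" and min: "\<And>a. a \<in> S \<Longrightarrow> P q a \<Longrightarrow> a = q"
    by blast
  have sq: "sublinear q" using q by (simp add: S_def)
  have superadd: "q x + q y \<le> q (x + y)" for x y
  proof -
    define A where "A = {(t *\<^sub>R y, t * q y) | t. t \<ge> 0}"
    have "cone_minorant A q"
      unfolding cone_minorant_def
    proof (intro conjI allI impI)
      show "(0, 0) \<in> A" unfolding A_def by force
      fix a r b s assume "(a, r) \<in> A" "(b, s) \<in> A"
      then obtain t t' where "a = t *\<^sub>R y" "r = t * q y" "b = t' *\<^sub>R y" "s = t' * q y" "t \<ge> 0" "t' \<ge> 0"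
        by (auto simp: A_def)
      then have "a + b = (t + t') *\<^sub>R y" "r + s = (t + t') * q y" "t + t' \<ge> 0"
        by (auto simp: algebra_simps)
      then show "(a + b, r + s) \<in> A" unfolding A_def by blast
    next
      fix c :: real and a r assume "c > 0" "(a, r) \<in> A"
      then obtain t where "a = t *\<^sub>R y" "r = t * q y" "t \<ge> 0" by (auto simp: A_def)
      with \<open>c > 0\<close> have "c *\<^sub>R a = (c * t) *\<^sub>R y" "c * r = (c * t) * q y" "c * t \<ge> 0" by auto
      then show "(c *\<^sub>R a, c * r) \<in> A" unfolding A_def by blast
    next
      fix a r assume "(a, r) \<in> A"
      then show "r \<le> q a" by (auto simp: A_def sublinear_scale[OF sq])
    qed
    from sublinear_cone_Inf[OF sq this] obtain q' where
      q': "sublinear q'" "\<And>x. q' x \<le> q x" "\<And>y r. (y, r) \<in> A \<Longrightarrow> q' (- y) \<le> - r" by blast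
    have "q' \<in> S" using q'(1,2) q unfolding S_def using order_trans by blast
    then have "q' = q" using min q'(2) by (auto simp: P_def)
    have "(y, q y) \<in> A" unfolding A_def by (force intro: exI[of _ 1])
    then have "q (- y) \<le> - q y" using q'(3) \<open>q' = q\<close> by simp
    moreover have "q x \<le> q (x + y) + q (- y)" using sublinear_add[OF sq, of "x + y" "- y"] by simp
    ultimately show ?thesis by simp
  qed
  have add: "q (x + y) = q x + q y" for x y
    using superadd[of x y] sublinear_add[OF sq, of x y] by simp
  have minus: "q (- x) = - q x" for x using add[of x "- x"] sublinear_zero[OF sq] by simp
  have "q (c *\<^sub>R x) = c * q x" for c x
  proof (cases "c \<ge> 0")
    case True then show ?thesis by (rule sublinear_scale[OF sq])
  next
    case False
    then show ?thesis using sublinear_scale[OF sq, of "- c" x] minus[of "c *\<^sub>R x"] by simp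
  qed
  then have "linear q" using add by (intro linearI) auto
  then show ?thesis using q by (auto simp: S_def)
qed

theorem Hahn_Banach_cone:
  fixes p :: "'v::real_vector \<Rightarrow> real"
  assumes "sublinear p" "cone_minorant A p"
  obtains g where "linear g" "\<And>x. g x \<le> p x" "\<And>y r. (y, r) \<in> A \<Longrightarrow> r \<le> g y"
proof -
  from sublinear_cone_Inf[OF assms] obtain q where q: "sublinear q" "\<And>x. q x \<le> p x"
    "\<And>y r. (y, r) \<in> A \<Longrightarrow> q (- y) \<le> - r" by blast
  from linear_below_sublinear[OF q(1)] obtain g where g: "linear g" "\<And>x. g x \<le> q x" by blast
  have "r \<le> g y" if "(y, r) \<in> A" for y r
    using q(3)[OF that] g(2)[of "- y"] linear_neg[OF g(1), of y] by simp
  moreover have "g x \<le> p x" for x using g(2)[of x] q(2)[of x] by simp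
  ultimately show ?thesis using that g(1) by blast
qed

text \<open>The functional \<open>f\<close> is linear on the whole type although only its values on
  \<open>F\<close> matter. Users produce it from a functional on \<open>F\<close> by composing with
  an algebraic projection or left inverse, about whose continuity nothing is known.\<close>

theorem Hahn_Banach_extension:
  fixes p f :: "'v::real_vector \<Rightarrow> real"
  assumes p: "sublinear p" and F: "subspace F" and f: "linear f" and le: "\<And>x. x \<in> F \<Longrightarrow> f x \<le> p x"
  obtains g where "linear g" "\<And>x. g x \<le> p x" "\<And>x. x \<in> F \<Longrightarrow> g x = f x"
proof -
  define A where "A = {(y, f y) | y. y \<in> F}"
  have "cone_minorant A p"
    unfolding cone_minorant_def A_def
    using F f le by (auto simp: subspace_0 linear_0 linear_add linear_cmul subspace_add subspace_scale)
  from Hahn_Banach_cone[OF p this] obtain g where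
    g: "linear g" "\<And>x. g x \<le> p x" "\<And>y r. (y, r) \<in> A \<Longrightarrow> r \<le> g y" by blast
  have "g x = f x" if x: "x \<in> F" for x
  proof -
    have "f x \<le> g x" using g(3) x by (auto simp: A_def)
    moreover have "f (- x) \<le> g (- x)" using g(3) x F by (auto simp: A_def subspace_neg)
    ultimately show ?thesis using f g(1) by (simp add: linear_neg)
  qed
  then show ?thesis using that g by blast
qed

section \<open>Separation, norming functionals and vectors from functionals on the dual\<close>

lemma sublinear_scaled_norm: "0 \<le> C \<Longrightarrow> sublinear (\<lambda>x::'a::real_normed_vector. C * norm x)"
  unfolding sublinear_def
  by (auto simp: algebra_simps) (metis distrib_left mult_left_mono norm_triangle_ineq)

lemma linear_abs_le_sublinear:
  assumes "linear g" "\<And>x. g x \<le> p x" "\<And>x. p (- x) = p x"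
  shows "\<bar>g x\<bar> \<le> (p x :: real)"
  using assms(2)[of x] assms(2)[of "- x"] assms(3)[of x] linear_neg[OF assms(1), of x] by simp

lemma bounded_functional_Blinfun:
  fixes g :: "'a::real_normed_vector \<Rightarrow> real"
  assumes "linear g" "\<And>x. \<bar>g x\<bar> \<le> C * norm x" "0 \<le> C"
  obtains f :: "'a \<Rightarrow>\<^sub>L real" where "\<And>x. blinfun_apply f x = g x" "norm f \<le> C"
proof -
  have bl: "bounded_linear g"
    using assms by (intro bounded_linear_intro[where K = C]) (auto simp: linear_add linear_cmul mult.commute)
  have "norm (Blinfun g) \<le> C"
    using assms(2,3) by (intro norm_blinfun_bound) (auto simp: bounded_linear_Blinfun_apply[OF bl])
  then show ?thesis using that[of "Blinfun g"] by (simp add: bounded_linear_Blinfun_apply[OF bl])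
qed

text \<open>The cone over \<open>S\<close> at height \<open>e\<close> is a minorant of the norm,
  convexity being what closes it under addition. A one-point \<open>S\<close> gives norming
  functionals, a convex hull gives Mazur's theorem.\<close>

lemma convex_separation_from_ball:
  fixes S :: "'a::real_normed_vector set"
  assumes S: "convex S" and e: "e > 0" "\<And>x. x \<in> S \<Longrightarrow> e \<le> norm x"
  obtains f :: "'a \<Rightarrow>\<^sub>L real" where "norm f \<le> 1" "\<And>x. x \<in> S \<Longrightarrow> e \<le> blinfun_apply f x"
proof -
  define A where "A = insert (0, 0) {(s *\<^sub>R x, s * e) | s x. s > 0 \<and> x \<in> S}"
  have p: "sublinear (\<lambda>x::'a. 1 * norm x)" by (rule sublinear_scaled_norm) simp
  have "cone_minorant A (\<lambda>x. 1 * norm x)"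
    unfolding cone_minorant_def
  proof (intro conjI allI impI)
    show "(0, 0) \<in> A" by (simp add: A_def)
    fix y r y' r' assume 1: "(y, r) \<in> A" "(y', r') \<in> A"
    show "(y + y', r + r') \<in> A"
    proof (cases "(y, r) = (0, 0) \<or> (y', r') = (0, 0)")
      case True then show ?thesis using 1 by auto
    next
      case False
      with 1 obtain s x s' x' where sx: "y = s *\<^sub>R x" "r = s * e" "s > 0" "x \<in> S"
        "y' = s' *\<^sub>R x'" "r' = s' * e" "s' > 0" "x' \<in> S" by (auto simp: A_def)
      define z where "z = (s / (s + s')) *\<^sub>R x + (s' / (s + s')) *\<^sub>R x'"
      have "z \<in> S" unfolding z_def using sx by (intro convexD[OF S]) (auto simp: add_divide_distrib[symmetric])
      moreover have "y + y' = (s + s') *\<^sub>R z" unfolding z_def using sx by (simp add: scaleR_add_right)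
      moreover have "r + r' = (s + s') * e" using sx by (simp add: algebra_simps)
      ultimately show ?thesis unfolding A_def using sx by force
    qed
  next
    fix c :: real and y r assume "c > 0" "(y, r) \<in> A"
    then consider "y = 0" "r = 0" | s x where "y = s *\<^sub>R x" "r = s * e" "s > 0" "x \<in> S"
      by (auto simp: A_def)
    then show "(c *\<^sub>R y, c * r) \<in> A"
    proof cases
      case 1 then show ?thesis by (simp add: A_def)
    next
      case 2
      then have "c *\<^sub>R y = (c * s) *\<^sub>R x" "c * r = (c * s) * e" "c * s > 0" using \<open>c > 0\<close> by auto
      then show ?thesis unfolding A_def using 2 by blast
    qed
  next
    fix y r assume "(y, r) \<in> A"
    then show "r \<le> 1 * norm y" using e(2) by (auto simp: A_def)
  qed
  from Hahn_Banach_cone[OF p this] obtain g where g: "linear g" "\<And>x. g x \<le> 1 * norm x"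
    "\<And>y r. (y, r) \<in> A \<Longrightarrow> r \<le> g y" by blast
  have "\<bar>g x\<bar> \<le> 1 * norm x" for x by (rule linear_abs_le_sublinear[OF g(1,2)]) auto
  from bounded_functional_Blinfun[OF g(1) this] obtain f :: "'a \<Rightarrow>\<^sub>L real"
    where f: "\<And>x. blinfun_apply f x = g x" "norm f \<le> 1" by auto
  have "e \<le> blinfun_apply f x" if "x \<in> S" for x
  proof -
    have "(1 *\<^sub>R x, 1 * e) \<in> A" unfolding A_def using that by (intro insertI2 CollectI exI[of _ 1] exI[of _ x]) auto
    then show ?thesis using g(3) f(1) by fastforce
  qed
  then show ?thesis using that f(2) by blast
qed

lemma norming_functional:
  fixes x :: "'a::real_normed_vector"
  obtains f :: "'a \<Rightarrow>\<^sub>L real" where "norm f \<le> 1" "blinfun_apply f x = norm x"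
proof (cases "x = 0")
  case True then show ?thesis using that[of 0] by simp
next
  case False
  obtain f :: "'a \<Rightarrow>\<^sub>L real" where f: "norm f \<le> 1" "\<And>y. y \<in> {x} \<Longrightarrow> norm x \<le> blinfun_apply f y"
    by (rule convex_separation_from_ball[of "{x}" "norm x"]) (use False in auto)
  have "blinfun_apply f x \<le> norm x"
    using norm_blinfun[of f x] f(1) mult_right_mono[OF f(1), of "norm x"] by simp
  then show ?thesis using that f by (auto intro: antisym)
qed

lemma functional_le_norm:
  fixes f :: "'a::real_normed_vector \<Rightarrow>\<^sub>L real"
  shows "norm f \<le> 1 \<Longrightarrow> \<bar>blinfun_apply f x\<bar> \<le> norm x"
  using norm_blinfun[of f x] mult_right_mono[of "norm f" 1 "norm x"] by simp

lemma functionals_separate: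
  fixes x y :: "'a::real_normed_vector"
  assumes "\<And>f :: 'a \<Rightarrow>\<^sub>L real. blinfun_apply f x = blinfun_apply f y" shows "x = y"
proof -
  obtain f :: "'a \<Rightarrow>\<^sub>L real" where "blinfun_apply f (x - y) = norm (x - y)"
    by (rule norming_functional)
  then show ?thesis using assms[of f] by (simp add: blinfun.diff_right)
qed

lemma Mazur_null:
  fixes u :: "nat \<Rightarrow> 'a::real_normed_vector"
  assumes u: "weakly_converges u 0" and e: "e > 0"
  shows "\<exists>w \<in> convex hull (range u). norm w < e"
proof (rule ccontr)
  assume "\<not> ?thesis"
  then have ge: "e \<le> norm x" if "x \<in> convex hull (range u)" for x using that by (meson not_less)
  obtain f :: "'a \<Rightarrow>\<^sub>L real" where f: "\<And>x. x \<in> convex hull (range u) \<Longrightarrow> e \<le> blinfun_apply f x"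
    using convex_separation_from_ball[OF convex_convex_hull e ge] by metis
  have "e \<le> blinfun_apply f (u n)" for n by (rule f) (simp add: hull_inc)
  moreover have "(\<lambda>n. blinfun_apply f (u n)) \<longlonglongrightarrow> 0"
    using u by (auto simp: weakly_converges_def)
  ultimately have "e \<le> 0" by (intro LIMSEQ_le_const) auto
  with e show False by simp
qed

lemma reflexive_representation:
  fixes \<psi> :: "('a::real_normed_vector \<Rightarrow>\<^sub>L real) \<Rightarrow> real"
  assumes refl: "reflexive_type TYPE('a)" and lin: "linear \<psi>"
    and le: "\<And>f. \<bar>\<psi> f\<bar> \<le> C * norm f" and C: "0 \<le> C"
  obtains x where "\<And>f. blinfun_apply f x = \<psi> f" "norm x \<le> C"
proof -
  obtain \<Psi> :: "('a \<Rightarrow>\<^sub>L real) \<Rightarrow>\<^sub>L real" where \<Psi>: "\<And>f. blinfun_apply \<Psi> f = \<psi> f"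
    using bounded_functional_Blinfun[OF lin le C] by metis
  obtain x :: 'a where x: "\<And>f. blinfun_apply \<Psi> f = blinfun_apply f x"
    using refl unfolding reflexive_type_def by blast
  obtain f :: "'a \<Rightarrow>\<^sub>L real" where f: "norm f \<le> 1" "blinfun_apply f x = norm x" by (rule norming_functional)
  have "norm x \<le> C * norm f" using le[of f] \<Psi>[of f] x[of f] f(2) by simp
  also have "\<dots> \<le> C" using f(1) C mult_left_mono[of "norm f" 1 C] by simp
  finally show ?thesis using that x \<Psi> by simp
qed

section \<open>Weakly unconditionally Cauchy series in reflexive spaces\<close>

lemma apply_Bcontfun_nat:
  fixes s :: "nat \<Rightarrow> real"
  assumes "bounded (range s)" shows "apply_bcontfun (Bcontfun s) = s"
  using assms by (intro Bcontfun_inverse) (auto simp: bcontfun_def)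

lemma bounded_range_abs: "bounded (range (s :: nat \<Rightarrow> real)) \<longleftrightarrow> (\<exists>M. \<forall>n. \<bar>s n\<bar> \<le> M)"
  by (auto simp: bounded_iff)

definition unit_seq :: "nat \<Rightarrow> nat \<Rightarrow>\<^sub>C real" where
  "unit_seq i = Bcontfun (\<lambda>j. if j = i then 1 else 0)"

lemma apply_unit_seq: "apply_bcontfun (unit_seq i) j = (if j = i then 1 else 0)"
proof -
  have "bounded (range (\<lambda>j. if j = i then 1 else 0 :: real))" by (simp only: bounded_range_abs) (auto intro: exI[of _ 1])
  then show ?thesis by (simp add: unit_seq_def apply_Bcontfun_nat)
qed

lemma apply_unit_seq_sum: "apply_bcontfun (\<Sum>j<n. a j *\<^sub>R unit_seq j) i = (if i < n then a i else 0)"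
proof -
  have "apply_bcontfun (sum f F) i = (\<Sum>j\<in>F. apply_bcontfun (f j) i)" for f :: "nat \<Rightarrow> nat \<Rightarrow>\<^sub>C real" and F
    by (induction F rule: infinite_finite_induct) (auto simp: plus_bcontfun.rep_eq zero_bcontfun.rep_eq)
  then show ?thesis by (simp add: scaleR_bcontfun.rep_eq apply_unit_seq if_distrib cong: if_cong)
qed

text \<open>The cone consists of the pairs of a convergent sequence and its limit. \<open>Lm\<close>
  is a total function with unspecified values on unbounded sequences, which accounts for the
  boundedness hypotheses.\<close>

theorem Banach_limit_exists:
  obtains Lm :: "(nat \<Rightarrow> real) \<Rightarrow> real" where
    "\<And>s t. bounded (range s) \<Longrightarrow> bounded (range t) \<Longrightarrow> Lm (\<lambda>n. s n + t n) = Lm s + Lm t"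
    "\<And>c s. bounded (range s) \<Longrightarrow> Lm (\<lambda>n. c * s n) = c * Lm s"
    "\<And>s l. s \<longlonglongrightarrow> l \<Longrightarrow> Lm s = l"
    "\<And>s M. (\<And>n. \<bar>s n\<bar> \<le> M) \<Longrightarrow> \<bar>Lm s\<bar> \<le> M"
proof -
  define A where "A = {(s :: nat \<Rightarrow>\<^sub>C real, l). apply_bcontfun s \<longlonglongrightarrow> l}"
  have p: "sublinear (\<lambda>s :: nat \<Rightarrow>\<^sub>C real. 1 * norm s)" by (rule sublinear_scaled_norm) simp
  have "cone_minorant A (\<lambda>s. 1 * norm s)"
    unfolding cone_minorant_def A_def
  proof (intro conjI allI impI, goal_cases)
    case 1 show ?case by (simp add: zero_bcontfun.rep_eq)
  next
    case 2 then show ?case by (auto simp: plus_bcontfun.rep_eq intro: tendsto_add)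
  next
    case 3 then show ?case by (auto simp: scaleR_bcontfun.rep_eq intro: tendsto_mult)
  next
    case (4 s l)
    then have "apply_bcontfun s \<longlonglongrightarrow> l" by simp
    moreover have "apply_bcontfun s n \<le> norm s" for n using norm_bounded[of s n] by simp
    ultimately show ?case by (simp add: LIMSEQ_le_const2)
  qed
  from Hahn_Banach_cone[OF p this] obtain g where
    g: "linear g" "\<And>x. g x \<le> 1 * norm x" "\<And>y r. (y, r) \<in> A \<Longrightarrow> r \<le> g y" by blast
  have gn: "\<bar>g x\<bar> \<le> 1 * norm x" for x by (rule linear_abs_le_sublinear[OF g(1,2)]) auto
  have glim: "g s = l" if s: "apply_bcontfun s \<longlonglongrightarrow> l" for s l
  proof -
    have "l \<le> g s" using g(3) s by (simp add: A_def)
    moreover have "apply_bcontfun (- s) \<longlonglongrightarrow> - l" using tendsto_minus[OF s] by (simp add: uminus_bcontfun.rep_eq)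
    then have "- l \<le> g (- s)" using g(3) by (simp add: A_def)
    ultimately show ?thesis using linear_neg[OF g(1)] by simp
  qed
  define Lm where "Lm s = g (Bcontfun s)" for s
  show ?thesis
  proof (rule that[of Lm])
    fix s t :: "nat \<Rightarrow> real" assume st: "bounded (range s)" "bounded (range t)"
    have "bounded (range (\<lambda>n. s n + t n))"
      using st by (intro bounded_plus_comp)
    then have "Bcontfun (\<lambda>n. s n + t n) = Bcontfun s + Bcontfun t"
      using st by (intro bcontfun_eqI) (simp add: apply_Bcontfun_nat plus_bcontfun.rep_eq)
    then show "Lm (\<lambda>n. s n + t n) = Lm s + Lm t" by (simp add: Lm_def linear_add[OF g(1)])
  next
    fix c and s :: "nat \<Rightarrow> real" assume s: "bounded (range s)"
    have "bounded (range (\<lambda>n. c *\<^sub>R s n))" using s by (rule bounded_scaleR_comp)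
    then have "Bcontfun (\<lambda>n. c * s n) = c *\<^sub>R Bcontfun s"
      using s by (intro bcontfun_eqI) (simp add: apply_Bcontfun_nat scaleR_bcontfun.rep_eq)
    then show "Lm (\<lambda>n. c * s n) = c * Lm s" by (simp add: Lm_def linear_cmul[OF g(1)])
  next
    fix s :: "nat \<Rightarrow> real" and l assume s: "s \<longlonglongrightarrow> l"
    then have "bounded (range s)" by (metis convergent_def convergent_imp_bounded)
    with s show "Lm s = l" unfolding Lm_def by (intro glim) (simp add: apply_Bcontfun_nat)
  next
    fix s :: "nat \<Rightarrow> real" and M assume s: "\<And>n. \<bar>s n\<bar> \<le> M"
    then have "bounded (range s)" by (auto simp: bounded_range_abs)
    then have "norm (Bcontfun s) \<le> M" using s by (intro norm_bound) (simp add: apply_Bcontfun_nat)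
    then show "\<bar>Lm s\<bar> \<le> M" using gn[of "Bcontfun s"] by (simp add: Lm_def)
  qed
qed

lemma abs_functional_le:
  fixes f :: "'a::real_normed_vector \<Rightarrow>\<^sub>L real"
  assumes "norm x \<le> C" shows "\<bar>blinfun_apply f x\<bar> \<le> C * norm f"
  using norm_blinfun[of f x] mult_left_mono[OF assms, of "norm f"] by (simp add: mult.commute)

text \<open>By reflexivity the functional that sends \<open>f\<close> to the Banach limit of
  \<open>f (u n)\<close> is evaluation at a vector. Bounded sequences thus have generalised weak
  limits that depend linearly on the sequence, which limits along subsequences would not do.\<close>

lemma weak_Banach_limit:
  fixes u :: "nat \<Rightarrow> 'a::real_normed_vector"
  assumes refl: "reflexive_type TYPE('a)"
    and add: "\<And>s t. bounded (range s) \<Longrightarrow> bounded (range t) \<Longrightarrow> Lm (\<lambda>n. s n + t n) = Lm s + Lm t"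
    and scale: "\<And>c s. bounded (range s) \<Longrightarrow> Lm (\<lambda>n. c * s n) = c * Lm s"
    and bound: "\<And>s M. (\<And>n. \<bar>s n\<bar> \<le> M) \<Longrightarrow> \<bar>Lm s :: real\<bar> \<le> M"
    and u: "\<And>n. norm (u n) \<le> C"
  shows "\<exists>x. (\<forall>f :: 'a \<Rightarrow>\<^sub>L real. blinfun_apply f x = Lm (\<lambda>n. blinfun_apply f (u n))) \<and> norm x \<le> C"
proof -
  have C: "0 \<le> C" using u[of 0] norm_ge_zero order_trans by blast
  define \<psi> where "\<psi> f = Lm (\<lambda>n. blinfun_apply f (u n))" for f :: "'a \<Rightarrow>\<^sub>L real"
  have b: "\<bar>blinfun_apply f (u n)\<bar> \<le> C * norm f" for f :: "'a \<Rightarrow>\<^sub>L real" and n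
    by (rule abs_functional_le[OF u])
  have bd: "bounded (range (\<lambda>n. blinfun_apply f (u n)))" for f :: "'a \<Rightarrow>\<^sub>L real"
    using b by (auto simp: bounded_range_abs)
  have "linear \<psi>"
    by (rule linearI) (simp_all add: \<psi>_def blinfun.add_left blinfun.scaleR_left add[OF bd bd] scale[OF bd])
  moreover have "\<bar>\<psi> f\<bar> \<le> C * norm f" for f unfolding \<psi>_def by (rule bound) (rule b)
  ultimately show ?thesis using reflexive_representation[OF refl _ _ C, of \<psi>] by (metis \<psi>_def)
qed

section \<open>Convergent subsequences in separable spaces\<close>

lemma pointwise_bounded_subsequence:
  fixes F :: "nat \<Rightarrow> 'i \<Rightarrow> real"
  assumes "countable S" "\<And>x. x \<in> S \<Longrightarrow> \<exists>M. \<forall>n. \<bar>F n x\<bar> \<le> M"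
  obtains k :: "nat \<Rightarrow> nat" where "strict_mono k" "\<And>x. x \<in> S \<Longrightarrow> convergent (\<lambda>n. F (k n) x)"
proof -
  obtain M where M: "\<And>x n. x \<in> S \<Longrightarrow> \<bar>F n x\<bar> \<le> M x" using assms(2) by metis
  \<comment> \<open>The pointwise bounds are normalised to the common bound 1 that the diagonal
    argument expects.\<close>
  have "norm (F n x / (1 + \<bar>M x\<bar>)) \<le> 1" if "x \<in> S" for n x
    using M[OF that, of n] by (simp add: abs_divide)
  from function_convergent_subsequence[OF assms(1), of "\<lambda>n x. F n x / (1 + \<bar>M x\<bar>)" 1, OF this]
  obtain k :: "nat \<Rightarrow> nat" where k: "strict_mono k"
    "\<And>x. x \<in> S \<Longrightarrow> \<exists>l. (\<lambda>n. F (k n) x / (1 + \<bar>M x\<bar>)) \<longlonglongrightarrow> l" by blast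
  have "convergent (\<lambda>n. F (k n) x)" if x: "x \<in> S" for x
  proof -
    have nz: "1 + \<bar>M x\<bar> \<noteq> 0" by linarith
    obtain l where "(\<lambda>n. F (k n) x / (1 + \<bar>M x\<bar>)) \<longlonglongrightarrow> l" using k(2)[OF x] by blast
    from tendsto_mult_right[OF this, of "1 + \<bar>M x\<bar>"] show ?thesis
      by (auto simp: convergent_def nz)
  qed
  then show ?thesis using that k(1) by blast
qed

lemma dense_approx:
  fixes x :: "'a::metric_space"
  assumes "closure D = UNIV" "e > 0" obtains d where "d \<in> D" "dist d x < e"
  using assms closure_approachable[of x D] by blast

text \<open>
  It suffices that countably many norming functionals converge: a Banach limit of differences of two
  subsequences is an element of \<open>X\<close> by reflexivity, and the norming functionals see that it vanishes.
\<close>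

lemma weakly_Cauchy_subsequence:
  fixes z :: "nat \<Rightarrow> 'a::real_normed_vector"
  assumes sep: "separable_type TYPE('a)" and refl: "reflexive_type TYPE('a)"
    and z: "\<And>n. norm (z n) \<le> C"
  obtains k :: "nat \<Rightarrow> nat" where "strict_mono k"
    "\<And>f :: 'a \<Rightarrow>\<^sub>L real. convergent (\<lambda>n. blinfun_apply f (z (k n)))"
proof -
  obtain D :: "'a set" where D: "countable D" "closure D = UNIV"
    using sep by (auto simp: separable_type_def)
  define nf where "nf d = (SOME f :: 'a \<Rightarrow>\<^sub>L real. norm f \<le> 1 \<and> blinfun_apply f d = norm d)" for d
  have nf: "norm (nf d) \<le> 1" "blinfun_apply (nf d) d = norm d" for d
    using someI_ex[of "\<lambda>f :: 'a \<Rightarrow>\<^sub>L real. norm f \<le> 1 \<and> blinfun_apply f d = norm d"]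
      norming_functional[of d] unfolding nf_def by metis+
  have "\<exists>M. \<forall>n. \<bar>blinfun_apply (nf d) (z n)\<bar> \<le> M" for d using abs_functional_le[OF z] by blast
  then obtain k where k: "strict_mono k" "\<And>d. d \<in> D \<Longrightarrow> convergent (\<lambda>n. blinfun_apply (nf d) (z (k n)))"
    using pointwise_bounded_subsequence[OF D(1), of "\<lambda>n d. blinfun_apply (nf d) (z n)"] by blast
  have "convergent (\<lambda>n. blinfun_apply f (z (k n)))" for f :: "'a \<Rightarrow>\<^sub>L real"
  proof (rule ccontr)
    assume "\<not> ?thesis"
    then have "\<not> Cauchy (\<lambda>n. blinfun_apply f (z (k n)))" by (simp add: Cauchy_convergent_iff)
    then obtain e where e: "e > 0" "\<And>N. \<exists>m\<ge>N. \<exists>n\<ge>N. e \<le> \<bar>blinfun_apply f (z (k m)) - blinfun_apply f (z (k n))\<bar>"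
      unfolding Cauchy_def by (auto simp: dist_real_def not_less)
    have "\<exists>m\<ge>N. \<exists>n\<ge>N. e \<le> blinfun_apply f (z (k m)) - blinfun_apply f (z (k n))" for N
      using e(2)[of N] by (metis abs_real_def minus_diff_eq)
    then obtain a b where ab: "\<And>N. a N \<ge> N" "\<And>N. b N \<ge> N"
      "\<And>N. e \<le> blinfun_apply f (z (k (a N))) - blinfun_apply f (z (k (b N)))" by metis
    define u where "u N = z (k (a N)) - z (k (b N))" for N
    have u: "norm (u N) \<le> 2 * C" for N
      unfolding u_def using norm_triangle_ineq4[of "z (k (a N))" "z (k (b N))"] z[of "k (a N)"] z[of "k (b N)"] by simp
    obtain Lm :: "(nat \<Rightarrow> real) \<Rightarrow> real" where Lm:
      "\<And>s t. bounded (range s) \<Longrightarrow> bounded (range t) \<Longrightarrow> Lm (\<lambda>n. s n + t n) = Lm s + Lm t"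
      "\<And>c s. bounded (range s) \<Longrightarrow> Lm (\<lambda>n. c * s n) = c * Lm s"
      "\<And>s l. s \<longlonglongrightarrow> l \<Longrightarrow> Lm s = l"
      "\<And>s M. (\<And>n. \<bar>s n\<bar> \<le> M) \<Longrightarrow> \<bar>Lm s\<bar> \<le> M"
      using Banach_limit_exists by blast
    obtain x where x: "\<And>f :: 'a \<Rightarrow>\<^sub>L real. blinfun_apply f x = Lm (\<lambda>n. blinfun_apply f (u n))"
      proof -
      have "\<exists>x. (\<forall>f :: 'a \<Rightarrow>\<^sub>L real. blinfun_apply f x = Lm (\<lambda>n. blinfun_apply f (u n))) \<and> norm x \<le> 2 * C"
        by (rule weak_Banach_limit[OF refl]) (fact Lm u)+
      then show ?thesis using that by blast
    qed
    have nf0: "blinfun_apply (nf d) x = 0" if d: "d \<in> D" for d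
    proof -
      obtain l where l: "(\<lambda>n. blinfun_apply (nf d) (z (k n))) \<longlonglongrightarrow> l" using k(2)[OF d] by (auto simp: convergent_def)
      have "filterlim a at_top sequentially" "filterlim b at_top sequentially"
        using ab by (auto intro: filterlim_at_top_mono[OF filterlim_ident])
      from tendsto_diff[OF filterlim_compose[OF l this(1)] filterlim_compose[OF l this(2)]]
      have "(\<lambda>n. blinfun_apply (nf d) (u n)) \<longlonglongrightarrow> 0" by (simp add: u_def blinfun.diff_right)
      then show ?thesis using x Lm(3) by metis
    qed
    \<comment> \<open>A point \<open>d\<close> of the dense set close to \<open>x\<close> has a
      norming functional that vanishes at \<open>x\<close>; this gives
      \<open>norm d \<le> norm (d - x)\<close>, impossible when \<open>d\<close> lies within a
      quarter of \<open>norm x\<close>.\<close>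
    have "x = 0"
    proof (rule ccontr)
      assume "x \<noteq> 0"
      then obtain d where d: "d \<in> D" "dist d x < norm x / 4" using dense_approx[OF D(2), of "norm x / 4" x] by auto
      have "norm d = blinfun_apply (nf d) (d - x)" using nf0[OF d(1)] nf(2) by (simp add: blinfun.diff_right)
      also have "\<dots> \<le> norm (d - x)" using functional_le_norm[OF nf(1), of d "d - x"] by simp
      finally have "norm d \<le> norm (d - x)" .
      moreover have "norm x \<le> norm d + norm (d - x)" by (metis norm_minus_commute norm_triangle_sub)
      ultimately show False using d(2) by (simp add: dist_norm) (smt (verit) norm_ge_zero)
    qed
    then have L0: "Lm (\<lambda>n. blinfun_apply f (u n)) = 0" using x[of f] by simp
    \<comment> \<open>The shift by \<open>- M\<close> replaces positivity: the values
      \<open>f (u n)\<close> lie between \<open>e\<close> and \<open>M\<close>, so the shifted ones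
      have modulus at most \<open>M - e\<close>, whereas their Banach limit is
      \<open>0 - M\<close>.\<close>
    define M where "M = 2 * C * norm f"
    have fu: "\<bar>blinfun_apply f (u n)\<bar> \<le> M" for n unfolding M_def by (rule abs_functional_le[OF u])
    have ge: "e \<le> blinfun_apply f (u n)" for n using ab(3)[of n] by (simp add: u_def blinfun.diff_right)
    have "\<bar>blinfun_apply f (u n) + (- M)\<bar> \<le> M - e" for n using fu[of n] ge[of n] e(1) by linarith
    then have "\<bar>Lm (\<lambda>n. blinfun_apply f (u n) + (- M))\<bar> \<le> M - e" by (rule Lm(4))
    moreover have "Lm (\<lambda>n. blinfun_apply f (u n) + (- M)) = Lm (\<lambda>n. blinfun_apply f (u n)) + Lm (\<lambda>n. - M)"
      using fu by (intro Lm(1)) (auto simp: bounded_range_abs)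
    moreover have "Lm (\<lambda>n. - M) = - M" by (intro Lm(3)) simp
    ultimately show False using L0 e(1) by simp
  qed
  then show ?thesis using that k(1) by blast
qed

text \<open>Sequential weak-star compactness of the dual ball of a separable space. Convergence on
  the dense set spreads to all points because the functionals are uniformly Lipschitz.\<close>

lemma functionals_pointwise_subsequence:
  fixes f :: "nat \<Rightarrow> 'a::real_normed_vector \<Rightarrow>\<^sub>L real"
  assumes sep: "separable_type TYPE('a)" and f: "\<And>n. norm (f n) \<le> 1"
  obtains k g where "strict_mono (k :: nat \<Rightarrow> nat)" "\<And>x. (\<lambda>n. blinfun_apply (f (k n)) x) \<longlonglongrightarrow> blinfun_apply g x"
proof -
  obtain D :: "'a set" where D: "countable D" "closure D = UNIV"
    using sep by (auto simp: separable_type_def)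
  have fx: "\<bar>blinfun_apply (f n) x\<bar> \<le> norm x" for n x by (rule functional_le_norm[OF f])
  obtain k where k: "strict_mono k" "\<And>d. d \<in> D \<Longrightarrow> convergent (\<lambda>n. blinfun_apply (f (k n)) d)"
    using pointwise_bounded_subsequence[OF D(1), of "\<lambda>n d. blinfun_apply (f n) d"] fx by metis
  have conv: "convergent (\<lambda>n. blinfun_apply (f (k n)) x)" for x
  proof -
    have "Cauchy (\<lambda>n. blinfun_apply (f (k n)) x)"
      unfolding Cauchy_def
    proof (intro allI impI)
      fix e :: real assume e: "e > 0"
      obtain d where d: "d \<in> D" "dist d x < e / 3" using dense_approx[OF D(2), of "e / 3" x] e by auto
      have "Cauchy (\<lambda>n. blinfun_apply (f (k n)) d)" using k(2)[OF d(1)] by (simp add: Cauchy_convergent_iff)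
      then obtain N where N: "\<And>m n. m \<ge> N \<Longrightarrow> n \<ge> N \<Longrightarrow> dist (blinfun_apply (f (k m)) d) (blinfun_apply (f (k n)) d) < e / 3"
        unfolding Cauchy_def using e by (meson divide_pos_pos zero_less_numeral)
      have close: "\<bar>blinfun_apply (f (k n)) d - blinfun_apply (f (k n)) x\<bar> < e / 3" for n
        using fx[of "k n" "d - x"] d(2) by (simp add: blinfun.diff_right dist_norm)
      show "\<exists>N. \<forall>m\<ge>N. \<forall>n\<ge>N. dist (blinfun_apply (f (k m)) x) (blinfun_apply (f (k n)) x) < e"
      proof (intro exI[of _ N] allI impI)
        fix m n assume "m \<ge> N" "n \<ge> N"
        from N[OF this] close[of m] close[of n] show "dist (blinfun_apply (f (k m)) x) (blinfun_apply (f (k n)) x) < e"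
          unfolding dist_real_def by linarith
      qed
    qed
    then show ?thesis by (simp add: Cauchy_convergent_iff)
  qed
  define g where "g x = lim (\<lambda>n. blinfun_apply (f (k n)) x)" for x
  have g: "(\<lambda>n. blinfun_apply (f (k n)) x) \<longlonglongrightarrow> g x" for x
    unfolding g_def using conv by (simp add: convergent_LIMSEQ_iff)
  have "linear g"
  proof (rule linearI)
    fix x y show "g (x + y) = g x + g y"
      using tendsto_add[OF g[of x] g[of y]] g[of "x + y"] by (simp add: blinfun.add_right LIMSEQ_unique)
  next
    fix c x show "g (c *\<^sub>R x) = c *\<^sub>R g x"
      using tendsto_mult_left[OF g[of x], of c] g[of "c *\<^sub>R x"] by (simp add: blinfun.scaleR_right LIMSEQ_unique)
  qed
  moreover have "\<bar>g x\<bar> \<le> 1 * norm x" for x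
    using tendsto_rabs[OF g[of x]] fx by (simp add: LIMSEQ_le_const2)
  ultimately obtain h where "\<And>x. blinfun_apply h x = g x" using bounded_functional_Blinfun[of g 1] by (metis zero_le_one)
  then show ?thesis using that[of k h] k(1) g by simp
qed

text \<open>In \<open>R l m n\<close>, \<open>l\<close> numbers the tolerance, \<open>m\<close> is
  an index already chosen and \<open>n\<close> a later one. \<open>B m\<close> exceeds every
  threshold \<open>b l j\<close> with \<open>l\<close> and \<open>j\<close> at most
  \<open>m\<close>, so each jump serves all earlier terms at once.\<close>

lemma fast_subsequence:
  assumes "\<And>l m. \<forall>\<^sub>F n in sequentially. R l m n"
  obtains r :: "nat \<Rightarrow> nat" where "strict_mono r" "\<And>l i. l < i \<Longrightarrow> R l (r l) (r i)"
proof -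
  obtain b where b: "\<And>l m n. n \<ge> b l m \<Longrightarrow> R l m n"
    using assms unfolding eventually_sequentially by metis
  define B where "B m = Suc m + (\<Sum>l\<le>m. \<Sum>j\<le>m. b l j)" for m
  have B: "b l j \<le> B m" if "l \<le> m" "j \<le> m" for l j m
  proof -
    have "b l j \<le> (\<Sum>j\<le>m. b l j)" using that by (intro member_le_sum) auto
    also have "\<dots> \<le> (\<Sum>l\<le>m. \<Sum>j\<le>m. b l j)" using that by (intro member_le_sum[of l "{..m}" "\<lambda>l. \<Sum>j\<le>m. b l j"]) auto
    finally show ?thesis by (simp add: B_def)
  qed
  define r where "r = rec_nat 0 (\<lambda>_. B)"
  have r: "r (Suc i) = B (r i)" for i by (simp add: r_def)
  have sm: "strict_mono r" by (rule strict_mono_Suc_iff[THEN iffD2]) (simp add: r B_def)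
  have "R l (r l) (r i)" if "l < i" for l i
  proof -
    obtain j where j: "i = Suc j" "l \<le> j" using \<open>l < i\<close> by (metis less_Suc_eq_le lessE less_imp_le_nat)
    have "l \<le> r j" using j(2) strict_mono_imp_increasing[OF sm, of j] by simp
    moreover have "r l \<le> r j" using j(2) sm by (simp add: strict_mono_less_eq)
    ultimately have "b l (r l) \<le> r i" using B[of l "r j" "r l"] by (simp add: j(1) r)
    then show ?thesis by (rule b)
  qed
  then show ?thesis using that sm by blast
qed

text \<open>A weakly unconditionally Cauchy series together with its constant: equivalently, an
  operator of norm at most \<open>C\<close> on the finitely supported sequences of c_0 sends the
  unit vectors to the \<open>x j\<close>.\<close>

definition wuC :: "(nat \<Rightarrow> 'a::real_normed_vector) \<Rightarrow> real \<Rightarrow> bool" where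
  "wuC x C \<longleftrightarrow> (\<forall>F a. finite F \<longrightarrow> (\<forall>j\<in>F. \<bar>a j\<bar> \<le> 1) \<longrightarrow> norm (\<Sum>j\<in>F. a j *\<^sub>R x j) \<le> C)"

lemma wuC_D: "wuC x C \<Longrightarrow> finite F \<Longrightarrow> (\<And>j. j \<in> F \<Longrightarrow> \<bar>a j\<bar> \<le> 1) \<Longrightarrow> norm (\<Sum>j\<in>F. a j *\<^sub>R x j) \<le> C"
  by (auto simp: wuC_def)

lemma wuC_abs_sum:
  fixes f :: "'a::real_normed_vector \<Rightarrow>\<^sub>L real"
  assumes "wuC x C" "finite F" shows "(\<Sum>j\<in>F. \<bar>blinfun_apply f (x j)\<bar>) \<le> C * norm f"
proof -
  have "(\<Sum>j\<in>F. \<bar>blinfun_apply f (x j)\<bar>) = blinfun_apply f (\<Sum>j\<in>F. sgn (blinfun_apply f (x j)) *\<^sub>R x j)"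
    by (simp add: blinfun.sum_right blinfun.scaleR_right sgn_mult_self_eq abs_sgn mult.commute)
  also have "\<dots> \<le> C * norm f"
    using abs_functional_le[OF wuC_D[OF assms], of "\<lambda>j. sgn (blinfun_apply f (x j))" f]
    by (force simp: sgn_if)
  finally show ?thesis .
qed

lemma wuC_summable:
  fixes f :: "'a::real_normed_vector \<Rightarrow>\<^sub>L real"
  assumes "wuC x C" shows "summable (\<lambda>j. \<bar>blinfun_apply f (x j)\<bar>)"
  using wuC_abs_sum[OF assms] by (intro summableI_nonneg_bounded[of _ "C * norm f"]) auto

lemma wuC_subseq:
  assumes "wuC x C" "inj k" shows "wuC (x \<circ> k) C"
  unfolding wuC_def
proof (intro allI impI)
  fix F and a :: "nat \<Rightarrow> real" assume F: "finite F" "\<forall>j\<in>F. \<bar>a j\<bar> \<le> 1"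
  have "(\<Sum>j\<in>F. a j *\<^sub>R (x \<circ> k) j) = (\<Sum>i\<in>k ` F. a (inv k i) *\<^sub>R x i)"
    using assms(2) by (subst sum.reindex) (auto simp: inj_on_def)
  also have "norm \<dots> \<le> C" using F assms(2) by (intro wuC_D[OF assms(1)]) auto
  finally show "norm (\<Sum>j\<in>F. a j *\<^sub>R (x \<circ> k) j) \<le> C" .
qed

text \<open>
  If \<open>g\<^sub>n(x\<^sub>n)\<close> stays away from \<open>0\<close> for a pointwise null sequence \<open>g\<^sub>n\<close>, make the matrix \<open>g\<^sub>i(x\<^sub>j)\<close> almost
  diagonal along a subsequence; reflexivity then provides the sum of that subsequence, on which \<open>g\<^sub>n\<close> cannot tend to \<open>0\<close>.
\<close>

theorem wuC_reflexive_null: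
  fixes x :: "nat \<Rightarrow> 'a::real_normed_vector"
  assumes sep: "separable_type TYPE('a)" and refl: "reflexive_type TYPE('a)" and x: "wuC x C"
  shows "x \<longlonglongrightarrow> 0"
proof (rule ccontr)
  assume "\<not> x \<longlonglongrightarrow> 0"
  then obtain e where e: "e > 0" "\<And>N. \<exists>n\<ge>N. e \<le> norm (x n)"
    by (auto simp: LIMSEQ_iff not_less)
  then have "\<exists>\<^sub>\<infinity>n. e \<le> norm (x n)" by (auto simp: INFM_nat_le)
  from infinite_enumerate[OF this[unfolded INFM_iff_infinite]]
  obtain k0 :: "nat \<Rightarrow> nat" where k0: "strict_mono k0" "\<And>n. e \<le> norm (x (k0 n))" by blast
  define nf where "nf d = (SOME f :: 'a \<Rightarrow>\<^sub>L real. norm f \<le> 1 \<and> blinfun_apply f d = norm d)" for d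
  have nf: "norm (nf d) \<le> 1" "blinfun_apply (nf d) d = norm d" for d
    using someI_ex[of "\<lambda>f :: 'a \<Rightarrow>\<^sub>L real. norm f \<le> 1 \<and> blinfun_apply f d = norm d"]
      norming_functional[of d] unfolding nf_def by metis+
  obtain k1 f where k1: "strict_mono k1"
    "\<And>y. (\<lambda>n. blinfun_apply (nf (x (k0 (k1 n)))) y) \<longlonglongrightarrow> blinfun_apply f y"
    using functionals_pointwise_subsequence[OF sep, of "\<lambda>n. nf (x (k0 n))"] nf(1) by metis
  define y where "y n = x (k0 (k1 n))" for n
  \<comment> \<open>Subtracting the pointwise limit \<open>f\<close> makes the functionals pointwise
    null. It costs little on the diagonal, since \<open>f (y n)\<close> tends to 0 for a weakly
    unconditionally Cauchy series; hence \<open>e / 2\<close> remains.\<close>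
  define g where "g n = nf (y n) - f" for n
  have "inj (k0 \<circ> k1)" using strict_mono_o[OF k0(1) k1(1)] strict_mono_imp_inj_on by blast
  from wuC_subseq[OF x this] have y: "wuC y C" unfolding y_def comp_def .
  have g0: "(\<lambda>n. blinfun_apply (g n) z) \<longlonglongrightarrow> 0" for z
    using tendsto_diff[OF k1(2)[of z] tendsto_const[of "blinfun_apply f z"]] by (simp add: g_def y_def blinfun.diff_left)
  have "(\<lambda>n. \<bar>blinfun_apply f (y n)\<bar>) \<longlonglongrightarrow> 0" by (rule summable_LIMSEQ_zero[OF wuC_summable[OF y]])
  then have "\<forall>\<^sub>F n in sequentially. \<bar>blinfun_apply f (y n)\<bar> < e / 2" using e(1) by (intro order_tendstoD) auto
  then have gy: "\<forall>\<^sub>F n in sequentially. e / 2 \<le> blinfun_apply (g n) (y n)"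
  proof (rule eventually_mono)
    fix n assume "\<bar>blinfun_apply f (y n)\<bar> < e / 2"
    then show "e / 2 \<le> blinfun_apply (g n) (y n)"
      using k0(2)[of "k1 n"] nf(2)[of "y n"] by (simp add: g_def blinfun.diff_left y_def abs_less_iff)
  qed
  \<comment> \<open>The diagonal entry is at least \<open>e / 2\<close>. Entries at earlier vectors
    sum to at most \<open>e / 8\<close> through the geometric factor, those at later vectors to at
    most \<open>e / 8\<close>, so \<open>e / 4\<close> survives in the sum.\<close>
  define R where "R l m n \<longleftrightarrow> e / 2 \<le> blinfun_apply (g n) (y n) \<and> \<bar>blinfun_apply (g n) (y m)\<bar> \<le> e / 16 * (1/2)^l
     \<and> (\<forall>F. finite F \<longrightarrow> F \<subseteq> {n..} \<longrightarrow> (\<Sum>j\<in>F. \<bar>blinfun_apply (g m) (y j)\<bar>) \<le> e / 8)" for l m n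
  have "\<forall>\<^sub>F n in sequentially. R l m n" for l m
  proof -
    have 1: "\<forall>\<^sub>F n in sequentially. \<bar>blinfun_apply (g n) (y m)\<bar> < e / 16 * (1/2)^l"
      using tendsto_rabs_zero[OF g0[of "y m"]] e(1) by (intro order_tendstoD) auto
    have "summable (\<lambda>j. norm (\<bar>blinfun_apply (g m) (y j)\<bar>))" using wuC_summable[OF y] by simp
    from suminf_exist_split[OF _ summable_norm_cancel[OF this], of "e / 8"] e(1)
    obtain N where N: "\<And>n. n \<ge> N \<Longrightarrow> norm (\<Sum>i. \<bar>blinfun_apply (g m) (y (i + n))\<bar>) < e / 8" by auto
    have 2: "(\<Sum>j\<in>F. \<bar>blinfun_apply (g m) (y j)\<bar>) \<le> e / 8" if "n \<ge> N" "finite F" "F \<subseteq> {n..}" for n F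
    proof -
      have "(\<Sum>j\<in>F. \<bar>blinfun_apply (g m) (y j)\<bar>) = (\<Sum>i\<in>(\<lambda>j. j - n) ` F. \<bar>blinfun_apply (g m) (y (i + n))\<bar>)"
      proof (subst sum.reindex)
        show "inj_on (\<lambda>j. j - n) F" using that(3) by (intro inj_on_diff_nat) auto
        show "(\<Sum>j\<in>F. \<bar>blinfun_apply (g m) (y j)\<bar>) = sum ((\<lambda>i. \<bar>blinfun_apply (g m) (y (i + n))\<bar>) \<circ> (\<lambda>j. j - n)) F"
          using that(3) by (intro sum.cong) auto
      qed
      also have "\<dots> \<le> (\<Sum>i. \<bar>blinfun_apply (g m) (y (i + n))\<bar>)"
        using that(2) wuC_summable[OF y, of "g m"]
        by (intro sum_le_suminf) (simp_all add: summable_iff_shift[of "\<lambda>j. \<bar>blinfun_apply (g m) (y j)\<bar>" n])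
      also have "\<dots> \<le> e / 8" using N[OF that(1)] by simp
      finally show ?thesis .
    qed
    have "\<forall>\<^sub>F n in sequentially. n \<ge> N" by (rule eventually_ge_at_top)
    with 1 gy show ?thesis
    proof eventually_elim
      case (elim n) then show ?case unfolding R_def using 2[of n] by (meson less_imp_le)
    qed
  qed
  from fast_subsequence[of R, OF this] obtain r where r: "strict_mono r" "\<And>l i. l < i \<Longrightarrow> R l (r l) (r i)" by blast
  have C: "0 \<le> C" using wuC_D[OF y, of "{}"] by simp
  have inj: "inj r" using r(1) strict_mono_imp_inj_on by blast
  have yr: "wuC (y \<circ> r) C" using wuC_subseq[OF y inj] .
  define \<psi> where "\<psi> h = (\<Sum>i. blinfun_apply h (y (r i)))" for h :: "'a \<Rightarrow>\<^sub>L real"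
  have sm: "summable (\<lambda>i. \<bar>blinfun_apply h (y (r i))\<bar>)" for h :: "'a \<Rightarrow>\<^sub>L real" using wuC_summable[OF yr] by simp
  have sm': "summable (\<lambda>i. blinfun_apply h (y (r i)))" for h :: "'a \<Rightarrow>\<^sub>L real"
    using sm[of h] by (rule summable_rabs_cancel)
  have "linear \<psi>"
    using sm' by (intro linearI) (auto simp: \<psi>_def blinfun.add_left blinfun.scaleR_left suminf_add[symmetric] suminf_mult[symmetric])
  moreover have "\<bar>\<psi> h\<bar> \<le> C * norm h" for h
  proof -
    have "\<bar>\<psi> h\<bar> \<le> (\<Sum>i. \<bar>blinfun_apply h (y (r i))\<bar>)" unfolding \<psi>_def by (rule summable_rabs[OF sm])
    also have "\<dots> \<le> C * norm h"
      using wuC_abs_sum[OF yr, of _ h] by (intro suminf_le_const[OF sm]) simp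
    finally show ?thesis .
  qed
  ultimately obtain z where z: "\<And>h. blinfun_apply h z = \<psi> h"
    using reflexive_representation[OF refl _ _ C] by blast
  have "e / 4 \<le> blinfun_apply (g (r (Suc i))) z" for i
  proof -
    define n where "n = r (Suc i)"
    have Rn: "R i (r i) n" using r(2)[of i "Suc i"] by (simp add: n_def)
    then have main: "e / 2 \<le> blinfun_apply (g n) (y n)" by (simp add: R_def)
    have lim: "(\<lambda>j. \<Sum>l<j. blinfun_apply (g n) (y (r l))) \<longlonglongrightarrow> blinfun_apply (g n) z"
      using summable_LIMSEQ[OF sm'[of "g n"]] z[of "g n"] by (simp add: \<psi>_def)
    have "e / 4 \<le> (\<Sum>l<j. blinfun_apply (g n) (y (r l)))" if j: "j \<ge> i + 2" for j
    proof -
      have "(\<Sum>l<j. blinfun_apply (g n) (y (r l))) = (\<Sum>l<Suc i. blinfun_apply (g n) (y (r l)))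
        + blinfun_apply (g n) (y n) + (\<Sum>l=Suc (Suc i)..<j. blinfun_apply (g n) (y (r l)))"
        using sum.atLeastLessThan_concat[of 0 "Suc (Suc i)" j "\<lambda>l. blinfun_apply (g n) (y (r l))"] j
        by (simp add: n_def lessThan_atLeast0)
      moreover have "\<bar>\<Sum>l<Suc i. blinfun_apply (g n) (y (r l))\<bar> \<le> e / 8"
      proof -
        have "\<bar>\<Sum>l<Suc i. blinfun_apply (g n) (y (r l))\<bar> \<le> (\<Sum>l<Suc i. e / 16 * (1/2)^l)"
          using r(2)[of _ "Suc i"] by (intro order_trans[OF sum_abs] sum_mono) (auto simp: R_def n_def)
        also have "\<dots> = e / 16 * (\<Sum>l<Suc i. (1/2)^l)" by (simp only: sum_distrib_left)
        also have "\<dots> \<le> e / 16 * 2" using e(1) by (intro mult_left_mono) (subst sum_gp_strict, auto)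
        finally show ?thesis using e(1) by simp
      qed
      moreover have "\<bar>\<Sum>l=Suc (Suc i)..<j. blinfun_apply (g n) (y (r l))\<bar> \<le> e / 8"
      proof -
        have "\<bar>\<Sum>l=Suc (Suc i)..<j. blinfun_apply (g n) (y (r l))\<bar> \<le> (\<Sum>l=Suc (Suc i)..<j. \<bar>blinfun_apply (g n) (y (r l))\<bar>)"
          by (rule sum_abs)
        also have "\<dots> = (\<Sum>j\<in>r ` {Suc (Suc i)..<j}. \<bar>blinfun_apply (g n) (y j)\<bar>)"
          using inj by (subst sum.reindex) (auto simp: inj_on_def)
        also have "\<dots> \<le> e / 8"
        proof -
          have "R (Suc i) (r (Suc i)) (r (Suc (Suc i)))" by (rule r(2)) simp
          then have *: "\<forall>F. finite F \<longrightarrow> F \<subseteq> {r (Suc (Suc i))..} \<longrightarrow> (\<Sum>j\<in>F. \<bar>blinfun_apply (g (r (Suc i))) (y j)\<bar>) \<le> e / 8"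
            unfolding R_def by (elim conjE)
          have "r ` {Suc (Suc i)..<j} \<subseteq> {r (Suc (Suc i))..}" using strict_mono_less_eq[OF r(1)] by auto
          then show ?thesis unfolding n_def by (intro *[rule_format]) auto
        qed
        finally show ?thesis .
      qed
      ultimately show ?thesis using main by linarith
    qed
    then show ?thesis using lim unfolding n_def by (intro LIMSEQ_le_const) auto
  qed
  moreover have "(\<lambda>i. blinfun_apply (g (r (Suc i))) z) \<longlonglongrightarrow> 0"
    using LIMSEQ_Suc[OF LIMSEQ_subseq_LIMSEQ[OF g0[of z] r(1)]] by (simp add: comp_def)
  ultimately have "e / 4 \<le> 0" by (intro LIMSEQ_le_const) auto
  with e(1) show False by simp
qed

text \<open>If tails were not uniformly small, there would be successive disjoint blocks of norm
  above \<open>e\<close>. Such blocks again satisfy \<open>wuC\<close> with the same constant, so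
  they would tend to 0. The uniformity in the coefficients is the form in which the absence of c_0
  in \<open>X\<close> is used later.\<close>

lemma wuC_reflexive_tail:
  fixes x :: "nat \<Rightarrow> 'a::real_normed_vector"
  assumes sep: "separable_type TYPE('a)" and refl: "reflexive_type TYPE('a)" and x: "wuC x C" and e: "e > 0"
  shows "\<exists>n0. \<forall>F a M. finite F \<longrightarrow> F \<subseteq> {n0..} \<longrightarrow> (\<forall>j\<in>F. \<bar>a j\<bar> \<le> M) \<longrightarrow> 0 \<le> M \<longrightarrow> norm (\<Sum>j\<in>F. a j *\<^sub>R x j) \<le> e * M"
proof (rule ccontr)
  assume "\<not> ?thesis"
  then have ex: "\<exists>F a M. finite F \<and> F \<subseteq> {n..} \<and> (\<forall>j\<in>F. \<bar>a j\<bar> \<le> M) \<and> 0 \<le> M \<and> e * M < norm (\<Sum>j\<in>F. a j *\<^sub>R x j)" for n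
    by (meson not_less)
  have "\<exists>F a. finite F \<and> F \<subseteq> {n..} \<and> (\<forall>j\<in>F. \<bar>a j\<bar> \<le> 1) \<and> e < norm (\<Sum>j\<in>F. a j *\<^sub>R x j)" for n
  proof -
    obtain F a M where F: "finite F" "F \<subseteq> {n..}" "\<And>j. j \<in> F \<Longrightarrow> \<bar>a j\<bar> \<le> M" "0 \<le> M" "e * M < norm (\<Sum>j\<in>F. a j *\<^sub>R x j)"
      using ex by metis
    have "M \<noteq> 0" using F(3,5) by auto
    then have M: "M > 0" using F(4) by simp
    have eq: "(\<Sum>j\<in>F. (a j / M) *\<^sub>R x j) = (1/M) *\<^sub>R (\<Sum>j\<in>F. a j *\<^sub>R x j)" by (simp add: scaleR_right.sum)
    have "e < norm (\<Sum>j\<in>F. (a j / M) *\<^sub>R x j)" unfolding eq using F(5) M by (simp add: less_divide_eq)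
    then show ?thesis using F(1,2,3) M by (intro exI[of _ F] exI[of _ "\<lambda>j. a j / M"]) (auto simp: divide_le_eq)
  qed
  then obtain F a where Fa: "\<And>n. finite (F n)" "\<And>n. F n \<subseteq> {n..}" "\<And>n j. j \<in> F n \<Longrightarrow> \<bar>a n j\<bar> \<le> (1::real)"
    "\<And>n. e < norm (\<Sum>j\<in>F n. a n j *\<^sub>R x j)" by metis
  define s where "s = rec_nat 0 (\<lambda>_ n. Suc (n + Max (insert 0 (F n))))"
  have s: "s (Suc i) = Suc (s i + Max (insert 0 (F (s i))))" for i by (simp add: s_def)
  have sm: "strict_mono s" by (rule strict_mono_Suc_iff[THEN iffD2]) (simp add: s)
  have F_lt: "j < s (Suc i)" if "j \<in> F (s i)" for i j
    proof -
    have "j \<le> Max (insert 0 (F (s i)))" using that Fa(1) by (intro Max_ge) auto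
    then show ?thesis unfolding s by simp
  qed
  have disj: "F (s i) \<inter> F (s i') = {}" if "i < i'" for i i'
  proof -
    have "s (Suc i) \<le> s i'" using that sm by (simp add: strict_mono_less_eq Suc_le_eq)
    then show ?thesis using F_lt[of _ i] Fa(2)[of "s i'"] by fastforce
  qed
  then have disj': "F (s i) \<inter> F (s i') = {}" if "i \<noteq> i'" for i i'
    using that by (metis inf_commute linorder_neqE_nat)
  define b where "b i = (\<Sum>j\<in>F (s i). a (s i) j *\<^sub>R x j)" for i
  have "wuC b C"
    unfolding wuC_def
  proof (intro allI impI)
    fix G and c :: "nat \<Rightarrow> real" assume G: "finite G" "\<forall>i\<in>G. \<bar>c i\<bar> \<le> 1"
    define U where "U = (\<Union>i\<in>G. F (s i))"
    define idx where "idx j = (THE i. i \<in> G \<and> j \<in> F (s i))" for j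
    have idx: "idx j = i" if "i \<in> G" "j \<in> F (s i)" for i j
      unfolding idx_def using that disj' by (intro the_equality) auto
    have "(\<Sum>i\<in>G. c i *\<^sub>R b i) = (\<Sum>i\<in>G. \<Sum>j\<in>F (s i). (c (idx j) * a (s (idx j)) j) *\<^sub>R x j)"
      by (simp add: b_def scaleR_sum_right idx)
    also have "\<dots> = (\<Sum>j\<in>U. (c (idx j) * a (s (idx j)) j) *\<^sub>R x j)"
      unfolding U_def using G(1) Fa(1) disj' by (subst sum.UNION_disjoint) auto
    also have "norm \<dots> \<le> C"
    proof (rule wuC_D[OF x])
      show "finite U" unfolding U_def using G(1) Fa(1) by auto
      fix j assume "j \<in> U"
      then obtain i where "i \<in> G" "j \<in> F (s i)" by (auto simp: U_def)
      then show "\<bar>c (idx j) * a (s (idx j)) j\<bar> \<le> 1"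
        using idx[of i j] G(2) Fa(3)[of j "s i"] by (simp add: abs_mult mult_le_one)
    qed
    finally show "norm (\<Sum>i\<in>G. c i *\<^sub>R b i) \<le> C" .
  qed
  from wuC_reflexive_null[OF sep refl this] have "b \<longlonglongrightarrow> 0" .
  then have "(\<lambda>i. norm (b i)) \<longlonglongrightarrow> 0" by (rule tendsto_norm_zero)
  moreover have "e \<le> norm (b i)" for i using Fa(4)[of "s i"] by (simp add: b_def)
  ultimately have "e \<le> 0" by (intro LIMSEQ_le_const) auto
  with e show False by simp
qed

section \<open>A lattice form of the Dunford--Pettis property\<close>

text \<open>
  The running maxima \<open>g n i\<close> of the tail from \<open>h n\<close> stabilise up to an \<open>m\<close>-small error. Minima \<open>H\<close> of
  stabilised maxima decrease pointwise to \<open>0\<close>, hence uniformly by Dini's argument, and what is cut off from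
  \<open>h n\<close> by \<open>H\<close> is \<open>m\<close>-small. This replaces Egorov's theorem and avoids measures.
\<close>

theorem exhaustive_pointwise_null:
  fixes m :: "('k::topological_space \<Rightarrow> real) \<Rightarrow> 'x::real_normed_vector"
  assumes cpt: "compact Kd" and C: "0 \<le> C"
    and add: "\<And>h h' M M'. (\<And>\<phi>. \<phi> \<in> Kd \<Longrightarrow> \<bar>h \<phi>\<bar> \<le> M) \<Longrightarrow> (\<And>\<phi>. \<phi> \<in> Kd \<Longrightarrow> \<bar>h' \<phi>\<bar> \<le> M') \<Longrightarrow>
        m (\<lambda>\<phi>. h \<phi> + h' \<phi>) = m h + m h'"
    and bound: "\<And>h M. (\<And>\<phi>. \<phi> \<in> Kd \<Longrightarrow> \<bar>h \<phi>\<bar> \<le> M) \<Longrightarrow> 0 \<le> M \<Longrightarrow> norm (m h) \<le> C * M"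
    and exhaustive: "\<And>d. (\<And>j \<phi>. \<phi> \<in> Kd \<Longrightarrow> 0 \<le> d j \<phi>) \<Longrightarrow> (\<And>r \<phi>. \<phi> \<in> Kd \<Longrightarrow> (\<Sum>j<r. d j \<phi>) \<le> 1) \<Longrightarrow>
        (\<lambda>j::nat. m (d j)) \<longlonglongrightarrow> 0"
    and cont: "\<And>n::nat. continuous_on Kd (h n)"
    and h01: "\<And>n \<phi>. \<phi> \<in> Kd \<Longrightarrow> 0 \<le> h n \<phi> \<and> h n \<phi> \<le> 1"
    and null: "\<And>\<phi>. \<phi> \<in> Kd \<Longrightarrow> (\<lambda>n. h n \<phi>) \<longlonglongrightarrow> 0"
  shows "(\<lambda>n. m (h n)) \<longlonglongrightarrow> 0"
proof -
  define g where "g n i \<phi> = Max ((\<lambda>j. h (n + j) \<phi>) ` {..i})" for n i :: nat and \<phi>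
  have g0: "g n 0 = h n" for n by (simp add: g_def fun_eq_iff)
  have gS: "g n (Suc i) = (\<lambda>\<phi>. max (h (n + Suc i) \<phi>) (g n i \<phi>))" for n i
    by (simp add: g_def fun_eq_iff atMost_Suc)
  have g_cont: "continuous_on Kd (g n i)" for n i
    by (induction i) (auto simp: g0 gS cont intro!: continuous_on_max)
  have g01: "0 \<le> g n i \<phi> \<and> g n i \<phi> \<le> 1" if "\<phi> \<in> Kd" for n i \<phi>
    by (induction i) (use h01[OF that] in \<open>auto simp: g0 gS max_def\<close>)
  have g_mono: "g n i \<phi> \<le> g n i' \<phi>" if "i \<le> i'" for n i i' \<phi>
    using that by (induction rule: dec_induct) (auto simp: gS)
  have h_le_g: "h (n + j) \<phi> \<le> g n i \<phi>" if "j \<le> i" for n j i \<phi>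
    unfolding g_def using that by (intro Max_ge) auto
  \<comment> \<open>Otherwise there are infinitely many functions below successive increments of
    \<open>g n\<close>, none of them \<open>m\<close>-small. The increments telescope and
    \<open>g n\<close> takes values in [0,1], so this contradicts exhaustivity.\<close>
  have stable: "\<exists>p. \<forall>q\<ge>p. \<forall>d. (\<forall>\<phi>\<in>Kd. 0 \<le> d \<phi> \<and> d \<phi> \<le> g n q \<phi> - g n p \<phi>) \<longrightarrow> norm (m d) \<le> \<eta>"
    if \<eta>: "\<eta> > 0" for n \<eta>
  proof (rule ccontr)
    assume "\<not> ?thesis"
    then obtain Q D where QD: "\<And>p. Q p \<ge> p" "\<And>p \<phi>. \<phi> \<in> Kd \<Longrightarrow> 0 \<le> D p \<phi> \<and> D p \<phi> \<le> g n (Q p) \<phi> - g n p \<phi>"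
      "\<And>p. norm (m (D p)) > \<eta>" by (metis not_less)
    define s where "s = rec_nat 0 (\<lambda>_. Q)"
    have s: "s (Suc i) = Q (s i)" for i by (simp add: s_def)
    have tele: "(\<Sum>i<r. D (s i) \<phi>) \<le> g n (s r) \<phi> - g n (s 0) \<phi>" if "\<phi> \<in> Kd" for r \<phi>
    proof (induction r)
      case (Suc r) then show ?case using QD(2)[OF that, of "s r"] by (simp add: s)
    qed simp
    have "(\<Sum>i<r. D (s i) \<phi>) \<le> 1" if "\<phi> \<in> Kd" for r \<phi>
      using tele[OF that, of r] g01[OF that, of n "s r"] g01[OF that, of n "s 0"] by linarith
    then have "(\<lambda>i. m (D (s i))) \<longlonglongrightarrow> 0" using QD(2) by (intro exhaustive) auto
    then have "(\<lambda>i. norm (m (D (s i)))) \<longlonglongrightarrow> 0" by (rule tendsto_norm_zero)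
    moreover have "\<eta> \<le> norm (m (D (s i)))" for i using QD(3)[of "s i"] by simp
    ultimately have "\<eta> \<le> 0" by (intro LIMSEQ_le_const) auto
    with \<eta> show False by simp
  qed
  have small: "\<exists>n0. \<forall>n\<ge>n0. norm (m (h n)) \<le> (2 + C) * \<epsilon>" if \<epsilon>: "\<epsilon> > 0" for \<epsilon>
  proof -
    have "\<exists>p. \<forall>q\<ge>p. \<forall>d. (\<forall>\<phi>\<in>Kd. 0 \<le> d \<phi> \<and> d \<phi> \<le> g n q \<phi> - g n p \<phi>) \<longrightarrow> norm (m d) \<le> \<epsilon> * (1/2)^n" for n
      using \<epsilon> by (intro stable) simp
    then obtain p where p: "\<And>n q d. q \<ge> p n \<Longrightarrow> (\<And>\<phi>. \<phi> \<in> Kd \<Longrightarrow> 0 \<le> d \<phi> \<and> d \<phi> \<le> g n q \<phi> - g n (p n) \<phi>) \<Longrightarrow>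
      norm (m d) \<le> \<epsilon> * (1/2)^n" by metis
    define H where "H = rec_nat (g 0 (p 0)) (\<lambda>i Hi \<phi>. min (Hi \<phi>) (g (Suc i) (p (Suc i)) \<phi>))"
    have H0: "H 0 = g 0 (p 0)" and HS: "H (Suc i) = (\<lambda>\<phi>. min (H i \<phi>) (g (Suc i) (p (Suc i)) \<phi>))" for i
      by (simp_all add: H_def)
    have H_cont: "continuous_on Kd (H i)" for i
      by (induction i) (auto simp: H0 HS g_cont intro!: continuous_on_min)
    have H01: "0 \<le> H i \<phi> \<and> H i \<phi> \<le> 1" if "\<phi> \<in> Kd" for i \<phi>
      by (induction i) (use g01[OF that] in \<open>auto simp: H0 HS min_def\<close>)
    have H_anti: "H i' \<phi> \<le> H i \<phi>" if "i \<le> i'" for i i' \<phi>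
      using that by (induction rule: dec_induct) (auto simp: HS min_def)
    have H_le_g: "H i \<phi> \<le> g i (p i) \<phi>" for i \<phi> by (cases i) (auto simp: H0 HS)
    have H_small: "\<exists>i. H i \<phi> < \<epsilon>" if \<phi>: "\<phi> \<in> Kd" for \<phi>
    proof -
      obtain n where n: "\<And>j. j \<ge> n \<Longrightarrow> h j \<phi> < \<epsilon>"
        using order_tendstoD(2)[OF null[OF \<phi>] \<epsilon>] by (auto simp: eventually_sequentially)
      have "g n i \<phi> < \<epsilon>" for i by (induction i) (auto simp: g0 gS n)
      then show ?thesis using H_le_g[of n \<phi>] by (meson le_less_trans)
    qed
    have "\<exists>T. open T \<and> T \<inter> Kd = H i -` {..<\<epsilon>} \<inter> Kd" for i
      using H_cont[of i] continuous_on_open_invariant[of Kd "H i"] open_lessThan by blast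
    then obtain T where T: "\<And>i. open (T i)" "\<And>i. T i \<inter> Kd = H i -` {..<\<epsilon>} \<inter> Kd" by metis
    have "Kd \<subseteq> (\<Union>i\<in>UNIV. T i)" using H_small T(2) by fastforce
    from compactE_image[OF cpt _ this] T(1) obtain I where I: "finite I" "Kd \<subseteq> (\<Union>i\<in>I. T i)" by auto
    define n1 where "n1 = Max (insert 0 I)"
    have H_eps: "H n1 \<phi> \<le> \<epsilon>" if \<phi>: "\<phi> \<in> Kd" for \<phi>
    proof -
      obtain i where i: "i \<in> I" "\<phi> \<in> T i" using I(2) \<phi> by blast
      then have "H i \<phi> < \<epsilon>" using T(2)[of i] \<phi> by blast
      moreover have "i \<le> n1" unfolding n1_def using I(1) i(1) by (intro Max_ge) auto
      ultimately show ?thesis using H_anti[of i n1 \<phi>] by simp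
    qed
    \<comment> \<open>For \<open>n \<ge> n0\<close> and \<open>i \<le> n1\<close>,
      \<open>h n\<close> is among the functions of which \<open>g i (n - i)\<close> is the maximum,
      and \<open>n - i \<ge> p i\<close>, so stability from \<open>p i\<close> on applies.\<close>
    define n0 where "n0 = (\<Sum>i\<le>n1. i + p i)"
    have n0: "i + p i \<le> n0" if "i \<le> n1" for i
      unfolding n0_def using that by (intro member_le_sum[of i "{..n1}" "\<lambda>i. i + p i"]) auto
    have "norm (m (h n)) \<le> (2 + C) * \<epsilon>" if n: "n \<ge> n0" for n
    proof -
      \<comment> \<open>The part of \<open>h n\<close> above \<open>H j\<close>. From
        \<open>j\<close> to \<open>Suc j\<close> it grows by at most the excess of
        \<open>h n\<close> over \<open>g (Suc j) (p (Suc j))\<close>; the tolerances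
        \<open>\<epsilon> * (1/2)^i\<close> sum to at most \<open>2 * \<epsilon>\<close>, and the
        remainder, below \<open>H n1\<close>, costs \<open>C * \<epsilon>\<close>.\<close>
      define \<theta> where "\<theta> j \<phi> = max 0 (h n \<phi> - H j \<phi>)" for j \<phi>
      have \<theta>b: "\<bar>\<theta> j \<phi>\<bar> \<le> 1" if "\<phi> \<in> Kd" for j \<phi>
        using h01[OF that, of n] H01[OF that, of j] by (auto simp: \<theta>_def)
      have hg: "h n \<phi> \<le> g i (n - i) \<phi>" if "i \<le> n1" for i \<phi>
        using h_le_g[of "n - i" "n - i" i \<phi>] n0[OF that] n by simp
      have le: "norm (m d) \<le> \<epsilon> * (1/2)^i"
        if "i \<le> n1" "\<And>\<phi>. \<phi> \<in> Kd \<Longrightarrow> 0 \<le> d \<phi> \<and> d \<phi> \<le> max 0 (h n \<phi> - g i (p i) \<phi>)" for i d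
      proof (rule p[of i "n - i"])
        show "p i \<le> n - i" using n0[OF that(1)] n by simp
        then have "g i (p i) \<phi> \<le> g i (n - i) \<phi>" for \<phi> by (rule g_mono)
        then show "0 \<le> d \<phi> \<and> d \<phi> \<le> g i (n - i) \<phi> - g i (p i) \<phi>" if "\<phi> \<in> Kd" for \<phi>
          using \<open>\<And>\<phi>. \<phi> \<in> Kd \<Longrightarrow> 0 \<le> d \<phi> \<and> d \<phi> \<le> max 0 (h n \<phi> - g i (p i) \<phi>)\<close>[OF that] hg[OF \<open>i \<le> n1\<close>, of \<phi>]
          \<open>g i (p i) \<phi> \<le> g i (n - i) \<phi>\<close> by (auto simp: max_def split: if_splits)
      qed
      have "norm (m (\<theta> j)) \<le> (\<Sum>i\<le>j. \<epsilon> * (1/2)^i)" if "j \<le> n1" for j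
        using that
      proof (induction j)
        case 0
        have "norm (m (\<theta> 0)) \<le> \<epsilon> * (1/2)^0" by (rule le) (auto simp: \<theta>_def H0)
        then show ?case by simp
      next
        case (Suc j)
        have d: "0 \<le> \<theta> (Suc j) \<phi> - \<theta> j \<phi> \<and> \<theta> (Suc j) \<phi> - \<theta> j \<phi> \<le> max 0 (h n \<phi> - g (Suc j) (p (Suc j)) \<phi>)" for \<phi>
          by (auto simp: \<theta>_def HS min_def max_def)
        have "m (\<theta> (Suc j)) = m (\<lambda>\<phi>. \<theta> j \<phi> + (\<theta> (Suc j) \<phi> - \<theta> j \<phi>))" by simp
        also have "\<dots> = m (\<theta> j) + m (\<lambda>\<phi>. \<theta> (Suc j) \<phi> - \<theta> j \<phi>)"
        proof (rule add[where M = 1 and M' = 2])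
          fix \<phi> assume "\<phi> \<in> Kd"
          from \<theta>b[OF this, of j] \<theta>b[OF this, of "Suc j"]
          show "\<bar>\<theta> j \<phi>\<bar> \<le> 1" "\<bar>\<theta> (Suc j) \<phi> - \<theta> j \<phi>\<bar> \<le> 2" by auto
        qed
        finally have "norm (m (\<theta> (Suc j))) \<le> norm (m (\<theta> j)) + norm (m (\<lambda>\<phi>. \<theta> (Suc j) \<phi> - \<theta> j \<phi>))"
          using norm_triangle_ineq by metis
        also have "\<dots> \<le> (\<Sum>i\<le>j. \<epsilon> * (1/2)^i) + \<epsilon> * (1/2)^Suc j"
          using Suc le[OF Suc.prems d] by (intro add_mono) auto
        finally show ?case by simp
      qed
      from this[of n1] have "norm (m (\<theta> n1)) \<le> \<epsilon> * (\<Sum>i\<le>n1. (1/2)^i)" by (simp add: sum_distrib_left)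
      also have "\<dots> \<le> \<epsilon> * 2"
        using \<epsilon> by (intro mult_left_mono) (subst lessThan_Suc_atMost[symmetric], subst sum_gp_strict, auto)
      finally have 1: "norm (m (\<theta> n1)) \<le> 2 * \<epsilon>" by simp
      have 2: "norm (m (\<lambda>\<phi>. h n \<phi> - \<theta> n1 \<phi>)) \<le> C * \<epsilon>"
      proof (rule bound)
        fix \<phi> assume "\<phi> \<in> Kd"
        then show "\<bar>h n \<phi> - \<theta> n1 \<phi>\<bar> \<le> \<epsilon>"
          using h01[of \<phi> n] H01[of \<phi> n1] H_eps[of \<phi>] by (auto simp: \<theta>_def max_def)
      qed (use \<epsilon> in simp)
      have "m (h n) = m (\<lambda>\<phi>. \<theta> n1 \<phi> + (h n \<phi> - \<theta> n1 \<phi>))" by simp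
      also have "\<dots> = m (\<theta> n1) + m (\<lambda>\<phi>. h n \<phi> - \<theta> n1 \<phi>)"
      proof (rule add[where M = 1 and M' = 2])
        fix \<phi> assume "\<phi> \<in> Kd"
        then show "\<bar>\<theta> n1 \<phi>\<bar> \<le> 1" "\<bar>h n \<phi> - \<theta> n1 \<phi>\<bar> \<le> 2" using \<theta>b[of \<phi> n1] h01[of \<phi> n] by auto
      qed
      finally have "norm (m (h n)) \<le> norm (m (\<theta> n1)) + norm (m (\<lambda>\<phi>. h n \<phi> - \<theta> n1 \<phi>))"
        using norm_triangle_ineq by metis
      with 1 2 show ?thesis by (simp add: algebra_simps)
    qed
    then show ?thesis by blast
  qed
  show ?thesis
    unfolding LIMSEQ_iff
  proof (intro allI impI)
    fix r :: real assume "r > 0"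
    then have "r / (2 * (2 + C)) > 0" using C by simp
    from small[OF this] obtain n0 where "\<And>n. n \<ge> n0 \<Longrightarrow> norm (m (h n)) \<le> (2 + C) * (r / (2 * (2 + C)))" by blast
    moreover have "(2 + C) * (r / (2 * (2 + C))) < r" using C \<open>r > 0\<close> by (simp add: field_simps add_nonneg_pos)
    ultimately show "\<exists>n0. \<forall>n\<ge>n0. norm (m (h n) - 0) < r" by (metis diff_zero le_less_trans)
  qed
qed

text \<open>\<open>In i\<close> will say that a fixed operator belongs to the \<open>i\<close>-th
  compact set. By monotonicity at most two indices \<open>i\<close> fail \<open>In i\<close> but
  satisfy \<open>In (Suc (Suc i))\<close>. They cost \<open>B\<close> each on top of a geometric
  series with sum at most \<open>2 * B\<close>.\<close>

lemma hump_sum: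
  fixes b :: "nat \<Rightarrow> real"
  assumes B: "0 \<le> B" and b: "\<And>i. b i \<le> B" and mono: "\<And>i. In i \<Longrightarrow> In (Suc i)"
    and inner: "\<And>i. In i \<Longrightarrow> b i \<le> B * (1/2)^i" and outer: "\<And>i. \<not> In (Suc (Suc i)) \<Longrightarrow> b i \<le> B * (1/2)^i"
  shows "(\<Sum>i<r. b i) \<le> 4 * B"
proof -
  have mono': "In j" if "In i" "i \<le> j" for i j using that(2,1) by (induction rule: dec_induct) (auto intro: mono)
  define S where "S = {i. i < r \<and> \<not> In i \<and> In (Suc (Suc i))}"
  have fin: "finite S" by (simp add: S_def)
  have card: "card S \<le> 2"
  proof (cases "S = {}")
    case False
    define k where "k = Min S"
    have k: "k \<in> S" unfolding k_def using False fin by (rule Min_in[rotated])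
    have "S \<subseteq> {k, Suc k}"
    proof
      fix i assume i: "i \<in> S"
      then have "k \<le> i" unfolding k_def using fin by (intro Min_le)
      moreover have "\<not> Suc (Suc k) \<le> i" using mono'[of "Suc (Suc k)" i] i k by (auto simp: S_def)
      ultimately show "i \<in> {k, Suc k}" by auto
    qed
    then have "card S \<le> card {k, Suc k}" by (intro card_mono) auto
    then show ?thesis by simp
  qed simp
  have "(\<Sum>i<r. b i) \<le> (\<Sum>i<r. B * (1/2)^i + (if i \<in> S then B else 0))"
  proof (rule sum_mono)
    fix i assume "i \<in> {..<r}"
    then show "b i \<le> B * (1/2)^i + (if i \<in> S then B else 0)"
      using b[of i] inner[of i] outer[of i] B by (auto simp: S_def intro: add_increasing)
  qed
  also have "\<dots> = B * (\<Sum>i<r. (1/2)^i) + (\<Sum>i\<in>S. B)"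
    by (simp add: sum.distrib sum_distrib_left sum.If_cases S_def Collect_conj_eq lessThan_def)
  also have "(\<Sum>i\<in>S. B) = real (card S) * B" by simp
  also have "B * (\<Sum>i<r. (1/2)^i) + real (card S) * B \<le> B * 2 + 2 * B"
    using B card by (intro add_mono mult_left_mono mult_right_mono) (subst sum_gp_strict, auto)
  finally show ?thesis by simp
qed

text \<open>Banach-Alaoglu by Tychonoff's theorem, in the topology of pointwise convergence. With
  \<open>p\<close> a norm composed with a projection onto a subspace, the set is the dual ball of
  that subspace, realised by functions on the whole type.\<close>

lemma dual_ball_compact:
  fixes p :: "'a::real_vector \<Rightarrow> real"
  shows "compact {\<phi> :: 'a \<Rightarrow> real. linear \<phi> \<and> (\<forall>x. \<bar>\<phi> x\<bar> \<le> p x)}"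
proof -
  have "compactin (product_topology (\<lambda>_. euclidean) UNIV) (PiE UNIV (\<lambda>x. {- p x..p x}))"
    by (simp add: compactin_PiE compactin_euclidean_iff)
  then have c: "compact (PiE UNIV (\<lambda>x. {- p x..p x}))"
    by (simp add: euclidean_product_topology compactin_euclidean_iff)
  have ev: "continuous_on UNIV (\<lambda>\<phi> :: 'a \<Rightarrow> real. \<phi> x)" for x by (rule continuous_on_product_coordinates)
  have "closed ({\<phi> :: 'a \<Rightarrow> real. \<forall>x y. \<phi> (x + y) = \<phi> x + \<phi> y} \<inter> {\<phi>. \<forall>c x. \<phi> (c *\<^sub>R x) = c * \<phi> x})"
    by (intro closed_Int closed_Collect_all closed_Collect_eq continuous_intros ev)
  moreover have "{\<phi> :: 'a \<Rightarrow> real. linear \<phi> \<and> (\<forall>x. \<bar>\<phi> x\<bar> \<le> p x)} =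
    PiE UNIV (\<lambda>x. {- p x..p x}) \<inter> ({\<phi>. \<forall>x y. \<phi> (x + y) = \<phi> x + \<phi> y} \<inter> {\<phi>. \<forall>c x. \<phi> (c *\<^sub>R x) = c * \<phi> x})"
    by (auto simp: linear_iff abs_le_iff PiE_def Pi_def minus_le_iff)
  ultimately show ?thesis using c by (simp add: compact_Int_closed)
qed

section \<open>Compactness of the inclusion into the ambient space\<close>

text \<open>
  The sets \<open>K n\<close> are an exhaustion of the operator collection by compact sets, and \<open>Z\<close>, \<open>N\<close> are \<open>M\<^sub>0\<close> and its norm.
  The last assumption is the \<open>\<L>\<^sup>\<infinity>\<close> property in coordinates: \<open>c\<close> are Hahn--Banach extensions of the coordinates
  of a finite-dimensional space close to \<open>\<ell>\<^sup>\<infinity>\<^sub>n\<close>, and \<open>e\<close> is its basis.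
\<close>

locale oO_space =
  fixes K :: "nat \<Rightarrow> ('a::banach \<Rightarrow>\<^sub>L 'b::real_normed_vector) set"
    and Z :: "'a set" and N :: "'a \<Rightarrow> real" and CX \<Lambda> :: real
  assumes X_sep: "separable_type TYPE('a)" and X_refl: "reflexive_type TYPE('a)"
    and K_Suc: "K n \<subseteq> K (Suc n)"
    and K_bdd: "\<exists>c. \<forall>L\<in>K n. norm L \<le> c"
    and normed: "normed_space_on Z N"
    and N_upper: "x \<in> Z \<Longrightarrow> L \<in> K n \<Longrightarrow> norm (blinfun_apply L x) \<le> N x"
    and N_least: "x \<in> Z \<Longrightarrow> 0 \<le> b \<Longrightarrow> (\<And>n L. L \<in> K n \<Longrightarrow> norm (blinfun_apply L x) \<le> b) \<Longrightarrow> N x \<le> b"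
    and Z_tail: "x \<in> Z \<Longrightarrow> e > 0 \<Longrightarrow> \<exists>n. \<forall>m. \<forall>L\<in>K m - K n. norm (blinfun_apply L x) \<le> e"
    and CX: "0 \<le> CX" "x \<in> Z \<Longrightarrow> norm x \<le> CX * N x"
    and \<Lambda>: "0 \<le> \<Lambda>"
    and LPR: "finite S \<Longrightarrow> S \<subseteq> Z \<Longrightarrow> \<exists>(n::nat) e c. (\<forall>t<n. e t \<in> Z \<and> linear (c t) \<and> (\<forall>z\<in>Z. \<bar>c t z\<bar> \<le> N z)) \<and>
        (\<forall>z\<in>span S. z = (\<Sum>t<n. c t z *\<^sub>R e t)) \<and>
        (\<forall>a M. 0 \<le> M \<longrightarrow> (\<forall>t<n. \<bar>a t\<bar> \<le> M) \<longrightarrow> N (\<Sum>t<n. a t *\<^sub>R e t) \<le> \<Lambda> * M)"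
begin

lemma Z_subspace: "subspace Z"
  and N_ge0: "x \<in> Z \<Longrightarrow> 0 \<le> N x"
  and N_scale: "x \<in> Z \<Longrightarrow> N (c *\<^sub>R x) = \<bar>c\<bar> * N x"
  and N_triangle: "x \<in> Z \<Longrightarrow> y \<in> Z \<Longrightarrow> N (x + y) \<le> N x + N y"
  and N_eq0: "x \<in> Z \<Longrightarrow> N x = 0 \<longleftrightarrow> x = 0"
  using normed by (auto simp: normed_space_on_def)

lemma Z_0 [simp]: "0 \<in> Z" by (rule subspace_0[OF Z_subspace])
lemma Z_add: "x \<in> Z \<Longrightarrow> y \<in> Z \<Longrightarrow> x + y \<in> Z" by (rule subspace_add[OF Z_subspace])
lemma Z_diff: "x \<in> Z \<Longrightarrow> y \<in> Z \<Longrightarrow> x - y \<in> Z" by (rule subspace_diff[OF Z_subspace])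
lemma Z_scale: "x \<in> Z \<Longrightarrow> c *\<^sub>R x \<in> Z" by (rule subspace_scale[OF Z_subspace])
lemma Z_sum: "(\<And>i. i \<in> F \<Longrightarrow> f i \<in> Z) \<Longrightarrow> sum f F \<in> Z" by (rule subspace_sum[OF Z_subspace])
lemma Z_lincomb: "(\<And>i. i \<in> F \<Longrightarrow> f i \<in> Z) \<Longrightarrow> (\<Sum>i\<in>F. a i *\<^sub>R f i) \<in> Z"
  by (intro Z_sum Z_scale)

lemma N_zero [simp]: "N 0 = 0" using N_eq0 by simp

lemma N_minus: "x \<in> Z \<Longrightarrow> N (- x) = N x" using N_scale[of x "-1"] by simp

lemma N_diff: "x \<in> Z \<Longrightarrow> y \<in> Z \<Longrightarrow> N (x - y) \<le> N x + N y"
  using N_triangle[of x "- y"] N_minus subspace_neg[OF Z_subspace] by simp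

lemma N_diff_commute: "x \<in> Z \<Longrightarrow> y \<in> Z \<Longrightarrow> N (x - y) = N (y - x)"
  using N_minus[OF Z_diff] by (metis minus_diff_eq)

lemma N_sum: "(\<And>i. i \<in> F \<Longrightarrow> f i \<in> Z) \<Longrightarrow> N (sum f F) \<le> (\<Sum>i\<in>F. N (f i))"
proof (induction F rule: infinite_finite_induct)
  case (insert x F)
  then have "N (f x + sum f F) \<le> N (f x) + N (sum f F)" by (intro N_triangle Z_sum) auto
  with insert show ?case by auto
qed auto

lemma K_mono: "m \<le> n \<Longrightarrow> K m \<subseteq> K n"
  by (induction rule: dec_induct) (use K_Suc in blast)+

text \<open>Each operator sees at most two humps at full size. The window from \<open>m i\<close> to
  \<open>m (Suc (Suc i))\<close> is two steps wide to leave room for differences of consecutive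
  operators.\<close>

lemma gliding_hump:
  assumes w: "\<And>i. w i \<in> Z" "\<And>i. N (w i) \<le> B" and m: "\<And>i. m i \<le> m (Suc i)"
    and inner: "\<And>i L. L \<in> K (m i) \<Longrightarrow> norm (blinfun_apply L (w i)) \<le> B * (1/2)^i"
    and outer: "\<And>i n L. L \<in> K n - K (m (Suc (Suc i))) \<Longrightarrow> norm (blinfun_apply L (w i)) \<le> B * (1/2)^i"
  shows "N (\<Sum>i<r. w i) \<le> 4 * B"
proof -
  have B: "0 \<le> B" using N_ge0[OF w(1)] w(2) order_trans by blast
  show ?thesis
  proof (rule N_least)
    fix n L assume L: "L \<in> K n"
    have "norm (blinfun_apply L (\<Sum>i<r. w i)) \<le> (\<Sum>i<r. norm (blinfun_apply L (w i)))"
      by (simp add: blinfun.sum_right norm_sum)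
    also have "\<dots> \<le> 4 * B"
    proof (rule hump_sum[where In = "\<lambda>i. L \<in> K (m i)", OF B])
      show "norm (blinfun_apply L (w i)) \<le> B" for i using N_upper[OF w(1) L] w(2) order_trans by blast
      show "L \<in> K (m i) \<Longrightarrow> L \<in> K (m (Suc i))" for i using K_mono[OF m] by blast
    qed (use inner outer L in auto)
    finally show "norm (blinfun_apply L (\<Sum>i<r. w i)) \<le> 4 * B" .
  qed (use B w(1) in \<open>auto intro: Z_sum\<close>)
qed

text \<open>Convex combinations of the \<open>u n\<close> keep \<open>\<phi>\<close> above
  \<open>\<delta>\<close> and, by Mazur, can be made small in \<open>X\<close>, hence small on any
  given compact set of operators. Chosen as humps they have sums bounded in \<open>N\<close>, on
  which \<open>\<phi>\<close> would be at least \<open>r * \<delta>\<close>.\<close>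

lemma weakly_null_functional_aux:
  fixes \<phi> :: "'a \<Rightarrow> real"
  assumes u: "\<And>n. u n \<in> Z" "\<And>n. N (u n) \<le> C" and weak: "weakly_converges u 0"
    and \<phi>: "linear \<phi>" "\<And>z. z \<in> Z \<Longrightarrow> \<bar>\<phi> z\<bar> \<le> D * N z" and \<delta>: "\<delta> > 0" "\<And>n. \<delta> \<le> \<phi> (u n)"
  shows False
proof -
  define B where "B = max C 1"
  define H where "H = {x \<in> Z. N x \<le> B \<and> \<delta> \<le> \<phi> x}"
  have "convex H"
  proof (rule convexI)
    fix x y and s t :: real assume *: "x \<in> H" "y \<in> H" "0 \<le> s" "0 \<le> t" "s + t = 1"
    have "N (s *\<^sub>R x + t *\<^sub>R y) \<le> N (s *\<^sub>R x) + N (t *\<^sub>R y)" using * by (intro N_triangle Z_scale) (auto simp: H_def)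
    also have "\<dots> = s * N x + t * N y" using * by (simp add: N_scale H_def)
    also have "\<dots> \<le> s * B + t * B" using * by (intro add_mono mult_left_mono) (auto simp: H_def)
    also have "\<dots> = B" using *(5) by (simp add: distrib_right[symmetric])
    finally have "N (s *\<^sub>R x + t *\<^sub>R y) \<le> B" .
    moreover have "s * \<delta> + t * \<delta> \<le> s * \<phi> x + t * \<phi> y"
      using * by (intro add_mono mult_left_mono) (auto simp: H_def)
    then have "\<delta> \<le> \<phi> (s *\<^sub>R x + t *\<^sub>R y)"
      using *(5) \<phi>(1) by (simp add: linear_add linear_cmul distrib_right[symmetric])
    ultimately show "s *\<^sub>R x + t *\<^sub>R y \<in> H"
      using * by (auto simp: H_def intro: Z_add Z_scale)
  qed
  moreover have "range u \<subseteq> H" using u \<delta> by (auto simp: H_def B_def intro: le_max_iff_disj[THEN iffD2])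
  ultimately have hull: "convex hull (range u) \<subseteq> H" by (simp add: hull_minimal)
  have step: "\<exists>w m'. w \<in> H \<and> m \<le> m' \<and> (\<forall>L\<in>K m. norm (blinfun_apply L w) \<le> B * (1/2)^i) \<and>
      (\<forall>n. \<forall>L\<in>K n - K m'. norm (blinfun_apply L w) \<le> B * (1/2)^i)" for m i :: nat
  proof -
    obtain c where c: "\<And>L. L \<in> K m \<Longrightarrow> norm L \<le> c" using K_bdd by blast
    define \<eta> where "\<eta> = B * (1/2)^i / (\<bar>c\<bar> + 1)"
    have "\<eta> > 0" by (simp add: \<eta>_def B_def divide_pos_pos)
    then obtain w where w: "w \<in> convex hull (range u)" "norm w < \<eta>" using Mazur_null[OF weak] by blast
    then have wH: "w \<in> H" using hull by blast
    have "norm (blinfun_apply L w) \<le> B * (1/2)^i" if L: "L \<in> K m" for L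
    proof -
      have "norm (blinfun_apply L w) \<le> norm L * norm w" by (rule norm_blinfun)
      also have "\<dots> \<le> (\<bar>c\<bar> + 1) * \<eta>" using c[OF L] w(2) by (intro mult_mono) auto
      also have "\<dots> = B * (1/2)^i" by (simp add: \<eta>_def add_nonneg_eq_0_iff)
      finally show ?thesis .
    qed
    moreover obtain m0 where m0: "\<And>n L. L \<in> K n - K m0 \<Longrightarrow> norm (blinfun_apply L w) \<le> B * (1/2)^i"
      using Z_tail[of w "B * (1/2)^i"] wH by (auto simp: H_def B_def)
    moreover have "K m0 \<subseteq> K (max m m0)" by (rule K_mono) simp
    ultimately show ?thesis using wH by (intro exI[of _ w] exI[of _ "max m m0"]) auto
  qed
  then obtain W M' where WM: "\<And>m i. W m i \<in> H" "\<And>m i. m \<le> M' m i"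
    "\<And>m i L. L \<in> K m \<Longrightarrow> norm (blinfun_apply L (W m i)) \<le> B * (1/2)^i"
    "\<And>m i n L. L \<in> K n - K (M' m i) \<Longrightarrow> norm (blinfun_apply L (W m i)) \<le> B * (1/2)^i" by metis
  define m where "m = rec_nat 0 (\<lambda>i m. M' m i)"
  have m: "m (Suc i) = M' (m i) i" for i by (simp add: m_def)
  define w where "w i = W (m i) i" for i
  have wH: "w i \<in> H" for i by (simp add: w_def WM)
  have bound: "N (\<Sum>i<r. w i) \<le> 4 * B" for r
  proof (rule gliding_hump[where m = m])
    fix i show "w i \<in> Z" "N (w i) \<le> B" using wH[of i] by (auto simp: H_def)
    show mm: "m i \<le> m (Suc i)" for i using WM(2) by (simp add: m)
    show "L \<in> K (m i) \<Longrightarrow> norm (blinfun_apply L (w i)) \<le> B * (1/2)^i" for L by (simp add: w_def WM(3))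
    show "norm (blinfun_apply L (w i)) \<le> B * (1/2)^i" if "L \<in> K n - K (m (Suc (Suc i)))" for L n
      unfolding w_def using that K_mono[OF mm[of "Suc i"]] by (intro WM(4)[of L n]) (auto simp: m)
  qed
  have "real r * \<delta> \<le> \<bar>D\<bar> * (4 * B)" for r
  proof -
    have "real r * \<delta> = (\<Sum>i<r. \<delta>)" by simp
    also have "\<dots> \<le> (\<Sum>i<r. \<phi> (w i))" using wH by (intro sum_mono) (auto simp: H_def)
    also have "\<dots> = \<phi> (\<Sum>i<r. w i)" by (simp add: linear_sum[OF \<phi>(1)])
    also have "\<dots> \<le> D * N (\<Sum>i<r. w i)" using \<phi>(2)[OF Z_sum[of "{..<r}" w]] wH by (auto simp: H_def)
    also have "\<dots> \<le> \<bar>D\<bar> * (4 * B)"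
      using bound[of r] N_ge0[OF Z_sum[of "{..<r}" w]] wH by (intro mult_mono) (auto simp: H_def)
    finally show ?thesis .
  qed
  moreover obtain r :: nat where "\<bar>D\<bar> * (4 * B) < real r * \<delta>" using reals_Archimedean3[OF \<delta>(1)] by blast
  ultimately show False by (meson not_less)
qed

theorem weakly_null_functional:
  fixes \<phi> :: "'a \<Rightarrow> real"
  assumes u: "\<And>n. u n \<in> Z" "\<And>n. N (u n) \<le> C" and weak: "weakly_converges u 0"
    and \<phi>: "linear \<phi>" "\<And>z. z \<in> Z \<Longrightarrow> \<bar>\<phi> z\<bar> \<le> D * N z"
  shows "(\<lambda>n. \<phi> (u n)) \<longlonglongrightarrow> 0"
proof (rule ccontr)
  assume "\<not> ?thesis"
  then obtain \<delta> where \<delta>: "\<delta> > 0" "\<And>n0. \<exists>n\<ge>n0. \<delta> \<le> \<bar>\<phi> (u n)\<bar>"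
    by (auto simp: LIMSEQ_iff not_less)
  then have "\<exists>\<^sub>\<infinity>n. \<delta> \<le> \<bar>\<phi> (u n)\<bar>" by (auto simp: INFM_nat_le)
  from infinite_enumerate[OF this[unfolded INFM_iff_infinite]]
  obtain k :: "nat \<Rightarrow> nat" where k: "strict_mono k" "\<And>n. \<delta> \<le> \<bar>\<phi> (u (k n))\<bar>" by blast
  \<comment> \<open>The signs turn a lower bound for the modulus of \<open>\<phi>\<close> into one
    for \<open>\<phi>\<close> itself and do not affect weak convergence to 0.\<close>
  define v where "v n = sgn (\<phi> (u (k n))) *\<^sub>R u (k n)" for n
  have "v n \<in> Z" "N (v n) \<le> max C 0" for n
    using u[of "k n"] by (auto simp: v_def Z_scale N_scale abs_sgn_eq)
  moreover have "weakly_converges v 0"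
    unfolding weakly_converges_def
  proof
    fix f :: "'a \<Rightarrow>\<^sub>L real"
    have "(\<lambda>n. blinfun_apply f (u n)) \<longlonglongrightarrow> 0" using weak by (auto simp: weakly_converges_def)
    from LIMSEQ_subseq_LIMSEQ[OF this k(1)] have lim: "(\<lambda>n. \<bar>blinfun_apply f (u (k n))\<bar>) \<longlonglongrightarrow> 0"
      by (simp add: comp_def tendsto_rabs_zero_iff)
    have "(\<lambda>n. blinfun_apply f (v n)) \<longlonglongrightarrow> 0"
      by (rule tendsto_rabs_zero_cancel, rule tendsto_sandwich[OF _ _ tendsto_const lim])
         (auto simp: v_def blinfun.scaleR_right abs_mult abs_sgn_eq)
    then show "(\<lambda>n. blinfun_apply f (v n)) \<longlonglongrightarrow> blinfun_apply f 0" by simp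
  qed
  moreover have "\<delta> \<le> \<phi> (v n)" for n
    using k(2)[of n] by (simp add: v_def linear_cmul[OF \<phi>(1)] sgn_mult_self_eq abs_sgn mult.commute)
  ultimately show False using weakly_null_functional_aux[of v "max C 0" \<phi> D \<delta>] \<phi> \<delta>(1) by blast
qed

text \<open>A purely algebraic projection. It lets functionals on \<open>Z\<close> be treated as
  functions on the whole type.\<close>

lemma Z_projection:
  obtains \<pi> :: "'a \<Rightarrow> 'a" where "linear \<pi>" "\<And>x. \<pi> x \<in> Z" "\<And>z. z \<in> Z \<Longrightarrow> \<pi> z = z"
  using linear_exists_left_inverse_on[OF linear_ident Z_subspace inj_on_id2] by (metis rangeI subsetD)

text \<open>Each \<open>u j\<close> is \<open>m\<close> of the evaluation at \<open>u j\<close> on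
  the dual ball. The evaluations tend to 0 pointwise by the gliding hump, and \<open>m\<close> is
  exhaustive because \<open>wuC\<close> series in \<open>X\<close> are null, so the lattice theorem
  applies. Positive and negative parts are treated apart, as it requires values in [0,1].\<close>

lemma N_le_1_weakly_null:
  assumes u: "\<And>n. u n \<in> Z" "\<And>n. N (u n) \<le> 1" and weak: "weakly_converges u 0"
  shows "u \<longlonglongrightarrow> 0"
proof -
  obtain \<pi> :: "'a \<Rightarrow> 'a" where \<pi>: "linear \<pi>" "\<And>x. \<pi> x \<in> Z" "\<And>z. z \<in> Z \<Longrightarrow> \<pi> z = z"
    using Z_projection by metis
  \<comment> \<open>The bound by \<open>N (\<pi> x)\<close> forces \<open>\<phi>\<close> to vanish
    on the kernel of \<open>\<pi>\<close>, so \<open>Kd\<close> is exactly the dual ball of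
    \<open>Z\<close> with the norm \<open>N\<close>.\<close>
  define Kd where "Kd = {\<phi> :: 'a \<Rightarrow> real. linear \<phi> \<and> (\<forall>x. \<bar>\<phi> x\<bar> \<le> N (\<pi> x))}"
  have cpt: "compact Kd" unfolding Kd_def by (rule dual_ball_compact)
  obtain Lm :: "(nat \<Rightarrow> real) \<Rightarrow> real" where Lm:
    "\<And>s t. bounded (range s) \<Longrightarrow> bounded (range t) \<Longrightarrow> Lm (\<lambda>n. s n + t n) = Lm s + Lm t"
    "\<And>c s. bounded (range s) \<Longrightarrow> Lm (\<lambda>n. c * s n) = c * Lm s"
    "\<And>s l. s \<longlonglongrightarrow> l \<Longrightarrow> Lm s = l"
    "\<And>s M. (\<And>n. \<bar>s n\<bar> \<le> M) \<Longrightarrow> \<bar>Lm s\<bar> \<le> M"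
    using Banach_limit_exists by blast
  define R where "R k n e c \<longleftrightarrow> (\<forall>t<(n::nat). e t \<in> Z \<and> linear (c t) \<and> (\<forall>z\<in>Z. \<bar>c t z\<bar> \<le> N z)) \<and>
        (\<forall>z\<in>span (u ` {..k}). z = (\<Sum>t<n. c t z *\<^sub>R e t)) \<and>
        (\<forall>a M. 0 \<le> M \<longrightarrow> (\<forall>t<n. \<bar>a t\<bar> \<le> M) \<longrightarrow> N (\<Sum>t<n. a t *\<^sub>R e t) \<le> \<Lambda> * M)" for k :: nat and n e c
  have "\<exists>n e c. R k n e c" for k
    unfolding R_def by (rule LPR) (use u in auto)
  then obtain n e c where R: "\<And>k. R k (n k) (e k) (c k)" by metis
  have nec: "\<And>k t. t < (n k :: nat) \<Longrightarrow> e k t \<in> Z \<and> linear (c k t) \<and> (\<forall>z\<in>Z. \<bar>c k t z\<bar> \<le> N z)"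
    "\<And>k z. z \<in> span (u ` {..k}) \<Longrightarrow> z = (\<Sum>t<n k. c k t z *\<^sub>R e k t)"
    "\<And>k a M. 0 \<le> M \<Longrightarrow> (\<And>t. t < n k \<Longrightarrow> \<bar>a t\<bar> \<le> M) \<Longrightarrow> N (\<Sum>t<n k. a t *\<^sub>R e k t) \<le> \<Lambda> * M"
    using R unfolding R_def by blast+
  \<comment> \<open>The extension of the inclusion to functions \<open>h\<close> on the dual ball is a weak Banach limit \<open>m h\<close> of \<open>P k h\<close>.\<close>
  define P where "P k h = (\<Sum>t<n k. h (c k t \<circ> \<pi>) *\<^sub>R e k t)" for k and h :: "('a \<Rightarrow> real) \<Rightarrow> real"
  have c_Kd: "c k t \<circ> \<pi> \<in> Kd" if "t < n k" for k t
    using nec(1)[OF that] \<pi>(2) linear_compose[OF \<pi>(1)] by (auto simp: Kd_def)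
  define C where "C = CX * \<Lambda>"
  have C: "0 \<le> C" using CX(1) \<Lambda> by (simp add: C_def)
  have P_bound: "norm (P k h) \<le> C * M" if "0 \<le> M" "\<And>\<phi>. \<phi> \<in> Kd \<Longrightarrow> \<bar>h \<phi>\<bar> \<le> M" for k h M
  proof -
    have "P k h \<in> Z" unfolding P_def using nec(1) by (intro Z_lincomb) auto
    then have "norm (P k h) \<le> CX * N (P k h)" by (rule CX(2))
    also have "\<dots> \<le> CX * (\<Lambda> * M)"
      unfolding P_def using that c_Kd CX(1) by (intro mult_left_mono nec(3)) auto
    finally show ?thesis by (simp add: C_def)
  qed
  define Q where "Q h x \<longleftrightarrow> (\<forall>f :: 'a \<Rightarrow>\<^sub>L real. blinfun_apply f x = Lm (\<lambda>k. blinfun_apply f (P k h)))" for h x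
  define m where "m h = (SOME x. Q h x)" for h
  define bd where "bd h M \<longleftrightarrow> 0 \<le> M \<and> (\<forall>\<phi>\<in>Kd. \<bar>h \<phi>\<bar> \<le> M)" for h :: "('a \<Rightarrow> real) \<Rightarrow> real" and M
  have m_ex: "\<exists>x. Q h x \<and> norm x \<le> C * M" if "bd h M" for h M
    unfolding Q_def
  proof (rule weak_Banach_limit[OF X_refl])
    show "norm (P k h) \<le> C * M" for k using that by (intro P_bound) (auto simp: bd_def)
  qed (fact Lm)+
  have Q_unique: "x = y" if "Q h x" "Q h y" for h x y
  proof (rule functionals_separate)
    fix f :: "'a \<Rightarrow>\<^sub>L real"
    show "blinfun_apply f x = blinfun_apply f y"
      using that(1)[unfolded Q_def, rule_format, of f] that(2)[unfolded Q_def, rule_format, of f] by (rule trans[OF _ sym])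
  qed
  have m_Q: "m h = x" if "Q h x" for h x
    unfolding m_def using someI[of "Q h", OF that] that by (rule Q_unique)
  have m: "Q h (m h)" "norm (m h) \<le> C * M" if "bd h M" for h M
    using m_ex[OF that] m_Q[of h] by auto
  have Kd0: "(\<lambda>_. 0) \<in> Kd" unfolding Kd_def using N_ge0 \<pi>(2) by (auto simp: linear_iff)
  have bdI: "bd h M" if "\<And>\<phi>. \<phi> \<in> Kd \<Longrightarrow> \<bar>h \<phi>\<bar> \<le> M" for h M
    using that[OF Kd0] that unfolding bd_def by auto
  have fP_bdd: "bounded (range (\<lambda>k. blinfun_apply f (P k h)))" if "bd h M" for f :: "'a \<Rightarrow>\<^sub>L real" and h M
  proof -
    have "norm (P k h) \<le> C * M" for k using that by (intro P_bound) (auto simp: bd_def)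
    from abs_functional_le[OF this] show ?thesis by (auto simp: bounded_range_abs)
  qed
  have m_add: "m (\<lambda>\<phi>. h \<phi> + h' \<phi>) = m h + m h'"
    if h: "bd h M" and h': "bd h' M'" for h h' M M'
  proof (rule m_Q)
    have P: "P k (\<lambda>\<phi>. h \<phi> + h' \<phi>) = P k h + P k h'" for k
      by (simp add: P_def scaleR_left_distrib sum.distrib)
    have Qh: "Q h (m h)" "Q h' (m h')" using m(1)[OF h] m(1)[OF h'] by auto
    show "Q (\<lambda>\<phi>. h \<phi> + h' \<phi>) (m h + m h')"
      unfolding Q_def
    proof
      fix f :: "'a \<Rightarrow>\<^sub>L real"
      have "Lm (\<lambda>k. blinfun_apply f (P k h) + blinfun_apply f (P k h')) =
        Lm (\<lambda>k. blinfun_apply f (P k h)) + Lm (\<lambda>k. blinfun_apply f (P k h'))"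
        by (rule Lm(1)[OF fP_bdd[OF h] fP_bdd[OF h']])
      then show "blinfun_apply f (m h + m h') = Lm (\<lambda>k. blinfun_apply f (P k (\<lambda>\<phi>. h \<phi> + h' \<phi>)))"
        using Qh by (simp add: P Q_def blinfun.add_right)
    qed
  qed
  have m_scale: "m (\<lambda>\<phi>. s * h \<phi>) = s *\<^sub>R m h" if h: "bd h M" for h M s
  proof (rule m_Q)
    have P: "P k (\<lambda>\<phi>. s * h \<phi>) = s *\<^sub>R P k h" for k by (simp add: P_def scaleR_sum_right)
    have Qh: "Q h (m h)" using m(1)[OF h] .
    show "Q (\<lambda>\<phi>. s * h \<phi>) (s *\<^sub>R m h)"
      unfolding Q_def
    proof
      fix f :: "'a \<Rightarrow>\<^sub>L real"
      have "Lm (\<lambda>k. s * blinfun_apply f (P k h)) = s * Lm (\<lambda>k. blinfun_apply f (P k h))"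
        by (rule Lm(2)[OF fP_bdd[OF h]])
      then show "blinfun_apply f (s *\<^sub>R m h) = Lm (\<lambda>k. blinfun_apply f (P k (\<lambda>\<phi>. s * h \<phi>)))"
        using Qh by (simp add: P Q_def blinfun.scaleR_right)
    qed
  qed
  have m_sum: "m (\<lambda>\<phi>. \<Sum>j\<in>F. a j * d j \<phi>) = (\<Sum>j\<in>F. a j *\<^sub>R m (d j))"
    if F: "finite F" and d: "\<And>j \<phi>. j \<in> F \<Longrightarrow> \<phi> \<in> Kd \<Longrightarrow> \<bar>d j \<phi>\<bar> \<le> 1" for F :: "nat set" and a d
    using F d
  proof (induction F)
    case empty
    have "m (\<lambda>\<phi>. 0 * 0) = 0 *\<^sub>R m (\<lambda>\<phi>. 0)" by (rule m_scale[of "\<lambda>_. 0" 0]) (simp add: bd_def)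
    then show ?case by simp
  next
    case (insert j F)
    have "m (\<lambda>\<phi>. a j * d j \<phi> + (\<Sum>i\<in>F. a i * d i \<phi>)) = m (\<lambda>\<phi>. a j * d j \<phi>) + m (\<lambda>\<phi>. \<Sum>i\<in>F. a i * d i \<phi>)"
    proof (rule m_add[where M = "\<bar>a j\<bar>" and M' = "\<Sum>i\<in>F. \<bar>a i\<bar>"]; rule bdI)
      fix \<phi> assume \<phi>: "\<phi> \<in> Kd"
      show "\<bar>a j * d j \<phi>\<bar> \<le> \<bar>a j\<bar>" using insert.prems[of j \<phi>] \<phi> by (simp add: abs_mult mult_left_le)
      show "\<bar>\<Sum>i\<in>F. a i * d i \<phi>\<bar> \<le> (\<Sum>i\<in>F. \<bar>a i\<bar>)"
        using insert.prems \<phi> by (intro order_trans[OF sum_abs] sum_mono) (simp add: abs_mult mult_left_le)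
    qed
    also have "m (\<lambda>\<phi>. a j * d j \<phi>) = a j *\<^sub>R m (d j)" using insert.prems by (intro m_scale[of _ 1] bdI) auto
    finally show ?case using insert by simp
  qed
  have exhaustive: "(\<lambda>j. m (d j)) \<longlonglongrightarrow> 0"
    if d0: "\<And>j \<phi>. \<phi> \<in> Kd \<Longrightarrow> 0 \<le> d j \<phi>" and d1: "\<And>r \<phi>. \<phi> \<in> Kd \<Longrightarrow> (\<Sum>j<r. d j \<phi>) \<le> 1" for d :: "nat \<Rightarrow> ('a \<Rightarrow> real) \<Rightarrow> real"
  proof (rule wuC_reflexive_null[OF X_sep X_refl])
    have sum1: "(\<Sum>j\<in>F. d j \<phi>) \<le> 1" if "finite F" "\<phi> \<in> Kd" for F \<phi>
    proof -
      obtain r where "F \<subseteq> {..<r}" using finite_nat_iff_bounded \<open>finite F\<close> by blast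
      then have "(\<Sum>j\<in>F. d j \<phi>) \<le> (\<Sum>j<r. d j \<phi>)" using d0 that by (intro sum_mono2) auto
      then show ?thesis using d1[OF that(2), of r] by simp
    qed
    \<comment> \<open>A combination of the \<open>d j\<close> with coefficients of modulus at most 1
      is bounded by their sum, hence by 1, so \<open>m\<close> maps it into the ball of radius
      \<open>C\<close>.\<close>
    show "wuC (\<lambda>j. m (d j)) C"
      unfolding wuC_def
    proof (intro allI impI)
      fix F and a :: "nat \<Rightarrow> real" assume F: "finite F" "\<forall>j\<in>F. \<bar>a j\<bar> \<le> 1"
      have dle: "\<bar>d j \<phi>\<bar> \<le> 1" if "\<phi> \<in> Kd" for j \<phi> using sum1[of "{j}" \<phi>] d0[of \<phi> j] that by simp
      have "(\<Sum>j\<in>F. a j *\<^sub>R m (d j)) = m (\<lambda>\<phi>. \<Sum>j\<in>F. a j * d j \<phi>)"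
        using m_sum[OF F(1), of d a] dle by simp
      also have "norm \<dots> \<le> C * 1"
      proof (rule m(2), rule bdI)
        fix \<phi> assume \<phi>: "\<phi> \<in> Kd"
        have "\<bar>\<Sum>j\<in>F. a j * d j \<phi>\<bar> \<le> (\<Sum>j\<in>F. d j \<phi>)"
          using F d0[OF \<phi>] by (intro order_trans[OF sum_abs] sum_mono) (simp add: abs_mult mult_left_le_one_le)
        also have "\<dots> \<le> 1" by (rule sum1[OF F(1) \<phi>])
        finally show "\<bar>\<Sum>j\<in>F. a j * d j \<phi>\<bar> \<le> 1" .
      qed
      finally show "norm (\<Sum>j\<in>F. a j *\<^sub>R m (d j)) \<le> C" by simp
    qed
  qed
  have u_pi: "\<pi> (u j) = u j" for j using \<pi>(3) u(1) by simp
  have ev_b: "\<bar>\<phi> (u j)\<bar> \<le> 1" if "\<phi> \<in> Kd" for \<phi> j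
  proof -
    have "\<bar>\<phi> (u j)\<bar> \<le> N (\<pi> (u j))" using that by (auto simp: Kd_def)
    then show ?thesis using u(2)[of j] by (simp add: u_pi)
  qed
  have m_ev: "m (\<lambda>\<phi>. \<phi> (u j)) = u j" for j
  proof (rule m_Q, unfold Q_def, rule)
    fix f :: "'a \<Rightarrow>\<^sub>L real"
    \<comment> \<open>\<open>P k\<close> reproduces the vectors \<open>u 0\<close>, ...,
      \<open>u k\<close>, so the sequence is eventually constant and its Banach limit is an honest
      limit.\<close>
    have "P k (\<lambda>\<phi>. \<phi> (u j)) = u j" if "k \<ge> j" for k
      using nec(2)[of "u j" k] that by (simp add: P_def u_pi span_base)
    then have "\<forall>\<^sub>F k in sequentially. blinfun_apply f (P k (\<lambda>\<phi>. \<phi> (u j))) = blinfun_apply f (u j)"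
      by (metis (mono_tags, lifting) eventually_sequentiallyI)
    then have "(\<lambda>k. blinfun_apply f (P k (\<lambda>\<phi>. \<phi> (u j)))) \<longlonglongrightarrow> blinfun_apply f (u j)" by (rule tendsto_eventually)
    then show "blinfun_apply f (u j) = Lm (\<lambda>k. blinfun_apply f (P k (\<lambda>\<phi>. \<phi> (u j))))" by (simp add: Lm(3))
  qed
  have ev_null: "(\<lambda>j. \<phi> (u j)) \<longlonglongrightarrow> 0" if "\<phi> \<in> Kd" for \<phi>
  proof (rule weakly_null_functional[OF u weak])
    show "linear \<phi>" using that by (simp add: Kd_def)
    fix z assume "z \<in> Z"
    moreover have "\<bar>\<phi> z\<bar> \<le> N (\<pi> z)" using that by (simp add: Kd_def)
    ultimately show "\<bar>\<phi> z\<bar> \<le> 1 * N z" using \<pi>(3) by simp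
  qed
  have main: "(\<lambda>j. m (\<lambda>\<phi>. max 0 (s * \<phi> (u j)))) \<longlonglongrightarrow> 0" if s: "\<bar>s\<bar> = 1" for s
  proof (rule exhaustive_pointwise_null[OF cpt C, of m])
    show "m (\<lambda>\<phi>. h \<phi> + h' \<phi>) = m h + m h'"
      if "\<And>\<phi>. \<phi> \<in> Kd \<Longrightarrow> \<bar>h \<phi>\<bar> \<le> M" "\<And>\<phi>. \<phi> \<in> Kd \<Longrightarrow> \<bar>h' \<phi>\<bar> \<le> M'" for h h' M M'
      using that by (intro m_add[OF bdI bdI]) auto
    show "norm (m h) \<le> C * M" if "\<And>\<phi>. \<phi> \<in> Kd \<Longrightarrow> \<bar>h \<phi>\<bar> \<le> M" "0 \<le> M" for h M
      using that by (intro m(2) bdI) auto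
    show "(\<lambda>j. m (d j)) \<longlonglongrightarrow> 0"
      if "\<And>j \<phi>. \<phi> \<in> Kd \<Longrightarrow> 0 \<le> d j \<phi>" "\<And>r \<phi>. \<phi> \<in> Kd \<Longrightarrow> (\<Sum>j<r. d j \<phi>) \<le> 1" for d
      by (rule exhaustive[OF that])
    show "continuous_on Kd (\<lambda>\<phi>. max 0 (s * \<phi> (u j)))" for j
      by (intro continuous_intros continuous_on_subset[OF continuous_on_product_coordinates]) auto
    fix \<phi> assume \<phi>: "\<phi> \<in> Kd"
    have "\<bar>s * \<phi> (u j)\<bar> \<le> 1" for j using ev_b[OF \<phi>, of j] s by (simp add: abs_mult)
    then show "0 \<le> max 0 (s * \<phi> (u j)) \<and> max 0 (s * \<phi> (u j)) \<le> 1" for j by (simp add: abs_le_iff)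
    have "(\<lambda>j. max 0 (s * \<phi> (u j))) \<longlonglongrightarrow> max 0 (s * 0)" by (intro tendsto_intros ev_null[OF \<phi>])
    then show "(\<lambda>j. max 0 (s * \<phi> (u j))) \<longlonglongrightarrow> 0" by simp
  qed
  have "u j = m (\<lambda>\<phi>. max 0 (1 * \<phi> (u j))) + (- 1) *\<^sub>R m (\<lambda>\<phi>. max 0 ((- 1) * \<phi> (u j)))" for j
  proof -
    have b: "\<bar>max 0 (s * \<phi> (u j))\<bar> \<le> 1" if "\<phi> \<in> Kd" "\<bar>s\<bar> = 1" for \<phi> and s :: real
      using ev_b[OF that(1), of j] that(2) by (auto simp: abs_if split: if_splits)
    have "u j = m (\<lambda>\<phi>. \<phi> (u j))" by (simp add: m_ev)
    also have "(\<lambda>\<phi> :: 'a \<Rightarrow> real. \<phi> (u j)) = (\<lambda>\<phi>. max 0 (1 * \<phi> (u j)) + (- 1) * max 0 ((- 1) * \<phi> (u j)))"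
      by (rule ext) (simp add: max_def)
    also have "m \<dots> = m (\<lambda>\<phi>. max 0 (1 * \<phi> (u j))) + m (\<lambda>\<phi>. (- 1) * max 0 ((- 1) * \<phi> (u j)))"
      using b[of _ 1] b[of _ "-1"] by (intro m_add[of _ 1 _ 1] bdI) (auto simp: abs_mult)
    also have "m (\<lambda>\<phi>. (- 1) * max 0 ((- 1) * \<phi> (u j))) = (- 1) *\<^sub>R m (\<lambda>\<phi>. max 0 ((- 1) * \<phi> (u j)))"
      using b[of _ "-1"] by (intro m_scale[of _ 1] bdI) auto
    finally show ?thesis .
  qed
  moreover have "(\<lambda>j. m (\<lambda>\<phi>. max 0 (1 * \<phi> (u j))) + (- 1) *\<^sub>R m (\<lambda>\<phi>. max 0 ((- 1) * \<phi> (u j)))) \<longlonglongrightarrow> 0 + (- 1) *\<^sub>R 0"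
    by (intro tendsto_add tendsto_scaleR tendsto_const main) auto
  ultimately show ?thesis by simp
qed

text \<open>Differences of a weakly Cauchy subsequence, with both indices tending to infinity, are
  weakly null; scaled into the unit ball of \<open>N\<close> they tend to 0 in
  \<open>X\<close>.\<close>

theorem bounded_Cauchy_subsequence:
  assumes z: "\<And>n. z n \<in> Z" "\<And>n. N (z n) \<le> C"
  obtains k :: "nat \<Rightarrow> nat" where "strict_mono k" "Cauchy (\<lambda>n. z (k n))"
proof -
  have C: "0 \<le> C" using N_ge0[OF z(1)] z(2) order_trans by blast
  have "norm (z n) \<le> CX * C" for n
    using CX(2)[OF z(1)] mult_left_mono[OF z(2) CX(1)] order_trans by blast
  then obtain k :: "nat \<Rightarrow> nat" where k: "strict_mono k"
    "\<And>f :: 'a \<Rightarrow>\<^sub>L real. convergent (\<lambda>n. blinfun_apply f (z (k n)))"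
    using weakly_Cauchy_subsequence[OF X_sep X_refl] by metis
  have "Cauchy (\<lambda>n. z (k n))"
  proof (rule ccontr)
    assume "\<not> ?thesis"
    then obtain e where e: "e > 0" "\<And>n0. \<exists>m\<ge>n0. \<exists>n\<ge>n0. e \<le> norm (z (k m) - z (k n))"
      unfolding Cauchy_def by (auto simp: dist_norm not_less)
    then obtain a b where ab: "\<And>i. a i \<ge> i" "\<And>i. b i \<ge> i" "\<And>i. e \<le> norm (z (k (a i)) - z (k (b i)))" by metis
    \<comment> \<open>The summand 1 avoids division by zero when \<open>C\<close> is 0.\<close>
    define s where "s = 1 / (2 * C + 1)"
    have s: "s > 0" using C by (simp add: s_def)
    define u where "u i = s *\<^sub>R (z (k (a i)) - z (k (b i)))" for i
    have uZ: "u i \<in> Z" for i unfolding u_def by (intro Z_scale Z_diff z(1))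
    have "N (u i) \<le> 1" for i
    proof -
      have "N (z (k (a i)) - z (k (b i))) \<le> C + C" using N_diff[OF z(1) z(1)] z(2) by (meson add_mono order_trans)
      then have "s * N (z (k (a i)) - z (k (b i))) \<le> s * (2 * C + 1)" using s by (intro mult_left_mono) auto
      also have "s * (2 * C + 1) = 1" using C by (simp add: s_def)
      finally show ?thesis using s by (simp add: u_def N_scale Z_diff z(1))
    qed
    moreover have "weakly_converges u 0"
      unfolding weakly_converges_def
    proof
      fix f :: "'a \<Rightarrow>\<^sub>L real"
      obtain l where l: "(\<lambda>n. blinfun_apply f (z (k n))) \<longlonglongrightarrow> l" using k(2) by (auto simp: convergent_def)
      have "filterlim a at_top sequentially" "filterlim b at_top sequentially"
        using ab by (auto intro: filterlim_at_top_mono[OF filterlim_ident])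
      from tendsto_mult_left[OF tendsto_diff[OF filterlim_compose[OF l this(1)] filterlim_compose[OF l this(2)]], of s]
      show "(\<lambda>n. blinfun_apply f (u n)) \<longlonglongrightarrow> blinfun_apply f 0" by (simp add: u_def blinfun.diff_right blinfun.scaleR_right)
    qed
    ultimately have "u \<longlonglongrightarrow> 0" by (rule N_le_1_weakly_null[OF uZ])
    then have "(\<lambda>i. norm (u i)) \<longlonglongrightarrow> 0" by (rule tendsto_norm_zero)
    moreover have "s * e \<le> norm (u i)" for i using ab(3)[of i] s by (simp add: u_def)
    ultimately have "s * e \<le> 0" by (intro LIMSEQ_le_const) auto
    with s e(1) show False by (simp add: mult_le_0_iff)
  qed
  then show ?thesis using that k(1) by blast
qed

end

section \<open>Embedding into the null sequences\<close>

context oO_space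
begin

lemma finite_net:
  assumes e: "e > 0"
  obtains F where "finite F" "F \<subseteq> Z" "\<And>x. x \<in> F \<Longrightarrow> N x \<le> 1" "\<And>z. z \<in> Z \<Longrightarrow> N z \<le> 1 \<Longrightarrow> \<exists>x\<in>F. norm (z - x) < e"
proof -
  define B where "B = {z \<in> Z. N z \<le> 1}"
  have "Met_TC.mtotally_bounded B"
    unfolding Met_TC.mtotally_bounded_sequentially
  proof (intro conjI allI impI)
    fix \<sigma> :: "nat \<Rightarrow> 'a" assume "range \<sigma> \<subseteq> B"
    then have \<sigma>: "\<And>n. \<sigma> n \<in> Z" "\<And>n. N (\<sigma> n) \<le> 1" by (auto simp: B_def)
    obtain k :: "nat \<Rightarrow> nat" where "strict_mono k" "Cauchy (\<lambda>n. \<sigma> (k n))"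
      using bounded_Cauchy_subsequence[of \<sigma> 1] \<sigma> by metis
    then show "\<exists>r. strict_mono r \<and> Met_TC.MCauchy (\<sigma> \<circ> r)" by (auto simp: comp_def)
  qed simp
  then obtain F where "finite F" "F \<subseteq> B" "B \<subseteq> (\<Union>x\<in>F. ball x e)"
    using e by (auto simp: Met_TC.mtotally_bounded_def)
  then show ?thesis using that[of F] by (force simp: B_def dist_norm norm_minus_commute)
qed

text \<open>At each point of a finite \<open>X\<close>-net of the unit ball, one operator nearly
  attains the supremum over \<open>A\<close>, and one functional norms its value there. Three errors
  of 1/8 occur, from the choice of the operator and, twice, from the passage to the net point; they
  fit into the allowance 1/2.\<close>

lemma shell_functionals:
  fixes A :: "('a \<Rightarrow>\<^sub>L 'b) set"
  assumes L: "\<And>L. L \<in> A \<Longrightarrow> norm L \<le> c" and A: "\<And>x L. x \<in> Z \<Longrightarrow> L \<in> A \<Longrightarrow> norm (blinfun_apply L x) \<le> N x"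
  shows "\<exists>G :: ('a \<Rightarrow>\<^sub>L real) set. finite G \<and> (\<forall>g\<in>G. \<exists>L\<in>A. \<forall>x. \<bar>blinfun_apply g x\<bar> \<le> norm (blinfun_apply L x)) \<and>
    (\<forall>z\<in>Z. N z \<le> 1 \<longrightarrow> (\<forall>L\<in>A. \<exists>g\<in>G. norm (blinfun_apply L z) \<le> \<bar>blinfun_apply g z\<bar> + 1/2))"
proof (cases "A = {}")
  case True then show ?thesis by (intro exI[of _ "{}"]) auto
next
  case False
  define d where "d = \<bar>c\<bar> + 1"
  have d: "d > 0" by (simp add: d_def)
  have Ld: "norm (blinfun_apply L x) \<le> d * norm x" if "L \<in> A" for L x
  proof -
    have "norm L \<le> d" using L[OF that] by (simp add: d_def)
    then show ?thesis using norm_blinfun[of L x] mult_right_mono[of "norm L" d "norm x"] by simp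
  qed
  obtain F where F: "finite F" "F \<subseteq> Z" "\<And>x. x \<in> F \<Longrightarrow> N x \<le> 1"
    "\<And>z. z \<in> Z \<Longrightarrow> N z \<le> 1 \<Longrightarrow> \<exists>x\<in>F. norm (z - x) < 1 / (8 * d)"
    using finite_net[of "1 / (8 * d)"] d by auto
  have "\<exists>g. (\<exists>L\<in>A. \<forall>y. \<bar>blinfun_apply g y\<bar> \<le> norm (blinfun_apply L y)) \<and>
     (\<forall>L\<in>A. norm (blinfun_apply L x) \<le> blinfun_apply g x + 1/8)" if x: "x \<in> F" for x
  proof -
    have bdd: "bdd_above ((\<lambda>L. norm (blinfun_apply L x)) ` A)"
      by (rule bdd_aboveI2[of _ _ "d * norm x"]) (rule Ld)
    define q where "q = (SUP L\<in>A. norm (blinfun_apply L x))"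
    have "q - 1/8 < q" by simp
    then obtain L0 where L0: "L0 \<in> A" "q - 1/8 < norm (blinfun_apply L0 x)"
      unfolding q_def using less_cSUP_iff[OF False bdd] by blast
    obtain f :: "'b \<Rightarrow>\<^sub>L real" where f: "norm f \<le> 1" "blinfun_apply f (blinfun_apply L0 x) = norm (blinfun_apply L0 x)"
      by (rule norming_functional)
    have "norm (blinfun_apply L x) \<le> q" if "L \<in> A" for L
      unfolding q_def using that bdd by (rule cSUP_upper)
    then show ?thesis
      using L0 f functional_le_norm[OF f(1)] by (intro exI[of _ "f o\<^sub>L L0"]) force
  qed
  then obtain g where g: "\<And>x. x \<in> F \<Longrightarrow> \<exists>L\<in>A. \<forall>y. \<bar>blinfun_apply (g x) y\<bar> \<le> norm (blinfun_apply L y)"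
    "\<And>x L. x \<in> F \<Longrightarrow> L \<in> A \<Longrightarrow> norm (blinfun_apply L x) \<le> blinfun_apply (g x) x + 1/8" by metis
  have "\<exists>h\<in>g ` F. norm (blinfun_apply L z) \<le> \<bar>blinfun_apply h z\<bar> + 1/2" if z: "z \<in> Z" "N z \<le> 1" and LA: "L \<in> A" for z L
  proof -
    obtain x where x: "x \<in> F" "norm (z - x) < 1 / (8 * d)" using F(4)[OF z] by blast
    have small: "norm (blinfun_apply L' (z - x)) \<le> 1/8" if "L' \<in> A" for L'
    proof -
      have "norm (blinfun_apply L' (z - x)) \<le> d * (1 / (8 * d))"
        using Ld[OF that, of "z - x"] x(2) d by (meson less_imp_le mult_left_mono order_trans)
      then show ?thesis using d by simp
    qed
    have "norm (blinfun_apply L z) \<le> norm (blinfun_apply L x) + norm (blinfun_apply L (z - x))"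
      using norm_triangle_ineq[of "blinfun_apply L x" "blinfun_apply L (z - x)"] by (simp add: blinfun.diff_right)
    moreover have "\<bar>blinfun_apply (g x) (z - x)\<bar> \<le> 1/8" using g(1)[OF x(1)] small by (meson order_trans)
    moreover have "blinfun_apply (g x) x = blinfun_apply (g x) z - blinfun_apply (g x) (z - x)" by (simp add: blinfun.diff_right)
    ultimately have "norm (blinfun_apply L z) \<le> \<bar>blinfun_apply (g x) z\<bar> + 1/2"
      using small[OF LA] g(2)[OF x(1) LA] by linarith
    then show ?thesis using x(1) by blast
  qed
  then show ?thesis using F(1) g(1) by (intro exI[of _ "g ` F"]) auto
qed

text \<open>The operators are cut into shells, each handled by finitely many functionals. The
  coordinates of \<open>z\<close> tend to 0 because \<open>z\<close> is small on far shells. The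
  allowance 1/2 against vectors normalised to \<open>N\<close> equal to 1 gives the factor 2 in the
  lower estimate.\<close>

theorem c0_coordinates:
  obtains g :: "nat \<Rightarrow> 'a \<Rightarrow>\<^sub>L real" where
    "\<And>j z. z \<in> Z \<Longrightarrow> \<bar>blinfun_apply (g j) z\<bar> \<le> N z"
    "\<And>z. z \<in> Z \<Longrightarrow> (\<lambda>j. blinfun_apply (g j) z) \<longlonglongrightarrow> 0"
    "\<And>z b. z \<in> Z \<Longrightarrow> (\<And>j. \<bar>blinfun_apply (g j) z\<bar> \<le> b) \<Longrightarrow> N z \<le> 2 * b"
proof -
  define Sh where "Sh n = K n - (if n = 0 then {} else K (n - 1))" for n
  have ShK: "Sh n \<subseteq> K n" for n by (auto simp: Sh_def)
  have cover: "\<exists>i. L \<in> Sh i" if "L \<in> K n" for L n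
  proof -
    define i where "i = (LEAST i. L \<in> K i)"
    have i: "L \<in> K i" unfolding i_def using that by (rule LeastI)
    have "L \<notin> K (i - 1)" if "i \<noteq> 0" using not_less_Least[of "i - 1" "\<lambda>i. L \<in> K i"] that by (simp add: i_def)
    then show ?thesis using i by (intro exI[of _ i]) (auto simp: Sh_def)
  qed
  define P where "P n G \<longleftrightarrow> finite G \<and> (\<forall>g\<in>G. \<exists>L\<in>Sh n. \<forall>x. \<bar>blinfun_apply g x\<bar> \<le> norm (blinfun_apply L x)) \<and>
    (\<forall>z\<in>Z. N z \<le> 1 \<longrightarrow> (\<forall>L\<in>Sh n. \<exists>g\<in>G. norm (blinfun_apply L z) \<le> \<bar>blinfun_apply g z\<bar> + 1/2))"
    for n and G :: "('a \<Rightarrow>\<^sub>L real) set"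
  have "\<exists>G. P n G" for n
  proof -
    obtain c where c: "\<And>L. L \<in> K n \<Longrightarrow> norm L \<le> c" using K_bdd by blast
    show ?thesis unfolding P_def
      by (rule shell_functionals[of _ c]) (use c ShK N_upper in blast)+
  qed
  then obtain G where G: "\<And>n. P n (G n)" by metis
  define GG where "GG = (\<Union>n. G n)"
  have cnt: "countable GG" unfolding GG_def using G by (auto simp: P_def intro: countable_finite)
  have G_le: "\<bar>blinfun_apply h z\<bar> \<le> N z" if h: "h \<in> GG" and z: "z \<in> Z" for h z
  proof -
    obtain n where "h \<in> G n" using h by (auto simp: GG_def)
    then obtain L where L: "L \<in> Sh n" "\<And>x. \<bar>blinfun_apply h x\<bar> \<le> norm (blinfun_apply L x)"
      using G[of n] by (auto simp: P_def)
    then show ?thesis using N_upper[OF z, of L n] ShK[of n] L(2)[of z] by fastforce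
  qed
  have G_fin: "finite {h \<in> GG. e < \<bar>blinfun_apply h z\<bar>}" if z: "z \<in> Z" and e: "e > 0" for z e
  proof -
    obtain n0 where n0: "\<And>m L. L \<in> K m - K n0 \<Longrightarrow> norm (blinfun_apply L z) \<le> e" using Z_tail[OF z e] by blast
    have "{h \<in> GG. e < \<bar>blinfun_apply h z\<bar>} \<subseteq> (\<Union>n\<le>n0. G n)"
    proof
      fix h assume h: "h \<in> {h \<in> GG. e < \<bar>blinfun_apply h z\<bar>}"
      then obtain n where n: "h \<in> G n" by (auto simp: GG_def)
      then obtain L where L: "L \<in> Sh n" "\<And>x. \<bar>blinfun_apply h x\<bar> \<le> norm (blinfun_apply L x)"
        using G[of n] by (auto simp: P_def)
      have "n \<le> n0"
      proof (rule ccontr)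
        assume "\<not> n \<le> n0"
        then have "K n0 \<subseteq> K (n - 1)" "n \<noteq> 0" by (auto intro!: K_mono)
        then have "L \<in> K n - K n0" using L(1) by (auto simp: Sh_def)
        from n0[OF this] L(2)[of z] h show False by auto
      qed
      then show "h \<in> (\<Union>n\<le>n0. G n)" using n by blast
    qed
    then show ?thesis by (rule finite_subset) (use G in \<open>auto simp: P_def\<close>)
  qed
  \<comment> \<open>An injective enumeration, with 0 at the indices left over: a functional repeated
    infinitely often would destroy the convergence to 0.\<close>
  define g where "g j = (if j \<in> to_nat_on GG ` GG then from_nat_into GG j else 0)" for j
  have g_in: "g j = 0 \<or> g j \<in> GG \<and> j = to_nat_on GG (g j)" for j
    using cnt by (auto simp: g_def)
  have g_ex: "\<exists>j. g j = h" if "h \<in> GG" for h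
    using that cnt by (intro exI[of _ "to_nat_on GG h"]) (auto simp: g_def)
  show ?thesis
  proof (rule that[of g])
    show "\<bar>blinfun_apply (g j) z\<bar> \<le> N z" if "z \<in> Z" for j z
      using g_in[of j] G_le[OF _ that] N_ge0[OF that] by auto
    show "(\<lambda>j. blinfun_apply (g j) z) \<longlonglongrightarrow> 0" if z: "z \<in> Z" for z
      unfolding LIMSEQ_iff
    proof (intro allI impI)
      fix r :: real assume r: "r > 0"
      have "{j. r / 2 < \<bar>blinfun_apply (g j) z\<bar>} \<subseteq> to_nat_on GG ` {h \<in> GG. r / 2 < \<bar>blinfun_apply h z\<bar>}"
      proof
        fix j assume "j \<in> {j. r / 2 < \<bar>blinfun_apply (g j) z\<bar>}"
        then have *: "r / 2 < \<bar>blinfun_apply (g j) z\<bar>" by simp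
        then have "g j \<noteq> 0" using r by auto
        then show "j \<in> to_nat_on GG ` {h \<in> GG. r / 2 < \<bar>blinfun_apply h z\<bar>}" using g_in[of j] * by blast
      qed
      then have "finite {j. r / 2 < \<bar>blinfun_apply (g j) z\<bar>}"
        by (rule finite_subset) (use G_fin[OF z, of "r / 2"] r in simp)
      then obtain m where "{j. r / 2 < \<bar>blinfun_apply (g j) z\<bar>} \<subseteq> {..<m}" using finite_nat_iff_bounded by blast
      then have "\<bar>blinfun_apply (g j) z\<bar> \<le> r / 2" if "j \<ge> m" for j using that by (force simp: not_less[symmetric])
      then show "\<exists>no. \<forall>n\<ge>no. norm (blinfun_apply (g n) z - 0) < r" using r by (intro exI[of _ m]) force
    qed
    fix z b assume z: "z \<in> Z" and b: "\<And>j. \<bar>blinfun_apply (g j) z\<bar> \<le> b"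
    have b0: "0 \<le> b" using b[of 0] by linarith
    show "N z \<le> 2 * b"
    proof (cases "N z = 0")
      case True then show ?thesis using b0 by simp
    next
      case False
      then have pos: "N z > 0" using N_ge0[OF z] by simp
      define s where "s = 1 / N z"
      have s: "s > 0" "s * N z = 1" using pos by (auto simp: s_def)
      have sz: "s *\<^sub>R z \<in> Z" "N (s *\<^sub>R z) = 1" using z s by (auto simp: Z_scale N_scale)
      have "N (s *\<^sub>R z) \<le> s * b + 1/2"
      proof (rule N_least[OF sz(1)])
        fix n L assume "L \<in> K n"
        then obtain i where i: "L \<in> Sh i" using cover by blast
        then obtain h where h: "h \<in> G i" "norm (blinfun_apply L (s *\<^sub>R z)) \<le> \<bar>blinfun_apply h (s *\<^sub>R z)\<bar> + 1/2"
          using G[of i, unfolded P_def, THEN conjunct2, THEN conjunct2, rule_format, OF sz(1) eq_refl[OF sz(2)] i] by blast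
        obtain j where "g j = h" using g_ex h(1) by (auto simp: GG_def)
        then have "\<bar>blinfun_apply h (s *\<^sub>R z)\<bar> \<le> s * b"
          using b[of j] s(1) by (simp add: blinfun.scaleR_right abs_mult)
        then show "norm (blinfun_apply L (s *\<^sub>R z)) \<le> s * b + 1/2" using h(2) by linarith
      qed (use s(1) b0 in simp)
      then have "1 \<le> 2 * (s * b)" using sz(2) by simp
      then have "N z * 1 \<le> N z * (2 * (s * b))" using pos by (intro mult_left_mono) auto
      also have "\<dots> = 2 * b" using s(2) by (simp add: mult.commute)
      finally show ?thesis by simp
    qed
  qed
qed

text \<open>The analogue of \<open>wuC\<close> for the norm \<open>N\<close>: the operator on
  finitely supported sequences that sends the unit vectors to the \<open>y j\<close> is bounded by
  \<open>C\<close>. Building in the scale \<open>M\<close> avoids normalising coefficients.\<close>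

definition lincomb_bounded :: "(nat \<Rightarrow> 'a) \<Rightarrow> real \<Rightarrow> bool" where
  "lincomb_bounded y C \<longleftrightarrow> (\<forall>F a M. finite F \<longrightarrow> 0 \<le> M \<longrightarrow> (\<forall>j\<in>F. \<bar>a j\<bar> \<le> M) \<longrightarrow> N (\<Sum>j\<in>F. a j *\<^sub>R y j) \<le> C * M)"

lemma lincomb_boundedD:
  "lincomb_bounded y C \<Longrightarrow> finite F \<Longrightarrow> 0 \<le> M \<Longrightarrow> (\<And>j. j \<in> F \<Longrightarrow> \<bar>a j\<bar> \<le> M) \<Longrightarrow> N (\<Sum>j\<in>F. a j *\<^sub>R y j) \<le> C * M"
  unfolding lincomb_bounded_def by blast

lemma lincomb_bounded_wuC:
  assumes y: "\<And>j. y j \<in> Z" and b: "lincomb_bounded y C"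
  shows "wuC y (CX * C)"
  unfolding wuC_def
proof (intro allI impI)
  fix F and a :: "nat \<Rightarrow> real" assume F: "finite F" "\<forall>j\<in>F. \<bar>a j\<bar> \<le> 1"
  have "norm (\<Sum>j\<in>F. a j *\<^sub>R y j) \<le> CX * N (\<Sum>j\<in>F. a j *\<^sub>R y j)"
    by (intro CX(2) Z_lincomb y)
  also have "\<dots> \<le> CX * (C * 1)" using F CX(1) by (intro mult_left_mono lincomb_boundedD[OF b]) auto
  finally show "norm (\<Sum>j\<in>F. a j *\<^sub>R y j) \<le> CX * C" by simp
qed

end

locale oO_coords = oO_space +
  fixes g :: "nat \<Rightarrow> 'a \<Rightarrow>\<^sub>L real"
  assumes g_le: "z \<in> Z \<Longrightarrow> \<bar>blinfun_apply (g j) z\<bar> \<le> N z"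
    and g_null: "z \<in> Z \<Longrightarrow> (\<lambda>j. blinfun_apply (g j) z) \<longlonglongrightarrow> 0"
    and g_norming: "z \<in> Z \<Longrightarrow> (\<And>j. \<bar>blinfun_apply (g j) z\<bar> \<le> b) \<Longrightarrow> N z \<le> 2 * b"
begin

abbreviation "gg j z \<equiv> blinfun_apply (g j) z"

text \<open>\<open>N z\<close> is controlled by the coordinates \<open>gg j z\<close>, a null
  sequence, and null sequences are approximated by finitely supported rational ones. For each of
  these a nearby point of \<open>Z\<close> is picked, if there is one.\<close>

lemma dense_sequence:
  obtains zs :: "nat \<Rightarrow> 'a" where "\<And>i. zs i \<in> Z" "\<And>z e. z \<in> Z \<Longrightarrow> e > 0 \<Longrightarrow> \<exists>i. N (z - zs i) \<le> e"
proof -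
  define near where "near q n z \<longleftrightarrow> z \<in> Z \<and> (\<forall>j. \<bar>gg j z - (if j < length q then real_of_rat (q ! j) else 0)\<bar> \<le> 1 / real (Suc n))"
    for q :: "rat list" and n z
  define pick where "pick = (\<lambda>(q, n). if \<exists>z. near q n z then SOME z. near q n z else 0)"
  have near_pick: "near q n (pick (q, n))" if "near q n z" for q n z
  proof -
    have "pick (q, n) = (SOME z. near q n z)" using that by (auto simp: pick_def)
    then show ?thesis using someI[of "near q n", OF that] by simp
  qed
  have pick_Z: "pick (q, n) \<in> Z" for q n
  proof (cases "\<exists>z. near q n z")
    case True then show ?thesis using near_pick unfolding near_def by blast
  next
    case False then show ?thesis unfolding pick_def prod.case by (subst if_not_P) auto
  qed
  show ?thesis
  proof (rule that[of "\<lambda>i. pick (from_nat i)"])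
    show "pick (from_nat i) \<in> Z" for i using pick_Z by (metis surj_pair)
    fix z and e :: real assume z: "z \<in> Z" and e: "e > 0"
    obtain n where n: "1 / real (Suc n) < e / 4" using nat_approx_posE[of "e / 4"] e by auto
    have n0: "0 < 1 / real (Suc n)" by simp
    obtain J where J: "\<And>j. j \<ge> J \<Longrightarrow> \<bar>gg j z\<bar> < 1 / real (Suc n)"
      using order_tendstoD(2)[OF tendsto_rabs_zero[OF g_null[OF z]] n0] by (auto simp: eventually_sequentially)
    have "\<exists>r. \<bar>gg j z - real_of_rat r\<bar> \<le> 1 / real (Suc n)" for j
    proof -
      obtain r where "gg j z < real_of_rat r" "real_of_rat r < gg j z + 1 / real (Suc n)"
        using of_rat_dense[of "gg j z" "gg j z + 1 / real (Suc n)"] n0 by auto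
      then show ?thesis by (intro exI[of _ r]) linarith
    qed
    then obtain r where r: "\<And>j. \<bar>gg j z - real_of_rat (r j)\<bar> \<le> 1 / real (Suc n)" by metis
    define q where "q = map r [0..<J]"
    have "near q n z" unfolding near_def using z r J by (auto simp: q_def not_less intro: less_imp_le)
    then have near: "near q n z" "near q n (pick (q, n))" using near_pick by blast+
    define z' where "z' = pick (q, n)"
    have "N (z - z') \<le> 2 * (2 / real (Suc n))"
    proof (rule g_norming)
      show "z - z' \<in> Z" using z pick_Z by (simp add: z'_def Z_diff)
      fix j
      define w where "w = (if j < length q then real_of_rat (q ! j) else 0)"
      have "\<bar>gg j z - w\<bar> \<le> 1 / real (Suc n)" "\<bar>gg j z' - w\<bar> \<le> 1 / real (Suc n)"
        using near unfolding near_def w_def z'_def by blast+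
      then show "\<bar>gg j (z - z')\<bar> \<le> 2 / real (Suc n)" unfolding blinfun.diff_right by linarith
    qed
    then have "N (z - z') \<le> e" using n by linarith
    moreover obtain i where "from_nat i = (q, n)" using surj_from_nat by (metis surjD)
    ultimately show "\<exists>i. N (z - pick (from_nat i)) \<le> e" by (intro exI[of _ i]) (simp add: z'_def)
  qed
qed

text \<open>For \<open>z\<close> in a finite-dimensional subspace, finitely many of the \<open>g j\<close> are norming, so the coordinates extend to \<open>c\<^sub>0\<close>.\<close>

lemma local_lift:
  assumes S: "finite S" "S \<subseteq> Z"
  obtains J y where "\<And>j. y j \<in> Z" "\<And>j. j \<ge> J \<Longrightarrow> y j = 0"
    "\<And>z. z \<in> span S \<Longrightarrow> (\<Sum>j<J. gg j z *\<^sub>R y j) = z" "lincomb_bounded y (2 * \<Lambda>)"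
proof -
  from LPR[OF S] obtain n :: nat and e c where data: "\<forall>t<n. e t \<in> Z \<and> linear (c t) \<and> (\<forall>z\<in>Z. \<bar>c t z\<bar> \<le> N z)"
    "\<forall>z\<in>span S. z = (\<Sum>t<n. c t z *\<^sub>R e t)"
    "\<forall>a M. 0 \<le> M \<longrightarrow> (\<forall>t<n. \<bar>a t\<bar> \<le> M) \<longrightarrow> N (\<Sum>t<n. a t *\<^sub>R e t) \<le> \<Lambda> * M"
    by (elim exE conjE)
  have nec: "\<And>t. t < n \<Longrightarrow> e t \<in> Z" "\<And>t. t < n \<Longrightarrow> linear (c t)"
    "\<And>t z. t < n \<Longrightarrow> z \<in> Z \<Longrightarrow> \<bar>c t z\<bar> \<le> N z" "\<And>z. z \<in> span S \<Longrightarrow> z = (\<Sum>t<n. c t z *\<^sub>R e t)"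
    "\<And>a M. 0 \<le> M \<Longrightarrow> (\<And>t. t < n \<Longrightarrow> \<bar>a t\<bar> \<le> M) \<Longrightarrow> N (\<Sum>t<n. a t *\<^sub>R e t) \<le> \<Lambda> * M"
    using data by blast+
  have spanZ: "span S \<subseteq> Z" using S(2) Z_subspace by (simp add: span_minimal)
  have "(\<lambda>j. \<Sum>t<n. \<bar>gg j (e t)\<bar>) \<longlonglongrightarrow> (\<Sum>t<n. 0)"
    using nec(1) g_null by (intro tendsto_sum tendsto_rabs_zero) auto
  then have "\<forall>\<^sub>F j in sequentially. (\<Sum>t<n. \<bar>gg j (e t)\<bar>) < 1/4" by (intro order_tendstoD) auto
  then obtain J where J: "\<And>j. j \<ge> J \<Longrightarrow> (\<Sum>t<n. \<bar>gg j (e t)\<bar>) < 1/4" by (auto simp: eventually_sequentially)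
  \<comment> \<open>Beyond \<open>J\<close> every coordinate of \<open>z\<close> is at most
    \<open>N z / 4\<close>. In \<open>N z \<le> 2 * max b (N z / 4)\<close> the second alternative
    forces \<open>N z = 0\<close>, so the coordinates below \<open>J\<close> alone are norming on
    \<open>span S\<close> with the same factor 2.\<close>
  have tail: "\<bar>gg j z\<bar> \<le> N z / 4" if "j \<ge> J" "z \<in> span S" for j z
  proof -
    have zZ: "z \<in> Z" using that spanZ by blast
    have "gg j z = (\<Sum>t<n. c t z * gg j (e t))"
      by (subst nec(4)[OF that(2)]) (simp add: blinfun.sum_right blinfun.scaleR_right)
    also have "\<bar>\<dots>\<bar> \<le> (\<Sum>t<n. N z * \<bar>gg j (e t)\<bar>)"
      using nec(3)[OF _ zZ] by (intro order_trans[OF sum_abs] sum_mono) (auto simp: abs_mult intro: mult_right_mono)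
    also have "\<dots> = N z * (\<Sum>t<n. \<bar>gg j (e t)\<bar>)" by (simp add: sum_distrib_left)
    also have "\<dots> \<le> N z * (1/4)" using J[OF that(1)] N_ge0[OF zZ] by (intro mult_left_mono) auto
    finally show ?thesis by simp
  qed
  have norming: "N z \<le> 2 * b" if z: "z \<in> span S" and b: "0 \<le> b" "\<And>j. j < J \<Longrightarrow> \<bar>gg j z\<bar> \<le> b" for z b
  proof -
    have zZ: "z \<in> Z" using z spanZ by blast
    have "N z \<le> 2 * max b (N z / 4)"
    proof (rule g_norming[OF zZ])
      show "\<bar>gg j z\<bar> \<le> max b (N z / 4)" for j using b(2)[of j] tail[OF _ z, of j] by (cases "j < J") (auto simp: le_max_iff_disj)
    qed
    then show ?thesis using N_ge0[OF zZ] b(1) by (auto simp: max_def split: if_splits)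
  qed
  have unit_seq_norm: "norm (\<Sum>j<J. a j *\<^sub>R unit_seq j) \<le> M" if "0 \<le> M" "\<And>j. j < J \<Longrightarrow> \<bar>a j\<bar> \<le> M" for a M
    using that by (intro norm_bound) (auto simp: apply_unit_seq_sum)
  define V where "V x = (\<Sum>j<J. gg j x *\<^sub>R unit_seq j)" for x
  have V: "linear V"
    by (rule linearI) (simp_all add: V_def blinfun.add_right blinfun.scaleR_right scaleR_left_distrib sum.distrib scaleR_sum_right)
  have inj: "inj_on V (span S)"
  proof (rule inj_onI)
    fix x y assume xy: "x \<in> span S" "y \<in> span S" "V x = V y"
    have "gg j x = gg j y" if "j < J" for j
      using arg_cong[OF xy(3), of "\<lambda>s. apply_bcontfun s j"] that by (simp add: V_def apply_unit_seq_sum)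
    then have "N (x - y) \<le> 2 * 0" using xy by (intro norming) (auto simp: span_diff blinfun.diff_right)
    moreover have xyZ: "x - y \<in> Z" using xy spanZ Z_diff by blast
    ultimately have "N (x - y) = 0" using N_ge0[OF xyZ] by linarith
    then show "x = y" using N_eq0[OF xyZ] by simp
  qed
  obtain W where W: "linear W" "\<And>x. x \<in> span S \<Longrightarrow> W (V x) = x"
    using linear_exists_left_inverse_on[OF V subspace_span inj] by blast
  have p: "sublinear (\<lambda>s :: nat \<Rightarrow>\<^sub>C real. 2 * norm s)" by (rule sublinear_scaled_norm) simp
  have ext: "\<exists>l. linear l \<and> (\<forall>s. \<bar>l s\<bar> \<le> 2 * norm s) \<and> (\<forall>z\<in>span S. l (V z) = c t z)" if t: "t < n" for t
  proof -
    have lin: "linear (c t \<circ> W)" using W(1) nec(2)[OF t] by (rule linear_compose)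
    have sub: "subspace (V ` span S)" using V by (intro linear_subspace_image) auto
    have le: "(c t \<circ> W) s \<le> 2 * norm s" if "s \<in> V ` span S" for s
    proof -
      obtain z where z: "z \<in> span S" "s = V z" using \<open>s \<in> V ` span S\<close> by blast
      have "\<bar>gg j z\<bar> \<le> norm s" if "j < J" for j
        using norm_bounded[of s j] that by (simp add: z(2) V_def apply_unit_seq_sum)
      then have "N z \<le> 2 * norm s" using z(1) by (intro norming) auto
      then show ?thesis using nec(3)[OF t, of z] z spanZ by (auto simp: W(2) abs_le_iff)
    qed
    obtain l where l: "linear l" "\<And>x. l x \<le> 2 * norm x" "\<And>x. x \<in> V ` span S \<Longrightarrow> l x = (c t \<circ> W) x"
      using Hahn_Banach_extension[OF p sub lin le] by blast
    have "\<bar>l s\<bar> \<le> 2 * norm s" for s by (rule linear_abs_le_sublinear[OF l(1,2)]) auto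
    then show ?thesis using l W(2) by (intro exI[of _ l]) auto
  qed
  obtain l where l: "\<And>t. t < n \<Longrightarrow> linear (l t)" "\<And>t s. t < n \<Longrightarrow> \<bar>l t s\<bar> \<le> 2 * norm s"
    "\<And>t z. t < n \<Longrightarrow> z \<in> span S \<Longrightarrow> l t (V z) = c t z" using ext by metis
  \<comment> \<open>The images of the unit vectors under the operator whose coordinates are the
    extensions \<open>l t\<close>. The bound 2 for \<open>l t\<close> times \<open>\<Lambda>\<close>
    for the \<open>e t\<close> gives the constant.\<close>
  define y where "y j = (if j < J then \<Sum>t<n. l t (unit_seq j) *\<^sub>R e t else 0)" for j
  have comb: "(\<Sum>j<J. a j *\<^sub>R y j) = (\<Sum>t<n. l t (\<Sum>j<J. a j *\<^sub>R unit_seq j) *\<^sub>R e t)" for a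
  proof -
    have "(\<Sum>j<J. a j *\<^sub>R y j) = (\<Sum>j<J. \<Sum>t<n. (a j * l t (unit_seq j)) *\<^sub>R e t)" by (simp add: y_def scaleR_sum_right)
    also have "\<dots> = (\<Sum>t<n. \<Sum>j<J. (a j * l t (unit_seq j)) *\<^sub>R e t)" by (rule sum.swap)
    also have "\<dots> = (\<Sum>t<n. l t (\<Sum>j<J. a j *\<^sub>R unit_seq j) *\<^sub>R e t)"
    proof (rule sum.cong[OF refl])
      fix t assume "t \<in> {..<n}"
      then have t: "linear (l t)" using l(1) by simp
      show "(\<Sum>j<J. (a j * l t (unit_seq j)) *\<^sub>R e t) = l t (\<Sum>j<J. a j *\<^sub>R unit_seq j) *\<^sub>R e t"
        by (simp add: linear_sum[OF t] linear_cmul[OF t] scaleR_sum_left)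
    qed
    finally show ?thesis .
  qed
  show ?thesis
  proof (rule that[of y J])
    show "y j \<in> Z" for j using nec(1) by (auto simp: y_def intro: Z_lincomb)
    show "y j = 0" if "j \<ge> J" for j using that by (simp add: y_def)
    show "(\<Sum>j<J. gg j z *\<^sub>R y j) = z" if z: "z \<in> span S" for z
    proof -
      have "(\<Sum>j<J. gg j z *\<^sub>R y j) = (\<Sum>t<n. l t (V z) *\<^sub>R e t)" by (simp add: comb V_def)
      also have "\<dots> = (\<Sum>t<n. c t z *\<^sub>R e t)" using z by (simp add: l(3))
      also have "\<dots> = z" using nec(4)[OF z] by simp
      finally show ?thesis .
    qed
    show "lincomb_bounded y (2 * \<Lambda>)"
      unfolding lincomb_bounded_def
    proof (intro allI impI)
      fix F and a :: "nat \<Rightarrow> real" and M assume F: "finite F" "0 \<le> M" "\<forall>j\<in>F. \<bar>a j\<bar> \<le> M"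
      define a' where "a' j = (if j \<in> F then a j else 0)" for j
      have "(\<Sum>j\<in>F. a j *\<^sub>R y j) = (\<Sum>j\<in>F \<inter> {..<J}. a j *\<^sub>R y j)"
        using F(1) by (intro sum.mono_neutral_right) (auto simp: y_def)
      also have "\<dots> = (\<Sum>j<J. a' j *\<^sub>R y j)" by (intro sum.mono_neutral_cong_left) (auto simp: a'_def)
      also have "\<dots> = (\<Sum>t<n. l t (\<Sum>j<J. a' j *\<^sub>R unit_seq j) *\<^sub>R e t)" by (rule comb)
      also have "N \<dots> \<le> \<Lambda> * (2 * M)"
      proof (rule nec(5))
        fix t assume "t < n"
        then have "\<bar>l t (\<Sum>j<J. a' j *\<^sub>R unit_seq j)\<bar> \<le> 2 * norm (\<Sum>j<J. a' j *\<^sub>R unit_seq j)" by (rule l(2))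
        also have "\<dots> \<le> 2 * M" using F by (intro mult_left_mono unit_seq_norm) (auto simp: a'_def)
        finally show "\<bar>l t (\<Sum>j<J. a' j *\<^sub>R unit_seq j)\<bar> \<le> 2 * M" .
      qed (use F(2) in simp)
      finally show "N (\<Sum>j\<in>F. a j *\<^sub>R y j) \<le> 2 * \<Lambda> * M" by (simp add: mult_ac)
    qed
  qed
qed

end

section \<open>Approximate factorisation of the identity\<close>

text \<open>A factorisation of the identity of \<open>Z\<close> through c_0: the \<open>u k\<close>
  are the coordinates of the first operator, the \<open>v k\<close> the images of the unit vectors
  under the second, and \<open>C\<close> bounds both. Without biorthogonality it is a frame, not yet
  a basis.\<close>

definition c0_frame :: "'a::real_normed_vector set \<Rightarrow> ('a \<Rightarrow> real) \<Rightarrow> real \<Rightarrow> (nat \<Rightarrow> 'a \<Rightarrow> real) \<Rightarrow> (nat \<Rightarrow> 'a) \<Rightarrow> bool" where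
  "c0_frame Z N C u v \<longleftrightarrow> (\<forall>k. v k \<in> Z) \<and> (\<forall>k. linear (u k)) \<and> (\<forall>k. \<forall>z\<in>Z. \<bar>u k z\<bar> \<le> C * N z) \<and>
     (\<forall>z\<in>Z. (\<lambda>k. u k z) \<longlonglongrightarrow> 0) \<and>
     (\<forall>F a M. finite F \<longrightarrow> 0 \<le> M \<longrightarrow> (\<forall>k\<in>F. \<bar>a k\<bar> \<le> M) \<longrightarrow> N (\<Sum>k\<in>F. a k *\<^sub>R v k) \<le> C * M) \<and>
     (\<forall>z\<in>Z. (\<lambda>n. N (z - (\<Sum>k<n. u k z *\<^sub>R v k))) \<longlonglongrightarrow> 0)"

context oO_coords
begin

text \<open>Lifts that are exact on \<open>zs 0\<close>, ..., \<open>zs k\<close> are chosen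
  separately for each \<open>k\<close> and need not be compatible. Their coefficients are bounded in
  \<open>N\<close>, so compactness of the inclusion and a diagonal subsequence give limits in
  \<open>X\<close>; nothing places these limits \<open>x j\<close> in \<open>Z\<close>.\<close>

lemma approximating_coefficients:
  obtains zs :: "nat \<Rightarrow> 'a" and y :: "nat \<Rightarrow> nat \<Rightarrow> 'a" and J :: "nat \<Rightarrow> nat" and x :: "nat \<Rightarrow> 'a" where
    "\<And>i. zs i \<in> Z" "\<And>z e. z \<in> Z \<Longrightarrow> e > 0 \<Longrightarrow> \<exists>i. N (z - zs i) \<le> e"
    "\<And>k j. y k j \<in> Z" "\<And>k j. j \<ge> J k \<Longrightarrow> y k j = 0" "\<And>k. lincomb_bounded (y k) (2 * \<Lambda>)"
    "\<And>i k. i \<le> k \<Longrightarrow> (\<Sum>j<J k. gg j (zs i) *\<^sub>R y k j) = zs i"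
    "\<And>j. (\<lambda>k. y k j) \<longlonglongrightarrow> x j" "wuC x (CX * (2 * \<Lambda>))"
proof -
  obtain zs :: "nat \<Rightarrow> 'a" where zs: "\<And>i. zs i \<in> Z" "\<And>z e. z \<in> Z \<Longrightarrow> e > 0 \<Longrightarrow> \<exists>i. N (z - zs i) \<le> e"
    by (rule dense_sequence) (rule that)
  define P where "P k J y \<longleftrightarrow> (\<forall>j. y j \<in> Z) \<and> (\<forall>j\<ge>J. y j = 0) \<and>
    (\<forall>z\<in>span (zs ` {..k}). (\<Sum>j<J. gg j z *\<^sub>R y j) = z) \<and> lincomb_bounded y (2 * \<Lambda>)" for k J :: nat and y
  have "\<exists>J y. P k J y" for k
  proof (rule local_lift[of "zs ` {..k}"])
    show "finite (zs ` {..k})" "zs ` {..k} \<subseteq> Z" using zs(1) by auto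
    fix J y assume A: "\<And>j. y j \<in> Z" "\<And>j. j \<ge> J \<Longrightarrow> y j = 0"
      "\<And>z. z \<in> span (zs ` {..k}) \<Longrightarrow> (\<Sum>j<J. gg j z *\<^sub>R y j) = z" "lincomb_bounded y (2 * \<Lambda>)"
    have "P k J y" unfolding P_def using A by blast
    then show "\<exists>J y. P k J y" by blast
  qed
  then obtain J0 y0 where "\<And>k. P k (J0 k) (y0 k)" by metis
  then have y0: "\<And>k j. y0 k j \<in> Z" "\<And>k j. j \<ge> J0 k \<Longrightarrow> y0 k j = 0"
    "\<And>k z. z \<in> span (zs ` {..k}) \<Longrightarrow> (\<Sum>j<J0 k. gg j z *\<^sub>R y0 k j) = z" "\<And>k. lincomb_bounded (y0 k) (2 * \<Lambda>)"
    unfolding P_def by blast+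
  have N1: "N (y0 k j) \<le> 2 * \<Lambda>" for k j
    using lincomb_boundedD[OF y0(4), of "{j}" 1 "\<lambda>_. 1" k] by simp
  define PC where "PC j s \<longleftrightarrow> Cauchy (\<lambda>k. y0 (s k) j)" for j and s :: "nat \<Rightarrow> nat"
  interpret subseqs PC
  proof
    fix n and s :: "nat \<Rightarrow> nat"
    obtain r where "strict_mono r" "Cauchy (\<lambda>k. y0 (s (r k)) n)"
      using bounded_Cauchy_subsequence[of "\<lambda>k. y0 (s k) n" "2 * \<Lambda>"] y0(1) N1 by metis
    then show "\<exists>r'. strict_mono r' \<and> PC n (s \<circ> r')" by (auto simp: PC_def)
  qed
  define d where "d = diagseq"
  have d: "strict_mono d" unfolding d_def by (rule subseq_diagseq)
  have "convergent (\<lambda>k. y0 (d k) j)" for j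
  proof -
    have "PC j (diagseq \<circ> ((+) (Suc j)))"
    proof (rule diagseq_holds)
      fix r s :: "nat \<Rightarrow> nat" and n assume "strict_mono r" "PC n s"
      then show "PC n (s \<circ> r)" using Cauchy_subseq_Cauchy[of "\<lambda>k. y0 (s k) n" r] by (simp add: PC_def comp_def)
    qed
    then have "convergent (\<lambda>k. y0 (d (Suc j + k)) j)" by (simp add: PC_def Cauchy_convergent_iff d_def)
    then show ?thesis using convergent_ignore_initial_segment[of "\<lambda>k. y0 (d k) j" "Suc j"] by (simp add: add.commute)
  qed
  then obtain x where x: "\<And>j. (\<lambda>k. y0 (d k) j) \<longlonglongrightarrow> x j" unfolding convergent_def by metis
  show ?thesis
  proof (rule that[of zs "\<lambda>k. y0 (d k)" "\<lambda>k. J0 (d k)" x])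
    \<comment> \<open>Exactness survives the passage to a subsequence because
      \<open>d k \<ge> k\<close>.\<close>
    show "(\<Sum>j<J0 (d k). gg j (zs i) *\<^sub>R y0 (d k) j) = zs i" if "i \<le> k" for i k
      using that strict_mono_imp_increasing[OF d, of k] by (intro y0(3) span_base) auto
    show "wuC x (CX * (2 * \<Lambda>))"
      unfolding wuC_def
    proof (intro allI impI)
      fix F and a :: "nat \<Rightarrow> real" assume F: "finite F" "\<forall>j\<in>F. \<bar>a j\<bar> \<le> 1"
      have "(\<lambda>k. norm (\<Sum>j\<in>F. a j *\<^sub>R y0 (d k) j)) \<longlonglongrightarrow> norm (\<Sum>j\<in>F. a j *\<^sub>R x j)"
        by (intro tendsto_intros x)
      moreover have "norm (\<Sum>j\<in>F. a j *\<^sub>R y0 (d k) j) \<le> CX * (2 * \<Lambda>)" for k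
        by (rule wuC_D[OF lincomb_bounded_wuC[OF y0(1) y0(4)] F(1)]) (use F(2) in auto)
      ultimately show "norm (\<Sum>j\<in>F. a j *\<^sub>R x j) \<le> CX * (2 * \<Lambda>)" by (intro LIMSEQ_le_const2) auto
    qed
  qed (use zs y0 x in auto)
qed

lemma Q_linear: "linear (\<lambda>w. \<Sum>j<p. gg j w *\<^sub>R y j)" for p :: nat and y :: "nat \<Rightarrow> 'a"
  by (rule linearI) (simp_all add: blinfun.add_right blinfun.scaleR_right scaleR_left_distrib sum.distrib scaleR_sum_right)

lemma Q_bound:
  assumes "lincomb_bounded y C" "w \<in> Z" shows "N (\<Sum>j<p. gg j w *\<^sub>R y j) \<le> C * N w"
  using assms g_le N_ge0 by (intro lincomb_boundedD) auto

text \<open>The coefficients converge to the \<open>x j\<close> one by one, but closeness is wanted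
  as operators from c_0 to \<open>X\<close>. The tails of \<open>x\<close> are uniformly small
  because it is \<open>wuC\<close>, so only finitely many coefficients have to be close.\<close>

theorem exact_small_perturbation:
  obtains zs :: "nat \<Rightarrow> 'a" and x :: "nat \<Rightarrow> 'a" where
    "\<And>i. zs i \<in> Z" "\<And>z e. z \<in> Z \<Longrightarrow> e > 0 \<Longrightarrow> \<exists>i. N (z - zs i) \<le> e"
    "\<And>S \<epsilon>. finite S \<Longrightarrow> S \<subseteq> Z \<Longrightarrow> \<epsilon> > 0 \<Longrightarrow> \<exists>p y. (\<forall>j. y j \<in> Z) \<and> (\<forall>j\<ge>p. y j = 0) \<and>
       (\<forall>z\<in>span S. (\<Sum>j<p. gg j z *\<^sub>R y j) = z) \<and> lincomb_bounded y (2 * \<Lambda> + 1) \<and>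
       (\<forall>q\<ge>p. \<forall>a M. 0 \<le> M \<longrightarrow> (\<forall>j<q. \<bar>a j\<bar> \<le> M) \<longrightarrow> norm (\<Sum>j<q. a j *\<^sub>R (y j - x j)) \<le> \<epsilon> * M)"
proof -
  obtain zs :: "nat \<Rightarrow> 'a" and Y :: "nat \<Rightarrow> nat \<Rightarrow> 'a" and J :: "nat \<Rightarrow> nat" and x :: "nat \<Rightarrow> 'a" where
    zs: "\<And>i. zs i \<in> Z" "\<And>z e. z \<in> Z \<Longrightarrow> e > 0 \<Longrightarrow> \<exists>i. N (z - zs i) \<le> e"
    and Y: "\<And>k j. Y k j \<in> Z" "\<And>k j. j \<ge> J k \<Longrightarrow> Y k j = 0" "\<And>k. lincomb_bounded (Y k) (2 * \<Lambda>)"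
      "\<And>i k. i \<le> k \<Longrightarrow> (\<Sum>j<J k. gg j (zs i) *\<^sub>R Y k j) = zs i"
    and x: "\<And>j. (\<lambda>k. Y k j) \<longlonglongrightarrow> x j" "wuC x (CX * (2 * \<Lambda>))"
    by (rule approximating_coefficients) (rule that)
  define Q where "Q p k w = (\<Sum>j<p. gg j w *\<^sub>R Y k j)" for p k w
  have QZ: "Q p k w \<in> Z" for p k w unfolding Q_def by (intro Z_lincomb Y)
  have Qb: "N (Q p k w) \<le> 2 * \<Lambda> * N w" if "w \<in> Z" for p k w unfolding Q_def using Y(3) that by (rule Q_bound)
  \<comment> \<open>The truncated operators tend to the identity pointwise on \<open>Z\<close>, in
    the norm \<open>N\<close>: on the dense sequence only the cut tail is lost, and the operators
    are bounded by \<open>2 * \<Lambda>\<close>. \<open>\<eta>1\<close> makes the three errors add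
    up to \<open>\<eta>\<close>.\<close>
  have approx: "\<exists>p0 k0. \<forall>p\<ge>p0. \<forall>k\<ge>k0. N (w - Q p k w) \<le> \<eta>" if w: "w \<in> Z" and \<eta>: "\<eta> > 0" for w \<eta>
  proof -
    define \<eta>1 where "\<eta>1 = \<eta> / (4 * \<Lambda> + 1)"
    have \<eta>1: "\<eta>1 > 0" using \<eta> \<Lambda> by (simp add: \<eta>1_def add_nonneg_pos)
    have tot: "\<eta>1 + 2 * \<Lambda> * \<eta>1 + 2 * \<Lambda> * \<eta>1 = \<eta>" using \<Lambda> by (simp add: \<eta>1_def field_simps add_nonneg_eq_0_iff)
    obtain i where i: "N (w - zs i) \<le> \<eta>1" using zs(2)[OF w \<eta>1] by blast
    obtain p0 where p0: "\<And>j. j \<ge> p0 \<Longrightarrow> \<bar>gg j (zs i)\<bar> < \<eta>1"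
      using order_tendstoD(2)[OF tendsto_rabs_zero[OF g_null[OF zs(1)]] \<eta>1] by (auto simp: eventually_sequentially)
    have "N (w - Q p k w) \<le> \<eta>" if p: "p \<ge> p0" and k: "k \<ge> i" for p k
    proof -
      define m where "m = max p (J k)"
      have "zs i = (\<Sum>j<J k. gg j (zs i) *\<^sub>R Y k j)" using Y(4)[OF k] by simp
      also have "\<dots> = (\<Sum>j<m. gg j (zs i) *\<^sub>R Y k j)"
        unfolding m_def by (rule sum.mono_neutral_left) (auto simp: Y(2))
      also have "\<dots> = Q p k (zs i) + (\<Sum>j=p..<m. gg j (zs i) *\<^sub>R Y k j)"
        unfolding Q_def lessThan_atLeast0 by (rule sum.atLeastLessThan_concat[symmetric]) (auto simp: m_def)
      finally have z: "zs i - Q p k (zs i) = (\<Sum>j=p..<m. gg j (zs i) *\<^sub>R Y k j)" by (simp add: algebra_simps)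
      have "N (zs i - Q p k (zs i)) \<le> 2 * \<Lambda> * \<eta>1"
        unfolding z using p0 p \<eta>1 by (intro lincomb_boundedD[OF Y(3)]) (auto intro: less_imp_le)
      moreover have "N (Q p k (w - zs i)) \<le> 2 * \<Lambda> * \<eta>1"
        using Qb[of "w - zs i" p k] mult_left_mono[OF i, of "2 * \<Lambda>"] \<Lambda> w zs(1) by (simp add: Z_diff)
      moreover have eq: "w - Q p k w = (w - zs i) + ((zs i - Q p k (zs i)) - Q p k (w - zs i))"
        unfolding Q_def linear_diff[OF Q_linear] by simp
      have "N (w - Q p k w) \<le> N (w - zs i) + N ((zs i - Q p k (zs i)) - Q p k (w - zs i))"
        unfolding eq by (intro N_triangle Z_diff w zs(1) QZ)
      moreover have "N ((zs i - Q p k (zs i)) - Q p k (w - zs i)) \<le> N (zs i - Q p k (zs i)) + N (Q p k (w - zs i))"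
        using zs(1) QZ by (intro N_diff Z_diff)
      ultimately show ?thesis using i tot by linarith
    qed
    then show ?thesis by blast
  qed
  show ?thesis
  proof (rule that[of zs x])
    fix S and \<epsilon> :: real assume S: "finite S" "S \<subseteq> Z" and \<epsilon>: "\<epsilon> > 0"
    \<comment> \<open>The final error consists of \<open>\<delta>\<close> for the first
      \<open>p\<close> coefficients, \<open>CX * \<delta>\<close> for the correction and
      \<open>\<delta>\<close> for the tail of \<open>x\<close>. The cap 1 keeps the bound of the
      corrected lift at \<open>2 * \<Lambda> + 1\<close>.\<close>
    define \<delta> where "\<delta> = min 1 (\<epsilon> / (2 + CX))"
    have \<delta>: "\<delta> > 0" "\<delta> \<le> 1" using \<epsilon> CX(1) by (auto simp: \<delta>_def)
    have "\<delta> * (2 + CX) \<le> \<epsilon> / (2 + CX) * (2 + CX)" using CX(1) by (intro mult_right_mono) (auto simp: \<delta>_def)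
    then have \<delta>\<epsilon>: "\<delta> * (2 + CX) \<le> \<epsilon>" using CX(1) by simp
    obtain JS yS where yS: "\<And>j. yS j \<in> Z" "\<And>z. z \<in> span S \<Longrightarrow> (\<Sum>j<JS. gg j z *\<^sub>R yS j) = z"
      by (rule local_lift[OF S]) (rule that)
    obtain n0 where n0': "\<forall>F a M. finite F \<longrightarrow> F \<subseteq> {n0..} \<longrightarrow> (\<forall>j\<in>F. \<bar>a j\<bar> \<le> M) \<longrightarrow> 0 \<le> M \<longrightarrow>
        norm (\<Sum>j\<in>F. a j *\<^sub>R x j) \<le> \<delta> * M"
      using wuC_reflexive_tail[OF X_sep X_refl x(2) \<delta>(1)] by (rule exE)
    have n0: "norm (\<Sum>j\<in>F. a j *\<^sub>R x j) \<le> \<delta> * M"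
      if "finite F" "F \<subseteq> {n0..}" "\<And>j. j \<in> F \<Longrightarrow> \<bar>a j\<bar> \<le> M" "0 \<le> M" for F a M
      by (rule n0'[rule_format]) (use that in auto)
    define \<eta> where "\<eta> = \<delta> / (real JS + 1)"
    have \<eta>: "\<eta> > 0" "real JS * \<eta> \<le> \<delta>" using \<delta>(1) by (auto simp: \<eta>_def field_simps)
    have "\<exists>p0 k0. \<forall>p\<ge>p0. \<forall>k\<ge>k0. N (yS j - Q p k (yS j)) \<le> \<eta>" for j using yS(1) \<eta>(1) by (rule approx)
    then obtain p0 k0 where pk: "\<And>j p k. p \<ge> p0 j \<Longrightarrow> k \<ge> k0 j \<Longrightarrow> N (yS j - Q p k (yS j)) \<le> \<eta>" by metis
    define p where "p = JS + n0 + (\<Sum>j<JS. p0 j)"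
    have p: "JS \<le> p" "n0 \<le> p" by (auto simp: p_def)
    have pj: "p0 j \<le> p" if "j < JS" for j
      using member_le_sum[of j "{..<JS}" p0] that by (simp add: p_def)
    define k1 where "k1 = (\<Sum>j<JS. k0 j)"
    have kj: "k0 j \<le> k1" if "j < JS" for j
      using member_le_sum[of j "{..<JS}" k0] that by (simp add: k1_def)
    have "\<forall>\<^sub>F k in sequentially. \<forall>j\<in>{..<p}. dist (Y k j) (x j) < \<delta> / (real p + 1)"
      using \<delta>(1) x(1) by (intro eventually_ball_finite ballI tendstoD) (auto simp: divide_pos_pos add_nonneg_pos)
    then obtain k2 where k2: "\<And>k j. k \<ge> k2 \<Longrightarrow> j < p \<Longrightarrow> dist (Y k j) (x j) < \<delta> / (real p + 1)"
      unfolding eventually_sequentially by blast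
    define k where "k = max k1 k2"
    have close: "norm (Y k j - x j) \<le> \<delta> / (real p + 1)" if "j < p" for j
      using k2[of k j] that by (simp add: k_def dist_norm less_imp_le)
    define r where "r j = (if j < JS then yS j - Q p k (yS j) else 0)" for j
    have rZ: "r j \<in> Z" for j using yS(1) QZ by (simp add: r_def Z_diff)
    have rN: "N (r j) \<le> (if j < JS then \<eta> else 0)" for j
      using pk[of j p k] pj[of j] kj[of j] by (auto simp: r_def k_def)
    have r0: "r j = 0" if "j \<ge> JS" for j using that by (simp add: r_def)
    have r_sum: "N (\<Sum>j\<in>F. a j *\<^sub>R r j) \<le> \<delta> * M" if F: "finite F" "0 \<le> M" "\<And>j. j \<in> F \<Longrightarrow> \<bar>a j\<bar> \<le> M" for F a M
    proof -
      have "(\<Sum>j\<in>F. a j *\<^sub>R r j) = (\<Sum>j\<in>F \<inter> {..<JS}. a j *\<^sub>R r j)"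
        using F(1) by (intro sum.mono_neutral_right) (auto simp: r_def)
      also have "N \<dots> \<le> (\<Sum>j\<in>F \<inter> {..<JS}. N (a j *\<^sub>R r j))" using rZ by (intro N_sum Z_scale)
      also have "\<dots> \<le> (\<Sum>j\<in>F \<inter> {..<JS}. M * \<eta>)"
      proof (rule sum_mono)
        fix j assume j: "j \<in> F \<inter> {..<JS}"
        have "N (a j *\<^sub>R r j) = \<bar>a j\<bar> * N (r j)" by (rule N_scale[OF rZ])
        also have "\<dots> \<le> M * \<eta>" using j F rN[of j] N_ge0[OF rZ] by (intro mult_mono) auto
        finally show "N (a j *\<^sub>R r j) \<le> M * \<eta>" .
      qed
      also have "\<dots> \<le> (\<Sum>j<JS. M * \<eta>)" using F(2) \<eta>(1) by (intro sum_mono2) auto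
      also have "\<dots> = (real JS * \<eta>) * M" by simp
      also have "\<dots> \<le> \<delta> * M" using \<eta>(2) F(2) by (rule mult_right_mono)
      finally show ?thesis .
    qed
    \<comment> \<open>
      Truncating at \<open>p\<close> makes the coefficients close to the limits \<open>x j\<close>, but loses exactness on \<open>span S\<close>;
      the correction \<open>r\<close> composes the defect with a lift that is exact there.
    \<close>
    define y where "y j = (if j < p then Y k j + r j else 0)" for j
    have y_sum: "(\<Sum>j\<in>F. a j *\<^sub>R y j) = (\<Sum>j\<in>F \<inter> {..<p}. a j *\<^sub>R Y k j) + (\<Sum>j\<in>F \<inter> {..<p}. a j *\<^sub>R r j)" if "finite F" for F a
    proof -
      have "(\<Sum>j\<in>F. a j *\<^sub>R y j) = (\<Sum>j\<in>F \<inter> {..<p}. a j *\<^sub>R y j)"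
        using that by (intro sum.mono_neutral_right) (auto simp: y_def)
      also have "\<dots> = (\<Sum>j\<in>F \<inter> {..<p}. a j *\<^sub>R Y k j + a j *\<^sub>R r j)"
        by (intro sum.cong) (auto simp: y_def scaleR_add_right)
      finally show ?thesis by (simp add: sum.distrib)
    qed
    show "\<exists>p y. (\<forall>j. y j \<in> Z) \<and> (\<forall>j\<ge>p. y j = 0) \<and> (\<forall>z\<in>span S. (\<Sum>j<p. gg j z *\<^sub>R y j) = z) \<and>
       lincomb_bounded y (2 * \<Lambda> + 1) \<and>
       (\<forall>q\<ge>p. \<forall>a M. 0 \<le> M \<longrightarrow> (\<forall>j<q. \<bar>a j\<bar> \<le> M) \<longrightarrow> norm (\<Sum>j<q. a j *\<^sub>R (y j - x j)) \<le> \<epsilon> * M)"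
    proof (intro exI[of _ p] exI[of _ y] conjI allI impI ballI)
      fix j show "y j \<in> Z" using Y(1) rZ by (auto simp: y_def intro: Z_add)
    next
      fix j assume "p \<le> j" then show "y j = 0" by (simp add: y_def)
    next
      fix z assume z: "z \<in> span S"
      have "(\<Sum>j<p. gg j z *\<^sub>R r j) = (\<Sum>j<JS. gg j z *\<^sub>R r j)"
        using p(1) by (intro sum.mono_neutral_right) (auto simp: r_def)
      also have "\<dots> = (\<Sum>j<JS. gg j z *\<^sub>R yS j) - (\<Sum>j<JS. gg j z *\<^sub>R Q p k (yS j))"
        by (simp add: r_def scaleR_diff_right sum_subtractf)
      also have "(\<Sum>j<JS. gg j z *\<^sub>R Q p k (yS j)) = Q p k (\<Sum>j<JS. gg j z *\<^sub>R yS j)"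
        unfolding Q_def by (simp add: linear_sum[OF Q_linear] linear_cmul[OF Q_linear])
      finally have "(\<Sum>j<p. gg j z *\<^sub>R r j) = z - Q p k z" by (simp add: yS(2)[OF z])
      then show "(\<Sum>j<p. gg j z *\<^sub>R y j) = z" by (simp add: y_sum Q_def)
    next
      show "lincomb_bounded y (2 * \<Lambda> + 1)"
        unfolding lincomb_bounded_def
      proof (intro allI impI)
        fix F and a :: "nat \<Rightarrow> real" and M assume F: "finite F" "0 \<le> M" "\<forall>j\<in>F. \<bar>a j\<bar> \<le> M"
        have "N (\<Sum>j\<in>F. a j *\<^sub>R y j) \<le> N (\<Sum>j\<in>F \<inter> {..<p}. a j *\<^sub>R Y k j) + N (\<Sum>j\<in>F \<inter> {..<p}. a j *\<^sub>R r j)"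
          unfolding y_sum[OF F(1)] by (intro N_triangle Z_lincomb Y(1) rZ)
        also have "\<dots> \<le> 2 * \<Lambda> * M + \<delta> * M"
          using F by (intro add_mono lincomb_boundedD[OF Y(3)] r_sum) auto
        also have "\<dots> \<le> (2 * \<Lambda> + 1) * M" using \<delta>(2) F(2) mult_right_mono[of \<delta> 1 M] by (simp add: distrib_right)
        finally show "N (\<Sum>j\<in>F. a j *\<^sub>R y j) \<le> (2 * \<Lambda> + 1) * M" .
      qed
    next
      fix q and a :: "nat \<Rightarrow> real" and M assume q: "p \<le> q" and M: "0 \<le> M" "\<forall>j<q. \<bar>a j\<bar> \<le> M"
      have "{..<q} \<inter> {..<p} = {..<p}" using q by auto
      then have "(\<Sum>j<q. a j *\<^sub>R (y j - x j)) = (\<Sum>j<p. a j *\<^sub>R Y k j) + (\<Sum>j<p. a j *\<^sub>R r j) - (\<Sum>j<q. a j *\<^sub>R x j)"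
        by (simp add: scaleR_diff_right sum_subtractf y_sum)
      also have "(\<Sum>j<q. a j *\<^sub>R x j) = (\<Sum>j<p. a j *\<^sub>R x j) + (\<Sum>j=p..<q. a j *\<^sub>R x j)"
        unfolding lessThan_atLeast0 using q by (intro sum.atLeastLessThan_concat[symmetric]) auto
      finally have eq: "(\<Sum>j<q. a j *\<^sub>R (y j - x j)) =
         (\<Sum>j<p. a j *\<^sub>R (Y k j - x j)) + (\<Sum>j<p. a j *\<^sub>R r j) - (\<Sum>j=p..<q. a j *\<^sub>R x j)"
        by (simp add: scaleR_diff_right sum_subtractf)
      have "norm (\<Sum>j<p. a j *\<^sub>R (Y k j - x j)) \<le> (\<Sum>j<p. M * (\<delta> / (real p + 1)))"
      proof (intro order_trans[OF norm_sum] sum_mono)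
        fix j assume j: "j \<in> {..<p}"
        then have "\<bar>a j\<bar> * norm (Y k j - x j) \<le> M * (\<delta> / (real p + 1))"
          using q M close[of j] by (intro mult_mono) auto
        then show "norm (a j *\<^sub>R (Y k j - x j)) \<le> M * (\<delta> / (real p + 1))" by simp
      qed
      also have "\<dots> = (real p / (real p + 1)) * (\<delta> * M)" by simp
      also have "\<dots> \<le> 1 * (\<delta> * M)" using \<delta>(1) M(1) by (intro mult_right_mono) auto
      finally have 1: "norm (\<Sum>j<p. a j *\<^sub>R (Y k j - x j)) \<le> \<delta> * M" by simp
      have "norm (\<Sum>j<p. a j *\<^sub>R r j) \<le> CX * N (\<Sum>j<p. a j *\<^sub>R r j)" by (intro CX(2) Z_lincomb rZ)
      also have "\<dots> \<le> CX * (\<delta> * M)" using CX(1) q M by (intro mult_left_mono r_sum) auto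
      finally have 2: "norm (\<Sum>j<p. a j *\<^sub>R r j) \<le> CX * (\<delta> * M)" .
      have 3: "norm (\<Sum>j=p..<q. a j *\<^sub>R x j) \<le> \<delta> * M" using p(2) M by (intro n0) auto
      have "norm (\<Sum>j<q. a j *\<^sub>R (y j - x j)) \<le> \<delta> * M + CX * (\<delta> * M) + \<delta> * M"
        unfolding eq using 1 2 3 norm_triangle_ineq4[of "(\<Sum>j<p. a j *\<^sub>R (Y k j - x j)) + (\<Sum>j<p. a j *\<^sub>R r j)" "\<Sum>j=p..<q. a j *\<^sub>R x j"]
          norm_triangle_ineq[of "\<Sum>j<p. a j *\<^sub>R (Y k j - x j)" "\<Sum>j<p. a j *\<^sub>R r j"] by linarith
      also have "\<dots> = (\<delta> * (2 + CX)) * M" by (simp add: algebra_simps)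
      also have "\<dots> \<le> \<epsilon> * M" using \<delta>\<epsilon> M(1) by (rule mult_right_mono)
      finally show "norm (\<Sum>j<q. a j *\<^sub>R (y j - x j)) \<le> \<epsilon> * M" .
    qed
  qed (use zs in auto)
qed

end

section \<open>Nested operators and the telescoping factorisation\<close>

context oO_coords
begin

text \<open>The order of the choices matters: the next operator is made close to \<open>x\<close> on
  \<open>K (m n)\<close> and exact on the range of the previous one and on \<open>zs n\<close>; only
  then is \<open>m (Suc n)\<close> taken so large that its finitely many coefficients are negligible
  outside \<open>K (m (Suc n))\<close>.\<close>

lemma nested_operators:
  obtains zs x :: "nat \<Rightarrow> 'a" and p m :: "nat \<Rightarrow> nat" and y :: "nat \<Rightarrow> nat \<Rightarrow> 'a" and S :: "nat \<Rightarrow> 'a set" where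
    "\<And>i. zs i \<in> Z" "\<And>z e. z \<in> Z \<Longrightarrow> e > 0 \<Longrightarrow> \<exists>i. N (z - zs i) \<le> e"
    "p 0 = 0" "\<And>n j. y n j \<in> Z" "\<And>n j. j \<ge> p n \<Longrightarrow> y n j = 0"
    "\<And>n z. z \<in> span (S n) \<Longrightarrow> (\<Sum>j<p n. gg j z *\<^sub>R y n j) = z" "\<And>n. lincomb_bounded (y n) (2 * \<Lambda> + 1)"
    "\<And>n k L. L \<in> K k - K (m n) \<Longrightarrow> (\<Sum>j<p n. norm (blinfun_apply L (y n j))) \<le> (1/2)^n"
    "\<And>n. S n \<union> y n ` {..<p n} \<union> {zs n} \<subseteq> S (Suc n)" "\<And>n. m n \<le> m (Suc n)" "\<And>n. p n \<le> p (Suc n)"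
    "\<And>n L q a M. L \<in> K (m n) \<Longrightarrow> q \<ge> p (Suc n) \<Longrightarrow> 0 \<le> M \<Longrightarrow> (\<And>j. j < q \<Longrightarrow> \<bar>a j\<bar> \<le> M) \<Longrightarrow>
       norm (blinfun_apply L (\<Sum>j<q. a j *\<^sub>R (y (Suc n) j - x j))) \<le> M * (1/2)^n"
proof -
  obtain zs x :: "nat \<Rightarrow> 'a" where zs: "\<And>i. zs i \<in> Z" "\<And>z e. z \<in> Z \<Longrightarrow> e > 0 \<Longrightarrow> \<exists>i. N (z - zs i) \<le> e"
    and pert: "\<And>S \<epsilon>. finite S \<Longrightarrow> S \<subseteq> Z \<Longrightarrow> \<epsilon> > 0 \<Longrightarrow> \<exists>p y. (\<forall>j. y j \<in> Z) \<and> (\<forall>j\<ge>p. y j = 0) \<and>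
       (\<forall>z\<in>span S. (\<Sum>j<p. gg j z *\<^sub>R y j) = z) \<and> lincomb_bounded y (2 * \<Lambda> + 1) \<and>
       (\<forall>q\<ge>p. \<forall>a M. 0 \<le> M \<longrightarrow> (\<forall>j<q. \<bar>a j\<bar> \<le> M) \<longrightarrow> norm (\<Sum>j<q. a j *\<^sub>R (y j - x j)) \<le> \<epsilon> * M)"
    by (rule exact_small_perturbation) (rule that)
  define P :: "nat \<Rightarrow> nat \<times> (nat \<Rightarrow> 'a) \<times> nat \<times> 'a set \<Rightarrow> bool" where
    "P n s \<longleftrightarrow> (case s of (p, y, m, S) \<Rightarrow> (n = 0 \<longrightarrow> p = 0) \<and> (\<forall>j. y j \<in> Z) \<and> (\<forall>j\<ge>p. y j = 0) \<and> finite S \<and> S \<subseteq> Z \<and>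
       (\<forall>z\<in>span S. (\<Sum>j<p. gg j z *\<^sub>R y j) = z) \<and> lincomb_bounded y (2 * \<Lambda> + 1) \<and>
       (\<forall>k. \<forall>L\<in>K k - K m. (\<Sum>j<p. norm (blinfun_apply L (y j))) \<le> (1/2)^n))" for n s
  define R :: "nat \<Rightarrow> nat \<times> (nat \<Rightarrow> 'a) \<times> nat \<times> 'a set \<Rightarrow> nat \<times> (nat \<Rightarrow> 'a) \<times> nat \<times> 'a set \<Rightarrow> bool" where
    "R n s s' \<longleftrightarrow> (case s of (p, y, m, S) \<Rightarrow> case s' of (p', y', m', S') \<Rightarrow>
       S \<union> y ` {..<p} \<union> {zs n} \<subseteq> S' \<and> m \<le> m' \<and> p \<le> p' \<and>
       (\<forall>L\<in>K m. \<forall>q\<ge>p'. \<forall>a M. 0 \<le> M \<longrightarrow> (\<forall>j<q. \<bar>a j\<bar> \<le> M) \<longrightarrow>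
          norm (blinfun_apply L (\<Sum>j<q. a j *\<^sub>R (y' j - x j))) \<le> M * (1/2)^n))" for n s s'
  have "\<exists>f. \<forall>n. P n (f n) \<and> R n (f n) (f (Suc n))"
  proof (rule dependent_nat_choice)
    \<comment> \<open>The zero operator is the start, so that the telescoping sum later begins at
      0.\<close>
    have "P 0 (0, \<lambda>_. 0, 0, {})" by (simp add: P_def lincomb_bounded_def \<Lambda>)
    then show "\<exists>s. P 0 s" by blast
  next
    fix s n assume Ps: "P n s"
    obtain p y m S where s: "s = (p, y, m, S)" by (cases s)
    have yZ: "\<And>j. y j \<in> Z" and S: "finite S" "S \<subseteq> Z" using Ps by (auto simp: P_def s)
    define S' where "S' = S \<union> y ` {..<p} \<union> {zs n}"
    have S': "finite S'" "S' \<subseteq> Z" using S yZ zs(1) by (auto simp: S'_def)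
    obtain c where c: "\<And>L. L \<in> K m \<Longrightarrow> norm L \<le> c" using K_bdd by blast
    define \<epsilon> where "\<epsilon> = (1/2)^n / (\<bar>c\<bar> + 1)"
    have \<epsilon>: "\<epsilon> > 0" by (simp add: \<epsilon>_def add_nonneg_pos)
    obtain p0 y' where y': "\<forall>j. y' j \<in> Z" "\<forall>j\<ge>p0. y' j = 0" "\<forall>z\<in>span S'. (\<Sum>j<p0. gg j z *\<^sub>R y' j) = z"
      "lincomb_bounded y' (2 * \<Lambda> + 1)"
      "\<forall>q\<ge>p0. \<forall>a M. 0 \<le> M \<longrightarrow> (\<forall>j<q. \<bar>a j\<bar> \<le> M) \<longrightarrow> norm (\<Sum>j<q. a j *\<^sub>R (y' j - x j)) \<le> \<epsilon> * M"
      using pert[OF S' \<epsilon>] by (elim exE conjE)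
    define p' where "p' = max p p0"
    have "\<exists>k. \<forall>i. \<forall>L\<in>K i - K k. norm (blinfun_apply L (y' j)) \<le> (1/2)^Suc n / (real p' + 1)" for j
      using y'(1) by (intro Z_tail) (auto simp: add_nonneg_pos)
    then obtain k where k: "\<And>i j L. L \<in> K i - K (k j) \<Longrightarrow> norm (blinfun_apply L (y' j)) \<le> (1/2)^Suc n / (real p' + 1)"
      by metis
    define m' where "m' = m + (\<Sum>j<p'. k j)"
    have "(\<Sum>j<p'. norm (blinfun_apply L (y' j))) \<le> (1/2)^Suc n" if L: "L \<in> K i - K m'" for i L
    proof -
      have "(\<Sum>j<p'. norm (blinfun_apply L (y' j))) \<le> (\<Sum>j<p'. (1/2)^Suc n / (real p' + 1))"
      proof (rule sum_mono)
        fix j assume "j \<in> {..<p'}"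
        then have "k j \<le> m'" using member_le_sum[of j "{..<p'}" k] by (simp add: m'_def)
        then have "L \<in> K i - K (k j)" using L K_mono by blast
        then show "norm (blinfun_apply L (y' j)) \<le> (1/2)^Suc n / (real p' + 1)" by (rule k)
      qed
      also have "\<dots> = (real p' / (real p' + 1)) * (1/2)^Suc n" by simp
      also have "\<dots> \<le> 1 * (1/2)^Suc n" by (intro mult_right_mono) auto
      finally show ?thesis by simp
    qed
    moreover have "(\<Sum>j<p'. gg j z *\<^sub>R y' j) = z" if "z \<in> span S'" for z
    proof -
      have "(\<Sum>j<p'. gg j z *\<^sub>R y' j) = (\<Sum>j<p0. gg j z *\<^sub>R y' j)"
        using y'(2) by (intro sum.mono_neutral_right) (auto simp: p'_def)
      then show ?thesis using y'(3) that by simp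
    qed
    moreover have "\<forall>j\<ge>p'. y' j = 0" using y'(2) by (simp add: p'_def)
    ultimately have "P (Suc n) (p', y', m', S')"
      unfolding P_def prod.case using y'(1,4) S' by blast
    moreover have "norm (blinfun_apply L (\<Sum>j<q. a j *\<^sub>R (y' j - x j))) \<le> M * (1/2)^n"
      if L: "L \<in> K m" and q: "q \<ge> p'" and M: "0 \<le> M" "\<forall>j<q. \<bar>a j\<bar> \<le> M" for L q a M
    proof -
      have "norm (blinfun_apply L (\<Sum>j<q. a j *\<^sub>R (y' j - x j))) \<le> norm L * norm (\<Sum>j<q. a j *\<^sub>R (y' j - x j))"
        by (rule norm_blinfun)
      also have "\<dots> \<le> (\<bar>c\<bar> + 1) * (\<epsilon> * M)"
        using c[OF L] y'(5) q M by (intro mult_mono) (auto simp: p'_def)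
      also have "\<dots> = M * (1/2)^n" by (simp add: \<epsilon>_def add_nonneg_eq_0_iff)
      finally show ?thesis .
    qed
    then have "R n s (p', y', m', S')"
      unfolding R_def s prod.case by (auto simp: S'_def m'_def p'_def)
    ultimately show "\<exists>s'. P (Suc n) s' \<and> R n s s'" by blast
  qed
  then obtain f where f: "\<And>n. P n (f n)" "\<And>n. R n (f n) (f (Suc n))" by blast
  define p where "p n = fst (f n)" for n
  define y where "y n = fst (snd (f n))" for n
  define m where "m n = fst (snd (snd (f n)))" for n
  define S where "S n = snd (snd (snd (f n)))" for n
  have fn: "f n = (p n, y n, m n, S n)" for n by (simp add: p_def y_def m_def S_def)
  show ?thesis
  proof (rule that[of zs p y S m x])
    show "p 0 = 0" using f(1)[of 0] by (simp add: P_def fn)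
    show "y n j \<in> Z" for n j using f(1)[of n] by (simp add: P_def fn)
    show "y n j = 0" if "j \<ge> p n" for n j using f(1)[of n] that by (simp add: P_def fn)
    show "(\<Sum>j<p n. gg j z *\<^sub>R y n j) = z" if "z \<in> span (S n)" for n z using f(1)[of n] that by (simp add: P_def fn)
    show "lincomb_bounded (y n) (2 * \<Lambda> + 1)" for n using f(1)[of n] by (simp add: P_def fn)
    show "(\<Sum>j<p n. norm (blinfun_apply L (y n j))) \<le> (1/2)^n" if "L \<in> K k - K (m n)" for n k L
      using f(1)[of n] that unfolding P_def fn prod.case by blast
    show "S n \<union> y n ` {..<p n} \<union> {zs n} \<subseteq> S (Suc n)" "m n \<le> m (Suc n)" "p n \<le> p (Suc n)" for n
      using f(2)[of n] unfolding R_def fn prod.case by blast+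
    show "norm (blinfun_apply L (\<Sum>j<q. a j *\<^sub>R (y (Suc n) j - x j))) \<le> M * (1/2)^n"
      if "L \<in> K (m n)" "q \<ge> p (Suc n)" "0 \<le> M" "\<And>j. j < q \<Longrightarrow> \<bar>a j\<bar> \<le> M" for n L q a M
      using f(2)[of n] that unfolding R_def fn prod.case by blast
  qed (fact zs)+
qed

text \<open>
  With \<open>Q n\<close> the nested operators, \<open>z = \<Sum>n. (Q (n + 1) - Q n) z\<close>. Replacing \<open>z\<close> by \<open>z - Q (n - 1) z\<close> in the
  \<open>n\<close>-th term changes nothing but makes the coefficients tend to \<open>0\<close>.
\<close>

theorem c0_frame_exists: "\<exists>C u v. 0 \<le> C \<and> c0_frame Z N C u v"
proof -
  obtain zs x :: "nat \<Rightarrow> 'a" and p m :: "nat \<Rightarrow> nat" and y :: "nat \<Rightarrow> nat \<Rightarrow> 'a" and S :: "nat \<Rightarrow> 'a set" where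
    zs: "\<And>i. zs i \<in> Z" "\<And>z e. z \<in> Z \<Longrightarrow> e > 0 \<Longrightarrow> \<exists>i. N (z - zs i) \<le> e"
    and p0: "p 0 = 0" and yZ: "\<And>n j. y n j \<in> Z" and y0: "\<And>n j. j \<ge> p n \<Longrightarrow> y n j = 0"
    and exact: "\<And>n z. z \<in> span (S n) \<Longrightarrow> (\<Sum>j<p n. gg j z *\<^sub>R y n j) = z"
    and lb: "\<And>n. lincomb_bounded (y n) (2 * \<Lambda> + 1)"
    and outer: "\<And>n k L. L \<in> K k - K (m n) \<Longrightarrow> (\<Sum>j<p n. norm (blinfun_apply L (y n j))) \<le> (1/2)^n"
    and S_Suc: "\<And>n. S n \<union> y n ` {..<p n} \<union> {zs n} \<subseteq> S (Suc n)"
    and m_Suc: "\<And>n. m n \<le> m (Suc n)" and p_Suc: "\<And>n. p n \<le> p (Suc n)"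
    and inner: "\<And>n L q a M. L \<in> K (m n) \<Longrightarrow> q \<ge> p (Suc n) \<Longrightarrow> 0 \<le> M \<Longrightarrow> (\<And>j. j < q \<Longrightarrow> \<bar>a j\<bar> \<le> M) \<Longrightarrow>
       norm (blinfun_apply L (\<Sum>j<q. a j *\<^sub>R (y (Suc n) j - x j))) \<le> M * (1/2)^n"
  proof (rule nested_operators, goal_cases)
    case (1 zs x p m y S)
    show thesis by (rule that[of zs p y S m x]) (fact 1)+
  qed
  define C2 where "C2 = 2 * \<Lambda> + 1"
  have C2: "C2 \<ge> 1" using \<Lambda> by (simp add: C2_def)
  define Q where "Q n w = (\<Sum>j<p n. gg j w *\<^sub>R y n j)" for n w
  have Q_lin: "linear (Q n)" for n unfolding Q_def by (rule Q_linear)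
  have QZ: "Q n w \<in> Z" for n w unfolding Q_def by (intro Z_lincomb yZ)
  have Qb: "N (Q n w) \<le> C2 * N w" if "w \<in> Z" for n w
    unfolding Q_def C2_def using lb that by (rule Q_bound)
  have Q0: "Q 0 w = 0" for w by (simp add: Q_def p0)
  have S_mono: "S n \<subseteq> S n'" if "n \<le> n'" for n n'
    using that by (induction rule: dec_induct) (use S_Suc in blast)+
  have Q_exact: "Q n z = z" if "z \<in> span (S n)" for n z using exact[OF that] by (simp add: Q_def)
  have QS: "Q n z \<in> span (S (Suc n))" for n z
    unfolding Q_def using S_Suc[of n] by (intro span_sum span_scale span_base) auto
  \<comment> \<open>For \<open>n = 0\<close> the subtraction gives \<open>n - 1 = 0\<close>, and
    \<open>Q 0 = 0\<close>, so the first correction is void.\<close>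
  have Q_prev: "Q (Suc n) (Q (n - 1) z) = Q (n - 1) z" "Q n (Q (n - 1) z) = Q (n - 1) z" for n z
  proof -
    have *: "Q (n - 1) z \<in> span (S n)" using QS[of "n - 1" z] by (cases n) (auto simp: Q0 span_zero)
    then show "Q n (Q (n - 1) z) = Q (n - 1) z" by (rule Q_exact)
    have "span (S n) \<subseteq> span (S (Suc n))" by (intro span_mono S_mono) simp
    then show "Q (Suc n) (Q (n - 1) z) = Q (n - 1) z" using * by (intro Q_exact) blast
  qed
  have Q_conv: "(\<lambda>n. N (z - Q n z)) \<longlonglongrightarrow> 0" if z: "z \<in> Z" for z
    unfolding LIMSEQ_iff
  proof (intro allI impI)
    fix r :: real assume r: "r > 0"
    define e where "e = r / (2 * (1 + C2))"
    have e: "e > 0" using r C2 by (simp add: e_def)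
    obtain i where i: "N (z - zs i) \<le> e" using zs(2)[OF z e] by blast
    have "N (z - Q n z) < r" if n: "n \<ge> Suc i" for n
    proof -
      have "zs i \<in> span (S n)" using S_Suc[of i] S_mono[OF n] by (auto intro: span_base)
      then have eq: "z - Q n z = (z - zs i) - Q n (z - zs i)" by (simp add: linear_diff[OF Q_lin] Q_exact)
      have "N (z - Q n z) \<le> N (z - zs i) + N (Q n (z - zs i))"
        unfolding eq by (intro N_diff Z_diff z zs(1) QZ)
      also have "\<dots> \<le> e + C2 * e"
      proof (rule add_mono[OF i])
        have "N (Q n (z - zs i)) \<le> C2 * N (z - zs i)" by (intro Qb Z_diff z zs(1))
        also have "\<dots> \<le> C2 * e" using i C2 by (intro mult_left_mono) auto
        finally show "N (Q n (z - zs i)) \<le> C2 * e" .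
      qed
      also have "\<dots> = e * (1 + C2)" by (simp add: algebra_simps)
      also have "\<dots> = r / 2" using C2 unfolding e_def by (simp add: field_simps)
      finally show ?thesis using r by simp
    qed
    then show "\<exists>no. \<forall>n\<ge>no. norm (N (z - Q n z) - 0) < r"
      using N_ge0[OF Z_diff[OF z QZ]] by (intro exI[of _ "Suc i"]) simp
  qed
  define vv where "vv n i = y (Suc n) i - y n i" for n i
  have vvZ: "vv n i \<in> Z" for n i unfolding vv_def by (intro Z_diff yZ)
  have vv0: "vv n i = 0" if "i \<ge> p (Suc n)" for n i
    using that p_Suc[of n] by (simp add: vv_def y0)
  define C3 where "C3 = 4 * (2 * C2 + 4)"
  have C3: "0 \<le> C3" using C2 by (simp add: C3_def)
  have block: "N (\<Sum>n<r. \<Sum>i<p (Suc n). a n i *\<^sub>R vv n i) \<le> C3 * M" if M: "0 \<le> M" and a: "\<And>n i. \<bar>a n i\<bar> \<le> M" for a M r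
  proof -
    \<comment> \<open>\<open>2 * C2 * M\<close> bounds a difference of two operators in
      \<open>N\<close>; the additional amount absorbs the factor 3 in
      \<open>(1/2)^n + (1/2)^(n-1) = 3 * (1/2)^n\<close>.\<close>
    define B where "B = (2 * C2 + 4) * M"
    define D where "D n = (\<Sum>i<p (Suc n). a n i *\<^sub>R vv n i)" for n
    have DZ: "D n \<in> Z" for n unfolding D_def by (intro Z_lincomb vvZ)
    have D_eq: "D n = (\<Sum>i<p (Suc n). a n i *\<^sub>R y (Suc n) i) - (\<Sum>i<p (Suc n). a n i *\<^sub>R y n i)" for n
      by (simp add: D_def vv_def scaleR_diff_right sum_subtractf)
    have DN: "N (D n) \<le> B" for n
    proof -
      have "N (D n) \<le> N (\<Sum>i<p (Suc n). a n i *\<^sub>R y (Suc n) i) + N (\<Sum>i<p (Suc n). a n i *\<^sub>R y n i)"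
        unfolding D_eq by (intro N_diff Z_lincomb yZ)
      also have "\<dots> \<le> C2 * M + C2 * M"
        unfolding C2_def using M a by (intro add_mono lincomb_boundedD[OF lb]) auto
      also have "\<dots> \<le> B" using M by (simp add: B_def algebra_simps)
      finally show ?thesis .
    qed
    have M_le: "3 * M \<le> B" using M C2 by (simp add: B_def mult_right_mono)
    have "N (\<Sum>n<r. D n) \<le> 4 * B"
    \<comment> \<open>For \<open>n \<ge> 1\<close> both operators in the \<open>n\<close>-th
      difference are close to \<open>x\<close> on \<open>K (m (n - 1))\<close>; for
      \<open>n = 0\<close> the bound in \<open>N\<close> suffices. Both have negligible coefficients
      outside \<open>K (m (Suc n))\<close>.\<close>
    proof (rule gliding_hump[where m = "\<lambda>i. m (i - 1)"])
      show "D n \<in> Z" "N (D n) \<le> B" for n by (fact DZ DN)+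
      show "m (n - 1) \<le> m (Suc n - 1)" for n using m_Suc[of "n - 1"] by (cases n) auto
    next
      fix n L assume L: "L \<in> K (m (n - 1))"
      show "norm (blinfun_apply L (D n)) \<le> B * (1/2)^n"
      proof (cases n)
        case 0
        then show ?thesis using N_upper[OF DZ L, of n] DN[of n] by simp
      next
        case (Suc k)
        define q where "q = p (Suc n)"
        have Lk: "L \<in> K (m k)" "L \<in> K (m n)" using L K_mono[OF m_Suc[of k]] by (auto simp: Suc)
        have 1: "norm (blinfun_apply L (\<Sum>j<q. a n j *\<^sub>R (y n j - x j))) \<le> M * (1/2)^k"
          using inner[OF Lk(1), of q M "a n"] p_Suc[of n] a M by (simp add: Suc q_def)
        have 2: "norm (blinfun_apply L (\<Sum>j<q. a n j *\<^sub>R (y (Suc n) j - x j))) \<le> M * (1/2)^n"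
          using inner[OF Lk(2), of q M "a n"] a M by (simp add: q_def)
        have "D n = (\<Sum>j<q. a n j *\<^sub>R (y (Suc n) j - x j)) - (\<Sum>j<q. a n j *\<^sub>R (y n j - x j))"
          unfolding D_eq q_def by (simp add: scaleR_diff_right sum_subtractf)
        then have "norm (blinfun_apply L (D n)) \<le> M * (1/2)^n + M * (1/2)^k"
          using 1 2 norm_triangle_ineq4[of "blinfun_apply L (\<Sum>j<q. a n j *\<^sub>R (y (Suc n) j - x j))"
            "blinfun_apply L (\<Sum>j<q. a n j *\<^sub>R (y n j - x j))"] by (simp add: blinfun.diff_right)
        also have "\<dots> = (3 * M) * (1/2)^n" by (simp add: Suc)
        also have "\<dots> \<le> B * (1/2)^n" using M_le by (rule mult_right_mono) simp
        finally show ?thesis .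
      qed
    next
      fix n k L assume "L \<in> K k - K (m (Suc (Suc n) - 1))"
      then have L: "L \<in> K k - K (m (Suc n))" "L \<in> K k - K (m n)" using K_mono[OF m_Suc[of n]] by auto
      have *: "norm (blinfun_apply L (\<Sum>i<p (Suc n). a n i *\<^sub>R y n' i)) \<le> M * (1/2)^n'"
        if "n' = n \<or> n' = Suc n" for n'
      proof -
        have "norm (blinfun_apply L (\<Sum>i<p (Suc n). a n i *\<^sub>R y n' i)) \<le> (\<Sum>i<p (Suc n). M * norm (blinfun_apply L (y n' i)))"
          using a by (simp add: blinfun.sum_right blinfun.scaleR_right)
            (intro order_trans[OF norm_sum] sum_mono, simp add: mult_right_mono)
        also have "\<dots> = M * (\<Sum>i<p (Suc n). norm (blinfun_apply L (y n' i)))" by (simp add: sum_distrib_left)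
        also have "(\<Sum>i<p (Suc n). norm (blinfun_apply L (y n' i))) = (\<Sum>i<p n'. norm (blinfun_apply L (y n' i)))"
          using p_Suc[of n] that by (intro sum.mono_neutral_right) (auto simp: y0)
        also have "M * (\<Sum>i<p n'. norm (blinfun_apply L (y n' i))) \<le> M * (1/2)^n'"
          using outer[of L k n'] L that M by (intro mult_left_mono) auto
        finally show ?thesis .
      qed
      have "norm (blinfun_apply L (D n)) \<le> M * (1/2)^Suc n + M * (1/2)^n"
        using *[of n] *[of "Suc n"] norm_triangle_ineq4[of "blinfun_apply L (\<Sum>i<p (Suc n). a n i *\<^sub>R y (Suc n) i)"
            "blinfun_apply L (\<Sum>i<p (Suc n). a n i *\<^sub>R y n i)"] unfolding D_eq by (simp add: blinfun.diff_right)
      also have "\<dots> \<le> (3 * M) * (1/2)^n" using M by simp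
      also have "\<dots> \<le> B * (1/2)^n" using M_le by (rule mult_right_mono) simp
      finally show "norm (blinfun_apply L (D n)) \<le> B * (1/2)^n" .
    qed
    then show ?thesis unfolding D_def C3_def B_def by (simp only: mult.assoc)
  qed
  define uu where "uu n i z = (if i < p (Suc n) then gg i (z - Q (n - 1) z) else 0)" for n i z
  have uu_lin: "linear (uu n i)" for n i
    by (rule linearI) (simp_all add: uu_def linear_add[OF Q_lin] linear_cmul[OF Q_lin] blinfun.add_right
        blinfun.diff_right blinfun.scaleR_right right_diff_distrib)
  have uu_le: "\<bar>uu n i z\<bar> \<le> N (z - Q (n - 1) z)" if "z \<in> Z" for n i z
    using g_le[OF Z_diff[OF that QZ]] N_ge0[OF Z_diff[OF that QZ]] by (simp add: uu_def)
  have row: "(\<Sum>i<p (Suc n). uu n i z *\<^sub>R vv n i) = Q (Suc n) z - Q n z" for n z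
  proof -
    define w where "w = z - Q (n - 1) z"
    have "(\<Sum>i<p (Suc n). uu n i z *\<^sub>R vv n i) = (\<Sum>i<p (Suc n). gg i w *\<^sub>R y (Suc n) i) - (\<Sum>i<p (Suc n). gg i w *\<^sub>R y n i)"
      by (simp add: uu_def vv_def w_def scaleR_diff_right sum_subtractf)
    also have "(\<Sum>i<p (Suc n). gg i w *\<^sub>R y n i) = Q n w"
      unfolding Q_def using p_Suc[of n] by (intro sum.mono_neutral_right) (auto simp: y0)
    also have "(\<Sum>i<p (Suc n). gg i w *\<^sub>R y (Suc n) i) = Q (Suc n) w" by (simp add: Q_def)
    finally have "(\<Sum>i<p (Suc n). uu n i z *\<^sub>R vv n i) = Q (Suc n) w - Q n w" .
    also have "\<dots> = Q (Suc n) z - Q n z" unfolding w_def linear_diff[OF Q_lin] Q_prev by simp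
    finally show ?thesis .
  qed
  have total: "(\<Sum>n<r. \<Sum>i<p (Suc n). uu n i z *\<^sub>R vv n i) = Q r z" for r z
    by (induction r) (simp_all add: row Q0)
  define v where "v k = vv (fst (prod_decode k)) (snd (prod_decode k))" for k
  define u where "u k = uu (fst (prod_decode k)) (snd (prod_decode k))" for k
  have vb: "N (\<Sum>k\<in>F. a k *\<^sub>R v k) \<le> C3 * M" if F: "finite F" "0 \<le> M" "\<And>k. k \<in> F \<Longrightarrow> \<bar>a k\<bar> \<le> M" for F a M
  proof -
    define F' where "F' = prod_decode ` F"
    obtain r where r: "fst ` F' \<subseteq> {..<r}" using F(1) finite_nat_iff_bounded unfolding F'_def by blast
    define a' where "a' n i = (if (n, i) \<in> F' then a (prod_encode (n, i)) else 0)" for n i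
    have "(\<Sum>k\<in>F. a k *\<^sub>R v k) = (\<Sum>(n, i)\<in>F'. a' n i *\<^sub>R vv n i)"
      unfolding F'_def by (subst sum.reindex) (auto simp: inj_on_def v_def a'_def F'_def split_beta intro!: sum.cong)
    also have "\<dots> = (\<Sum>(n, i)\<in>F' \<inter> Sigma {..<r} (\<lambda>n. {..<p (Suc n)}). a' n i *\<^sub>R vv n i)"
    proof (rule sum.mono_neutral_right)
      show "\<forall>k\<in>F' - F' \<inter> (SIGMA n:{..<r}. {..<p (Suc n)}). (case k of (n, i) \<Rightarrow> a' n i *\<^sub>R vv n i) = 0"
      proof
        fix k assume k: "k \<in> F' - F' \<inter> (SIGMA n:{..<r}. {..<p (Suc n)})"
        obtain n i where ni: "k = (n, i)" by (cases k)
        have "n < r" using k r by (force simp: ni)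
        then have "i \<ge> p (Suc n)" using k by (auto simp: ni)
        then show "(case k of (n, i) \<Rightarrow> a' n i *\<^sub>R vv n i) = 0" by (simp add: ni vv0)
      qed
    qed (use F(1) in \<open>auto simp: F'_def\<close>)
    also have "\<dots> = (\<Sum>(n, i)\<in>Sigma {..<r} (\<lambda>n. {..<p (Suc n)}). a' n i *\<^sub>R vv n i)"
      by (rule sum.mono_neutral_left) (auto simp: a'_def split: if_splits)
    also have "\<dots> = (\<Sum>n<r. \<Sum>i<p (Suc n). a' n i *\<^sub>R vv n i)" by (rule sum.Sigma[symmetric]) auto
    also have "N \<dots> \<le> C3 * M" using F by (intro block) (auto simp: a'_def F'_def)
    finally show ?thesis .
  qed
  \<comment> \<open>The enumeration of pairs does not follow the blocks. A finite set with small
    remainder and small coefficients outside it suffices: an initial segment containing it changes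
    the sum only by a combination with coefficients at most \<open>e\<close>.\<close>
  have u_null: "\<exists>F0. finite F0 \<and> (\<forall>k. k \<notin> F0 \<longrightarrow> \<bar>u k z\<bar> \<le> e) \<and> N (z - (\<Sum>k\<in>F0. u k z *\<^sub>R v k)) \<le> e"
    if z: "z \<in> Z" and e: "e > 0" for z e
  proof -
    obtain n0 where n0: "\<And>n. n \<ge> n0 \<Longrightarrow> N (z - Q n z) < e"
      using order_tendstoD(2)[OF Q_conv[OF z] e] by (auto simp: eventually_sequentially)
    define A where "A = (SIGMA n:{..<Suc n0}. {..<p (Suc n)})"
    have "(\<Sum>k\<in>prod_encode ` A. u k z *\<^sub>R v k) = (\<Sum>(n, i)\<in>A. uu n i z *\<^sub>R vv n i)"
      by (subst sum.reindex) (auto simp: u_def v_def split_beta inj_on_def intro!: sum.cong)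
    also have "\<dots> = (\<Sum>n<Suc n0. \<Sum>i<p (Suc n). uu n i z *\<^sub>R vv n i)"
      unfolding A_def by (rule sum.Sigma[symmetric]) auto
    finally have "(\<Sum>k\<in>prod_encode ` A. u k z *\<^sub>R v k) = Q (Suc n0) z" by (simp only: total)
    moreover have "\<bar>u k z\<bar> \<le> e" if k: "k \<notin> prod_encode ` A" for k
    proof -
      obtain n i where ni: "prod_decode k = (n, i)" by (cases "prod_decode k")
      have "k = prod_encode (n, i)" by (simp add: ni[symmetric])
      then have "(n, i) \<notin> A" using k by blast
      then consider "n \<ge> Suc n0" | "i \<ge> p (Suc n)" by (auto simp: A_def not_less)
      then show ?thesis
      proof cases
        case 1
        then have "N (z - Q (n - 1) z) < e" by (intro n0) simp
        then show ?thesis using uu_le[OF z, of n i] by (simp add: u_def ni)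
      next
        case 2 then show ?thesis using e by (simp add: u_def ni uu_def)
      qed
    qed
    ultimately show ?thesis
      using n0[of "Suc n0"] by (intro exI[of _ "prod_encode ` A"]) (auto simp: A_def)
  qed
  define C where "C = C3 + C2 + 1"
  have C: "0 \<le> C" "C3 \<le> C" "1 + C2 \<le> C" using C2 C3 by (auto simp: C_def)
  have "c0_frame Z N C u v"
    unfolding c0_frame_def
  proof (intro conjI allI ballI impI)
    show "v k \<in> Z" for k by (simp add: v_def vvZ)
    show "linear (u k)" for k by (simp add: u_def uu_lin)
  next
    fix k z assume z: "z \<in> Z"
    have "\<bar>u k z\<bar> \<le> N (z - Q (fst (prod_decode k) - 1) z)" unfolding u_def by (rule uu_le[OF z])
    also have "\<dots> \<le> N z + N (Q (fst (prod_decode k) - 1) z)" using z QZ by (rule N_diff)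
    also have "\<dots> \<le> (1 + C2) * N z" using Qb[OF z, of "fst (prod_decode k) - 1"] by (simp add: algebra_simps)
    also have "\<dots> \<le> C * N z" using C(3) N_ge0[OF z] by (rule mult_right_mono)
    finally show "\<bar>u k z\<bar> \<le> C * N z" .
  next
    fix z assume z: "z \<in> Z"
    show "(\<lambda>k. u k z) \<longlonglongrightarrow> 0"
      unfolding LIMSEQ_iff
    proof (intro allI impI)
      fix r :: real assume r: "r > 0"
      obtain F0 where F0: "finite F0" "\<forall>k. k \<notin> F0 \<longrightarrow> \<bar>u k z\<bar> \<le> r / 2" using u_null[OF z, of "r / 2"] r by auto
      obtain k0 where "F0 \<subseteq> {..<k0}" using F0(1) finite_nat_iff_bounded by blast
      then have "\<forall>k\<ge>k0. k \<notin> F0" by (auto simp: subset_iff)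
      then have "\<forall>k\<ge>k0. \<bar>u k z\<bar> \<le> r / 2" using F0(2) by blast
      then show "\<exists>no. \<forall>n\<ge>no. norm (u n z - 0) < r" using r by (intro exI[of _ k0]) force
    qed
    show "(\<lambda>n. N (z - (\<Sum>k<n. u k z *\<^sub>R v k))) \<longlonglongrightarrow> 0"
      unfolding LIMSEQ_iff
    proof (intro allI impI)
      fix r :: real assume r: "r > 0"
      define e where "e = r / (2 * (1 + C3))"
      have e: "e > 0" using r C3 by (simp add: e_def add_pos_nonneg)
      have e_tot: "e + C3 * e = r / 2"
      proof -
        have "e + C3 * e = e * (1 + C3)" by (simp add: algebra_simps)
        also have "\<dots> = r / 2" using C3 unfolding e_def by (simp add: field_simps)
        finally show ?thesis .
      qed
      obtain F0 where F0: "finite F0" "\<forall>k. k \<notin> F0 \<longrightarrow> \<bar>u k z\<bar> \<le> e" "N (z - (\<Sum>k\<in>F0. u k z *\<^sub>R v k)) \<le> e"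
        using u_null[OF z e] by auto
      obtain k0 where k0: "F0 \<subseteq> {..<k0}" using F0(1) finite_nat_iff_bounded by blast
      have vZ: "v k \<in> Z" for k by (simp add: v_def vvZ)
      have "N (z - (\<Sum>k<n. u k z *\<^sub>R v k)) < r" if n: "n \<ge> k0" for n
      proof -
        have "F0 \<subseteq> {..<n}" using k0 n by auto
        then have "(\<Sum>k<n. u k z *\<^sub>R v k) = (\<Sum>k\<in>{..<n} - F0. u k z *\<^sub>R v k) + (\<Sum>k\<in>F0. u k z *\<^sub>R v k)"
          by (rule sum.subset_diff) simp
        then have eq: "z - (\<Sum>k<n. u k z *\<^sub>R v k) = (z - (\<Sum>k\<in>F0. u k z *\<^sub>R v k)) - (\<Sum>k\<in>{..<n} - F0. u k z *\<^sub>R v k)"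
          by (simp add: algebra_simps)
        have "N (z - (\<Sum>k<n. u k z *\<^sub>R v k)) \<le> N (z - (\<Sum>k\<in>F0. u k z *\<^sub>R v k)) + N (\<Sum>k\<in>{..<n} - F0. u k z *\<^sub>R v k)"
          unfolding eq by (intro N_diff Z_diff Z_lincomb vZ z)
        also have "\<dots> \<le> e + C3 * e" using F0 e by (intro add_mono vb) auto
        finally show ?thesis using e_tot r by linarith
      qed
      moreover have "0 \<le> N (z - (\<Sum>k<n. u k z *\<^sub>R v k))" for n by (intro N_ge0 Z_diff Z_lincomb vZ z)
      ultimately show "\<exists>no. \<forall>n\<ge>no. norm (N (z - (\<Sum>k<n. u k z *\<^sub>R v k)) - 0) < r"
        by (intro exI[of _ k0]) simp
    qed
  next
    fix F :: "nat set" and a :: "nat \<Rightarrow> real" and M :: real assume F: "finite F" "0 \<le> M" "\<forall>k\<in>F. \<bar>a k\<bar> \<le> M"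
    have "N (\<Sum>k\<in>F. a k *\<^sub>R v k) \<le> C3 * M" using F by (intro vb) auto
    also have "\<dots> \<le> C * M" using C(2) F(2) by (rule mult_right_mono)
    finally show "N (\<Sum>k\<in>F. a k *\<^sub>R v k) \<le> C * M" .
  qed
  then show ?thesis using C(1) by blast
qed

end

section \<open>Complemented copies of the space of null sequences\<close>

text \<open>Forward substitution for a lower triangular system with matrix \<open>G\<close> and
  right-hand side \<open>h\<close>. Summing over a list exposes to the termination argument that the
  recursive calls have smaller indices.\<close>

fun triangular_solve :: "(nat \<Rightarrow> nat \<Rightarrow> real) \<Rightarrow> (nat \<Rightarrow> real) \<Rightarrow> nat \<Rightarrow> real" where
  "triangular_solve G h m = (h m - (\<Sum>n\<leftarrow>[0..<m]. G m n * triangular_solve G h n)) / G m m"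

declare triangular_solve.simps [simp del]

lemma triangular_solve_eq:
  "triangular_solve G h m = (h m - (\<Sum>n<m. G m n * triangular_solve G h n)) / G m m"
  by (subst triangular_solve.simps) (simp add: interv_sum_list_conv_sum_set_nat atLeast0LessThan)

lemma triangular_solve_add:
  "triangular_solve G (\<lambda>m. h m + h' m) m = triangular_solve G h m + triangular_solve G h' m"
proof (induction m rule: less_induct)
  case (less m)
  have "(\<Sum>n<m. G m n * triangular_solve G (\<lambda>m. h m + h' m) n) =
    (\<Sum>n<m. G m n * triangular_solve G h n) + (\<Sum>n<m. G m n * triangular_solve G h' n)"
    by (simp add: less distrib_left sum.distrib)
  then show ?case
    by (subst (1 2 3) triangular_solve_eq) (simp add: add_divide_distrib[symmetric])
qed

lemma triangular_solve_scale:
  "triangular_solve G (\<lambda>m. c * h m) m = c * triangular_solve G h m"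
proof (induction m rule: less_induct)
  case (less m)
  have "(\<Sum>n<m. G m n * triangular_solve G (\<lambda>m. c * h m) n) = c * (\<Sum>n<m. G m n * triangular_solve G h n)"
    by (simp add: less sum_distrib_left mult_ac)
  then show ?case
    by (subst (1 2) triangular_solve_eq) (simp add: right_diff_distrib)
qed

text \<open>The right-hand side is the \<open>l\<close>-th column of the matrix, so the
  \<open>l\<close>-th unit vector solves the system; this becomes biorthogonality.\<close>

lemma triangular_solve_column:
  assumes "\<And>m. m < l \<Longrightarrow> G m l = 0" "\<And>m. G m m \<noteq> 0"
  shows "triangular_solve G (\<lambda>m. G m l) m = (if m = l then 1 else 0)"
proof (induction m rule: less_induct)
  case (less m)
  have "(\<Sum>n<m. G m n * triangular_solve G (\<lambda>m. G m l) n) = (\<Sum>n<m. if n = l then G m l else 0)"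
    using less by (intro sum.cong) auto
  also have "\<dots> = (if l < m then G m l else 0)" by simp
  finally show ?case
    using assms by (subst triangular_solve_eq) auto
qed

text \<open>The bound reproduces itself: \<open>b + 1/8 * (8 * b)\<close> is \<open>2 * b\<close>,
  and division by a diagonal entry of modulus at least 1/4 gives \<open>8 * b\<close>.\<close>

lemma triangular_solve_bound:
  assumes h: "\<And>m. \<bar>h m\<bar> \<le> b" and diag: "\<And>m. 1/4 \<le> \<bar>G m m\<bar>" and low: "\<And>m. (\<Sum>n<m. \<bar>G m n\<bar>) \<le> 1/8"
  shows "\<bar>triangular_solve G h m\<bar> \<le> 8 * b"
proof (induction m rule: less_induct)
  case (less m)
  have b: "0 \<le> b" using h[of 0] by linarith
  have "\<bar>\<Sum>n<m. G m n * triangular_solve G h n\<bar> \<le> (\<Sum>n<m. \<bar>G m n\<bar> * (8 * b))"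
    using less by (intro order_trans[OF sum_abs] sum_mono) (simp add: abs_mult mult_left_mono)
  also have "\<dots> = (\<Sum>n<m. \<bar>G m n\<bar>) * (8 * b)" by (simp add: sum_distrib_right)
  also have "\<dots> \<le> 1/8 * (8 * b)" using low b by (intro mult_right_mono) auto
  finally have "\<bar>h m - (\<Sum>n<m. G m n * triangular_solve G h n)\<bar> \<le> 2 * b" using h[of m] by linarith
  moreover have "2 * b \<le> 8 * b * \<bar>G m m\<bar>" using mult_left_mono[OF diag[of m], of "8 * b"] b by simp
  ultimately have "\<bar>h m - (\<Sum>n<m. G m n * triangular_solve G h n)\<bar> \<le> 8 * b * \<bar>G m m\<bar>" by linarith
  then show ?case
    using diag[of m] by (subst triangular_solve_eq) (simp add: abs_divide divide_le_eq)
qed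

text \<open>The solution is bounded, so in the row sums the first \<open>k\<close> columns
  contribute a null sequence and the remaining ones a geometric tail, uniformly in the row.\<close>

lemma triangular_solve_null:
  assumes h: "h \<longlonglongrightarrow> 0" "\<And>m. \<bar>h m\<bar> \<le> b" and diag: "\<And>m. 1/4 \<le> \<bar>G m m\<bar>"
    and low: "\<And>m n. n < m \<Longrightarrow> \<bar>G m n\<bar> \<le> 1/16 * (1/2)^n" and col: "\<And>n. (\<lambda>m. G m n) \<longlonglongrightarrow> 0"
  shows "triangular_solve G h \<longlonglongrightarrow> 0"
proof -
  have b: "0 \<le> b" using h(2)[of 0] by linarith
  have low_sum: "(\<Sum>n<m. \<bar>G m n\<bar>) \<le> 1/8" for m
  proof -
    have "(\<Sum>n<m. \<bar>G m n\<bar>) \<le> (\<Sum>n<m. 1/16 * (1/2)^n)" using low by (intro sum_mono) auto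
    also have "\<dots> = 1/16 * (\<Sum>n<m. (1/2)^n)" by (simp only: sum_distrib_left)
    also have "\<dots> \<le> 1/16 * 2" by (intro mult_left_mono) (subst sum_gp_strict, auto)
    finally show ?thesis by simp
  qed
  define s where "s = triangular_solve G h"
  have s: "\<bar>s m\<bar> \<le> 8 * b" for m unfolding s_def by (rule triangular_solve_bound[OF h(2) diag low_sum])
  have "(\<lambda>m. \<Sum>n<m. G m n * s n) \<longlonglongrightarrow> 0"
    unfolding LIMSEQ_iff
  proof (intro allI impI)
    fix r :: real assume r: "r > 0"
    have "(\<lambda>k. b * (1/2)^k) \<longlonglongrightarrow> b * 0" by (intro tendsto_mult tendsto_const LIMSEQ_power_zero) auto
    then have "\<forall>\<^sub>F k in sequentially. b * (1/2)^k < r / 2" using r by (intro order_tendstoD) auto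
    then obtain k where k: "b * (1/2)^k < r / 2" by (auto simp: eventually_sequentially)
    have "(\<lambda>m. \<Sum>n<k. \<bar>G m n * s n\<bar>) \<longlonglongrightarrow> (\<Sum>n<k. \<bar>0 * s n\<bar>)" by (intro tendsto_sum tendsto_rabs tendsto_mult tendsto_const col)
    then have "\<forall>\<^sub>F m in sequentially. (\<Sum>n<k. \<bar>G m n * s n\<bar>) < r / 2" using r by (intro order_tendstoD) auto
    then obtain m0 where m0: "\<And>m. m \<ge> m0 \<Longrightarrow> (\<Sum>n<k. \<bar>G m n * s n\<bar>) < r / 2" by (auto simp: eventually_sequentially)
    have "\<bar>\<Sum>n<m. G m n * s n\<bar> < r" if m: "m \<ge> max m0 k" for m
    proof -
      have "(\<Sum>n<m. \<bar>G m n * s n\<bar>) = (\<Sum>n<k. \<bar>G m n * s n\<bar>) + (\<Sum>n=k..<m. \<bar>G m n * s n\<bar>)"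
        unfolding lessThan_atLeast0 using m by (intro sum.atLeastLessThan_concat[symmetric]) auto
      moreover have "(\<Sum>n=k..<m. \<bar>G m n * s n\<bar>) \<le> (\<Sum>n=k..<m. b / 2 * (1/2)^n)"
      proof (rule sum_mono)
        fix n assume "n \<in> {k..<m}"
        then have "\<bar>G m n\<bar> * \<bar>s n\<bar> \<le> (1/16 * (1/2)^n) * (8 * b)" using s[of n] by (intro mult_mono low) auto
        then show "\<bar>G m n * s n\<bar> \<le> b / 2 * (1/2)^n" by (simp add: abs_mult mult_ac)
      qed
      moreover have "(\<Sum>n=k..<m. b / 2 * (1/2)^n) \<le> b * (1/2)^k"
      proof -
        have "(\<Sum>n=k..<m. b / 2 * (1/2)^n) = b / 2 * (\<Sum>n=k..<m. (1/2)^n)" by (simp only: sum_distrib_left)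
        also have "(\<Sum>n=k..<m. (1/2::real)^n) = (\<Sum>n<m - k. (1/2)^k * (1/2)^n)"
          using m sum.shift_bounds_nat_ivl[of "\<lambda>n. (1/2::real)^n" 0 k "m - k"]
          by (simp add: lessThan_atLeast0 power_add mult.commute)
        also have "\<dots> = (1/2)^k * (\<Sum>n<m - k. (1/2)^n)" by (simp only: sum_distrib_left)
        also have "b / 2 * ((1/2)^k * (\<Sum>n<m - k. (1/2)^n)) \<le> b / 2 * ((1/2)^k * 2)"
          using b by (intro mult_left_mono) (subst sum_gp_strict, auto)
        finally show ?thesis by simp
      qed
      ultimately have "(\<Sum>n<m. \<bar>G m n * s n\<bar>) < r" using m0[of m] m k by simp
      with sum_abs show ?thesis by (rule le_less_trans)
    qed
    then show "\<exists>no. \<forall>n\<ge>no. norm ((\<Sum>i<n. G n i * s i) - 0) < r" by (intro exI[of _ "max m0 k"]) simp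
  qed
  then have lim: "(\<lambda>m. h m - (\<Sum>n<m. G m n * s n)) \<longlonglongrightarrow> 0" using tendsto_diff[OF h(1)] by force
  have lim4: "(\<lambda>m. 4 * \<bar>h m - (\<Sum>n<m. G m n * s n)\<bar>) \<longlonglongrightarrow> 0"
    using tendsto_mult_left[OF tendsto_rabs_zero[OF lim], of 4] by simp
  have "\<bar>s m\<bar> \<le> 4 * \<bar>h m - (\<Sum>n<m. G m n * s n)\<bar>" for m
  proof -
    define e where "e = h m - (\<Sum>n<m. G m n * s n)"
    have "s m = e / G m m" unfolding s_def e_def by (rule triangular_solve_eq)
    moreover have "\<bar>e\<bar> \<le> 4 * \<bar>e\<bar> * \<bar>G m m\<bar>" using mult_left_mono[OF diag[of m], of "4 * \<bar>e\<bar>"] by simp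
    ultimately show ?thesis using diag[of m] by (simp add: abs_divide divide_le_eq e_def)
  qed
  then have "(\<lambda>m. \<bar>s m\<bar>) \<longlonglongrightarrow> 0" by (intro tendsto_sandwich[OF _ _ tendsto_const lim4]) auto
  then show ?thesis unfolding s_def by (rule tendsto_rabs_zero_cancel)
qed

section \<open>A complemented copy of c_0 inside Z\<close>

context oO_coords
begin

text \<open>Otherwise the first \<open>p\<close> coordinates would be injective on \<open>Z\<close>
  and map it into the span of \<open>p\<close> unit vectors. This is where infinite dimension
  enters.\<close>

lemma common_kernel:
  assumes inf: "\<not> finite_dimensional Z"
  shows "\<exists>w\<in>Z. N w = 1 \<and> (\<forall>j<p. gg j w = 0)"
proof (rule ccontr)
  assume neg: "\<not> ?thesis"
  have ker: "w = 0" if w: "w \<in> Z" "\<And>j. j < p \<Longrightarrow> gg j w = 0" for w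
  proof (rule ccontr)
    assume "w \<noteq> 0"
    then have "N w > 0" using N_eq0[OF w(1)] N_ge0[OF w(1)] by linarith
    then have "(1 / N w) *\<^sub>R w \<in> Z" "N ((1 / N w) *\<^sub>R w) = 1" "\<forall>j<p. gg j ((1 / N w) *\<^sub>R w) = 0"
      using w by (auto simp: Z_scale N_scale blinfun.scaleR_right)
    with neg show False by blast
  qed
  define T where "T x = (\<Sum>j<p. gg j x *\<^sub>R unit_seq j)" for x
  have T: "linear T"
    by (rule linearI) (simp_all add: T_def blinfun.add_right blinfun.scaleR_right scaleR_left_distrib sum.distrib scaleR_sum_right)
  have ap: "apply_bcontfun (T x) i = (if i < p then gg i x else 0)" for x i
    by (simp add: T_def apply_unit_seq_sum)
  have inj: "inj_on T Z"
  proof (rule inj_onI)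
    fix x y assume xy: "x \<in> Z" "y \<in> Z" "T x = T y"
    have "gg j (x - y) = 0" if "j < p" for j
      using arg_cong[OF xy(3), of "\<lambda>s. apply_bcontfun s j"] that by (simp add: ap blinfun.diff_right)
    then have "x - y = 0" using xy by (intro ker Z_diff) auto
    then show "x = y" by simp
  qed
  obtain B where B: "B \<subseteq> Z" "independent B" "Z \<subseteq> span B" using maximal_independent_subset[of Z] by blast
  have span_B: "span B = Z" using B Z_subspace by (simp add: span_minimal subset_antisym)
  have "independent (T ` B)"
    using linear_independent_injective_image[OF T B(2)] inj by (simp add: span_B)
  moreover have "T ` B \<subseteq> span (unit_seq ` {..<p})" unfolding T_def by (intro image_subsetI span_sum span_scale span_base) auto
  ultimately have "finite (T ` B)" using independent_span_bound[of "unit_seq ` {..<p}" "T ` B"] by simp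
  then have "finite B" using finite_imageD inj_on_subset[OF inj B(1)] by blast
  then have "finite_dimensional Z" using span_B by (auto simp: finite_dimensional_def)
  with inf show False by blast
qed

text \<open>The \<open>w k\<close> are almost disjoint in the coordinates: zero before
  \<open>r k\<close>, negligible from \<open>r (Suc k)\<close> on. Sampling at coordinates
  \<open>j k\<close> where \<open>w k\<close> is large gives a lower triangular matrix with dominant
  diagonal, and forward substitution turns the samples into functionals biorthogonal to
  \<open>w\<close>.\<close>

theorem c0_copy:
  assumes inf: "\<not> finite_dimensional Z"
  obtains w :: "nat \<Rightarrow> 'a" and \<psi> :: "nat \<Rightarrow> 'a \<Rightarrow> real" where
    "\<And>k. w k \<in> Z" "lincomb_bounded w 3" "\<And>k. linear (\<psi> k)" "\<And>k z. z \<in> Z \<Longrightarrow> \<bar>\<psi> k z\<bar> \<le> 8 * N z"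
    "\<And>z. z \<in> Z \<Longrightarrow> (\<lambda>k. \<psi> k z) \<longlonglongrightarrow> 0" "\<And>k l. \<psi> k (w l) = (if k = l then 1 else 0)"
proof -
  have "\<exists>w j. w \<in> Z \<and> N w = 1 \<and> (\<forall>j<p. gg j w = 0) \<and> 1/4 \<le> \<bar>gg j w\<bar>" for p
  proof -
    obtain w where w: "w \<in> Z" "N w = 1" "\<forall>j<p. gg j w = 0" using common_kernel[OF inf] by blast
    \<comment> \<open>If all coordinates were below 1/4, norming with factor 2 would give
      \<open>N w \<le> 1/2\<close>.\<close>
    have "\<exists>j. 1/4 \<le> \<bar>gg j w\<bar>"
    proof (rule ccontr)
      assume "\<not> ?thesis"
      then have "\<bar>gg j w\<bar> \<le> 1/4" for j by (simp add: not_le less_imp_le)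
      then have "N w \<le> 2 * (1/4)" by (rule g_norming[OF w(1)])
      then show False using w(2) by simp
    qed
    then show ?thesis using w by blast
  qed
  then obtain W J where W: "\<And>p. W p \<in> Z" "\<And>p. N (W p) = 1" "\<And>p j. j < p \<Longrightarrow> gg j (W p) = 0"
    "\<And>p. 1/4 \<le> \<bar>gg (J p) (W p)\<bar>" by metis
  have J_ge: "J p \<ge> p" for p
  proof (rule ccontr)
    assume "\<not> p \<le> J p"
    then have "gg (J p) (W p) = 0" by (intro W(3)) simp
    then show False using W(4)[of p] by simp
  qed
  define R where "R l m n \<longleftrightarrow> J m < n \<and> (\<forall>j\<ge>n. \<bar>gg j (W m)\<bar> \<le> 1/16 * (1/2)^l)" for l m n
  have "\<forall>\<^sub>F n in sequentially. R l m n" for l m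
  proof -
    have "\<forall>\<^sub>F j in sequentially. \<bar>gg j (W m)\<bar> < 1/16 * (1/2)^l"
      using tendsto_rabs_zero[OF g_null[OF W(1)[of m]]] by (intro order_tendstoD) auto
    then obtain n0 where "\<And>j. j \<ge> n0 \<Longrightarrow> \<bar>gg j (W m)\<bar> < 1/16 * (1/2)^l" by (auto simp: eventually_sequentially)
    then have "R l m n" if "n \<ge> max n0 (Suc (J m))" for n
      unfolding R_def using that by (auto intro: less_imp_le)
    then show ?thesis unfolding eventually_sequentially by blast
  qed
  from fast_subsequence[of R, OF this] obtain r where r: "strict_mono r" "\<And>l i. l < i \<Longrightarrow> R l (r l) (r i)" by blast
  define w where "w i = W (r i)" for i
  define j where "j i = J (r i)" for i
  have w: "w i \<in> Z" "N (w i) = 1" "i' < r i \<Longrightarrow> gg i' (w i) = 0" "1/4 \<le> \<bar>gg (j i) (w i)\<bar>" for i i'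
    using W by (auto simp: w_def j_def)
  have j_ge: "j i \<ge> r i" for i using J_ge by (simp add: j_def)
  have jr: "j l < r i" if "l < i" for l i using r(2)[OF that] by (simp add: R_def j_def)
  have small: "\<bar>gg i' (w l)\<bar> \<le> 1/16 * (1/2)^l" if "l < i" "i' \<ge> r i" for l i i'
    using r(2)[OF that(1)] that(2) by (simp add: R_def w_def)
  define G where "G m n = gg (j m) (w n)" for m n
  have diag: "1/4 \<le> \<bar>G m m\<bar>" for m unfolding G_def by (rule w(4))
  have G0: "G m n = 0" if "m < n" for m n unfolding G_def by (rule w(3)[OF jr[OF that]])
  have low: "\<bar>G m n\<bar> \<le> 1/16 * (1/2)^n" if "n < m" for m n unfolding G_def by (rule small[OF that j_ge])
  have j_top: "filterlim j at_top sequentially"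
  proof (rule filterlim_at_top_mono[OF filterlim_ident], rule always_eventually, rule allI)
    show "i \<le> j i" for i using strict_mono_imp_increasing[OF r(1), of i] j_ge[of i] by linarith
  qed
  have col: "(\<lambda>m. G m n) \<longlonglongrightarrow> 0" for n
    unfolding G_def using filterlim_compose[OF g_null[OF w(1)] j_top] .
  have low_sum: "(\<Sum>n<m. \<bar>G m n\<bar>) \<le> 1/8" for m
  proof -
    have "(\<Sum>n<m. \<bar>G m n\<bar>) \<le> (\<Sum>n<m. 1/16 * (1/2)^n)" using low by (intro sum_mono) auto
    also have "\<dots> = 1/16 * (\<Sum>n<m. (1/2)^n)" by (simp only: sum_distrib_left)
    also have "\<dots> \<le> 1/16 * 2" by (intro mult_left_mono) (subst sum_gp_strict, auto)
    finally show ?thesis by simp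
  qed
  define \<psi> where "\<psi> m z = triangular_solve G (\<lambda>m. gg (j m) z) m" for m z
  show ?thesis
  proof (rule that[of w \<psi>])
    show "w k \<in> Z" for k by (rule w(1))
    show "linear (\<psi> k)" for k
      by (rule linearI) (simp_all add: \<psi>_def blinfun.add_right blinfun.scaleR_right triangular_solve_add triangular_solve_scale)
    show "\<bar>\<psi> k z\<bar> \<le> 8 * N z" if "z \<in> Z" for k z
      unfolding \<psi>_def by (rule triangular_solve_bound[OF g_le[OF that] diag low_sum])
    show "(\<lambda>k. \<psi> k z) \<longlonglongrightarrow> 0" if "z \<in> Z" for z
      unfolding \<psi>_def
      by (rule triangular_solve_null[OF filterlim_compose[OF g_null[OF that] j_top] g_le[OF that] diag low col])
    show "\<psi> k (w l) = (if k = l then 1 else 0)" for k l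
    proof -
      have "G m m \<noteq> 0" for m using diag[of m] by auto
      then show ?thesis unfolding \<psi>_def using triangular_solve_column[of l G k] G0 by (simp add: G_def)
    qed
    show "lincomb_bounded w 3"
      unfolding lincomb_bounded_def
    proof (intro allI impI)
      fix F and a :: "nat \<Rightarrow> real" and M assume F: "finite F" "0 \<le> M" "\<forall>l\<in>F. \<bar>a l\<bar> \<le> M"
      have "N (\<Sum>l\<in>F. a l *\<^sub>R w l) \<le> 2 * (9/8 * M)"
      proof (rule g_norming)
        show "(\<Sum>l\<in>F. a l *\<^sub>R w l) \<in> Z" by (intro Z_lincomb w(1))
        fix i
        \<comment> \<open>The \<open>w l\<close> whose own window contains the coordinate
          \<open>i\<close>; there is at most one. It contributes at most \<open>M\<close>, the
          geometric terms at most \<open>M / 8\<close> together, and norming doubles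
          \<open>9/8 * M\<close>.\<close>
        define A where "A = {l \<in> F. r l \<le> i \<and> i < r (Suc l)}"
        have "card A \<le> 1"
        proof -
          have "l = l'" if "l \<in> A" "l' \<in> A" for l l'
          proof (rule ccontr)
            assume "l \<noteq> l'"
            then consider "l < l'" | "l' < l" by linarith
            then show False
            proof cases
              case 1 then have "r (Suc l) \<le> r l'" using r(1) by (simp add: strict_mono_less_eq Suc_le_eq)
              then show False using that by (auto simp: A_def)
            next
              case 2 then have "r (Suc l') \<le> r l" using r(1) by (simp add: strict_mono_less_eq Suc_le_eq)
              then show False using that by (auto simp: A_def)
            qed
          qed
          then show ?thesis using F(1) by (simp add: card_le_Suc0_iff_eq A_def)
        qed
        have "\<bar>gg i (\<Sum>l\<in>F. a l *\<^sub>R w l)\<bar> \<le> (\<Sum>l\<in>F. \<bar>a l\<bar> * \<bar>gg i (w l)\<bar>)"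
          by (simp add: blinfun.sum_right blinfun.scaleR_right abs_mult[symmetric])
        also have "\<dots> \<le> (\<Sum>l\<in>F. M * (1/16 * (1/2)^l + (if l \<in> A then 1 else 0)))"
        proof (rule sum_mono)
          fix l assume l: "l \<in> F"
          have "\<bar>gg i (w l)\<bar> \<le> 1/16 * (1/2)^l + (if l \<in> A then 1 else 0)"
          proof -
            consider "i < r l" | "r (Suc l) \<le> i" | "l \<in> A" using l by (force simp: A_def)
            then show ?thesis
            proof cases
              case 1 then show ?thesis using w(3)[OF 1] by simp
            next
              case 2 then have "\<bar>gg i (w l)\<bar> \<le> 1/16 * (1/2)^l" by (intro small[of l "Suc l"]) auto
              then show ?thesis by simp
            next
              case 3 then show ?thesis using g_le[OF w(1), of i l] w(2)[of l] by (simp add: add_increasing)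
            qed
          qed
          then show "\<bar>a l\<bar> * \<bar>gg i (w l)\<bar> \<le> M * (1/16 * (1/2)^l + (if l \<in> A then 1 else 0))"
            using F l by (intro mult_mono) auto
        qed
        also have "\<dots> = M * ((\<Sum>l\<in>F. 1/16 * (1/2)^l) + (\<Sum>l\<in>F. if l \<in> A then 1 else 0))"
          by (simp only: sum_distrib_left[symmetric] sum.distrib)
        also have "(\<Sum>l\<in>F. if l \<in> A then 1 else 0 :: real) = real (card A)"
          using F(1) by (simp add: sum.If_cases A_def Int_def)
        also have "M * ((\<Sum>l\<in>F. 1/16 * (1/2)^l) + real (card A)) \<le> M * (1/8 + 1)"
        proof -
          obtain q where q: "F \<subseteq> {..<q}" using F(1) finite_nat_iff_bounded by blast
          have "(\<Sum>l\<in>F. 1/16 * (1/2::real)^l) \<le> (\<Sum>l<q. 1/16 * (1/2)^l)" using q by (intro sum_mono2) auto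
          also have "\<dots> = 1/16 * (\<Sum>l<q. (1/2)^l)" by (simp only: sum_distrib_left)
          also have "\<dots> \<le> 1/16 * 2" by (intro mult_left_mono) (subst sum_gp_strict, auto)
          finally show ?thesis using F(2) \<open>card A \<le> 1\<close> by (intro mult_left_mono add_mono) auto
        qed
        finally show "\<bar>gg i (\<Sum>l\<in>F. a l *\<^sub>R w l)\<bar> \<le> 9/8 * M" by simp
      qed
      also have "\<dots> \<le> 3 * M" using F(2) by simp
      finally show "N (\<Sum>l\<in>F. a l *\<^sub>R w l) \<le> 3 * M" .
    qed
  qed
qed

end

section \<open>Pelczynski's decomposition\<close>

definition row_seq :: "nat \<Rightarrow> (nat \<Rightarrow> real) \<Rightarrow> nat \<Rightarrow> real" where
  "row_seq n b i = b (prod_encode (n, i))"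

definition join_rows :: "(nat \<Rightarrow> nat \<Rightarrow> real) \<Rightarrow> nat \<Rightarrow> real" where
  "join_rows c k = c (fst (prod_decode k)) (snd (prod_decode k))"

lemma row_seq_join_rows [simp]: "row_seq n (join_rows c) = c n"
  by (simp add: row_seq_def join_rows_def fun_eq_iff)

lemma join_rows_row_seq [simp]: "join_rows (\<lambda>n. row_seq n b) = b"
  by (simp add: row_seq_def join_rows_def fun_eq_iff)

lemma row_seq_null:
  assumes "b \<longlonglongrightarrow> 0" shows "row_seq n b \<longlonglongrightarrow> 0"
proof -
  have "filterlim (\<lambda>i. prod_encode (n, i)) at_top sequentially"
    by (rule filterlim_at_top_mono[OF filterlim_ident]) (simp add: le_prod_encode_2)
  from filterlim_compose[OF assms this] show ?thesis by (simp add: row_seq_def[abs_def])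
qed

lemma row_seq_uniform:
  assumes "b \<longlonglongrightarrow> 0" "e > 0" shows "\<exists>n0. \<forall>n\<ge>n0. \<forall>i. \<bar>row_seq n b i\<bar> \<le> e"
proof -
  obtain k0 where k0: "\<And>k. k \<ge> k0 \<Longrightarrow> \<bar>b k\<bar> < e"
    using order_tendstoD(2)[OF tendsto_rabs_zero[OF assms(1)] assms(2)] by (auto simp: eventually_sequentially)
  have "\<bar>row_seq n b i\<bar> \<le> e" if "n \<ge> k0" for n i
    unfolding row_seq_def using k0[of "prod_encode (n, i)"] le_prod_encode_1[of n i] that by simp
  then show ?thesis by blast
qed

text \<open>Null rows alone are not enough: the rows must also tend to 0 uniformly, as membership in
  c_0(c_0) demands.\<close>

lemma join_rows_null:
  assumes c: "\<And>n. c n \<longlonglongrightarrow> 0" and unif: "\<And>e. e > 0 \<Longrightarrow> \<exists>n0. \<forall>n\<ge>n0. \<forall>i. \<bar>c n i\<bar> \<le> e"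
  shows "join_rows c \<longlonglongrightarrow> 0"
  unfolding LIMSEQ_iff
proof (intro allI impI)
  fix r :: real assume r: "r > 0"
  obtain n0 where n0: "\<And>n i. n \<ge> n0 \<Longrightarrow> \<bar>c n i\<bar> \<le> r / 2" using unif[of "r / 2"] r by auto
  have "\<exists>q. \<forall>i\<ge>q. \<bar>c n i\<bar> < r" for n
    using order_tendstoD(2)[OF tendsto_rabs_zero[OF c[of n]] r] by (auto simp: eventually_sequentially)
  then obtain q where q: "\<And>n i. i \<ge> q n \<Longrightarrow> \<bar>c n i\<bar> < r" by metis
  define A where "A = prod_encode ` (SIGMA n:{..<n0}. {..<q n})"
  have "finite A" by (simp add: A_def)
  then obtain k0 where k0: "A \<subseteq> {..<k0}" using finite_nat_iff_bounded by blast
  have "\<bar>join_rows c k\<bar> < r" if k: "k \<ge> k0" for k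
  proof -
    obtain n i where ni: "prod_decode k = (n, i)" by (cases "prod_decode k")
    have keq: "k = prod_encode (n, i)" by (simp add: ni[symmetric])
    have "k \<notin> A" using k k0 by auto
    then have "(n, i) \<notin> (SIGMA n:{..<n0}. {..<q n})" unfolding A_def keq by blast
    then consider "n \<ge> n0" | "i \<ge> q n" by (auto simp: not_less)
    then have "\<bar>c n i\<bar> < r"
    proof cases
      case 1 then show ?thesis using n0[OF 1, of i] r by linarith
    next
      case 2 then show ?thesis by (rule q)
    qed
    then show ?thesis by (simp add: join_rows_def ni)
  qed
  then show "\<exists>no. \<forall>n\<ge>no. norm (join_rows c n - 0) < r" by auto
qed

section \<open>Synthesis from null sequences and the decomposition method\<close>

locale oO_complete = oO_space +
  assumes complete: "(\<And>n. s n \<in> Z) \<Longrightarrow> (\<And>e. e > 0 \<Longrightarrow> \<exists>n0. \<forall>m\<ge>n0. \<forall>n\<ge>n0. N (s m - s n) \<le> e) \<Longrightarrow>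
    \<exists>z\<in>Z. (\<lambda>n. N (s n - z)) \<longlonglongrightarrow> 0"
begin

text \<open>The sum is taken in the norm of \<open>X\<close>. For null coefficients and
  \<open>lincomb_bounded\<close> vectors it also converges in \<open>N\<close>; for merely bounded
  coefficients only convergence in \<open>X\<close> will be shown, and the same map becomes the
  isomorphism from l^infinity.\<close>

definition syn :: "(nat \<Rightarrow> 'a) \<Rightarrow> (nat \<Rightarrow> real) \<Rightarrow> 'a" where
  "syn v a = (\<Sum>k. a k *\<^sub>R v k)"

lemma N_tendsto_imp_tendsto:
  assumes "\<And>n. s n \<in> Z" "z \<in> Z" "(\<lambda>n. N (s n - z)) \<longlonglongrightarrow> 0" shows "s \<longlonglongrightarrow> z"
proof -
  have lim: "(\<lambda>n. CX * N (s n - z)) \<longlonglongrightarrow> 0" using tendsto_mult_left[OF assms(3), of CX] by simp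
  have "\<forall>n. norm (s n - z) \<le> CX * N (s n - z)" by (intro allI CX(2) Z_diff assms)
  then have "(\<lambda>n. s n - z) \<longlonglongrightarrow> 0" by (rule Lim_null_comparison[OF always_eventually lim])
  then show ?thesis by (rule LIM_zero_cancel)
qed

context
  fixes v :: "nat \<Rightarrow> 'a" and C :: real
  assumes vZ: "\<And>k. v k \<in> Z" and vb: "lincomb_bounded v C" and C: "0 \<le> C"
begin

text \<open>Blocks far out have small coefficients, so the partial sums are Cauchy in
  \<open>N\<close>; the \<open>N\<close>-limit is the sum in \<open>X\<close> because
  \<open>CX * N\<close> dominates the norm of \<open>X\<close> on \<open>Z\<close>.\<close>

lemma syn_props:
  assumes a: "a \<longlonglongrightarrow> 0"
  shows "syn v a \<in> Z" "(\<lambda>n. N (syn v a - (\<Sum>k<n. a k *\<^sub>R v k))) \<longlonglongrightarrow> 0" "(\<lambda>k. a k *\<^sub>R v k) sums syn v a"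
proof -
  define s where "s n = (\<Sum>k<n. a k *\<^sub>R v k)" for n
  have sZ: "s n \<in> Z" for n unfolding s_def by (intro Z_lincomb vZ)
  have diff: "N (s m - s n) \<le> C * e" if "0 \<le> e" "\<And>k. k \<ge> n \<Longrightarrow> \<bar>a k\<bar> \<le> e" "n \<le> m" for m n e
  proof -
    have "s m = s n + (\<Sum>k=n..<m. a k *\<^sub>R v k)"
      unfolding s_def lessThan_atLeast0 using that(3) by (intro sum.atLeastLessThan_concat[symmetric]) auto
    then have "s m - s n = (\<Sum>k=n..<m. a k *\<^sub>R v k)" by simp
    moreover have "N (\<Sum>k=n..<m. a k *\<^sub>R v k) \<le> C * e" using that by (intro lincomb_boundedD[OF vb]) auto
    ultimately show ?thesis by simp
  qed
  have "\<exists>z\<in>Z. (\<lambda>n. N (s n - z)) \<longlonglongrightarrow> 0"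
  proof (rule complete[OF sZ])
    fix e :: real assume e: "e > 0"
    define e' where "e' = e / (C + 1)"
    have e': "e' > 0" using e C by (simp add: e'_def add_nonneg_pos)
    have Ce: "C * e' \<le> e" using e C by (simp add: e'_def field_simps)
    obtain n0 where n0: "\<And>k. k \<ge> n0 \<Longrightarrow> \<bar>a k\<bar> < e'"
      using order_tendstoD(2)[OF tendsto_rabs_zero[OF a] e'] by (auto simp: eventually_sequentially)
    have "N (s m - s n) \<le> e" if "m \<ge> n0" "n \<ge> n0" for m n
    proof (cases "n \<le> m")
      case True
      have "N (s m - s n) \<le> C * e'" using e' n0 that True by (intro diff) (auto intro: less_imp_le)
      then show ?thesis using Ce by simp
    next
      case False
      have "N (s n - s m) \<le> C * e'" using e' n0 that False by (intro diff) (auto intro: less_imp_le)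
      then show ?thesis using Ce N_diff_commute[OF sZ sZ, of m n] by simp
    qed
    then show "\<exists>n0. \<forall>m\<ge>n0. \<forall>n\<ge>n0. N (s m - s n) \<le> e" by blast
  qed
  then obtain z where z: "z \<in> Z" "(\<lambda>n. N (s n - z)) \<longlonglongrightarrow> 0" by blast
  have "s \<longlonglongrightarrow> z" by (rule N_tendsto_imp_tendsto[OF sZ z])
  then have sums: "(\<lambda>k. a k *\<^sub>R v k) sums z" by (simp add: sums_def s_def[abs_def])
  then have eq: "syn v a = z" by (simp add: syn_def sums_iff)
  show "syn v a \<in> Z" "(\<lambda>k. a k *\<^sub>R v k) sums syn v a" using z(1) sums by (simp_all add: eq)
  show "(\<lambda>n. N (syn v a - (\<Sum>k<n. a k *\<^sub>R v k))) \<longlonglongrightarrow> 0"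
    using z(2) N_diff_commute[OF sZ z(1)] by (simp add: eq s_def)
qed

lemma syn_bound:
  assumes a: "a \<longlonglongrightarrow> 0" and M: "\<And>k. \<bar>a k\<bar> \<le> M" shows "N (syn v a) \<le> C * M"
proof -
  have M0: "0 \<le> M" using M[of 0] by linarith
  have "N (syn v a) \<le> N (syn v a - (\<Sum>k<n. a k *\<^sub>R v k)) + C * M" for n
  proof -
    have "N ((syn v a - (\<Sum>k<n. a k *\<^sub>R v k)) + (\<Sum>k<n. a k *\<^sub>R v k)) \<le>
      N (syn v a - (\<Sum>k<n. a k *\<^sub>R v k)) + N (\<Sum>k<n. a k *\<^sub>R v k)"
      by (intro N_triangle Z_diff Z_lincomb vZ syn_props(1)[OF a])
    also have "N (\<Sum>k<n. a k *\<^sub>R v k) \<le> C * M" using M M0 by (intro lincomb_boundedD[OF vb]) auto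
    finally show ?thesis by simp
  qed
  moreover have "(\<lambda>n. N (syn v a - (\<Sum>k<n. a k *\<^sub>R v k)) + C * M) \<longlonglongrightarrow> 0 + C * M"
    by (intro tendsto_add tendsto_const syn_props(2)[OF a])
  ultimately show ?thesis by (intro LIMSEQ_le_const) auto
qed

lemma syn_add:
  assumes "a \<longlonglongrightarrow> 0" "b \<longlonglongrightarrow> 0" shows "syn v (\<lambda>k. a k + b k) = syn v a + syn v b"
  using sums_add[OF syn_props(3)[OF assms(1)] syn_props(3)[OF assms(2)]] by (simp add: syn_def scaleR_add_left sums_iff)

lemma syn_diff:
  assumes "a \<longlonglongrightarrow> 0" "b \<longlonglongrightarrow> 0" shows "syn v (\<lambda>k. a k - b k) = syn v a - syn v b"
  using sums_diff[OF syn_props(3)[OF assms(1)] syn_props(3)[OF assms(2)]] by (simp add: syn_def scaleR_diff_left sums_iff)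

lemma syn_scale:
  assumes "a \<longlonglongrightarrow> 0" shows "syn v (\<lambda>k. c * a k) = c *\<^sub>R syn v a"
  using sums_scaleR_right[OF syn_props(3)[OF assms], of c] by (simp add: syn_def sums_iff)

text \<open>\<open>\<phi>\<close> is continuous only for \<open>N\<close>, so convergence of the
  series in \<open>X\<close> would not be enough.\<close>

lemma functional_syn:
  fixes \<phi> :: "'a \<Rightarrow> real"
  assumes \<phi>: "linear \<phi>" "\<And>z. z \<in> Z \<Longrightarrow> \<bar>\<phi> z\<bar> \<le> D * N z" and a: "a \<longlonglongrightarrow> 0"
  shows "(\<lambda>k. a k * \<phi> (v k)) sums \<phi> (syn v a)"
proof -
  define s where "s n = (\<Sum>k<n. a k *\<^sub>R v k)" for n
  have lim: "(\<lambda>n. D * N (syn v a - s n)) \<longlonglongrightarrow> 0"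
    using tendsto_mult_left[OF syn_props(2)[OF a], of D] by (simp add: s_def)
  have "\<forall>n. norm (\<phi> (syn v a - s n)) \<le> D * N (syn v a - s n)"
    unfolding s_def real_norm_def by (intro allI \<phi>(2) Z_diff Z_lincomb vZ syn_props(1)[OF a])
  then have "(\<lambda>n. \<phi> (syn v a - s n)) \<longlonglongrightarrow> 0" by (rule Lim_null_comparison[OF always_eventually lim])
  then have "(\<lambda>n. \<phi> (syn v a) - \<phi> (s n)) \<longlonglongrightarrow> 0" by (simp add: linear_diff[OF \<phi>(1)])
  from tendsto_diff[OF tendsto_const[of "\<phi> (syn v a)"] this] have "(\<lambda>n. \<phi> (s n)) \<longlonglongrightarrow> \<phi> (syn v a)" by simp
  then show ?thesis by (simp add: sums_def s_def linear_sum[OF \<phi>(1)] linear_cmul[OF \<phi>(1)])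
qed

end

text \<open>
  Let \<open>V U = 1\<close> on \<open>Z\<close>, \<open>E = U V\<close>, and \<open>B A = 1\<close> on \<open>c\<^sub>0\<close>. Identify \<open>c\<^sub>0\<close> with \<open>c\<^sub>0(c\<^sub>0)\<close> and let \<open>b\<^sub>n\<close> be the
  rows of \<open>B z\<close>. The isomorphism sends \<open>z\<close> to the rows \<open>U z' + (1 - E) b\<^sub>1\<close>, \<open>E b\<^sub>1 + (1 - E) b\<^sub>2\<close>,
  \<open>E b\<^sub>2 + (1 - E) b\<^sub>3\<close>, ..., where \<open>z' = z - A B z + A b\<^sub>0\<close>.
\<close>

theorem Pelczynski_decomposition:
  assumes frame: "c0_frame Z N C u v" and C: "0 \<le> C"
    and w: "\<And>k. w k \<in> Z" "lincomb_bounded w D" and D: "0 \<le> D"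
    and \<psi>_lin: "\<And>k. linear (\<psi> k)" and \<psi>_le: "\<And>k z. z \<in> Z \<Longrightarrow> \<bar>\<psi> k z\<bar> \<le> D * N z"
    and \<psi>_null: "\<And>z. z \<in> Z \<Longrightarrow> (\<lambda>k. \<psi> k z) \<longlonglongrightarrow> 0"
    and \<psi>_w: "\<And>k l. \<psi> k (w l) = (if k = l then 1 else 0)"
  shows "\<exists>C' s t. 0 \<le> C' \<and> c0_frame Z N C' s t \<and> (\<forall>k l. s k (t l) = (if k = l then 1 else 0))"
proof -
  have fr: "\<forall>k. v k \<in> Z" "\<forall>k. linear (u k)" "\<forall>k. \<forall>z\<in>Z. \<bar>u k z\<bar> \<le> C * N z"
    "\<forall>z\<in>Z. (\<lambda>k. u k z) \<longlonglongrightarrow> 0" "lincomb_bounded v C"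
    "\<forall>z\<in>Z. (\<lambda>n. N (z - (\<Sum>k<n. u k z *\<^sub>R v k))) \<longlonglongrightarrow> 0"
    using frame unfolding c0_frame_def lincomb_bounded_def by - (elim conjE, assumption)+
  have v: "\<And>k. v k \<in> Z" "lincomb_bounded v C" and u_lin: "\<And>k. linear (u k)"
    and u_le: "\<And>k z. z \<in> Z \<Longrightarrow> \<bar>u k z\<bar> \<le> C * N z" and u_null: "\<And>z. z \<in> Z \<Longrightarrow> (\<lambda>k. u k z) \<longlonglongrightarrow> 0"
    and uv: "\<And>z. z \<in> Z \<Longrightarrow> (\<lambda>n. N (z - (\<Sum>k<n. u k z *\<^sub>R v k))) \<longlonglongrightarrow> 0"
    using fr by simp_all
  note V = syn_props[OF v C] syn_bound[OF v C] syn_add[OF v C] syn_diff[OF v C] syn_scale[OF v C]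
  note A = syn_props[OF w D] syn_bound[OF w D] syn_add[OF w D] syn_diff[OF w D] syn_scale[OF w D]
  have VU: "syn v (\<lambda>k. u k z) = z" if z: "z \<in> Z" for z
  proof -
    have "(\<lambda>n. N ((\<Sum>k<n. u k z *\<^sub>R v k) - z)) \<longlonglongrightarrow> 0"
      using uv[OF z] N_diff_commute[OF z Z_lincomb[of _ v]] v(1) by simp
    then have "(\<lambda>n. \<Sum>k<n. u k z *\<^sub>R v k) \<longlonglongrightarrow> z" using z v(1) by (intro N_tendsto_imp_tendsto Z_lincomb)
    then have "(\<lambda>k. u k z *\<^sub>R v k) sums z" by (simp add: sums_def)
    then show ?thesis by (simp add: syn_def sums_iff)
  qed
  have BA: "\<psi> k (syn w a) = a k" if a: "a \<longlonglongrightarrow> 0" for a k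
  proof -
    have "(\<lambda>j. a j * \<psi> k (w j)) sums \<psi> k (syn w a)" by (rule functional_syn[OF w D \<psi>_lin \<psi>_le a])
    moreover have "(\<lambda>j. a j * \<psi> k (w j)) = (\<lambda>j. if j = k then a k else 0)" by (auto simp: \<psi>_w)
    ultimately show ?thesis using sums_single[of k "\<lambda>_. a k"] by (metis (no_types, lifting) sums_unique2)
  qed
  define E where "E a k = u k (syn v a)" for a k
  have E_null: "E a \<longlonglongrightarrow> 0" if "a \<longlonglongrightarrow> 0" for a
    using u_null[OF V(1)[OF that]] by (simp add: E_def[abs_def])
  have E_bound: "\<bar>E a k\<bar> \<le> C * (C * M)" if "a \<longlonglongrightarrow> 0" "\<And>k. \<bar>a k\<bar> \<le> M" for a k M
    unfolding E_def using u_le[OF V(1)[OF that(1)]] mult_left_mono[OF V(4)[OF that] C] order_trans by blast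
  have E_add: "E (\<lambda>k. a k + b k) k = E a k + E b k" if "a \<longlonglongrightarrow> 0" "b \<longlonglongrightarrow> 0" for a b k
    by (simp add: E_def V(5)[OF that] linear_add[OF u_lin])
  have E_diff: "E (\<lambda>k. a k - b k) k = E a k - E b k" if "a \<longlonglongrightarrow> 0" "b \<longlonglongrightarrow> 0" for a b k
    by (simp add: E_def V(6)[OF that] linear_diff[OF u_lin])
  have E_scale: "E (\<lambda>k. c * a k) k = c * E a k" if "a \<longlonglongrightarrow> 0" for a c k
    by (simp add: E_def V(7)[OF that] linear_cmul[OF u_lin])
  have E_u: "E (\<lambda>k. u k z) = (\<lambda>k. u k z)" if "z \<in> Z" for z
    by (simp add: E_def fun_eq_iff VU[OF that])
  have E_idem: "E (E a) = E a" if "a \<longlonglongrightarrow> 0" for a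
    using E_u[OF V(1)[OF that]] by (simp add: E_def[abs_def])
  have VE: "syn v (E a) = syn v a" if "a \<longlonglongrightarrow> 0" for a
    using VU[OF V(1)[OF that]] by (simp add: E_def[abs_def])
  \<comment> \<open>\<open>Z\<close> is the direct sum of the kernel of \<open>B\<close> and of the
    copy of c_0, which holds all rows. \<open>zz z\<close> keeps the kernel part and row 0 alone. As
    row 0 is an arbitrary null sequence, it still ranges over all of \<open>Z\<close>, and rows 1,
    2, ... remain free for the shift.\<close>
  define zz where "zz z = z - syn w (\<lambda>k. \<psi> k z) + syn w (row_seq 0 (\<lambda>k. \<psi> k z))" for z
  define b where "b z n = row_seq n (\<lambda>k. \<psi> k z)" for z n
  \<comment> \<open>The range of \<open>E\<close> is a copy of \<open>Z\<close>, so each null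
    sequence splits into its parts under \<open>E\<close> and \<open>1 - E\<close>. Row
    \<open>n\<close> joins the \<open>E\<close>-part of \<open>b z n\<close> to the other part of
    \<open>b z (Suc n)\<close>; in row 0 the vacant \<open>E\<close>-part takes up
    \<open>zz z\<close>.\<close>
  define cc where "cc z n i = (case n of 0 \<Rightarrow> u i (zz z) | Suc m \<Rightarrow> E (b z n) i) + (b z (Suc n) i - E (b z (Suc n)) i)" for z n i
  have b_null: "b z n \<longlonglongrightarrow> 0" if "z \<in> Z" for z n unfolding b_def by (rule row_seq_null[OF \<psi>_null[OF that]])
  have b_le: "\<bar>b z n i\<bar> \<le> D * N z" if "z \<in> Z" for z n i unfolding b_def row_seq_def by (rule \<psi>_le[OF that])
  have zzZ: "zz z \<in> Z" if "z \<in> Z" for z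
    unfolding zz_def using \<psi>_null[OF that] by (intro Z_add Z_diff that A(1) row_seq_null)
  have zzN: "N (zz z) \<le> (1 + 2 * (D * D)) * N z" if z: "z \<in> Z" for z
  proof -
    have 1: "N (syn w (\<lambda>k. \<psi> k z)) \<le> D * (D * N z)" by (rule A(4)[OF \<psi>_null[OF z] \<psi>_le[OF z]])
    have 2: "N (syn w (b z 0)) \<le> D * (D * N z)" by (rule A(4)[OF b_null[OF z] b_le[OF z]])
    have "N (zz z) \<le> N (z - syn w (\<lambda>k. \<psi> k z)) + N (syn w (b z 0))"
      unfolding zz_def b_def[symmetric] using \<psi>_null[OF z] b_null[OF z] z by (intro N_triangle Z_diff A(1))
    also have "N (z - syn w (\<lambda>k. \<psi> k z)) \<le> N z + N (syn w (\<lambda>k. \<psi> k z))"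
      using \<psi>_null[OF z] z by (intro N_diff A(1))
    finally show ?thesis using 1 2 by (simp add: algebra_simps)
  qed
  have cc_null: "cc z n \<longlonglongrightarrow> 0" if z: "z \<in> Z" for z n
  proof -
    have "(\<lambda>i. (case n of 0 \<Rightarrow> u i (zz z) | Suc m \<Rightarrow> E (b z n) i)) \<longlonglongrightarrow> 0"
      using u_null[OF zzZ[OF z]] E_null[OF b_null[OF z]] by (cases n) auto
    from tendsto_add[OF this tendsto_diff[OF b_null[OF z] E_null[OF b_null[OF z]]]]
    show ?thesis by (simp add: cc_def[abs_def])
  qed
  define T where "T z = join_rows (cc z)" for z
  have T_null: "T z \<longlonglongrightarrow> 0" if z: "z \<in> Z" for z
    unfolding T_def
  proof (rule join_rows_null[OF cc_null[OF z]])
    fix e :: real assume e: "e > 0"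
    define e' where "e' = e / (1 + 2 * (C * C))"
    have pos: "1 + 2 * (C * C) > 0" using C by (simp add: add_pos_nonneg)
    have e': "e' > 0" using e pos by (simp add: e'_def)
    obtain n0 where n0: "\<And>n i. n \<ge> n0 \<Longrightarrow> \<bar>b z n i\<bar> \<le> e'"
      using row_seq_uniform[OF \<psi>_null[OF z] e'] unfolding b_def by blast
    have "\<bar>cc z n i\<bar> \<le> e" if n: "n \<ge> Suc n0" for n i
    proof -
      obtain m where m: "n = Suc m" using n by (cases n) auto
      have "\<bar>E (b z n) i\<bar> \<le> C * (C * e')" "\<bar>E (b z (Suc n)) i\<bar> \<le> C * (C * e')" "\<bar>b z (Suc n) i\<bar> \<le> e'"
        using n by (intro E_bound b_null z n0; simp)+
      then have "\<bar>cc z n i\<bar> \<le> C * (C * e') + (e' + C * (C * e'))" by (simp add: cc_def m)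
      also have "\<dots> = (1 + 2 * (C * C)) * e'" by (simp add: algebra_simps)
      also have "\<dots> = e" using pos by (simp add: e'_def)
      finally show ?thesis .
    qed
    then show "\<exists>n0. \<forall>n\<ge>n0. \<forall>i. \<bar>cc z n i\<bar> \<le> e" by blast
  qed
  define CT where "CT = C * (1 + 2 * (D * D)) + D + 2 * (C * (C * D))"
  have CT: "0 \<le> CT" using C D by (simp add: CT_def)
  have T_le: "\<bar>T z k\<bar> \<le> CT * N z" if z: "z \<in> Z" for z k
  proof -
    have "\<bar>cc z n i\<bar> \<le> CT * N z" for n i
    proof -
      have Eb: "\<bar>E (b z n') i\<bar> \<le> C * (C * (D * N z))" for n' by (rule E_bound[OF b_null[OF z] b_le[OF z]])
      have uz: "\<bar>u i (zz z)\<bar> \<le> C * ((1 + 2 * (D * D)) * N z)"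
        using u_le[OF zzZ[OF z]] mult_left_mono[OF zzN[OF z] C] order_trans by blast
      have nn: "0 \<le> C * ((1 + 2 * (D * D)) * N z)" "0 \<le> C * (C * (D * N z))" using C D N_ge0[OF z] by auto
      have "\<bar>cc z n i\<bar> \<le> C * ((1 + 2 * (D * D)) * N z) + C * (C * (D * N z)) + (D * N z + C * (C * (D * N z)))"
        using Eb[of n] Eb[of "Suc n"] uz b_le[OF z, of "Suc n" i] nn unfolding cc_def by (cases n) auto
      also have "\<dots> = CT * N z" by (simp add: CT_def algebra_simps)
      finally show ?thesis .
    qed
    then show ?thesis by (simp add: T_def join_rows_def)
  qed
  have b_lin: "b (x + y) n = (\<lambda>i. b x n i + b y n i)" "b (c *\<^sub>R x) n = (\<lambda>i. c * b x n i)" for x y n c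
    by (simp_all add: b_def row_seq_def fun_eq_iff linear_add[OF \<psi>_lin] linear_cmul[OF \<psi>_lin])
  have zz_b: "zz z = z - syn w (\<lambda>k. \<psi> k z) + syn w (b z 0)" for z by (simp add: zz_def b_def)
  have zz_add: "zz (x + y) = zz x + zz y" if "x \<in> Z" "y \<in> Z" for x y
    unfolding zz_b b_lin linear_add[OF \<psi>_lin]
    using A(5)[OF \<psi>_null[OF that(1)] \<psi>_null[OF that(2)]] A(5)[OF b_null[OF that(1)] b_null[OF that(2)]] by simp
  have zz_scale: "zz (c *\<^sub>R x) = c *\<^sub>R zz x" if "x \<in> Z" for x c
    unfolding zz_b b_lin linear_cmul[OF \<psi>_lin] real_scaleR_def
    using A(7)[OF \<psi>_null[OF that], of c] A(7)[OF b_null[OF that], of c] by (simp add: scaleR_diff_right scaleR_add_right)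
  have T_add: "T (x + y) k = T x k + T y k" if "x \<in> Z" "y \<in> Z" for x y k
    using that unfolding T_def join_rows_def cc_def b_lin
    by (simp add: E_add b_null zz_add linear_add[OF u_lin] split: nat.split)
  have T_scale: "T (c *\<^sub>R x) k = c * T x k" if "x \<in> Z" for x c k
    using that unfolding T_def join_rows_def cc_def b_lin
    by (simp add: E_scale b_null zz_scale linear_cmul[OF u_lin] algebra_simps split: nat.split)
  \<comment> \<open>Undoing the rows: \<open>V\<close> kills the part under \<open>1 - E\<close>, so
    row 0 returns \<open>zz z\<close> and, through \<open>\<psi>\<close>, the original row 0; every
    later row is assembled from two halves found in adjacent rows of \<open>c\<close>.\<close>
  define bf where "bf c n i = (case n of 0 \<Rightarrow> \<psi> i (syn v (row_seq 0 c)) |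
      Suc m \<Rightarrow> (row_seq m c i - E (row_seq m c) i) + E (row_seq n c) i)" for c n i
  define S where "S c = syn v (row_seq 0 c) - syn w (bf c 0) + syn w (join_rows (bf c))" for c
  have rn: "row_seq n c \<longlonglongrightarrow> 0" if "c \<longlonglongrightarrow> 0" for c n using that by (rule row_seq_null)
  have bf_null: "bf c n \<longlonglongrightarrow> 0" if c: "c \<longlonglongrightarrow> 0" for c n
  proof (cases n)
    case 0 then show ?thesis using \<psi>_null[OF V(1)[OF rn[OF c]]] by (simp add: bf_def[abs_def])
  next
    case (Suc m)
    show ?thesis
      using tendsto_add[OF tendsto_diff[OF rn[OF c, of m] E_null[OF rn[OF c, of m]]] E_null[OF rn[OF c, of n]]]
      by (simp add: bf_def[abs_def] Suc)
  qed
  have bfS_le: "\<bar>bf c (Suc m) i\<bar> \<le> (1 + 2 * (C * C)) * M"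
    if c: "c \<longlonglongrightarrow> 0" and M: "\<And>i. \<bar>row_seq m c i\<bar> \<le> M" "\<And>i. \<bar>row_seq (Suc m) c i\<bar> \<le> M" for c m i M
  proof -
    have "\<bar>E (row_seq m c) i\<bar> \<le> C * (C * M)" "\<bar>E (row_seq (Suc m) c) i\<bar> \<le> C * (C * M)"
      using E_bound[OF rn[OF c] M(1)] E_bound[OF rn[OF c] M(2)] by blast+
    then have "\<bar>bf c (Suc m) i\<bar> \<le> M + C * (C * M) + C * (C * M)" using M(1)[of i] by (simp add: bf_def)
    then show ?thesis by (simp add: algebra_simps)
  qed
  have jbf_null: "join_rows (bf c) \<longlonglongrightarrow> 0" if c: "c \<longlonglongrightarrow> 0" for c
  proof (rule join_rows_null[OF bf_null[OF c]])
    fix e :: real assume e: "e > 0"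
    define e' where "e' = e / (1 + 2 * (C * C))"
    have pos: "1 + 2 * (C * C) > 0" using C by (simp add: add_pos_nonneg)
    have e': "e' > 0" using e pos by (simp add: e'_def)
    obtain n0 where n0: "\<And>n i. n \<ge> n0 \<Longrightarrow> \<bar>row_seq n c i\<bar> \<le> e'" using row_seq_uniform[OF c e'] by blast
    have "\<bar>bf c n i\<bar> \<le> e" if n: "n \<ge> Suc n0" for n i
    proof -
      obtain m where m: "n = Suc m" "m \<ge> n0" using n by (cases n) auto
      have "\<bar>bf c n i\<bar> \<le> (1 + 2 * (C * C)) * e'" unfolding m(1) using m n0 c by (intro bfS_le) auto
      then show ?thesis using pos by (simp add: e'_def)
    qed
    then show "\<exists>n0. \<forall>n\<ge>n0. \<forall>i. \<bar>bf c n i\<bar> \<le> e" by blast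
  qed
  have SZ: "S c \<in> Z" if c: "c \<longlonglongrightarrow> 0" for c
    unfolding S_def by (intro Z_add Z_diff V(1) A(1) rn bf_null jbf_null c)
  define CS where "CS = C + D * (D * C) + D * (D * C + (1 + 2 * (C * C)))"
  have CS: "0 \<le> CS" using C D by (simp add: CS_def)
  have S_le: "N (S c) \<le> CS * M" if c: "c \<longlonglongrightarrow> 0" and M: "\<And>k. \<bar>c k\<bar> \<le> M" for c M
  proof -
    have M0: "0 \<le> M" using M[of 0] by linarith
    have r: "\<bar>row_seq n c i\<bar> \<le> M" for n i unfolding row_seq_def by (rule M)
    have 1: "N (syn v (row_seq 0 c)) \<le> C * M" by (rule V(4)[OF rn[OF c] r])
    have b0: "\<bar>bf c 0 i\<bar> \<le> D * (C * M)" for i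
      unfolding bf_def using order_trans[OF \<psi>_le[OF V(1)[OF rn[OF c]]] mult_left_mono[OF 1 D]] by simp
    have 2: "N (syn w (bf c 0)) \<le> D * (D * (C * M))" by (rule A(4)[OF bf_null[OF c] b0])
    have nn: "0 \<le> D * (C * M)" "0 \<le> (1 + 2 * (C * C)) * M" using C D M0 by auto
    have "\<bar>bf c n i\<bar> \<le> D * (C * M) + (1 + 2 * (C * C)) * M" for n i
      using b0[of i] bfS_le[OF c r r, of "n - 1" i] nn by (cases n) auto
    then have "\<bar>join_rows (bf c) k\<bar> \<le> D * (C * M) + (1 + 2 * (C * C)) * M" for k by (simp add: join_rows_def)
    then have 3: "N (syn w (join_rows (bf c))) \<le> D * (D * (C * M) + (1 + 2 * (C * C)) * M)"
      by (rule A(4)[OF jbf_null[OF c]])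
    have "N (S c) \<le> N (syn v (row_seq 0 c) - syn w (bf c 0)) + N (syn w (join_rows (bf c)))"
      unfolding S_def by (intro N_triangle Z_diff V(1) A(1) rn bf_null jbf_null c)
    also have "N (syn v (row_seq 0 c) - syn w (bf c 0)) \<le> N (syn v (row_seq 0 c)) + N (syn w (bf c 0))"
      by (intro N_diff V(1) A(1) rn bf_null c)
    finally have "N (S c) \<le> C * M + D * (D * (C * M)) + D * (D * (C * M) + (1 + 2 * (C * C)) * M)" using 1 2 3 by linarith
    also have "\<dots> = CS * M" by (simp add: CS_def algebra_simps)
    finally show ?thesis .
  qed
  have row_lin: "row_seq n (\<lambda>k. x k + y k) = (\<lambda>i. row_seq n x i + row_seq n y i)"
    "row_seq n (\<lambda>k. r * x k) = (\<lambda>i. r * row_seq n x i)" for n x y r by (simp_all add: row_seq_def fun_eq_iff)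
  have bf_add: "bf (\<lambda>k. x k + y k) n = (\<lambda>i. bf x n i + bf y n i)" if "x \<longlonglongrightarrow> 0" "y \<longlonglongrightarrow> 0" for x y n
    using that by (auto simp: bf_def fun_eq_iff row_lin E_add rn V(5) linear_add[OF \<psi>_lin] split: nat.split)
  have bf_scale: "bf (\<lambda>k. r * x k) n = (\<lambda>i. r * bf x n i)" if "x \<longlonglongrightarrow> 0" for x n r
    using that by (auto simp: bf_def fun_eq_iff row_lin E_scale rn V(7) linear_cmul[OF \<psi>_lin] algebra_simps split: nat.split)
  have S_add: "S (\<lambda>k. x k + y k) = S x + S y" if xy: "x \<longlonglongrightarrow> 0" "y \<longlonglongrightarrow> 0" for x y
  proof -
    have "join_rows (bf (\<lambda>k. x k + y k)) = (\<lambda>k. join_rows (bf x) k + join_rows (bf y) k)"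
      by (simp add: join_rows_def fun_eq_iff bf_add[OF xy])
    then show ?thesis
      unfolding S_def bf_add[OF xy] row_lin
      using V(5)[OF rn[OF xy(1)] rn[OF xy(2)]] A(5)[OF bf_null[OF xy(1)] bf_null[OF xy(2)]] A(5)[OF jbf_null[OF xy(1)] jbf_null[OF xy(2)]]
      by (simp add: algebra_simps)
  qed
  have S_scale: "S (\<lambda>k. r * x k) = r *\<^sub>R S x" if x: "x \<longlonglongrightarrow> 0" for x r
  proof -
    have "join_rows (bf (\<lambda>k. r * x k)) = (\<lambda>k. r * join_rows (bf x) k)"
      by (simp add: join_rows_def fun_eq_iff bf_scale[OF x])
    then show ?thesis
      unfolding S_def bf_scale[OF x] row_lin
      using V(7)[OF rn[OF x]] A(7)[OF bf_null[OF x]] A(7)[OF jbf_null[OF x]] by (simp add: algebra_simps)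
  qed
  have ST: "S (T z) = z" if z: "z \<in> Z" for z
  proof -
    have r: "row_seq n (T z) = cc z n" for n by (simp add: T_def)
    have bn: "b z n \<longlonglongrightarrow> 0" for n by (rule b_null[OF z])
    have En: "E (b z n) \<longlonglongrightarrow> 0" for n by (rule E_null[OF bn])
    have dn: "(\<lambda>i. b z n i - E (b z n) i) \<longlonglongrightarrow> 0" for n using tendsto_diff[OF bn En] by simp
    have Ed: "E (\<lambda>i. b z n i - E (b z n) i) k = 0" for n k by (simp add: E_diff[OF bn En] E_idem[OF bn])
    have cc0: "cc z 0 = (\<lambda>i. u i (zz z) + (b z (Suc 0) i - E (b z (Suc 0)) i))"
      and ccS: "cc z (Suc m) = (\<lambda>i. E (b z (Suc m)) i + (b z (Suc (Suc m)) i - E (b z (Suc (Suc m))) i))" for m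
      by (simp_all add: cc_def fun_eq_iff)
    have un: "(\<lambda>i. u i (zz z)) \<longlonglongrightarrow> 0" by (rule u_null[OF zzZ[OF z]])
    have zf: "syn v (cc z 0) = zz z"
      unfolding cc0 V(5)[OF un dn] V(6)[OF bn En] VE[OF bn] VU[OF zzZ[OF z]] by simp
    have E0: "E (cc z 0) k = u k (zz z)" for k
      unfolding cc0 E_add[OF un dn] Ed E_u[OF zzZ[OF z]] by simp
    have ES: "E (cc z (Suc m)) k = E (b z (Suc m)) k" for m k
      unfolding ccS E_add[OF En dn] Ed E_idem[OF bn] by simp
    have bf0: "bf (T z) 0 = b z 0"
    proof
      fix k
      have "bf (T z) 0 k = \<psi> k (zz z)" by (simp add: bf_def r zf)
      also have "\<dots> = \<psi> k z - \<psi> k (syn w (\<lambda>k. \<psi> k z)) + \<psi> k (syn w (b z 0))"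
        by (simp add: zz_def b_def linear_add[OF \<psi>_lin] linear_diff[OF \<psi>_lin])
      also have "\<dots> = b z 0 k" by (simp add: BA[OF \<psi>_null[OF z]] BA[OF bn])
      finally show "bf (T z) 0 k = b z 0 k" .
    qed
    have bfS: "bf (T z) (Suc n) = b z (Suc n)" for n
      by (rule ext, cases n) (simp_all add: bf_def r E0 ES, simp_all add: cc0 ccS)
    have "bf (T z) = b z"
    proof
      fix n show "bf (T z) n = b z n" by (cases n) (simp_all add: bf0 bfS)
    qed
    moreover have "join_rows (b z) = (\<lambda>k. \<psi> k z)" unfolding b_def[abs_def] by simp
    ultimately show ?thesis by (simp add: S_def r zf zz_def b_def)
  qed
  have TS: "T (S c) = c" if c: "c \<longlonglongrightarrow> 0" for c
  proof -
    define z where "z = S c"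
    have z: "z \<in> Z" unfolding z_def by (rule SZ[OF c])
    have \<psi>z: "(\<lambda>k. \<psi> k z) = join_rows (bf c)"
      by (rule ext) (simp add: z_def S_def linear_add[OF \<psi>_lin] linear_diff[OF \<psi>_lin] BA[OF bf_null[OF c]] BA[OF jbf_null[OF c]], simp add: bf_def)
    have bz: "b z n = bf c n" for n by (simp add: b_def \<psi>z)
    have zzz: "zz z = syn v (row_seq 0 c)" by (simp add: zz_def \<psi>z, simp add: z_def S_def)
    have r: "row_seq n c \<longlonglongrightarrow> 0" for n by (rule rn[OF c])
    have Er: "E (row_seq n c) \<longlonglongrightarrow> 0" for n by (rule E_null[OF r])
    have dn: "(\<lambda>i. row_seq n c i - E (row_seq n c) i) \<longlonglongrightarrow> 0" for n using tendsto_diff[OF r Er] by simp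
    have bfS: "bf c (Suc n) = (\<lambda>i. (row_seq n c i - E (row_seq n c) i) + E (row_seq (Suc n) c) i)" for n
      by (simp add: bf_def fun_eq_iff)
    have EbS: "E (bf c (Suc n)) k = E (row_seq (Suc n) c) k" for n k
      unfolding bfS E_add[OF dn Er] E_diff[OF r Er] E_idem[OF r] by simp
    have "cc z n i = row_seq n c i" for n i
    proof (cases n)
      case 0
      have "u i (zz z) = E (row_seq 0 c) i" by (simp add: zzz E_def)
      then show ?thesis by (simp add: cc_def 0 bz EbS, simp add: bfS)
    next
      case (Suc m)
      show ?thesis by (simp add: cc_def Suc bz EbS, simp add: bfS)
    qed
    then have "cc z = (\<lambda>n. row_seq n c)" by (simp add: fun_eq_iff)
    then show ?thesis by (simp add: T_def z_def[symmetric])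
  qed
  \<comment> \<open>\<open>T\<close> is linear on \<open>Z\<close> only; the projection makes the
    \<open>s k\<close> linear on the whole type, as \<open>c0_frame\<close> asks.\<close>
  obtain \<pi> :: "'a \<Rightarrow> 'a" where \<pi>: "linear \<pi>" "\<And>x. \<pi> x \<in> Z" "\<And>z. z \<in> Z \<Longrightarrow> \<pi> z = z"
    using Z_projection by metis
  define e where "e k i = (if i = k then 1 else 0 :: real)" for k i :: nat
  have fin_null: "(\<lambda>i. if i \<in> F then x i else 0 :: real) \<longlonglongrightarrow> 0" if "finite F" for F and x :: "nat \<Rightarrow> real"
  proof -
    obtain q where "F \<subseteq> {..<q}" using finite_nat_iff_bounded \<open>finite F\<close> by blast
    then have "\<forall>i\<ge>q. (if i \<in> F then x i else 0 :: real) = 0" by auto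
    then have "\<forall>\<^sub>F i in sequentially. (if i \<in> F then x i else 0 :: real) = 0" unfolding eventually_sequentially by blast
    then show ?thesis by (rule tendsto_eventually)
  qed
  have e_null: "e k \<longlonglongrightarrow> 0" for k using fin_null[of "{k}" "\<lambda>_. 1"] by (simp add: e_def[abs_def])
  define t where "t k = S (e k)" for k
  define s where "s k z = T (\<pi> z) k" for k z
  have tZ: "t k \<in> Z" for k unfolding t_def by (rule SZ[OF e_null])
  have S_fin: "S (\<lambda>i. if i \<in> F then x i else 0) = (\<Sum>k\<in>F. x k *\<^sub>R t k)" if "finite F" for F x
    using that
  proof (induction F)
    case empty
    have "S (\<lambda>i. 0 * e 0 i) = 0 *\<^sub>R S (e 0)" by (rule S_scale[OF e_null])
    then show ?case by simp
  next
    case (insert j F)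
    have "(\<lambda>i. if i \<in> insert j F then x i else 0) = (\<lambda>i. x j * e j i + (if i \<in> F then x i else 0))"
      using insert.hyps by (auto simp: e_def)
    moreover have "(\<lambda>i. x j * e j i) \<longlonglongrightarrow> 0" using tendsto_mult_left[OF e_null[of j], of "x j"] by simp
    ultimately have "S (\<lambda>i. if i \<in> insert j F then x i else 0) = S (\<lambda>i. x j * e j i) + S (\<lambda>i. if i \<in> F then x i else 0)"
      using fin_null[OF insert.hyps(1)] by (simp only: S_add)
    then show ?case using insert by (simp add: S_scale[OF e_null] t_def)
  qed
  have "c0_frame Z N (CT + CS) s t"
    unfolding c0_frame_def
  proof (intro conjI allI ballI impI)
    show "t k \<in> Z" for k by (rule tZ)
    show "linear (s k)" for k
      by (rule linearI) (simp_all add: s_def linear_add[OF \<pi>(1)] linear_cmul[OF \<pi>(1)] T_add T_scale \<pi>(2))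
    show "\<bar>s k z\<bar> \<le> (CT + CS) * N z" if z: "z \<in> Z" for k z
      using T_le[OF z, of k] mult_right_mono[of CT "CT + CS" "N z"] CS N_ge0[OF z] by (simp add: s_def \<pi>(3)[OF z])
    show "(\<lambda>k. s k z) \<longlonglongrightarrow> 0" if z: "z \<in> Z" for z using T_null[OF z] by (simp add: s_def \<pi>(3)[OF z])
    show "N (\<Sum>k\<in>F. a k *\<^sub>R t k) \<le> (CT + CS) * M" if F: "finite F" "0 \<le> M" "\<forall>k\<in>F. \<bar>a k\<bar> \<le> M" for F a M
    proof -
      have "N (S (\<lambda>i. if i \<in> F then a i else 0)) \<le> CS * M" using F by (intro S_le fin_null) auto
      also have "\<dots> \<le> (CT + CS) * M" using CT F(2) by (intro mult_right_mono) auto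
      finally show ?thesis by (simp add: S_fin[OF F(1)])
    qed
    show "(\<lambda>n. N (z - (\<Sum>k<n. s k z *\<^sub>R t k))) \<longlonglongrightarrow> 0" if z: "z \<in> Z" for z
      unfolding LIMSEQ_iff
    proof (intro allI impI)
      fix r :: real assume r: "r > 0"
      define e' where "e' = r / (2 * (CS + 1))"
      have e': "e' > 0" using r CS by (simp add: e'_def)
      have CSe: "CS * e' < r" using r CS unfolding e'_def by (simp add: field_simps add_nonneg_pos)
      obtain n0 where n0: "\<And>k. k \<ge> n0 \<Longrightarrow> \<bar>T z k\<bar> < e'"
        using order_tendstoD(2)[OF tendsto_rabs_zero[OF T_null[OF z]] e'] by (auto simp: eventually_sequentially)
      have "N (z - (\<Sum>k<n. s k z *\<^sub>R t k)) < r" if n: "n \<ge> n0" for n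
      proof -
        define x1 where "x1 i = (if i \<in> {..<n} then T z i else 0)" for i
        define x2 where "x2 i = T z i - x1 i" for i
        have x1: "x1 \<longlonglongrightarrow> 0" using fin_null[of "{..<n}" "T z"] by (simp add: x1_def[abs_def])
        have x2: "x2 \<longlonglongrightarrow> 0" using tendsto_diff[OF T_null[OF z] x1] by (simp add: x2_def[abs_def])
        have "T z = (\<lambda>i. x1 i + x2 i)" by (simp add: x2_def fun_eq_iff)
        then have "z = S x1 + S x2" using ST[OF z] S_add[OF x1 x2] by simp
        then have "z - S x1 = S x2" by (metis add_diff_cancel_left')
        moreover have "S x1 = (\<Sum>k<n. s k z *\<^sub>R t k)"
          using S_fin[of "{..<n}" "T z"] by (simp add: x1_def[abs_def] s_def \<pi>(3)[OF z])
        ultimately have "z - (\<Sum>k<n. s k z *\<^sub>R t k) = S x2" by simp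
        moreover have "N (S x2) \<le> CS * e'"
        proof (rule S_le[OF x2])
          show "\<bar>x2 k\<bar> \<le> e'" for k using n0[of k] n e' by (auto simp: x2_def x1_def)
        qed
        ultimately show ?thesis using CSe by simp
      qed
      moreover have "0 \<le> N (z - (\<Sum>k<n. s k z *\<^sub>R t k))" for n by (intro N_ge0 Z_diff Z_lincomb tZ z)
      ultimately show "\<exists>no. \<forall>n\<ge>no. norm (N (z - (\<Sum>k<n. s k z *\<^sub>R t k)) - 0) < r"
        by (intro exI[of _ n0]) simp
    qed
  qed
  moreover have "s k (t l) = (if k = l then 1 else 0)" for k l
    using TS[OF e_null[of l]] by (simp add: s_def \<pi>(3)[OF tZ]) (simp add: t_def e_def)
  ultimately show ?thesis using CT CS by (intro exI[of _ "CT + CS"] exI[of _ s] exI[of _ t]) auto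
qed

end

section \<open>The isomorphisms\<close>

text \<open>
  The locale \<open>Metric_space\<close> asks for nonnegativity and symmetry of the distance on the whole type, hence
  the hypotheses on \<open>N\<close> outside \<open>V\<close>.
\<close>

lemma Metric_space_norm:
  assumes "normed_space_on V N" "\<And>x. 0 \<le> N x" "\<And>x. N (- x) = N x"
  shows "Metric_space V (\<lambda>x y. N (x - y))"
proof
  have V: "subspace V" and zero: "\<And>x. x \<in> V \<Longrightarrow> N x = 0 \<longleftrightarrow> x = 0"
    and tri: "\<And>x y. x \<in> V \<Longrightarrow> y \<in> V \<Longrightarrow> N (x + y) \<le> N x + N y"
    using assms(1) by (auto simp: normed_space_on_def)
  show "0 \<le> N (x - y)" "N (x - y) = N (y - x)" for x y using assms(2) assms(3)[of "x - y"] by simp_all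
  show "N (x - y) = 0 \<longleftrightarrow> x = y" if "x \<in> V" "y \<in> V" for x y using zero[of "x - y"] subspace_diff[OF V that] by simp
  show "N (x - z) \<le> N (x - y) + N (y - z)" if "x \<in> V" "y \<in> V" "z \<in> V" for x y z
    using tri[of "x - y" "y - z"] subspace_diff[OF V] that by simp
qed

lemma normed_bounded_imp_continuous:
  assumes "Metric_space V (\<lambda>x y. N (x - y))" "Metric_space W (\<lambda>x y. N' (x - y))" "subspace V"
    and T: "\<And>x. x \<in> V \<Longrightarrow> T x \<in> W" "\<And>x y. x \<in> V \<Longrightarrow> y \<in> V \<Longrightarrow> T (x - y) = T x - T y"
    and le: "\<And>x. x \<in> V \<Longrightarrow> N' (T x) \<le> c * N x"
  shows "continuous_map (norm_topology V N) (norm_topology W N') T"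
  unfolding norm_topology_def Metric_space.metric_continuous_map[OF assms(1,2)]
proof (intro conjI ballI allI impI)
  show "T ` V \<subseteq> W" using T(1) by blast
  fix a and e :: real assume a: "a \<in> V" and e: "e > 0"
  define d where "d = e / (\<bar>c\<bar> + 1)"
  have "N' (T a - T x) < e" if x: "x \<in> V" "N (a - x) < d" for x
  proof -
    have nn: "0 \<le> N (a - x)" by (rule Metric_space.nonneg[OF assms(1)])
    have "N' (T a - T x) \<le> c * N (a - x)"
      using le[of "a - x"] T(2)[OF a x(1)] subspace_diff[OF assms(3) a x(1)] by simp
    also have "\<dots> \<le> (\<bar>c\<bar> + 1) * N (a - x)" using nn by (intro mult_right_mono) auto
    also have "\<dots> < (\<bar>c\<bar> + 1) * d" using x(2) by (intro mult_strict_left_mono) auto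
    also have "\<dots> = e" by (simp add: d_def add_nonneg_eq_0_iff)
    finally show ?thesis .
  qed
  moreover have "d > 0" using e by (simp add: d_def add_nonneg_pos)
  ultimately show "\<exists>d>0. \<forall>x. x \<in> V \<and> N (a - x) < d \<longrightarrow> N' (T a - T x) < e" by blast
qed

text \<open>The map goes from the sequence space \<open>W\<close> into \<open>V\<close>, as
  synthesis does; its inverse is the homeomorphism asked for.\<close>

lemma isomorphic_spacesI:
  fixes T :: "'w::real_vector \<Rightarrow> 'v::real_vector"
  assumes V: "Metric_space V (\<lambda>x y. N (x - y))" and W: "Metric_space W (\<lambda>x y. N' (x - y))"
    and sub: "subspace V" "subspace W" and bij: "bij_betw T W V"
    and add: "\<And>a b. a \<in> W \<Longrightarrow> b \<in> W \<Longrightarrow> T (a + b) = T a + T b"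
    and scale: "\<And>r a. a \<in> W \<Longrightarrow> T (r *\<^sub>R a) = r *\<^sub>R T a"
    and upper: "\<And>a. a \<in> W \<Longrightarrow> N (T a) \<le> c * N' a" and lower: "\<And>a. a \<in> W \<Longrightarrow> N' a \<le> d * N (T a)"
  shows "isomorphic_spaces V N W N'"
proof -
  define R where "R = inv_into W T"
  have TV: "T a \<in> V" if "a \<in> W" for a using bij that by (auto simp: bij_betw_def)
  have RW: "R x \<in> W" and TR: "T (R x) = x" if "x \<in> V" for x
    unfolding R_def using bij that by (auto simp: bij_betw_def inv_into_into f_inv_into_f)
  have RT: "R (T a) = a" if "a \<in> W" for a unfolding R_def using bij that by (auto simp: bij_betw_def)
  have T_diff: "T (a - b) = T a - T b" if "a \<in> W" "b \<in> W" for a b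
    using add[of a "(-1) *\<^sub>R b"] scale[of b "-1"] that subspace_neg[OF sub(2)] by simp
  have R_add: "R (x + y) = R x + R y" if "x \<in> V" "y \<in> V" for x y
    using RT[of "R x + R y"] add[OF RW RW, OF that] TR that subspace_add[OF sub(2)] RW by simp
  have R_scale: "R (r *\<^sub>R x) = r *\<^sub>R R x" if "x \<in> V" for r x
    using RT[of "r *\<^sub>R R x"] scale[OF RW[OF that], of r] TR[OF that] subspace_scale[OF sub(2) RW[OF that]] by simp
  have R_diff: "R (x - y) = R x - R y" if "x \<in> V" "y \<in> V" for x y
    using R_add[of x "(-1) *\<^sub>R y"] R_scale[of y "-1"] that subspace_neg[OF sub(1)] by simp
  have "homeomorphic_maps (norm_topology V N) (norm_topology W N') R T"
    unfolding homeomorphic_maps_def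
  proof (intro conjI)
    show "continuous_map (norm_topology V N) (norm_topology W N') R"
      using RW R_diff lower[OF RW] TR by (intro normed_bounded_imp_continuous[OF V W sub(1), where c = d]) auto
    show "continuous_map (norm_topology W N') (norm_topology V N) T"
      using TV T_diff upper by (intro normed_bounded_imp_continuous[OF W V sub(2), where c = c]) auto
  qed (simp_all add: norm_topology_def Metric_space.topspace_mtopology[OF V] Metric_space.topspace_mtopology[OF W] RT TR)
  then have "homeomorphic_map (norm_topology V N) (norm_topology W N') R" by (auto simp: homeomorphic_map_maps)
  then show ?thesis unfolding isomorphic_spaces_def linear_homeomorphism_def using R_add R_scale by blast
qed

lemma abs_bcontfun_le: "\<bar>apply_bcontfun a k\<bar> \<le> norm (a :: nat \<Rightarrow>\<^sub>C real)"
  using norm_bounded[of a k] by simp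

lemma subspace_c0: "subspace c0"
  unfolding subspace_def c0_def
  by (auto simp: zero_bcontfun.rep_eq[abs_def] plus_bcontfun.rep_eq[abs_def] scaleR_bcontfun.rep_eq[abs_def] fun_eq_iff
      intro: tendsto_add_zero tendsto_mult_right_zero)

lemma Metric_space_bcontfun: "Metric_space W (\<lambda>x y. norm (x - y :: nat \<Rightarrow>\<^sub>C real))"
proof
  show "norm (x - z) \<le> norm (x - y) + norm (y - z)" for x y z :: "nat \<Rightarrow>\<^sub>C real"
    using norm_triangle_ineq[of "x - y" "y - z"] by simp
qed (auto simp: norm_minus_commute)

context oO_complete
begin

context
  fixes C :: real and s :: "nat \<Rightarrow> 'a \<Rightarrow> real" and t :: "nat \<Rightarrow> 'a"
  assumes frame: "c0_frame Z N C s t" and C: "0 \<le> C" and biorth: "\<And>k l. s k (t l) = (if k = l then 1 else 0)"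
begin

lemma basis_props:
  "\<And>k. t k \<in> Z" "lincomb_bounded t C" "\<And>k. linear (s k)" "\<And>k z. z \<in> Z \<Longrightarrow> \<bar>s k z\<bar> \<le> C * N z"
  "\<And>z. z \<in> Z \<Longrightarrow> (\<lambda>k. s k z) \<longlonglongrightarrow> 0"
proof -
  have fr: "\<forall>k. t k \<in> Z" "\<forall>k. linear (s k)" "\<forall>k. \<forall>z\<in>Z. \<bar>s k z\<bar> \<le> C * N z"
    "\<forall>z\<in>Z. (\<lambda>k. s k z) \<longlonglongrightarrow> 0" "lincomb_bounded t C"
    using frame unfolding c0_frame_def lincomb_bounded_def by - (elim conjE, assumption)+
  show "\<And>k. t k \<in> Z" "lincomb_bounded t C" "\<And>k. linear (s k)" "\<And>k z. z \<in> Z \<Longrightarrow> \<bar>s k z\<bar> \<le> C * N z"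
    "\<And>z. z \<in> Z \<Longrightarrow> (\<lambda>k. s k z) \<longlonglongrightarrow> 0" using fr by simp_all
qed

lemmas syn_t = syn_props[OF basis_props(1,2) C] syn_bound[OF basis_props(1,2) C]
  syn_add[OF basis_props(1,2) C] syn_scale[OF basis_props(1,2) C]

lemma syn_coeffs: assumes z: "z \<in> Z" shows "syn t (\<lambda>k. s k z) = z"
proof -
  have "\<forall>z\<in>Z. (\<lambda>n. N (z - (\<Sum>k<n. s k z *\<^sub>R t k))) \<longlonglongrightarrow> 0"
    using frame unfolding c0_frame_def by (elim conjE)
  then have "(\<lambda>n. N (z - (\<Sum>k<n. s k z *\<^sub>R t k))) \<longlonglongrightarrow> 0" using z by blast
  then have "(\<lambda>n. N ((\<Sum>k<n. s k z *\<^sub>R t k) - z)) \<longlonglongrightarrow> 0"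
    using N_diff_commute[OF z Z_lincomb[of _ t]] basis_props(1) by simp
  then have "(\<lambda>n. \<Sum>k<n. s k z *\<^sub>R t k) \<longlonglongrightarrow> z" using z basis_props(1) by (intro N_tendsto_imp_tendsto Z_lincomb)
  then have "(\<lambda>k. s k z *\<^sub>R t k) sums z" by (simp add: sums_def)
  then show ?thesis by (simp add: syn_def sums_iff)
qed

lemma coeffs_syn: assumes a: "a \<longlonglongrightarrow> 0" shows "s k (syn t a) = a k"
proof -
  have "(\<lambda>j. a j * s k (t j)) sums s k (syn t a)"
    by (rule functional_syn[OF basis_props(1,2) C basis_props(3,4) a])
  moreover have "(\<lambda>j. a j * s k (t j)) = (\<lambda>j. if j = k then a k else 0)" by (auto simp: biorth)
  ultimately show ?thesis using sums_single[of k "\<lambda>_. a k"] by (metis (no_types, lifting) sums_unique2)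
qed

theorem isomorphic_c0:
  assumes N: "\<And>x. 0 \<le> N x" "\<And>x. N (- x) = N x"
  shows "isomorphic_spaces Z N c0 norm"
proof (rule isomorphic_spacesI[where T = "\<lambda>a. syn t (apply_bcontfun a)" and c = C and d = C])
  show "Metric_space Z (\<lambda>x y. N (x - y))" using normed N by (rule Metric_space_norm)
  show "Metric_space c0 (\<lambda>x y. norm (x - y))" by (rule Metric_space_bcontfun)
  show "subspace Z" by (rule Z_subspace)
  show "subspace c0" by (rule subspace_c0)
  show "syn t (apply_bcontfun (a + b)) = syn t (apply_bcontfun a) + syn t (apply_bcontfun b)" if "a \<in> c0" "b \<in> c0" for a b
    using syn_t(5)[of "apply_bcontfun a" "apply_bcontfun b"] that by (simp add: c0_def plus_bcontfun.rep_eq[abs_def])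
  show "syn t (apply_bcontfun (r *\<^sub>R a)) = r *\<^sub>R syn t (apply_bcontfun a)" if "a \<in> c0" for r a
    using syn_t(6)[of "apply_bcontfun a" r] that by (simp add: c0_def scaleR_bcontfun.rep_eq[abs_def])
  show "N (syn t (apply_bcontfun a)) \<le> C * norm a" if "a \<in> c0" for a
    using that abs_bcontfun_le by (intro syn_t(4)) (auto simp: c0_def)
  show "norm a \<le> C * N (syn t (apply_bcontfun a))" if "a \<in> c0" for a
  proof (rule norm_bound)
    have a: "apply_bcontfun a \<longlonglongrightarrow> 0" using that by (simp add: c0_def)
    show "norm (apply_bcontfun a k) \<le> C * N (syn t (apply_bcontfun a))" for k
      using basis_props(4)[OF syn_t(1)[OF a], of k] by (simp add: coeffs_syn[OF a])
  qed
  show "bij_betw (\<lambda>a. syn t (apply_bcontfun a)) c0 Z"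
    unfolding bij_betw_def
  proof
    show "inj_on (\<lambda>a. syn t (apply_bcontfun a)) c0"
    proof (rule inj_onI)
      fix a b assume ab: "a \<in> c0" "b \<in> c0" "syn t (apply_bcontfun a) = syn t (apply_bcontfun b)"
      then have "apply_bcontfun a k = apply_bcontfun b k" for k
        using coeffs_syn[of "apply_bcontfun a" k] coeffs_syn[of "apply_bcontfun b" k] by (simp add: c0_def)
      then show "a = b" by (intro bcontfun_eqI)
    qed
    show "(\<lambda>a. syn t (apply_bcontfun a)) ` c0 = Z"
    proof (intro equalityI subsetI)
      fix z assume "z \<in> (\<lambda>a. syn t (apply_bcontfun a)) ` c0"
      then show "z \<in> Z" using syn_t(1) by (auto simp: c0_def)
    next
      fix z assume z: "z \<in> Z"
      define a where "a = Bcontfun (\<lambda>k. s k z)"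
      have "bounded (range (\<lambda>k. s k z))" using basis_props(5)[OF z] by (metis convergent_def convergent_imp_bounded)
      then have a: "apply_bcontfun a = (\<lambda>k. s k z)" by (simp add: a_def apply_Bcontfun_nat)
      then have "a \<in> c0" "syn t (apply_bcontfun a) = z" using basis_props(5)[OF z] syn_coeffs[OF z] by (simp_all add: c0_def)
      then show "z \<in> (\<lambda>a. syn t (apply_bcontfun a)) ` c0" by force
    qed
  qed
qed

text \<open>With bounded coefficients the series need not converge in \<open>N\<close>, but the
  tails of a \<open>wuC\<close> series in the reflexive space \<open>X\<close> are uniformly small.
  The second part is uniform over all coefficient sequences, so that limits of coefficients pass
  through the sum.\<close>

lemma bounded_synthesis:
  assumes M: "\<And>k. \<bar>a k\<bar> \<le> M"
  shows "(\<lambda>k. a k *\<^sub>R t k) sums syn t a"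
    and "e > 0 \<Longrightarrow> \<exists>n0. \<forall>a M. (\<forall>k. \<bar>a k\<bar> \<le> M) \<longrightarrow> norm (syn t a - (\<Sum>k<n0. a k *\<^sub>R t k)) \<le> e * M"
proof -
  have wuC: "wuC t (CX * C)" by (rule lincomb_bounded_wuC[OF basis_props(1,2)])
  have tail: "\<exists>n0. \<forall>F a M. finite F \<longrightarrow> F \<subseteq> {n0..} \<longrightarrow> (\<forall>j\<in>F. \<bar>a j\<bar> \<le> M) \<longrightarrow> 0 \<le> M \<longrightarrow> norm (\<Sum>j\<in>F. a j *\<^sub>R t j) \<le> e * M"
    if "e > 0" for e by (rule wuC_reflexive_tail[OF X_sep X_refl wuC that])
  have sums: "(\<lambda>k. a k *\<^sub>R t k) sums syn t a" if M: "\<And>k. \<bar>a k\<bar> \<le> M" for a M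
  proof -
    have M0: "0 \<le> M" using M[of 0] by linarith
    have "summable (\<lambda>k. a k *\<^sub>R t k)"
      unfolding summable_Cauchy
    proof (intro allI impI)
      fix e :: real assume e: "e > 0"
      define e' where "e' = e / (2 * (M + 1))"
      have e': "e' > 0" using e M0 by (simp add: e'_def)
      have "e' * M < e" using e M0 by (simp add: e'_def field_simps add_nonneg_pos)
      moreover obtain n0 where n0: "\<forall>F a M. finite F \<longrightarrow> F \<subseteq> {n0..} \<longrightarrow> (\<forall>j\<in>F. \<bar>a j\<bar> \<le> M) \<longrightarrow> 0 \<le> M \<longrightarrow>
          norm (\<Sum>j\<in>F. a j *\<^sub>R t j) \<le> e' * M" using tail[OF e'] by (rule exE)
      have "norm (\<Sum>k=m..<n. a k *\<^sub>R t k) \<le> e' * M" if "m \<ge> n0" for m n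
        by (rule n0[rule_format]) (use that M M0 in auto)
      ultimately show "\<exists>n0. \<forall>m\<ge>n0. \<forall>n. norm (\<Sum>k=m..<n. a k *\<^sub>R t k) < e" by (meson le_less_trans)
    qed
    then show ?thesis by (simp add: syn_def summable_sums)
  qed
  show "(\<lambda>k. a k *\<^sub>R t k) sums syn t a" by (rule sums[OF M])
  show "\<exists>n0. \<forall>a M. (\<forall>k. \<bar>a k\<bar> \<le> M) \<longrightarrow> norm (syn t a - (\<Sum>k<n0. a k *\<^sub>R t k)) \<le> e * M" if e: "e > 0"
  proof -
    obtain n0 where n0: "\<forall>F a M. finite F \<longrightarrow> F \<subseteq> {n0..} \<longrightarrow> (\<forall>j\<in>F. \<bar>a j\<bar> \<le> M) \<longrightarrow> 0 \<le> M \<longrightarrow>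
        norm (\<Sum>j\<in>F. a j *\<^sub>R t j) \<le> e * M" using tail[OF e] by (rule exE)
    have "norm (syn t a - (\<Sum>k<n0. a k *\<^sub>R t k)) \<le> e * M" if a: "\<forall>k. \<bar>a k\<bar> \<le> M" for a M
    proof -
      have M0: "0 \<le> M" using spec[OF a, of 0] by linarith
      have "(\<lambda>n. \<Sum>k<n. a k *\<^sub>R t k) \<longlonglongrightarrow> syn t a" using sums[of a M] a by (simp add: sums_def)
      then have lim: "(\<lambda>n. norm ((\<Sum>k<n. a k *\<^sub>R t k) - (\<Sum>k<n0. a k *\<^sub>R t k))) \<longlonglongrightarrow> norm (syn t a - (\<Sum>k<n0. a k *\<^sub>R t k))"
        by (intro tendsto_norm tendsto_diff tendsto_const)
      have "norm ((\<Sum>k<n. a k *\<^sub>R t k) - (\<Sum>k<n0. a k *\<^sub>R t k)) \<le> e * M" if "n \<ge> n0" for n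
      proof -
        have "(\<Sum>k<n. a k *\<^sub>R t k) = (\<Sum>k<n0. a k *\<^sub>R t k) + (\<Sum>k=n0..<n. a k *\<^sub>R t k)"
          unfolding lessThan_atLeast0 using that by (intro sum.atLeastLessThan_concat[symmetric]) auto
        moreover have "norm (\<Sum>k=n0..<n. a k *\<^sub>R t k) \<le> e * M" by (rule n0[rule_format]) (use a M0 in auto)
        ultimately show ?thesis by simp
      qed
      then show ?thesis using lim by (intro LIMSEQ_le_const2) auto
    qed
    then show ?thesis by blast
  qed
qed

text \<open>Boundedness passes from partial sums to \<open>syn t a\<close> one operator at a time.
  Surjectivity takes the approximants of \<open>x\<close>, lets their coefficients converge along a
  subsequence, and identifies the resulting sum with \<open>x\<close> by the uniform tails.\<close>

theorem isomorphic_linf: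
  assumes N: "\<And>x. 0 \<le> N x" "\<And>x. N (- x) = N x" and M: "normed_space_on M N"
    and M_iff: "\<And>x. x \<in> M \<longleftrightarrow> (\<exists>b. \<forall>n. \<forall>L\<in>K n. norm (blinfun_apply L x) \<le> b)"
    and M_least: "\<And>x b. x \<in> M \<Longrightarrow> 0 \<le> b \<Longrightarrow> (\<And>n L. L \<in> K n \<Longrightarrow> norm (blinfun_apply L x) \<le> b) \<Longrightarrow> N x \<le> b"
    and approx: "\<And>x. x \<in> M \<Longrightarrow> \<exists>u. (\<forall>n. u n \<in> Z) \<and> (\<forall>n. N (u n) \<le> N x) \<and> weakly_converges u x"
  shows "isomorphic_spaces M N linf norm"
proof -
  have bound: "syn t a \<in> M \<and> N (syn t a) \<le> C * B" if a: "\<And>k. \<bar>a k\<bar> \<le> B" for a B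
  proof -
    have B: "0 \<le> B" using a[of 0] by linarith
    have Lle: "norm (blinfun_apply L (syn t a)) \<le> C * B" if L: "L \<in> K n" for n L
    proof -
      have "(\<lambda>n. \<Sum>k<n. a k *\<^sub>R t k) \<longlonglongrightarrow> syn t a" using bounded_synthesis(1)[of a B] a by (simp add: sums_def)
      then have "(\<lambda>n. norm (blinfun_apply L (\<Sum>k<n. a k *\<^sub>R t k))) \<longlonglongrightarrow> norm (blinfun_apply L (syn t a))"
        by (intro tendsto_norm blinfun.tendsto tendsto_const)
      moreover have "norm (blinfun_apply L (\<Sum>k<m. a k *\<^sub>R t k)) \<le> C * B" for m
      proof -
        have "norm (blinfun_apply L (\<Sum>k<m. a k *\<^sub>R t k)) \<le> N (\<Sum>k<m. a k *\<^sub>R t k)"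
          by (rule N_upper[OF Z_lincomb L]) (rule basis_props)
        also have "\<dots> \<le> C * B" using a B by (intro lincomb_boundedD[OF basis_props(2)]) auto
        finally show ?thesis .
      qed
      ultimately show ?thesis by (intro LIMSEQ_le_const2) auto
    qed
    then have "syn t a \<in> M" by (auto simp: M_iff)
    then show ?thesis using Lle B C by (auto intro: M_least)
  qed
  \<comment> \<open>The \<open>s k\<close> are continuous only for \<open>N\<close>, so they cannot
    be applied to the sum in \<open>X\<close>. The partial sums are bounded in \<open>N\<close> and
    null in \<open>X\<close>; by the gliding hump \<open>s k\<close> of them tends to 0, while it is
    eventually equal to \<open>a k\<close>.\<close>
  have zero: "a k = 0" if a: "\<And>k. \<bar>a k\<bar> \<le> B" and 0: "syn t a = 0" for a B k
  proof -
    define x where "x n = (\<Sum>k<n. a k *\<^sub>R t k)" for n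
    have xZ: "x n \<in> Z" for n unfolding x_def by (intro Z_lincomb basis_props)
    have B: "0 \<le> B" using a[of 0] by linarith
    have xN: "N (x n) \<le> C * B" for n unfolding x_def using a B by (intro lincomb_boundedD[OF basis_props(2)]) auto
    have "x \<longlonglongrightarrow> 0" using bounded_synthesis(1)[of a B] a by (simp add: sums_def x_def[abs_def] 0)
    then have "weakly_converges x 0" unfolding weakly_converges_def by (intro allI blinfun.tendsto tendsto_const)
    from weakly_null_functional[OF xZ xN this basis_props(3,4)] have "(\<lambda>n. s k (x n)) \<longlonglongrightarrow> 0" .
    moreover have "s k (x n) = a k" if "n > k" for n
    proof -
      have "s k (x n) = (\<Sum>j<n. a j * s k (t j))"
        unfolding x_def by (simp add: linear_sum[OF basis_props(3)] linear_cmul[OF basis_props(3)])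
      also have "\<dots> = (\<Sum>j<n. if j = k then a k else 0)" by (intro sum.cong) (auto simp: biorth)
      finally show ?thesis using that by simp
    qed
    then have "\<forall>\<^sub>F n in sequentially. s k (x n) = a k" by (meson eventually_gt_at_top eventually_mono)
    then have "(\<lambda>n. s k (x n)) \<longlonglongrightarrow> a k" by (rule tendsto_eventually)
    ultimately show ?thesis by (rule LIMSEQ_unique[OF _ _, symmetric])
  qed
  have onto: "\<exists>a. (\<forall>k. \<bar>a k\<bar> \<le> C * N x) \<and> syn t a = x" if x: "x \<in> M" for x
  proof -
    obtain u where u: "\<And>n. u n \<in> Z" "\<And>n. N (u n) \<le> N x" "weakly_converges u x" using approx[OF x] by blast
    have sb: "\<bar>s k (u n)\<bar> \<le> C * N x" for k n
      using basis_props(4)[OF u(1)] mult_left_mono[OF u(2) C] order_trans by blast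
    obtain r :: "nat \<Rightarrow> nat" where r: "strict_mono r" "\<And>k. convergent (\<lambda>n. s k (u (r n)))"
      using pointwise_bounded_subsequence[of "UNIV :: nat set" "\<lambda>n k. s k (u n)"] sb by (metis UNIV_I countableI_type)
    obtain a where a: "\<And>k. (\<lambda>n. s k (u (r n))) \<longlonglongrightarrow> a k" using r(2) unfolding convergent_def by metis
    have ab: "\<bar>a k\<bar> \<le> C * N x" for k
      using tendsto_rabs[OF a[of k]] sb by (intro LIMSEQ_le_const2[of "\<lambda>n. \<bar>s k (u (r n))\<bar>"]) auto
    have "(\<lambda>n. u (r n)) \<longlonglongrightarrow> syn t a"
      unfolding LIMSEQ_iff
    proof (intro allI impI)
      fix e :: real assume e: "e > 0"
      define B where "B = C * N x"
      have B: "0 \<le> B" using C N(1) by (simp add: B_def)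
      define e' where "e' = e / (4 * (B + 1))"
      have e': "e' > 0" using e B by (simp add: e'_def)
      have e'B: "e' * B < e / 3"
      proof -
        have "e' * B = e * (B / (4 * (B + 1)))" by (simp add: e'_def)
        also have "\<dots> < e * (1/3)" using e B by (intro mult_strict_left_mono) (auto simp: field_simps)
        finally show ?thesis by simp
      qed
      \<comment> \<open>The zero sequence only discharges the boundedness premise of
        \<open>bounded_synthesis\<close>; the conclusion quantifies over all coefficient
        sequences.\<close>
      obtain n0 where n0: "\<forall>a M. (\<forall>k. \<bar>a k\<bar> \<le> M) \<longrightarrow> norm (syn t a - (\<Sum>k<n0. a k *\<^sub>R t k)) \<le> e' * M"
        using bounded_synthesis(2)[where a = "\<lambda>_. 0" and M = 0, OF _ e'] by auto
      have "(\<lambda>n. \<Sum>k<n0. s k (u (r n)) *\<^sub>R t k) \<longlonglongrightarrow> (\<Sum>k<n0. a k *\<^sub>R t k)" by (intro tendsto_intros a)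
      then have "\<forall>\<^sub>F n in sequentially. dist (\<Sum>k<n0. s k (u (r n)) *\<^sub>R t k) (\<Sum>k<n0. a k *\<^sub>R t k) < e / 3"
        by (rule tendstoD) (use e in simp)
      then obtain n1 where n1: "\<And>n. n \<ge> n1 \<Longrightarrow> norm ((\<Sum>k<n0. s k (u (r n)) *\<^sub>R t k) - (\<Sum>k<n0. a k *\<^sub>R t k)) < e / 3"
        by (auto simp: eventually_sequentially dist_norm)
      have "norm (u (r n) - syn t a) < e" if "n \<ge> n1" for n
      proof -
        have 1: "norm (u (r n) - (\<Sum>k<n0. s k (u (r n)) *\<^sub>R t k)) \<le> e' * B"
          using n0[rule_format, of "\<lambda>k. s k (u (r n))" B] sb syn_coeffs[OF u(1)[of "r n"]] by (simp add: B_def)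
        have 2: "norm (syn t a - (\<Sum>k<n0. a k *\<^sub>R t k)) \<le> e' * B"
          using n0[rule_format, of a B] ab by (simp add: B_def)
        have "u (r n) - syn t a = (u (r n) - (\<Sum>k<n0. s k (u (r n)) *\<^sub>R t k)) +
          ((\<Sum>k<n0. s k (u (r n)) *\<^sub>R t k) - (\<Sum>k<n0. a k *\<^sub>R t k)) - (syn t a - (\<Sum>k<n0. a k *\<^sub>R t k))" by simp
        also have "norm \<dots> \<le> norm (u (r n) - (\<Sum>k<n0. s k (u (r n)) *\<^sub>R t k)) +
          norm ((\<Sum>k<n0. s k (u (r n)) *\<^sub>R t k) - (\<Sum>k<n0. a k *\<^sub>R t k)) + norm (syn t a - (\<Sum>k<n0. a k *\<^sub>R t k))"
          by (meson add_right_mono norm_triangle_ineq norm_triangle_ineq4 order_trans)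
        finally show ?thesis using 1 2 n1[OF that] e'B by linarith
      qed
      then show "\<exists>no. \<forall>n\<ge>no. norm (u (r n) - syn t a) < e" by blast
    qed
    have "syn t a = x"
    proof (rule functionals_separate)
      fix f :: "'a \<Rightarrow>\<^sub>L real"
      have "(\<lambda>n. blinfun_apply f (u n)) \<longlonglongrightarrow> blinfun_apply f x" using u(3) by (auto simp: weakly_converges_def)
      from LIMSEQ_subseq_LIMSEQ[OF this r(1)] have "(\<lambda>n. blinfun_apply f (u (r n))) \<longlonglongrightarrow> blinfun_apply f x" by (simp add: comp_def)
      moreover have "(\<lambda>n. blinfun_apply f (u (r n))) \<longlonglongrightarrow> blinfun_apply f (syn t a)"
        by (intro blinfun.tendsto tendsto_const) fact
      ultimately show "blinfun_apply f (syn t a) = blinfun_apply f x" by (rule LIMSEQ_unique[rotated])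
    qed
    then show ?thesis using ab by blast
  qed
  have add: "syn t (apply_bcontfun (a + b)) = syn t (apply_bcontfun a) + syn t (apply_bcontfun b)" for a b
    using sums_add[OF bounded_synthesis(1)[OF abs_bcontfun_le[of a]] bounded_synthesis(1)[OF abs_bcontfun_le[of b]]]
    by (simp add: syn_def plus_bcontfun.rep_eq scaleR_add_left sums_iff)
  have scale: "syn t (apply_bcontfun (r *\<^sub>R a)) = r *\<^sub>R syn t (apply_bcontfun a)" for r a
    using sums_scaleR_right[OF bounded_synthesis(1)[OF abs_bcontfun_le[of a]], of r]
    by (simp add: syn_def scaleR_bcontfun.rep_eq sums_iff)
  have inj: "a = b" if "syn t (apply_bcontfun a) = syn t (apply_bcontfun b)" for a b
  proof -
    have "syn t (apply_bcontfun (a + (- 1) *\<^sub>R b)) = 0" unfolding add scale using that by simp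
    then have "apply_bcontfun (a + (- 1) *\<^sub>R b) k = 0" for k by (rule zero[OF abs_bcontfun_le])
    then have "apply_bcontfun a k = apply_bcontfun b k" for k by (simp add: plus_bcontfun.rep_eq uminus_bcontfun.rep_eq)
    then show ?thesis by (intro bcontfun_eqI)
  qed
  have ex: "\<exists>a :: nat \<Rightarrow>\<^sub>C real. norm a \<le> C * N x \<and> syn t (apply_bcontfun a) = x" if x: "x \<in> M" for x
  proof -
    obtain a where a: "\<forall>k. \<bar>a k\<bar> \<le> C * N x" "syn t a = x" using onto[OF x] by blast
    have "bounded (range a)" using a(1) by (auto simp: bounded_range_abs)
    then have ap: "apply_bcontfun (Bcontfun a) = a" by (rule apply_Bcontfun_nat)
    have "norm (Bcontfun a) \<le> C * N x" by (rule norm_bound) (use a(1) ap in simp)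
    then show ?thesis using a(2) ap by (intro exI[of _ "Bcontfun a"]) simp
  qed
  have TM: "syn t (apply_bcontfun a) \<in> M" "N (syn t (apply_bcontfun a)) \<le> C * norm a" for a
    using bound[OF abs_bcontfun_le[of a]] by auto
  show ?thesis
  proof (rule isomorphic_spacesI[where T = "\<lambda>a. syn t (apply_bcontfun a)" and c = C and d = C])
    show "Metric_space M (\<lambda>x y. N (x - y))" using M N by (rule Metric_space_norm)
    show "Metric_space linf (\<lambda>x y. norm (x - y))" by (rule Metric_space_bcontfun)
    show "subspace M" using M by (simp add: normed_space_on_def)
    show "subspace linf" by (simp add: linf_def)
    show "bij_betw (\<lambda>a. syn t (apply_bcontfun a)) linf M"
      unfolding bij_betw_def linf_def using inj TM(1) ex by (fastforce intro: inj_onI)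
    \<comment> \<open>Surjectivity came with a norm bound for a preimage; injectivity identifies
      that preimage with \<open>a\<close>.\<close>
    show "norm a \<le> C * N (syn t (apply_bcontfun a))" for a
      using ex[OF TM(1)[of a]] inj by metis
  qed (rule add scale TM(2))+
qed

end

end

section \<open>From the definitions to the abstract setting\<close>

text \<open>Banach-Steinhaus by Baire's theorem. It makes compact sets of operators norm bounded:
  their topology is only known to make the evaluations at points continuous.\<close>

lemma uniform_boundedness:
  fixes A :: "('a::banach \<Rightarrow>\<^sub>L 'b::real_normed_vector) set"
  assumes "\<And>x. \<exists>b. \<forall>L\<in>A. norm (blinfun_apply L x) \<le> b"
  shows "\<exists>c. \<forall>L\<in>A. norm L \<le> c"
proof -
  define F where "F n = {x. \<forall>L\<in>A. norm (blinfun_apply L x) \<le> real n}" for n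
  have F_closed: "closed (F n)" for n
  proof -
    have "F n = (\<Inter>L\<in>A. {x. norm (blinfun_apply L x) \<le> real n})" by (auto simp: F_def)
    moreover have "closed {x. norm (blinfun_apply L x) \<le> real n}" for L :: "'a \<Rightarrow>\<^sub>L 'b"
      by (intro closed_Collect_le continuous_intros)
    ultimately show ?thesis by auto
  qed
  have cover: "(\<Union>n. F n) = UNIV"
  proof (intro equalityI subsetI UNIV_I)
    fix x
    obtain b where b: "\<forall>L\<in>A. norm (blinfun_apply L x) \<le> b" using assms by blast
    obtain n :: nat where "b \<le> real n" using real_arch_simple by blast
    then have "x \<in> F n" using b by (auto simp: F_def intro: order_trans)
    then show "x \<in> (\<Union>n. F n)" by blast
  qed
  have "\<exists>n. interior (F n) \<noteq> {}"
  proof (rule ccontr)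
    assume "\<not> ?thesis"
    then have "(euclidean :: 'a topology) interior_of \<Union>(range F) = {}"
      using F_closed by (intro Baire_category_alt) (auto simp: completely_metrizable_space_euclidean)
    then show False using cover by simp
  qed
  then obtain n x0 where "x0 \<in> interior (F n)" by blast
  then obtain e where e: "e > 0" "cball x0 e \<subseteq> F n" using mem_interior_cball by blast
  have "norm L \<le> 2 * real n / e" if L: "L \<in> A" for L
  proof (rule norm_blinfun_bound)
    fix x :: 'a
    show "norm (blinfun_apply L x) \<le> 2 * real n / e * norm x"
    proof (cases "x = 0")
      case False
      define y where "y = (e / norm x) *\<^sub>R x"
      have "norm y = e" using False e(1) by (simp add: y_def)
      then have "x0 + y \<in> F n" using e by (auto simp: dist_norm)
      moreover have "x0 \<in> F n" using e by auto
      ultimately have "norm (blinfun_apply L (x0 + y)) \<le> real n" "norm (blinfun_apply L x0) \<le> real n"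
        using L by (auto simp: F_def)
      then have "norm (blinfun_apply L y) \<le> 2 * real n"
        using norm_triangle_ineq4[of "blinfun_apply L (x0 + y)" "blinfun_apply L x0"] by (simp add: blinfun.add_right)
      moreover have "norm (blinfun_apply L y) = e / norm x * norm (blinfun_apply L x)"
        using e(1) by (simp add: y_def blinfun.scaleR_right)
      ultimately show ?thesis using False e(1) by (simp add: field_simps)
    qed simp
  qed (use e(1) in simp)
  then show ?thesis by blast
qed

text \<open>A countable compact cover need not absorb every compact set. Local compactness puts open
  sets \<open>V n\<close> between \<open>K n\<close> and \<open>K (Suc n)\<close>; they cover the
  space, so finitely many of them, hence a single member of the exhaustion, contain a given compact
  set.\<close>

lemma compact_exhaustion:
  assumes "Hausdorff_space \<tau>" "sigma_compact_space \<tau>" "locally_compact_space \<tau>"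
  obtains K :: "nat \<Rightarrow> 't set" where "\<And>n. compactin \<tau> (K n)" "\<And>n. K n \<subseteq> K (Suc n)"
    "(\<Union>n. K n) = topspace \<tau>" "\<And>D. compactin \<tau> D \<Longrightarrow> \<exists>n. D \<subseteq> K n"
proof -
  obtain \<K> where \<K>: "countable \<K>" "\<And>D. D \<in> \<K> \<Longrightarrow> compactin \<tau> D" "\<Union>\<K> = topspace \<tau>"
    using assms(2) by (auto simp: sigma_compact_space_def)
  \<comment> \<open>The empty set makes the family nonempty, so that \<open>from_nat_into\<close>
    enumerates exactly its members.\<close>
  define C where "C = from_nat_into (insert {} \<K>)"
  have rC: "range C = insert {} \<K>" unfolding C_def using \<K>(1) by (intro range_from_nat_into) auto
  have Cc: "compactin \<tau> (C n)" for n using rC \<K>(2) by (metis compactin_empty insertE rangeI)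
  have UC: "(\<Union>n. C n) = topspace \<tau>" using rC \<K>(3) by simp
  have "\<exists>U L. openin \<tau> U \<and> compactin \<tau> L \<and> D \<subseteq> U \<and> U \<subseteq> L" if "compactin \<tau> D" for D
    using locally_compact_space_compact_closed_compact[of \<tau>] assms(1,3) that by blast
  then obtain U L where UL: "\<And>D. compactin \<tau> D \<Longrightarrow> openin \<tau> (U D) \<and> compactin \<tau> (L D) \<and> D \<subseteq> U D \<and> U D \<subseteq> L D"
    by metis
  define K where "K = rec_nat {} (\<lambda>n A. L (A \<union> C n))"
  have K0: "K 0 = {}" and KS: "K (Suc n) = L (K n \<union> C n)" for n by (simp_all add: K_def)
  have Kc: "compactin \<tau> (K n)" for n
    by (induction n) (simp_all add: K0 KS UL compactin_Un Cc)
  define V where "V n = U (K n \<union> C n)" for n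
  have V: "openin \<tau> (V n)" "K n \<union> C n \<subseteq> V n" "V n \<subseteq> K (Suc n)" for n
    using UL[OF compactin_Un[OF Kc Cc], of n n] by (auto simp: V_def KS)
  have K_Suc: "K n \<subseteq> K (Suc n)" for n using V(2,3)[of n] by blast
  have K_mono: "K m \<subseteq> K n" if "m \<le> n" for m n
    using that by (induction rule: dec_induct) (use K_Suc in blast)+
  show ?thesis
  proof (rule that[of K, OF Kc K_Suc])
    show "(\<Union>n. K n) = topspace \<tau>"
    proof (intro equalityI)
      show "(\<Union>n. K n) \<subseteq> topspace \<tau>" using compactin_subset_topspace[OF Kc] by blast
      have "C n \<subseteq> K (Suc n)" for n using V(2,3)[of n] by blast
      then show "topspace \<tau> \<subseteq> (\<Union>n. K n)" unfolding UC[symmetric] by blast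
    qed
    fix D assume D: "compactin \<tau> D"
    have "C n \<subseteq> V n" for n using V(2)[of n] by blast
    then have "(\<Union>n. C n) \<subseteq> \<Union>(range V)" by (intro UN_mono) auto
    then have DV: "D \<subseteq> \<Union>(range V)" using compactin_subset_topspace[OF D] UC by simp
    have "openin \<tau> W" if "W \<in> range V" for W using that V(1) by auto
    then obtain \<F> where \<F>: "finite \<F>" "\<F> \<subseteq> range V" "D \<subseteq> \<Union>\<F>"
      using compactinD[OF D _ DV] by auto
    then obtain I where I: "finite I" "\<F> = V ` I" by (meson finite_subset_image)
    define m where "m = Max (insert 0 I)"
    have m: "i \<le> m" if "i \<in> I" for i unfolding m_def using I(1) that by (intro Max_ge) auto
    have "D \<subseteq> K (Suc m)"
    proof
      fix x assume "x \<in> D"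
      then obtain i where i: "i \<in> I" "x \<in> V i" using \<F>(3) unfolding I(2) by blast
      then have "x \<in> K (Suc i)" using V(3)[of i] by blast
      then show "x \<in> K (Suc m)" using K_mono[of "Suc i" "Suc m"] m[OF i(1)] by auto
    qed
    then show "\<exists>n. D \<subseteq> K n" by blast
  qed
qed

section \<open>Coordinates from the Banach-Mazur distance\<close>

lemma subspace_linf_n: "subspace (linf_n n)"
  unfolding subspace_def linf_n_def by (auto simp: zero_bcontfun.rep_eq plus_bcontfun.rep_eq scaleR_bcontfun.rep_eq)

lemma unit_seq_in_linf_n: "i < n \<Longrightarrow> unit_seq i \<in> linf_n n"
  by (auto simp: linf_n_def apply_unit_seq)

lemma linf_n_expansion: "a \<in> linf_n n \<Longrightarrow> a = (\<Sum>j<n. apply_bcontfun a j *\<^sub>R unit_seq j)"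
  by (rule bcontfun_eqI) (auto simp: apply_unit_seq_sum linf_n_def not_less)

lemma operator_norm_on_scaled:
  assumes V: "normed_space_on V N" and fin: "operator_norm_on V N N' T \<noteq> top" and x: "x \<in> V"
    and scale: "\<And>r. N' (T (r *\<^sub>R x)) = \<bar>r\<bar> * N' (T x)" and N': "0 \<le> N' (T x)" and T0: "x = 0 \<Longrightarrow> N' (T x) = 0"
  shows "N' (T x) \<le> enn2real (operator_norm_on V N N' T) * N x"
proof (cases "x = 0")
  case True then show ?thesis using V x T0 by (auto simp: normed_space_on_def)
next
  case False
  then have pos: "N x > 0" using V x by (auto simp: normed_space_on_def less_le)
  define y where "y = (1 / N x) *\<^sub>R x"
  have y: "y \<in> V" "N y = 1" using V x pos by (auto simp: normed_space_on_def y_def subspace_scale)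
  then have "ennreal (N' (T y)) \<le> operator_norm_on V N N' T"
    unfolding operator_norm_on_def by (intro SUP_upper) auto
  also have "\<dots> = ennreal (enn2real (operator_norm_on V N N' T))" using fin by (simp add: less_top)
  finally have "N' (T y) \<le> enn2real (operator_norm_on V N N' T)" by simp
  moreover have "N' (T y) = N' (T x) / N x" using scale[of "1 / N x"] pos by (simp add: y_def)
  ultimately show ?thesis using pos by (simp add: divide_le_eq)
qed

text \<open>An isomorphism \<open>T\<close> onto the n-dimensional l^infinity is divided by its norm
  \<open>a\<close>: the coordinates become contractive and extend to \<open>Z\<close> by
  Hahn-Banach, while the basis picks up the factor \<open>a\<close>, so that only the product of the
  two norms remains. The bound is \<open>r + 1\<close> because the infimum in the distance need not
  be attained.\<close>

lemma script_Linf_coordinates: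
  assumes Z: "normed_space_on Z N" and L: "script_Linf_space Z N"
    and N: "\<And>x. 0 \<le> N x" "\<And>x. N (- x) = N x"
  obtains \<Lambda> where "0 \<le> \<Lambda>" "\<And>S. finite S \<Longrightarrow> S \<subseteq> Z \<Longrightarrow>
     \<exists>(n::nat) e c. (\<forall>t<n. e t \<in> Z \<and> linear (c t) \<and> (\<forall>z\<in>Z. \<bar>c t z\<bar> \<le> N z)) \<and>
        (\<forall>z\<in>span S. z = (\<Sum>t<n. c t z *\<^sub>R e t)) \<and>
        (\<forall>a M. 0 \<le> M \<longrightarrow> (\<forall>t<n. \<bar>a t\<bar> \<le> M) \<longrightarrow> N (\<Sum>t<n. a t *\<^sub>R e t) \<le> \<Lambda> * M)"
proof -
  have Zs: "subspace Z" and N0: "\<And>x. x \<in> Z \<Longrightarrow> 0 \<le> N x" "\<And>x. x \<in> Z \<Longrightarrow> N x = 0 \<longleftrightarrow> x = 0"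
    and Nsc: "\<And>x r. x \<in> Z \<Longrightarrow> N (r *\<^sub>R x) = \<bar>r\<bar> * N x" and Ntri: "\<And>x y. x \<in> Z \<Longrightarrow> y \<in> Z \<Longrightarrow> N (x + y) \<le> N x + N y"
    using Z by (auto simp: normed_space_on_def)
  obtain r where r: "r \<ge> 1" and LP: "\<And>B. finite_dimensional B \<Longrightarrow> B \<subseteq> Z \<Longrightarrow>
      \<exists>C. finite_dimensional C \<and> B \<subseteq> C \<and> C \<subseteq> Z \<and> banach_mazur_distance C N (linf_n (dim C)) norm \<le> ennreal r"
    using L unfolding script_Linf_space_def by blast
  obtain \<pi> where \<pi>: "linear \<pi>" "\<And>x. \<pi> x \<in> Z" "\<And>z. z \<in> Z \<Longrightarrow> \<pi> z = z"
    using linear_exists_left_inverse_on[OF linear_ident Zs inj_on_id2] by (metis rangeI subsetD)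
  define p where "p x = N (\<pi> x)" for x
  have p: "sublinear p"
    unfolding sublinear_def p_def using \<pi>(2) Ntri Nsc by (auto simp: linear_add[OF \<pi>(1)] linear_cmul[OF \<pi>(1)])
  have p_minus: "p (- x) = p x" for x
    using Nsc[OF \<pi>(2), of "-1" x] by (simp add: p_def linear_neg[OF \<pi>(1)])
  show ?thesis
  proof (rule that[of "r + 1"])
    fix S assume S: "finite S" "S \<subseteq> Z"
    have spanZ: "span S \<subseteq> Z" using S(2) Zs by (simp add: span_minimal)
    obtain C where C: "finite_dimensional C" "span S \<subseteq> C" "C \<subseteq> Z"
      "banach_mazur_distance C N (linf_n (dim C)) norm \<le> ennreal r"
      using LP[of "span S"] S spanZ by (auto simp: finite_dimensional_def)
    define n where "n = dim C"
    have Cs: "subspace C" using C(1) by (auto simp: finite_dimensional_def)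
    have Cn: "normed_space_on C N" using Cs C(3) N0 Nsc Ntri unfolding normed_space_on_def by blast
    have Wn: "normed_space_on (linf_n n) norm"
      unfolding normed_space_on_def using subspace_linf_n by (auto intro: norm_triangle_ineq)
    show "\<exists>(n::nat) e c. (\<forall>t<n. e t \<in> Z \<and> linear (c t) \<and> (\<forall>z\<in>Z. \<bar>c t z\<bar> \<le> N z)) \<and>
        (\<forall>z\<in>span S. z = (\<Sum>t<n. c t z *\<^sub>R e t)) \<and>
        (\<forall>a M. 0 \<le> M \<longrightarrow> (\<forall>t<n. \<bar>a t\<bar> \<le> M) \<longrightarrow> N (\<Sum>t<n. a t *\<^sub>R e t) \<le> (r + 1) * M)"
    proof (cases "C = {0}")
      case True
      then have "\<forall>z\<in>span S. z = 0" using C(2) by blast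
      then show ?thesis using r N0(2)[OF subspace_0[OF Zs]]
        by - (rule exI[of _ 0], rule exI[of _ "\<lambda>_. 0"], rule exI[of _ "\<lambda>_ _. 0"], auto)
    next
      case False
      have "ennreal r < ennreal (r + 1)" using r by (simp add: ennreal_less_iff)
      then have "banach_mazur_distance C N (linf_n n) norm < ennreal (r + 1)"
        using C(4) le_less_trans unfolding n_def by blast
      then obtain T where T: "linear_homeomorphism C N (linf_n n) norm T"
        "operator_norm_on C N norm T * operator_norm_on (linf_n n) norm N (inv_into C T) < ennreal (r + 1)"
        unfolding banach_mazur_distance_def by (auto simp: INF_less_iff)
      define R where "R = inv_into C T"
      have CM: "Metric_space C (\<lambda>x y. N (x - y))" using Cn N by (rule Metric_space_norm)
      have hom: "homeomorphic_map (norm_topology C N) (norm_topology (linf_n n) norm) T"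
        and T_add: "\<And>x y. x \<in> C \<Longrightarrow> y \<in> C \<Longrightarrow> T (x + y) = T x + T y"
        and T_scale: "\<And>x c. x \<in> C \<Longrightarrow> T (c *\<^sub>R x) = c *\<^sub>R T x"
        using T(1) by (auto simp: linear_homeomorphism_def)
      have T_im: "T ` C = linf_n n" and T_inj: "inj_on T C"
        using homeomorphic_imp_surjective_map[OF hom] homeomorphic_imp_injective_map[OF hom]
        by (simp_all add: norm_topology_def Metric_space.topspace_mtopology[OF CM] Metric_space.topspace_mtopology[OF Metric_space_bcontfun])
      have TW: "T x \<in> linf_n n" if "x \<in> C" for x using T_im that by blast
      have RC: "R a \<in> C" and TR: "T (R a) = a" if "a \<in> linf_n n" for a
        using that T_im unfolding R_def by (auto simp: inv_into_into f_inv_into_f)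
      have RT: "R (T x) = x" if "x \<in> C" for x unfolding R_def using T_inj that by simp
      have R_add: "R (a + b) = R a + R b" if "a \<in> linf_n n" "b \<in> linf_n n" for a b
        using RT[of "R a + R b"] T_add[OF RC RC, OF that] TR that subspace_add[OF Cs] RC by simp
      have R_scale: "R (c *\<^sub>R a) = c *\<^sub>R R a" if "a \<in> linf_n n" for c a
        using RT[of "c *\<^sub>R R a"] T_scale[OF RC[OF that], of c] TR[OF that] subspace_scale[OF Cs RC[OF that]] by simp
      have T0: "T 0 = 0" using T_scale[of 0 0] subspace_0[OF Cs] by simp
      have R0: "R 0 = 0" using RT[of 0] subspace_0[OF Cs] T0 by simp
      define \<alpha> where "\<alpha> = operator_norm_on C N norm T"
      define \<beta> where "\<beta> = operator_norm_on (linf_n n) norm N R"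
      obtain x0 where x0: "x0 \<in> C" "x0 \<noteq> 0" using False subspace_0[OF Cs] by blast
      have Nx0: "N x0 > 0" using N0[of x0] x0 C(3) by (metis less_le subsetD)
      have Tx0: "T x0 \<noteq> 0" using inj_onD[OF T_inj, of x0 0] x0 T0 subspace_0[OF Cs] by auto
      \<comment> \<open>In \<open>ennreal\<close> the product of 0 and infinity is 0, so a finite
        product bounds both factors only once neither vanishes; hence the separate case of the zero
        space.\<close>
      have "\<alpha> \<noteq> 0"
      proof -
        have "norm (T ((1 / N x0) *\<^sub>R x0)) > 0" using Tx0 Nx0 by (simp add: T_scale[OF x0(1)])
        moreover have "ennreal (norm (T ((1 / N x0) *\<^sub>R x0))) \<le> \<alpha>"
          unfolding \<alpha>_def operator_norm_on_def using x0 Nx0 C(3)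
          by (intro SUP_upper) (auto simp: subspace_scale[OF Cs] Nsc subsetD)
        ultimately show ?thesis by (auto simp: ennreal_eq_0_iff)
      qed
      moreover have "\<beta> \<noteq> 0"
      proof -
        have eq: "R ((1 / norm (T x0)) *\<^sub>R T x0) = (1 / norm (T x0)) *\<^sub>R x0"
          using R_scale[OF TW[OF x0(1)]] RT[OF x0(1)] by simp
        have "N (R ((1 / norm (T x0)) *\<^sub>R T x0)) > 0"
          unfolding eq using Nsc[of x0 "1 / norm (T x0)"] x0 C(3) Tx0 Nx0 by auto
        moreover have "ennreal (N (R ((1 / norm (T x0)) *\<^sub>R T x0))) \<le> \<beta>"
          unfolding \<beta>_def operator_norm_on_def using Tx0
          by (intro SUP_upper) (auto simp: subspace_scale[OF subspace_linf_n] TW[OF x0(1)])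
        ultimately show ?thesis by (auto simp: ennreal_eq_0_iff)
      qed
      moreover have prod: "\<alpha> * \<beta> < ennreal (r + 1)" using T(2) by (simp add: \<alpha>_def \<beta>_def R_def)
      then have "\<alpha> * \<beta> \<noteq> top" by (metis ennreal_less_top less_irrefl less_trans)
      ultimately have fin: "\<alpha> \<noteq> top" "\<beta> \<noteq> top" by (auto simp: ennreal_mult_eq_top_iff)
      define a where "a = enn2real \<alpha>"
      define b where "b = enn2real \<beta>"
      have a: "a > 0" unfolding a_def using \<open>\<alpha> \<noteq> 0\<close> fin(1) by (simp add: enn2real_positive_iff less_top zero_less_iff_neq_zero)
      have b: "b \<ge> 0" by (simp add: b_def)
      have "enn2real (\<alpha> * \<beta>) \<le> r + 1" using prod r by (intro enn2real_leI) auto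
      then have ab: "a * b \<le> r + 1" by (simp add: a_def b_def enn2real_mult)
      have Tb: "norm (T x) \<le> a * N x" if x: "x \<in> C" for x
        unfolding a_def \<alpha>_def using Cn fin(1) x
        by (intro operator_norm_on_scaled) (auto simp: \<alpha>_def T_scale T0)
      have Rb: "N (R y) \<le> b * norm y" if y: "y \<in> linf_n n" for y
        unfolding b_def \<beta>_def using Wn fin(2) y C(3) RC[OF y]
        by (intro operator_norm_on_scaled) (auto simp: \<beta>_def R_scale R0 N Nsc subsetD N0(2)[OF subspace_0[OF Zs]])
      obtain \<kappa> where \<kappa>: "linear \<kappa>" "\<And>x. \<kappa> x \<in> C" "\<And>z. z \<in> C \<Longrightarrow> \<kappa> z = z"
        using linear_exists_left_inverse_on[OF linear_ident Cs inj_on_id2] by (metis rangeI subsetD)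
      define c0 where "c0 t x = apply_bcontfun (T (\<kappa> x)) t / a" for t x
      have "\<exists>h. linear h \<and> (\<forall>x. \<bar>h x\<bar> \<le> p x) \<and> (\<forall>x\<in>C. h x = c0 t x)" for t
      proof -
        have lin: "linear (c0 t)"
          by (rule linearI) (simp_all add: c0_def linear_add[OF \<kappa>(1)] linear_cmul[OF \<kappa>(1)] T_add T_scale \<kappa>(2)
              plus_bcontfun.rep_eq scaleR_bcontfun.rep_eq add_divide_distrib)
        have le: "c0 t x \<le> p x" if x: "x \<in> C" for x
        proof -
          have "apply_bcontfun (T x) t \<le> a * N x" using abs_bcontfun_le[of "T x" t] Tb[OF x] by linarith
          moreover have "p x = N x" using x C(3) \<pi>(3) by (auto simp: p_def)
          ultimately show ?thesis using a by (simp add: c0_def \<kappa>(3)[OF x] divide_le_eq mult.commute)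
        qed
        obtain h where h: "linear h" "\<And>x. h x \<le> p x" "\<And>x. x \<in> C \<Longrightarrow> h x = c0 t x"
          using Hahn_Banach_extension[OF p Cs lin le] by blast
        have "\<bar>h x\<bar> \<le> p x" for x using h(1,2) p_minus by (rule linear_abs_le_sublinear)
        then show ?thesis using h by blast
      qed
      then obtain h where h: "\<And>t. linear (h t)" "\<And>t x. \<bar>h t x\<bar> \<le> p x" "\<And>t x. x \<in> C \<Longrightarrow> h t x = c0 t x" by metis
      define e where "e t = a *\<^sub>R R (unit_seq t)" for t
      have R_sum: "R (\<Sum>t<m. y t *\<^sub>R unit_seq t) = (\<Sum>t<m. y t *\<^sub>R R (unit_seq t))" if "m \<le> n" for m y
        using that
      proof (induction m)
        case 0 then show ?case by (simp add: R0)
      next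
        case (Suc m)
        have "(\<Sum>t<m. y t *\<^sub>R unit_seq t) \<in> linf_n n"
          using Suc.prems by (intro subspace_sum[OF subspace_linf_n] subspace_scale[OF subspace_linf_n] unit_seq_in_linf_n) auto
        moreover have "unit_seq m \<in> linf_n n" using Suc.prems by (intro unit_seq_in_linf_n) simp
        ultimately show ?case using Suc by (simp add: R_add R_scale subspace_scale[OF subspace_linf_n])
      qed
      show ?thesis
      proof (intro exI[of _ n] exI[of _ e] exI[of _ h] conjI allI impI ballI)
        fix t assume "t < n"
        then show "e t \<in> Z" unfolding e_def using C(3) RC[OF unit_seq_in_linf_n] by (intro subspace_scale[OF Zs]) blast
        show "linear (h t)" by (rule h(1))
        show "\<bar>h t z\<bar> \<le> N z" if "z \<in> Z" for z using h(2)[of t z] \<pi>(3)[OF that] by (simp add: p_def)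
      next
        fix z assume "z \<in> span S"
        then have z: "z \<in> C" using C(2) by blast
        have "(\<Sum>t<n. h t z *\<^sub>R e t) = (\<Sum>t<n. apply_bcontfun (T z) t *\<^sub>R R (unit_seq t))"
          using a by (simp add: h(3)[OF z] c0_def \<kappa>(3)[OF z] e_def)
        also have "\<dots> = R (\<Sum>t<n. apply_bcontfun (T z) t *\<^sub>R unit_seq t)" by (rule R_sum[symmetric]) simp
        also have "(\<Sum>t<n. apply_bcontfun (T z) t *\<^sub>R unit_seq t) = T z" by (rule linf_n_expansion[OF TW[OF z], symmetric])
        finally show "z = (\<Sum>t<n. h t z *\<^sub>R e t)" using RT[OF z] by simp
      next
        fix y :: "nat \<Rightarrow> real" and M :: real assume y: "0 \<le> M" "\<forall>t<n. \<bar>y t\<bar> \<le> M"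
        define w where "w = (\<Sum>t<n. y t *\<^sub>R unit_seq t)"
        have w: "w \<in> linf_n n"
          unfolding w_def by (intro subspace_sum[OF subspace_linf_n] subspace_scale[OF subspace_linf_n] unit_seq_in_linf_n) auto
        have "norm w \<le> M" unfolding w_def using y by (intro norm_bound) (auto simp: apply_unit_seq_sum)
        have "(\<Sum>t<n. y t *\<^sub>R e t) = a *\<^sub>R R w"
          unfolding w_def R_sum[OF order_refl] e_def by (simp add: scaleR_sum_right mult.commute)
        then have "N (\<Sum>t<n. y t *\<^sub>R e t) = a * N (R w)" using Nsc[of "R w" a] RC[OF w] C(3) a by auto
        also have "\<dots> \<le> a * (b * M)" using Rb[OF w] \<open>norm w \<le> M\<close> a b by (intro mult_left_mono) (auto intro: order_trans mult_left_mono)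
        also have "\<dots> = (a * b) * M" by simp
        also have "\<dots> \<le> (r + 1) * M" using ab y(1) by (rule mult_right_mono)
        finally show "N (\<Sum>t<n. y t *\<^sub>R e t) \<le> (r + 1) * M" .
      qed
    qed
  qed (use r in simp)
qed

section \<open>M and M_0 in terms of real bounds, completeness and the continuous inclusion\<close>

lemma M_space_iff:
  "x \<in> M_space \<L> \<longleftrightarrow> (\<exists>b. \<forall>L\<in>\<L>. norm (blinfun_apply L x) \<le> b)"
proof
  assume "x \<in> M_space \<L>"
  then have fin: "(SUP L\<in>\<L>. ennreal (norm (blinfun_apply L x))) < top" by (simp add: M_space_def)
  have "norm (blinfun_apply L x) \<le> enn2real (SUP L\<in>\<L>. ennreal (norm (blinfun_apply L x)))" if "L \<in> \<L>" for L
  proof -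
    have "ennreal (norm (blinfun_apply L x)) \<le> (SUP L\<in>\<L>. ennreal (norm (blinfun_apply L x)))" using that by (rule SUP_upper)
    also have "\<dots> = ennreal (enn2real (SUP L\<in>\<L>. ennreal (norm (blinfun_apply L x))))" using fin by simp
    finally show ?thesis by simp
  qed
  then show "\<exists>b. \<forall>L\<in>\<L>. norm (blinfun_apply L x) \<le> b" by blast
next
  assume "\<exists>b. \<forall>L\<in>\<L>. norm (blinfun_apply L x) \<le> b"
  then obtain b where "\<forall>L\<in>\<L>. norm (blinfun_apply L x) \<le> b" by blast
  then have "(SUP L\<in>\<L>. ennreal (norm (blinfun_apply L x))) \<le> ennreal b" by (intro SUP_least ennreal_leI) blast
  also have "\<dots> < top" by simp
  finally show "x \<in> M_space \<L>" by (simp add: M_space_def)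
qed

lemma M_norm_nonneg: "0 \<le> M_norm \<L> x"
  by (simp add: M_norm_def)

lemma M_norm_minus: "M_norm \<L> (- x) = M_norm \<L> x"
  by (simp add: M_norm_def blinfun.minus_right)

lemma M_norm_upper:
  assumes "x \<in> M_space \<L>" "L \<in> \<L>" shows "norm (blinfun_apply L x) \<le> M_norm \<L> x"
proof -
  have "ennreal (norm (blinfun_apply L x)) \<le> (SUP L\<in>\<L>. ennreal (norm (blinfun_apply L x)))" using assms(2) by (rule SUP_upper)
  also have "\<dots> = ennreal (M_norm \<L> x)" using assms(1) by (simp add: M_norm_def M_space_def)
  finally show ?thesis by (simp add: M_norm_nonneg)
qed

lemma M_norm_least:
  assumes "0 \<le> b" "\<And>L. L \<in> \<L> \<Longrightarrow> norm (blinfun_apply L x) \<le> b" shows "M_norm \<L> x \<le> b"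
  unfolding M_norm_def using assms by (intro enn2real_leI SUP_least ennreal_leI)

lemma M0_space_tail:
  assumes x: "x \<in> M0_space \<L> \<tau>" and e: "e > 0"
  shows "\<exists>D. compactin \<tau> D \<and> (\<forall>L\<in>\<L> - D. norm (blinfun_apply L x) \<le> e)"
proof -
  have "(INF D\<in>{D. compactin \<tau> D}. SUP L\<in>\<L> - D. ennreal (norm (blinfun_apply L x))) < ennreal e"
    using x e by (simp add: M0_space_def limsup_at_infinity_def)
  then obtain D where D: "compactin \<tau> D" "(SUP L\<in>\<L> - D. ennreal (norm (blinfun_apply L x))) < ennreal e"
    by (auto simp: INF_less_iff)
  have "norm (blinfun_apply L x) \<le> e" if "L \<in> \<L> - D" for L
  proof -
    have "ennreal (norm (blinfun_apply L x)) \<le> (SUP L\<in>\<L> - D. ennreal (norm (blinfun_apply L x)))" using that by (rule SUP_upper)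
    then have "ennreal (norm (blinfun_apply L x)) < ennreal e" using D(2) by (rule le_less_trans)
    then show ?thesis by (simp add: ennreal_less_iff)
  qed
  then show ?thesis using D(1) by blast
qed

lemma continuous_inclusion_bound:
  fixes N :: "'a::real_normed_vector \<Rightarrow> real"
  assumes V: "normed_space_on V N" and N: "\<And>x. 0 \<le> N x" "\<And>x. N (- x) = N x"
    and cont: "continuous_map (norm_topology V N) euclidean (\<lambda>x. x)"
  obtains C where "0 \<le> C" "\<And>x. x \<in> V \<Longrightarrow> norm x \<le> C * N x"
proof -
  have MS: "Metric_space V (\<lambda>x y. N (x - y))" using V N by (rule Metric_space_norm)
  have "continuous_map (Metric_space.mtopology V (\<lambda>x y. N (x - y))) Met_TC.mtopology (\<lambda>x. x)"
    using cont by (simp add: norm_topology_def)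
  then have *: "\<forall>a\<in>V. \<forall>\<epsilon>>0. \<exists>\<delta>>0. \<forall>x. x \<in> V \<and> N (a - x) < \<delta> \<longrightarrow> dist a x < \<epsilon>"
    unfolding Metric_space.metric_continuous_map[OF MS Met_TC.Metric_space_axioms] by (rule conjunct2)
  have sub: "subspace V" and sc: "\<And>x c. x \<in> V \<Longrightarrow> N (c *\<^sub>R x) = \<bar>c\<bar> * N x" and z: "\<And>x. x \<in> V \<Longrightarrow> N x = 0 \<longleftrightarrow> x = 0"
    using V by (auto simp: normed_space_on_def)
  obtain \<delta> where \<delta>: "\<delta> > 0" "\<And>x. x \<in> V \<Longrightarrow> N (0 - x) < \<delta> \<Longrightarrow> dist 0 x < 1"
    using *[rule_format, OF subspace_0[OF sub], of 1] by auto
  have "norm x \<le> 2 / \<delta> * N x" if x: "x \<in> V" for x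
  proof (cases "x = 0")
    case False
    then have pos: "N x > 0" using z[OF x] N(1)[of x] by linarith
    define y where "y = (\<delta> / (2 * N x)) *\<^sub>R x"
    have "y \<in> V" using x sub by (simp add: y_def subspace_scale)
    moreover have "N (0 - y) < \<delta>" using pos \<delta>(1) by (simp add: N(2) y_def sc[OF x])
    ultimately have "norm y < 1" using \<delta>(2)[of y] by simp
    moreover have "norm y = \<delta> / (2 * N x) * norm x" using \<delta>(1) pos by (simp add: y_def)
    ultimately show ?thesis using \<delta>(1) pos by (simp add: field_simps)
  qed (use N(1)[of x] \<delta>(1) in simp)
  then show ?thesis using that[of "2 / \<delta>"] \<delta>(1) by simp
qed

lemma banach_space_on_complete:
  assumes V: "banach_space_on V N" and N: "\<And>x. 0 \<le> N x" "\<And>x. N (- x) = N x"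
    and s: "\<And>n. s n \<in> V" "\<And>e. e > 0 \<Longrightarrow> \<exists>n0. \<forall>m\<ge>n0. \<forall>n\<ge>n0. N (s m - s n) \<le> e"
  shows "\<exists>z\<in>V. (\<lambda>n. N (s n - z)) \<longlonglongrightarrow> 0"
proof -
  have MS: "Metric_space V (\<lambda>x y. N (x - y))"
    using V N by (intro Metric_space_norm) (auto simp: banach_space_on_def)
  interpret Metric_space V "\<lambda>x y. N (x - y)" by (rule MS)
  have "mcomplete" using V by (simp add: banach_space_on_def)
  moreover have "MCauchy s"
    unfolding MCauchy_def
  proof (intro conjI allI impI)
    show "range s \<subseteq> V" using s(1) by blast
    fix e :: real assume e: "e > 0"
    obtain n0 where "\<forall>m\<ge>n0. \<forall>n\<ge>n0. N (s m - s n) \<le> e / 2" using s(2)[of "e / 2"] e by auto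
    then have "\<forall>m n. n0 \<le> m \<longrightarrow> n0 \<le> n \<longrightarrow> N (s m - s n) < e" using e by force
    then show "\<exists>n0. \<forall>m n. n0 \<le> m \<longrightarrow> n0 \<le> n \<longrightarrow> N (s m - s n) < e" by blast
  qed
  ultimately obtain z where z: "limitin mtopology s z sequentially" unfolding mcomplete_def by blast
  then have "z \<in> V" and lim: "\<And>e. e > 0 \<Longrightarrow> \<exists>n0. \<forall>n\<ge>n0. s n \<in> V \<and> N (s n - z) < e"
    unfolding limit_metric_sequentially by auto
  moreover have "(\<lambda>n. N (s n - z)) \<longlonglongrightarrow> 0"
    unfolding LIMSEQ_iff
  proof (intro allI impI)
    fix r :: real assume "r > 0"
    from lim[OF this] show "\<exists>no. \<forall>n\<ge>no. norm (N (s n - z) - 0) < r" using N(1) by auto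
  qed
  ultimately show ?thesis by blast
qed

theorem corollary1p5:
  fixes \<L> :: "('a::banach \<Rightarrow>\<^sub>L 'b::banach) set"
    and \<tau> :: "('a \<Rightarrow>\<^sub>L 'b) topology"
  assumes "separable_type TYPE('a)"
    and "reflexive_type TYPE('a)"
    and "topspace \<tau> = \<L>"
    and "Hausdorff_space \<tau>"
    and "sigma_compact_space \<tau>"
    and "locally_compact_space \<tau>"
    and "\<And>x. continuous_map \<tau> euclidean (\<lambda>L. blinfun_apply L x)"
    and "closure (M_space \<L>) = UNIV"
    and "banach_space_on (M_space \<L>) (M_norm \<L>)"
    and "continuous_map (norm_topology (M_space \<L>) (M_norm \<L>)) euclidean (\<lambda>x. x)"
    and "assumption_A \<L> \<tau>"
    and "script_Linf_space (M0_space \<L> \<tau>) (M_norm \<L>)"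
    and "\<not> finite_dimensional (M0_space \<L> \<tau>)"
  shows "isomorphic_spaces (M0_space \<L> \<tau>) (M_norm \<L>) c0 norm \<and>
         isomorphic_spaces (M_space \<L>) (M_norm \<L>) linf norm"
proof -
  note sep = assms(1) and refl = assms(2) and top = assms(3) and cont = assms(7)
  define M where "M = M_space \<L>"
  define Z where "Z = M0_space \<L> \<tau>"
  define N where "N = M_norm \<L>"
  have N0: "0 \<le> N x" and Nm: "N (- x) = N x" for x by (simp_all add: N_def M_norm_nonneg M_norm_minus)
  have ZM: "Z \<subseteq> M" by (auto simp: Z_def M_def M0_space_def)
  have M_normed: "normed_space_on M N" using assms(9) by (simp add: M_def N_def banach_space_on_def)
  have Z_banach: "banach_space_on Z N" using assms(12) by (simp add: Z_def N_def script_Linf_space_def)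
  then have Z_normed: "normed_space_on Z N" by (simp add: banach_space_on_def)
  obtain K where K: "\<And>n. compactin \<tau> (K n)" "\<And>n. K n \<subseteq> K (Suc n)" "(\<Union>n. K n) = \<L>"
    "\<And>D. compactin \<tau> D \<Longrightarrow> \<exists>n. D \<subseteq> K n"
    using compact_exhaustion[OF assms(4,5,6)] unfolding top by metis
  have K_bdd: "\<exists>c. \<forall>L\<in>K n. norm L \<le> c" for n
  proof (rule uniform_boundedness)
    fix x
    have "compact ((\<lambda>L. blinfun_apply L x) ` K n)" using image_compactin[OF K(1) cont] by simp
    then have "bounded ((\<lambda>L. blinfun_apply L x) ` K n)" by (rule compact_imp_bounded)
    then show "\<exists>b. \<forall>L\<in>K n. norm (blinfun_apply L x) \<le> b" by (auto simp: bounded_iff)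
  qed
  have KL: "L \<in> K n \<Longrightarrow> L \<in> \<L>" for n L using K(3) by blast
  obtain CX where CX: "0 \<le> CX" "\<And>x. x \<in> M \<Longrightarrow> norm x \<le> CX * N x"
    using continuous_inclusion_bound[OF M_normed N0 Nm] assms(10) unfolding M_def N_def by metis
  obtain \<Lambda> where \<Lambda>: "0 \<le> \<Lambda>" "\<And>S. finite S \<Longrightarrow> S \<subseteq> Z \<Longrightarrow>
     \<exists>(n::nat) e c. (\<forall>t<n. e t \<in> Z \<and> linear (c t) \<and> (\<forall>z\<in>Z. \<bar>c t z\<bar> \<le> N z)) \<and>
        (\<forall>z\<in>span S. z = (\<Sum>t<n. c t z *\<^sub>R e t)) \<and>
        (\<forall>a M. 0 \<le> M \<longrightarrow> (\<forall>t<n. \<bar>a t\<bar> \<le> M) \<longrightarrow> N (\<Sum>t<n. a t *\<^sub>R e t) \<le> \<Lambda> * M)"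
    using script_Linf_coordinates[OF Z_normed _ N0 Nm] assms(12) unfolding Z_def N_def by blast
  interpret oO_space K Z N CX \<Lambda>
  proof
    show "norm (blinfun_apply L x) \<le> N x" if "x \<in> Z" "L \<in> K n" for x n L
      using M_norm_upper[of x \<L> L] that ZM KL by (auto simp: M_def N_def)
    show "N x \<le> b" if "0 \<le> b" "\<And>n L. L \<in> K n \<Longrightarrow> norm (blinfun_apply L x) \<le> b" for x b
      unfolding N_def using that K(3) by (intro M_norm_least) auto
    show "\<exists>n. \<forall>m. \<forall>L\<in>K m - K n. norm (blinfun_apply L x) \<le> e" if x: "x \<in> Z" and e: "e > 0" for x e
    proof -
      obtain D where D: "compactin \<tau> D" "\<forall>L\<in>\<L> - D. norm (blinfun_apply L x) \<le> e"
        using M0_space_tail[of x \<L> \<tau> e] x e by (auto simp: Z_def)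
      obtain n where "D \<subseteq> K n" using K(4)[OF D(1)] by blast
      then show ?thesis using D(2) KL by blast
    qed
    show "norm x \<le> CX * N x" if "x \<in> Z" for x using CX(2) ZM that by blast
  qed (fact sep refl K(2) K_bdd Z_normed CX(1) \<Lambda>)+
  obtain g :: "nat \<Rightarrow> 'a \<Rightarrow>\<^sub>L real" where
    g: "\<And>j z. z \<in> Z \<Longrightarrow> \<bar>blinfun_apply (g j) z\<bar> \<le> N z"
    "\<And>z. z \<in> Z \<Longrightarrow> (\<lambda>j. blinfun_apply (g j) z) \<longlonglongrightarrow> 0"
    "\<And>z b. z \<in> Z \<Longrightarrow> (\<And>j. \<bar>blinfun_apply (g j) z\<bar> \<le> b) \<Longrightarrow> N z \<le> 2 * b"
  proof (rule c0_coordinates, goal_cases)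
    case (1 g)
    show thesis by (rule that[of g]) (fact 1)+
  qed
  interpret oO_coords K Z N CX \<Lambda> g by unfold_locales (fact g)+
  interpret oO_complete K Z N CX \<Lambda>
    by unfold_locales (rule banach_space_on_complete[OF Z_banach N0 Nm])
  obtain C u v where frame: "0 \<le> C" "c0_frame Z N C u v" using c0_frame_exists by blast
  have inf: "\<not> finite_dimensional Z" using assms(13) by (simp add: Z_def)
  obtain w :: "nat \<Rightarrow> 'a" and \<psi> :: "nat \<Rightarrow> 'a \<Rightarrow> real" where
    w: "\<And>k. w k \<in> Z" "lincomb_bounded w 3" and \<psi>: "\<And>k. linear (\<psi> k)" "\<And>k z. z \<in> Z \<Longrightarrow> \<bar>\<psi> k z\<bar> \<le> 8 * N z"
    "\<And>z. z \<in> Z \<Longrightarrow> (\<lambda>k. \<psi> k z) \<longlonglongrightarrow> 0" "\<And>k l. \<psi> k (w l) = (if k = l then 1 else 0)"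
    by (rule c0_copy[OF inf]) (rule that)
  \<comment> \<open>The decomposition takes one constant for both the embedding and the functionals;
    8 is the larger of the two.\<close>
  have w8: "lincomb_bounded w 8"
    unfolding lincomb_bounded_def
  proof (intro allI impI)
    fix F and a :: "nat \<Rightarrow> real" and M assume F: "finite F" "0 \<le> M" "\<forall>j\<in>F. \<bar>a j\<bar> \<le> M"
    then have "N (\<Sum>j\<in>F. a j *\<^sub>R w j) \<le> 3 * M" by (intro lincomb_boundedD[OF w(2)]) auto
    then show "N (\<Sum>j\<in>F. a j *\<^sub>R w j) \<le> 8 * M" using F(2) by linarith
  qed
  obtain C' s t where basis: "0 \<le> C'" "c0_frame Z N C' s t" "\<And>k l. s k (t l) = (if k = l then 1 else 0)"
    using Pelczynski_decomposition[OF frame(2,1) w(1) w8 _ \<psi>] by auto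
  have "isomorphic_spaces Z N c0 norm"
    by (rule isomorphic_c0[OF basis(2,1,3) N0 Nm])
  moreover have "isomorphic_spaces M N linf norm"
  proof (rule isomorphic_linf[OF basis(2,1,3) N0 Nm M_normed])
    show "x \<in> M \<longleftrightarrow> (\<exists>b. \<forall>n. \<forall>L\<in>K n. norm (blinfun_apply L x) \<le> b)" for x
      unfolding M_def M_space_iff K(3)[symmetric] by blast
    show "N x \<le> b" if "0 \<le> b" "\<And>n L. L \<in> K n \<Longrightarrow> norm (blinfun_apply L x) \<le> b" for x b
      unfolding N_def using that K(3) by (intro M_norm_least) auto
    show "\<exists>u. (\<forall>n. u n \<in> Z) \<and> (\<forall>n. N (u n) \<le> N x) \<and> weakly_converges u x" if "x \<in> M" for x
    proof -
      have "x \<in> M_space \<L>" using \<open>x \<in> M\<close> by (simp add: M_def)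
      from assms(11)[unfolded assumption_A_def, rule_format, OF this]
      obtain u where u: "range u \<subseteq> Z" "bdd_above (range (\<lambda>n. N (u n)))" "weakly_converges u x" "(SUP n. N (u n)) \<le> N x"
        unfolding Z_def N_def by (elim exE conjE)
      have "N (u n) \<le> N x" for n using cSUP_upper[OF UNIV_I u(2), of n] u(4) by linarith
      then show ?thesis using u(1,3) by blast
    qed
  qed
  ultimately show ?thesis by (simp add: Z_def M_def N_def)
qed

end
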